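(* For any $(g,h,\kappa,\gamma)\in(0,+\infty)\times(0,+\infty]\times[0,+\infty)\times\mathbb R$ and any $j_*\in\mathbb Z\setminus\{0\}$, there exist small amplitude non-trivial analytic Stokes waves $u\in X$, solutions of $\mathcal F(c,u)=0$, with speed $c$ close to $c_*=\Omega_{j_*}/j_*$. That is: for every $\varepsilon>0$ there exist $c\in\mathbb R$ with $|c-c_*|<\varepsilon$ and $u\in X$ with $0<\|u\|_X<\varepsilon$ such that $\mathcal F(c,u)=0$.
   Context: Parameters: gravity $g>0$, depth $h\in(0,+\infty]$, surface tension $\kappa\ge0$, constant vorticity $\gamma\in\mathbb R$; $\mathbb T=\mathbb R/(2\pi\mathbb Z)$. Function spaces: for $\sigma>0$, $H^{\sigma,s}=H^{\sigma,s}(\mathbb T)$ is the space of real $2\pi$-periodic functions $u(x)=\sum_{k\in\mathbb Z}u_ke^{ikx}$ with $\|u\|_{\sigma,s}^2=\sum_k|u_k|^2\langle k\rangle^{2s}e^{2\sigma|k|}<\infty$, $\langle k\rangle=\max\{1,|k|\}$; $H^{\sigma,s}_0$ is its subspace of zero average functions. Fix $\sigma>0$ and $s\ge 7/2$ with $s+\frac12\in\mathbb N$, and set $X=H^{\sigma,s}\times H^{\sigma,s}_0$ (elements of $X$ are analytic functions). Water waves vector field: $G(\eta)\psi=(\Phi_y-\Phi_x\eta_x)|_{y=\eta(x)}$ is the Dirichlet–Neumann operator, where $\Phi$ is $2\pi$-periodic in $x$, $\Delta\Phi=0$ in $\{-h<y<\eta(x)\}$, $\Phi=\psi$ at $y=\eta(x)$,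 $\Phi_y\to0$ as $y\to-h$. $\partial_x^{-1}f$ is the zero average primitive of a zero average periodic function $f$ ($G(\eta)\psi$ has zero average). Let $\mathcal N(\eta,\psi)=(\mathcal N_1,\mathcal N_2)$, $$\mathcal N_1=G(\eta)\psi+\gamma\eta\eta_x,$$ $$\mathcal N_2=-g\eta-\tfrac{\psi_x^2}{2}+\tfrac{(\eta_x\psi_x+G(\eta)\psi)^2}{2(1+\eta_x^2)}+\kappa\,\partial_x\Big(\tfrac{\eta_x}{\sqrt{1+\eta_x^2}}\Big)+\gamma\eta\psi_x+\gamma\partial_x^{-1}G(\eta)\psi .$$ Let $\mathcal T(\eta,\zeta)=(\eta,\ \zeta+\frac\gamma2\partial_x^{-1}\Pi_0^\perp\eta)$, where $\Pi_0^\perp\eta=\eta-\frac1{2\pi}\int_{\mathbb T}\eta\,dx$. For $c\in\mathbb R$ and $u=(\eta,\zeta)\in X$ (near $0$) set $$\mathcal F(c,u)=c\,\partial_xu+\mathcal T^{-1}\mathcal N(\mathcal T u).$$ Solutions of $\mathcal F(c,u)=0$ are exactly the profiles of traveling waves $u(x-ct)$ (Stokes waves) with speed $c$ of the water waves equations with constant vorticity $\gamma$, $(\eta_t,\psi_t)=\mathcal N(\eta,\psi)$, written in the variables $(\eta,\zeta)$. One has $\mathcal F(c,0)=0$ for all $c$; non-trivial means $u\ne0$. Dispersion relation: for $\xi\neq0$, $\Omega_\xi=\frac\gamma2\tanh(h\xi)+\sqrt{(g+\kappa\xi^2)\xi\tanh(h\xi)+\frac{\gamma^2}4\tanh^2(h\xi)}$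 if $h<+\infty$, and $\Omega_\xi=\frac\gamma2\operatorname{sign}(\xi)+\sqrt{(g+\kappa\xi^2)|\xi|+\frac{\gamma^2}4}$ if $h=+\infty$. *)

theory Defs
  imports "HOL-Analysis.Analysis"
begin

section \<open>Periodic functions and the spaces \<open>H\<^sup>\<sigma>\<^sup>,\<^sup>s\<close>\<close>

text \<open>Functions on the torus are represented by \<open>2\<pi>\<close>-periodic functions on the real line.\<close>

definition periodic :: "(real \<Rightarrow> real) \<Rightarrow> bool" where
  "periodic f \<longleftrightarrow> (\<forall>x. f (x + 2 * pi) = f x)"

definition avg :: "(real \<Rightarrow> real) \<Rightarrow> real" where
  "avg f = integral {0..2 * pi} f / (2 * pi)"

definition fourier_coeff :: "(real \<Rightarrow> real) \<Rightarrow> int \<Rightarrow> complex" where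
  "fourier_coeff u k =
     integral {0..2 * pi} (\<lambda>x. complex_of_real (u x) * cis (- (of_int k * x))) / (2 * pi)"

definition bracket :: "int \<Rightarrow> real" where
  "bracket k = max 1 \<bar>of_int k\<bar>"

definition weighted_sq :: "real \<Rightarrow> real \<Rightarrow> (real \<Rightarrow> real) \<Rightarrow> int \<Rightarrow> real" where
  "weighted_sq \<sigma> s u k =
     (cmod (fourier_coeff u k))\<^sup>2 * bracket k powr (2 * s) * exp (2 * \<sigma> * \<bar>of_int k\<bar>)"

definition Hspace :: "real \<Rightarrow> real \<Rightarrow> (real \<Rightarrow> real) set" where
  "Hspace \<sigma> s = {u. periodic u
     \<and> (\<forall>x. ((\<lambda>k. fourier_coeff u k * cis (of_int k * x)) has_sum complex_of_real (u x)) UNIV)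
     \<and> weighted_sq \<sigma> s u summable_on UNIV}"

definition Hspace0 :: "real \<Rightarrow> real \<Rightarrow> (real \<Rightarrow> real) set" where
  "Hspace0 \<sigma> s = {u \<in> Hspace \<sigma> s. avg u = 0}"

definition Hnorm :: "real \<Rightarrow> real \<Rightarrow> (real \<Rightarrow> real) \<Rightarrow> real" where
  "Hnorm \<sigma> s u = sqrt (\<Sum>\<^sub>\<infinity>k. weighted_sq \<sigma> s u k)"

type_synonym state = "(real \<Rightarrow> real) \<times> (real \<Rightarrow> real)"

definition Xspace :: "real \<Rightarrow> real \<Rightarrow> state set" where
  "Xspace \<sigma> s = Hspace \<sigma> s \<times> Hspace0 \<sigma> s"

definition Xnorm :: "real \<Rightarrow> real \<Rightarrow> state \<Rightarrow> real" where
  "Xnorm \<sigma> s u = sqrt ((Hnorm \<sigma> s (fst u))\<^sup>2 + (Hnorm \<sigma> s (snd u))\<^sup>2)"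

text \<open>The zero average primitive; meaningful only for zero average \<open>f\<close>.\<close>

definition dinv :: "(real \<Rightarrow> real) \<Rightarrow> real \<Rightarrow> real" where
  "dinv f = (THE F. (\<forall>x. (F has_real_derivative f x) (at x)) \<and> periodic F \<and> avg F = 0)"

definition proj_perp :: "(real \<Rightarrow> real) \<Rightarrow> real \<Rightarrow> real" where
  "proj_perp f = (\<lambda>x. f x - avg f)"


section \<open>The Dirichlet--Neumann operator\<close>

definition pdx :: "(real \<times> real \<Rightarrow> real) \<Rightarrow> real \<times> real \<Rightarrow> real" where
  "pdx f = (\<lambda>(x, y). deriv (\<lambda>t. f (t, y)) x)"

definition pdy :: "(real \<times> real \<Rightarrow> real) \<Rightarrow> real \<times> real \<Rightarrow> real" where
  "pdy f = (\<lambda>(x, y). deriv (\<lambda>t. f (x, t)) y)"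

definition C1_on :: "(real \<times> real) set \<Rightarrow> (real \<times> real \<Rightarrow> real) \<Rightarrow> bool" where
  "C1_on S f \<longleftrightarrow> f differentiable_on S \<and> continuous_on S (pdx f) \<and> continuous_on S (pdy f)"

definition harmonic_on :: "(real \<times> real) set \<Rightarrow> (real \<times> real \<Rightarrow> real) \<Rightarrow> bool" where
  "harmonic_on S f \<longleftrightarrow> C1_on S f \<and> C1_on S (pdx f) \<and> C1_on S (pdy f)
     \<and> (\<forall>p\<in>S. pdx (pdx f) p + pdy (pdy f) p = 0)"

text \<open>The depth \<open>h\<close> is an extended real; \<open>h = \<infinity>\<close> is the case of infinite depth.\<close>

definition fluid :: "ereal \<Rightarrow> (real \<Rightarrow> real) \<Rightarrow> (real \<times> real) set" where
  "fluid h \<eta> = {(x, y). - h < ereal y \<and> y < \<eta> x}"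

definition fluid_surf :: "ereal \<Rightarrow> (real \<Rightarrow> real) \<Rightarrow> (real \<times> real) set" where
  "fluid_surf h \<eta> = {(x, y). - h < ereal y \<and> y \<le> \<eta> x}"

text \<open>The limit \<open>\<Phi>\<^sub>y \<rightarrow> 0\<close> at the bottom is uniform in \<open>x\<close>; a merely pointwise limit would not
  determine \<open>\<Phi>\<close> uniquely. The ereal filter \<open>at_right (- h)\<close> describes \<open>y \<down> - h\<close> for finite \<open>h\<close>
  and \<open>y \<rightarrow> - \<infinity>\<close> for \<open>h = \<infinity>\<close>.\<close>

definition is_potential ::
    "ereal \<Rightarrow> (real \<Rightarrow> real) \<Rightarrow> (real \<Rightarrow> real) \<Rightarrow> (real \<times> real \<Rightarrow> real) \<Rightarrow> bool" where
  "is_potential h \<eta> \<psi> \<Phi> \<longleftrightarrow>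
     (\<forall>x. - h < ereal (\<eta> x))
     \<and> (\<forall>(x, y)\<in>fluid h \<eta>. \<Phi> (x + 2 * pi, y) = \<Phi> (x, y))
     \<and> harmonic_on (fluid h \<eta>) \<Phi>
     \<and> continuous_on (fluid_surf h \<eta>) \<Phi>
     \<and> (\<forall>x. \<Phi> (x, \<eta> x) = \<psi> x)
     \<and> uniform_limit UNIV (\<lambda>y x. pdy \<Phi> (x, real_of_ereal y)) (\<lambda>_. 0) (at_right (- h))"

text \<open>The restriction of \<open>\<Phi>\<^sub>y - \<Phi>\<^sub>x \<eta>\<^sub>x\<close> to \<open>y = \<eta>(x)\<close> is its limit from inside the fluid.\<close>

definition dirichlet_neumann ::
    "ereal \<Rightarrow> (real \<Rightarrow> real) \<Rightarrow> (real \<Rightarrow> real) \<Rightarrow> real \<Rightarrow> real" where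
  "dirichlet_neumann h \<eta> \<psi> = (THE f. \<exists>\<Phi>. is_potential h \<eta> \<psi> \<Phi> \<and>
     (\<forall>x. ((\<lambda>p. pdy \<Phi> p - pdx \<Phi> p * deriv \<eta> (fst p)) \<longlongrightarrow> f x)
             (at (x, \<eta> x) within fluid h \<eta>)))"


section \<open>The water waves vector field and the traveling wave equation\<close>

definition N1 :: "ereal \<Rightarrow> real \<Rightarrow> state \<Rightarrow> real \<Rightarrow> real" where
  "N1 h \<gamma> = (\<lambda>(\<eta>, \<psi>) x. dirichlet_neumann h \<eta> \<psi> x + \<gamma> * \<eta> x * deriv \<eta> x)"

definition N2 :: "real \<Rightarrow> ereal \<Rightarrow> real \<Rightarrow> real \<Rightarrow> state \<Rightarrow> real \<Rightarrow> real" where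
  "N2 g h \<kappa> \<gamma> = (\<lambda>(\<eta>, \<psi>) x.
     - g * \<eta> x - (deriv \<psi> x)\<^sup>2 / 2
     + (deriv \<eta> x * deriv \<psi> x + dirichlet_neumann h \<eta> \<psi> x)\<^sup>2 / (2 * (1 + (deriv \<eta> x)\<^sup>2))
     + \<kappa> * deriv (\<lambda>z. deriv \<eta> z / sqrt (1 + (deriv \<eta> z)\<^sup>2)) x
     + \<gamma> * \<eta> x * deriv \<psi> x
     + \<gamma> * dinv (dirichlet_neumann h \<eta> \<psi>) x)"

definition Nfield :: "real \<Rightarrow> ereal \<Rightarrow> real \<Rightarrow> real \<Rightarrow> state \<Rightarrow> state" where
  "Nfield g h \<kappa> \<gamma> w = (N1 h \<gamma> w, N2 g h \<kappa> \<gamma> w)"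

definition Tmap :: "real \<Rightarrow> state \<Rightarrow> state" where
  "Tmap \<gamma> = (\<lambda>(\<eta>, \<zeta>). (\<eta>, \<lambda>x. \<zeta> x + \<gamma> / 2 * dinv (proj_perp \<eta>) x))"

definition Tmap_inv :: "real \<Rightarrow> state \<Rightarrow> state" where
  "Tmap_inv \<gamma> = (\<lambda>(\<eta>, \<psi>). (\<eta>, \<lambda>x. \<psi> x - \<gamma> / 2 * dinv (proj_perp \<eta>) x))"

lemma Tmap_inverse: "Tmap_inv \<gamma> (Tmap \<gamma> u) = u" "Tmap \<gamma> (Tmap_inv \<gamma> u) = u"
  by (auto simp: Tmap_def Tmap_inv_def split: prod.splits)

definition Fmap :: "real \<Rightarrow> ereal \<Rightarrow> real \<Rightarrow> real \<Rightarrow> real \<Rightarrow> state \<Rightarrow> state" where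
  "Fmap g h \<kappa> \<gamma> c u =
     (let v = Tmap_inv \<gamma> (Nfield g h \<kappa> \<gamma> (Tmap \<gamma> u))
      in (\<lambda>x. c * deriv (fst u) x + fst v x, \<lambda>x. c * deriv (snd u) x + snd v x))"

definition Omega :: "real \<Rightarrow> ereal \<Rightarrow> real \<Rightarrow> real \<Rightarrow> real \<Rightarrow> real" where
  "Omega g h \<kappa> \<gamma> \<xi> =
     (if h = \<infinity> then \<gamma> / 2 * sgn \<xi> + sqrt ((g + \<kappa> * \<xi>\<^sup>2) * \<bar>\<xi>\<bar> + \<gamma>\<^sup>2 / 4)
      else let t = tanh (real_of_ereal h * \<xi>)
           in \<gamma> / 2 * t + sqrt ((g + \<kappa> * \<xi>\<^sup>2) * \<xi> * t + \<gamma>\<^sup>2 / 4 * t\<^sup>2))"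

end

theory Submission
  imports Defs "HOL-Complex_Analysis.Complex_Analysis" "HOL-Real_Asymp.Real_Asymp"
begin

text \<open>
  In the moving frame of a wave of speed \<open>c\<close> the kinematic condition says that
  \<open>\<Phi>\<^sub>x - (c + \<gamma> \<eta>)\<close> and \<open>\<Phi>\<^sub>y\<close> are, on the surface, proportional to \<open>(1, \<eta>\<^sub>x)\<close>; hence the
  stream function of the potential is \<open>c \<eta> + \<gamma> \<eta>\<^sup>2 / 2\<close> on the surface up to a constant. Parametrize
  the fluid by a conformal map \<open>Z = X + i Y\<close> of a half plane or a strip. Everything is then determined by
  the boundary trace \<open>Y\<close>, an even periodic function, and what remains is Bernoulli's law, an equation
  for the Fourier coefficients of \<open>Y\<close> that is built from products and Fourier multipliers.

  Its linearization at the flat surface is diagonal, with symbol the dispersion function, which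
  vanishes at the wave number \<open>\<bar>j\<bar>\<close> when \<open>c = c\<^sub>*\<close>. Instead of \<open>j\<close> one takes the largest resonant wave
  number \<open>K\<close> of the speed \<open>c\<^sub>*\<close> and looks for waves of period \<open>2 \<pi> / K\<close>, so that the kernel on even functions
  is one-dimensional. Prescribing the first coefficient of \<open>Y\<close> to be \<open>e\<close>, dividing by \<open>e\<close> and solving the
  first mode for \<open>c - c\<^sub>*\<close> and the other modes for \<open>Y / e\<close> gives a fixed point problem for
  exponentially weighted sequences whose nonlinear part has Lipschitz constant \<open>O(e)\<close>. The
  curvature term is kept polynomial by taking the deviation of \<open>\<bar>Z'\<bar>\<inverse>\<close> from \<open>1\<close> as a second unknown.

  The exponential weight makes \<open>Z\<close> injective beyond the fluid domain, so that \<open>\<eta>\<close> and \<open>\<psi>\<close>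
  can be read off, and a contour shift gives the decay of their Fourier coefficients in the physical
  variable. The potential is the real part of a holomorphic function of the conformal
  variable; that it is the one used by the Dirichlet--Neumann operator is the maximum principle.
\<close>

section \<open>Weighted sequences and convolution\<close>

text \<open>The surface equation is quasilinear, and the unknown is chosen so that no derivative is
  lost: it is \<open>D n * y n\<close> rather than \<open>y n\<close>, with \<open>D\<close> the
  symbol of the linearization. This symbol grows at least like |m n|, and like
  \<open>\<kappa>\<close> times the square of \<open>m n\<close>. So \<open>y\<close>, its first
  derivative and \<open>\<kappa>\<close> times its second derivative are bounded affine functions of
  the unknown, and up to products and bounded multipliers Bernoulli's law contains nothing else.
  Gravity and capillary waves are thus treated at once. The factor \<open>1 / (1 + n^2)\<close> of
  the weight makes the weighted bounds an algebra under convolution. In finite depth the conformal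
  depth is unknown too: it is the physical depth shifted by the mean of \<open>Y\<close>, so that
  the multiplier coth depends on the solution. It is Lipschitz in the depth uniformly in the
  frequency, which makes the shift one more term of order \<open>e\<close>. The exponential rate is
  fixed before \<open>e\<close>. Its margin over \<open>\<sigma>\<close> and the depth pays for two
  derivatives, for inverting \<open>Z\<close> near the fluid, and for the loss in passing to the
  physical variable.\<close>

definition wt :: "real \<Rightarrow> int \<Rightarrow> real" where
  "wt \<rho> n = exp (- \<rho> * \<bar>of_int n\<bar>) / (1 + (of_int n)\<^sup>2)"

definition bd :: "real \<Rightarrow> real \<Rightarrow> (int \<Rightarrow> real) \<Rightarrow> bool" where
  "bd \<rho> C f \<longleftrightarrow> (\<forall>n. \<bar>f n\<bar> \<le> C * wt \<rho> n)"

definition conv :: "(int \<Rightarrow> real) \<Rightarrow> (int \<Rightarrow> real) \<Rightarrow> int \<Rightarrow> real" where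
  "conv f g n = (\<Sum>\<^sub>\<infinity>l. f l * g (n - l))"

definition wt_sum :: real where
  "wt_sum = (\<Sum>\<^sub>\<infinity>n::int. 1 / (1 + (of_int n)\<^sup>2))"

lemma wt_pos: "wt \<rho> n > 0"
  by (simp add: wt_def add_pos_nonneg)

lemma wt_nonneg [simp]: "wt \<rho> n \<ge> 0"
  using wt_pos less_imp_le by blast

lemma wt_uminus [simp]: "wt \<rho> (- n) = wt \<rho> n"
  by (simp add: wt_def)

lemma wt_0: "wt \<rho> 0 = 1"
  by (simp add: wt_def)

lemma summable_on_int_if_nat:
  fixes f :: "int \<Rightarrow> real"
  assumes "(\<lambda>n. f (int n)) summable_on UNIV" "(\<lambda>n. f (- int n)) summable_on UNIV"
  shows "f summable_on UNIV"
proof -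
  have 1: "f summable_on {0..}"
  proof -
    have "(f \<circ> int) summable_on UNIV" using assms(1) by (simp add: o_def)
    then have "f summable_on (int ` UNIV)"
      by (subst summable_on_reindex) (auto simp: inj_on_def)
    moreover have "range int = {0..}"
      by (auto simp: image_iff) (metis nonneg_int_cases)
    ultimately show ?thesis by simp
  qed
  have 2: "f summable_on {..0}"
  proof -
    have "(f \<circ> (\<lambda>n. - int n)) summable_on UNIV" using assms(2) by (simp add: o_def)
    then have "f summable_on ((\<lambda>n. - int n) ` UNIV)"
      by (subst summable_on_reindex) (auto simp: inj_on_def)
    moreover have "range (\<lambda>n. - int n) = {..0}"
      by (auto simp: image_iff) (metis add.inverse_inverse neg_0_le_iff_le nonneg_int_cases)
    ultimately show ?thesis by simp
  qed
  have "f summable_on ({0..} \<union> {..0})"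
    using 1 2 by (rule summable_on_union)
  moreover have "{0..} \<union> {..0} = (UNIV::int set)" by auto
  ultimately show ?thesis by simp
qed

lemma summable_wt0: "(\<lambda>n::int. 1 / (1 + (real_of_int n)\<^sup>2)) summable_on UNIV"
proof -
  have "summable (\<lambda>n. 1 / (1 + (real n)\<^sup>2))"
  proof (rule summable_comparison_test')
    show "summable (\<lambda>n. 1 / (real n)\<^sup>2)"
      using inverse_power_summable[of 2, where ?'a=real] by (simp add: inverse_eq_divide)
    show "norm (1 / (1 + (real n)\<^sup>2)) \<le> 1 / (real n)\<^sup>2" if "n \<ge> 1" for n
      using that by (auto intro!: frac_le)
  qed
  then have "(\<lambda>n. 1 / (1 + (real n)\<^sup>2)) summable_on UNIV"
    by (intro summable_nonneg_imp_summable_on) auto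
  then show ?thesis by (intro summable_on_int_if_nat) auto
qed

lemma wt_sum_nonneg: "wt_sum \<ge> 0"
  unfolding wt_sum_def by (intro infsum_nonneg) auto

text \<open>The triangle inequality handles the exponentials. For the denominators,
  \<open>1 + (l + k)^2\<close> is at most twice the sum of \<open>1 + l^2\<close> and
  \<open>1 + k^2\<close>; dividing by their product leaves a factor that is summable in
  \<open>l\<close>.\<close>

lemma wt_mult_le:
  assumes "\<rho> \<ge> 0"
  shows "wt \<rho> l * wt \<rho> (n - l)
    \<le> 2 * wt \<rho> n * (1 / (1 + (of_int l)\<^sup>2) + 1 / (1 + (of_int (n - l))\<^sup>2))"
proof -
  let ?l = "real_of_int l" and ?k = "real_of_int (n - l)"
  have e: "exp (- \<rho> * \<bar>?l\<bar>) * exp (- \<rho> * \<bar>?k\<bar>) \<le> exp (- \<rho> * \<bar>of_int n\<bar>)"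
  proof -
    have "\<bar>real_of_int n\<bar> \<le> \<bar>?l\<bar> + \<bar>?k\<bar>" by simp
    then have "\<rho> * \<bar>real_of_int n\<bar> \<le> \<rho> * (\<bar>?l\<bar> + \<bar>?k\<bar>)"
      using assms by (rule mult_left_mono)
    then show ?thesis by (simp add: exp_add [symmetric] algebra_simps)
  qed
  have n: "real_of_int n = ?l + ?k" by simp
  have p: "1 / ((1 + ?l\<^sup>2) * (1 + ?k\<^sup>2))
      \<le> 2 / (1 + (of_int n)\<^sup>2) * (1 / (1 + ?l\<^sup>2) + 1 / (1 + ?k\<^sup>2))"
  proof -
    have pos: "1 + ?l\<^sup>2 > 0" "1 + ?k\<^sup>2 > 0" "1 + (?l + ?k)\<^sup>2 > 0"
      by (auto intro: add_pos_nonneg)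
    have "(a + b)\<^sup>2 \<le> 2 * a\<^sup>2 + 2 * b\<^sup>2" for a b :: real
      using sum_squares_bound[of a b] by (simp add: power2_sum)
    from this[of ?l ?k] have "1 + (?l + ?k)\<^sup>2 \<le> 2 * ((1 + ?k\<^sup>2) + (1 + ?l\<^sup>2))" by simp
    moreover have "1 / (P * Q) \<le> 2 / N * (1 / P + 1 / Q)"
      if "P > 0" "Q > 0" "N > 0" "N \<le> 2 * (Q + P)" for P Q N :: real
    proof -
      have "1 / (P * Q) = (1 / N) * (N / (P * Q))" using that by simp
      also have "\<dots> \<le> (1 / N) * ((2 * (Q + P)) / (P * Q))"
        using that by (intro mult_left_mono divide_right_mono) auto
      also have "\<dots> = 2 / N * (1 / P + 1 / Q)" using that by (simp add: field_simps)
      finally show ?thesis .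
    qed
    ultimately show ?thesis unfolding n using pos by blast
  qed
  have "wt \<rho> l * wt \<rho> (n - l)
      = exp (- \<rho> * \<bar>?l\<bar>) * exp (- \<rho> * \<bar>?k\<bar>) * (1 / ((1 + ?l\<^sup>2) * (1 + ?k\<^sup>2)))"
    by (simp add: wt_def)
  also have "\<dots> \<le> exp (- \<rho> * \<bar>of_int n\<bar>) *
      (2 / (1 + (of_int n)\<^sup>2) * (1 / (1 + ?l\<^sup>2) + 1 / (1 + ?k\<^sup>2)))"
    by (intro mult_mono e p) auto
  also have "\<dots> = 2 * wt \<rho> n * (1 / (1 + ?l\<^sup>2) + 1 / (1 + ?k\<^sup>2))"
    by (simp add: wt_def)
  finally show ?thesis .
qed

lemma summable_wt0_shift: "(\<lambda>l::int. 1 / (1 + (real_of_int (n - l))\<^sup>2)) summable_on UNIV"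
  and infsum_wt0_shift: "(\<Sum>\<^sub>\<infinity>l::int. 1 / (1 + (real_of_int (n - l))\<^sup>2)) = wt_sum"
proof -
  have b: "bij_betw (\<lambda>l::int. n - l) UNIV UNIV"
    by (rule bij_betwI[where g="\<lambda>l. n - l"]) auto
  show "(\<lambda>l::int. 1 / (1 + (real_of_int (n - l))\<^sup>2)) summable_on UNIV"
    using summable_on_reindex_bij_betw[OF b, of "\<lambda>n. 1 / (1 + (real_of_int n)\<^sup>2)"] summable_wt0
    by simp
  show "(\<Sum>\<^sub>\<infinity>l::int. 1 / (1 + (real_of_int (n - l))\<^sup>2)) = wt_sum"
    using infsum_reindex_bij_betw[OF b, of "\<lambda>n. 1 / (1 + (real_of_int n)\<^sup>2)"]
    by (simp add: wt_sum_def)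
qed

lemma infsum_diff:
  fixes f g :: "'a \<Rightarrow> 'b::{topological_ab_group_add,t2_space}"
  assumes "f summable_on A" "g summable_on A"
  shows "infsum (\<lambda>x. f x - g x) A = infsum f A - infsum g A"
  using infsum_add[OF assms(1), of "\<lambda>x. - g x"] assms(2)
  by (simp add: infsum_uminus summable_on_uminus)

lemma bdD: "bd \<rho> C f \<Longrightarrow> \<bar>f n\<bar> \<le> C * wt \<rho> n"
  by (simp add: bd_def)

lemma bd_nonneg: "bd \<rho> C f \<Longrightarrow> C \<ge> 0"
  using bdD[of \<rho> C f 0] by (simp add: wt_0)

lemma bd_mono: "bd \<rho> C f \<Longrightarrow> C \<le> C' \<Longrightarrow> bd \<rho> C' f"
  unfolding bd_def by (meson mult_right_mono order_trans wt_nonneg)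

lemma bd_add: "bd \<rho> C f \<Longrightarrow> bd \<rho> D g \<Longrightarrow> bd \<rho> (C + D) (\<lambda>n. f n + g n)"
  unfolding bd_def by (auto simp: ring_distribs intro: order_trans[OF abs_triangle_ineq] add_mono)

lemma bd_cmult: "bd \<rho> C f \<Longrightarrow> bd \<rho> (\<bar>a\<bar> * C) (\<lambda>n. a * f n)"
  unfolding bd_def by (auto simp: abs_mult mult.assoc intro: mult_left_mono)

lemma bd_symbol:
  assumes "bd \<rho> C f" "\<And>n. \<bar>a n\<bar> \<le> A"
  shows "bd \<rho> (A * C) (\<lambda>n. a n * f n)"
proof -
  have "A \<ge> 0" using assms(2)[of 0] by simp
  then show ?thesis
    unfolding bd_def abs_mult mult.assoc
    by (auto intro!: mult_mono bdD assms)
qed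

text \<open>Sum \<open>wt_mult_le\<close> over \<open>l\<close>: each of its two terms contributes
  \<open>wt_sum\<close>, and with the factor 2 there this gives the 4.\<close>

lemma conv_summable_and_bd:
  assumes "\<rho> \<ge> 0" "bd \<rho> C f" "bd \<rho> D g"
  shows "(\<lambda>l. f l * g (n - l)) summable_on UNIV"
    and "\<bar>conv f g n\<bar> \<le> 4 * wt_sum * C * D * wt \<rho> n"
proof -
  let ?b = "\<lambda>l. (2 * C * D * wt \<rho> n) * (1 / (1 + (real_of_int l)\<^sup>2) + 1 / (1 + (real_of_int (n - l))\<^sup>2))"
  have C: "C \<ge> 0" "D \<ge> 0" using assms bd_nonneg by auto
  have le: "norm (f l * g (n - l)) \<le> ?b l" for l
  proof -
    have "norm (f l * g (n - l)) \<le> (C * wt \<rho> l) * (D * wt \<rho> (n - l))"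
      unfolding real_norm_def abs_mult
      by (rule mult_mono[OF bdD[OF assms(2)] bdD[OF assms(3)]]) (use C in auto)
    also have "\<dots> = (C * D) * (wt \<rho> l * wt \<rho> (n - l))" by simp
    also have "\<dots> \<le> (C * D) * (2 * wt \<rho> n * (1 / (1 + (of_int l)\<^sup>2) + 1 / (1 + (of_int (n - l))\<^sup>2)))"
      using C by (intro mult_left_mono wt_mult_le assms) auto
    finally show ?thesis by (simp add: mult_ac)
  qed
  have s: "?b summable_on UNIV"
    by (intro summable_on_cmult_right summable_on_add summable_wt0 summable_wt0_shift)
  have a: "(\<lambda>l. norm (f l * g (n - l))) summable_on UNIV"
    using s le by (intro Infinite_Sum.summable_on_comparison_test[OF s]) auto
  then show "(\<lambda>l. f l * g (n - l)) summable_on UNIV"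
    by (rule abs_summable_summable)
  have "norm (conv f g n) \<le> infsum ?b UNIV"
    unfolding conv_def
    by (rule norm_infsum_le[OF has_sum_infsum has_sum_infsum le])
      (use \<open>(\<lambda>l. f l * g (n - l)) summable_on UNIV\<close> s in auto)
  also have "infsum ?b UNIV = (2 * C * D * wt \<rho> n) * (wt_sum + wt_sum)"
    by (simp only: infsum_cmult_right' infsum_add[OF summable_wt0 summable_wt0_shift]
        infsum_wt0_shift wt_sum_def [symmetric])
  finally show "\<bar>conv f g n\<bar> \<le> 4 * wt_sum * C * D * wt \<rho> n"
    by (simp add: mult_ac)
qed

lemma bd_conv:
  assumes "\<rho> \<ge> 0" "bd \<rho> C f" "bd \<rho> D g"
  shows "bd \<rho> (4 * wt_sum * C * D) (conv f g)"
  using conv_summable_and_bd(2)[OF assms] by (auto simp: bd_def)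

text \<open>Bilinear splitting, by which Lipschitz bounds of products follow from those of the
  factors.\<close>

lemma conv_diff:
  assumes "\<rho> \<ge> 0" "bd \<rho> C f" "bd \<rho> C' f'" "bd \<rho> D g" "bd \<rho> D' g'"
  shows "conv f g n - conv f' g' n
    = conv (\<lambda>n. f n - f' n) g n + conv f' (\<lambda>n. g n - g' n) n"
proof -
  note s = conv_summable_and_bd(1)[OF assms(1)]
  have "conv (\<lambda>n. f n - f' n) g n = conv f g n - conv f' g n"
    unfolding conv_def left_diff_distrib
    by (rule infsum_diff) (use s assms in blast)+
  moreover have "conv f' (\<lambda>n. g n - g' n) n = conv f' g n - conv f' g' n"
    unfolding conv_def right_diff_distrib
    by (rule infsum_diff) (use s assms in blast)+
  ultimately show ?thesis by simp
qed

lemma conv_parity: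
  assumes "\<And>n. f (- n) = a * f n" "\<And>n. g (- n) = b * g n"
  shows "conv f g (- n) = a * b * conv f g n"
proof -
  have "conv f g (- n) = (\<Sum>\<^sub>\<infinity>l. f (- l) * g (- n - (- l)))"
    unfolding conv_def
    by (rule infsum_reindex_bij_betw[symmetric]) (rule bij_betwI[where g=uminus], auto)
  also have "\<dots> = (\<Sum>\<^sub>\<infinity>l. (a * b) * (f l * g (n - l)))"
  proof (rule infsum_cong)
    fix l
    have "g (- n - - l) = b * g (n - l)" using assms(2)[of "n - l"] by simp
    then show "f (- l) * g (- n - - l) = (a * b) * (f l * g (n - l))" by (simp add: assms(1))
  qed
  finally show ?thesis by (simp add: conv_def infsum_cmult_right')
qed

text \<open>The Leibniz rule on the Fourier side, from \<open>n = l + (n - l)\<close>.\<close>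

lemma conv_deriv:
  assumes "\<rho> \<ge> 0" "bd \<rho> C f" "bd \<rho> D g" "bd \<rho> C' (\<lambda>n. a * of_int n * f n)" "bd \<rho> D' (\<lambda>n. a * of_int n * g n)"
  shows "a * of_int n * conv f g n
    = conv (\<lambda>n. a * of_int n * f n) g n + conv f (\<lambda>n. a * of_int n * g n) n"
proof -
  note s = conv_summable_and_bd(1)[OF assms(1)]
  have "conv (\<lambda>n. a * of_int n * f n) g n + conv f (\<lambda>n. a * of_int n * g n) n
    = (\<Sum>\<^sub>\<infinity>l. (a * of_int l * f l) * g (n - l) + f l * (a * of_int (n - l) * g (n - l)))"
    unfolding conv_def by (rule infsum_add[symmetric]) (use s assms in blast)+
  also have "\<dots> = (\<Sum>\<^sub>\<infinity>l. (a * of_int n) * (f l * g (n - l)))"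
    by (rule infsum_cong) (simp add: algebra_simps)
  finally show ?thesis by (simp add: conv_def infsum_cmult_right')
qed

lemma conv_commute: "conv f g = conv g f"
proof
  fix n
  have "conv f g n = (\<Sum>\<^sub>\<infinity>l. f (n - l) * g (n - (n - l)))"
    unfolding conv_def
    by (rule infsum_reindex_bij_betw[symmetric]) (rule bij_betwI[where g="\<lambda>l. n - l"], auto)
  then show "conv f g n = conv g f n" by (simp add: conv_def mult.commute)
qed

section \<open>A contraction principle for weighted sequences\<close>

text \<open>Picard iteration carried out coefficient by coefficient, so that the weighted sequences
  need not be made a complete metric space. The image of 0 lies within half the radius and the
  contraction factor is 1/2, hence the iterates stay in the ball. The set \<open>S\<close> carries a
  side condition that survives pointwise limits.\<close>

lemma weighted_contraction:
  fixes T :: "('a \<Rightarrow> 'b::banach) \<Rightarrow> 'a \<Rightarrow> 'b" and w :: "'a \<Rightarrow> real"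
  assumes r: "r \<ge> 0" and w: "\<And>n. w n \<ge> 0"
    and zero: "(\<lambda>_. 0) \<in> S"
    and closed: "\<And>zs z. (\<And>k. zs k \<in> S) \<Longrightarrow> (\<And>n. (\<lambda>k::nat. zs k n) \<longlonglongrightarrow> z n) \<Longrightarrow> z \<in> S"
    and T_S: "\<And>z. z \<in> S \<Longrightarrow> (\<And>n. norm (z n) \<le> r * w n) \<Longrightarrow> T z \<in> S"
    and T_0: "\<And>n. norm (T (\<lambda>_. 0) n) \<le> r / 2 * w n"
    and lip: "\<And>z z' d n. z \<in> S \<Longrightarrow> z' \<in> S \<Longrightarrow> (\<And>n. norm (z n) \<le> r * w n) \<Longrightarrow>
       (\<And>n. norm (z' n) \<le> r * w n) \<Longrightarrow> d \<ge> 0 \<Longrightarrow>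
       (\<And>n. norm (z n - z' n) \<le> d * w n) \<Longrightarrow> norm (T z n - T z' n) \<le> d / 2 * w n"
  shows "\<exists>z\<in>S. (\<forall>n. norm (z n) \<le> r * w n) \<and> T z = z"
proof -
  define zs where "zs k = (T ^^ k) (\<lambda>_. 0)" for k
  have zs_Suc: "zs (Suc k) = T (zs k)" for k by (simp add: zs_def)
  \<comment> \<open>The radius is the partial sum of the geometric series of the increments
    \<open>r / 2 * (1/2)^k\<close>.\<close>
  have main: "zs k \<in> S \<and> (\<forall>n. norm (zs k n) \<le> r * (1 - (1/2)^k) * w n) \<and>
      (\<forall>n. norm (zs (Suc k) n - zs k n) \<le> r / 2 * (1/2)^k * w n)" for k
  proof (induction k)
    case 0
    then show ?case using zero T_0 by (simp add: zs_def)
  next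
    case (Suc k)
    have b: "norm (zs k n) \<le> r * w n" for n
    proof -
      have "r * (1 - (1/2)^k) * w n \<le> r * 1 * w n"
        using r w by (intro mult_right_mono mult_left_mono) auto
      moreover have "norm (zs k n) \<le> r * (1 - (1/2)^k) * w n" using Suc by blast
      ultimately show ?thesis by linarith
    qed
    have S: "zs (Suc k) \<in> S" unfolding zs_Suc using Suc b by (intro T_S) auto
    have b1: "norm (zs (Suc k) n) \<le> r * (1 - (1/2)^Suc k) * w n" for n
    proof -
      have "norm (zs (Suc k) n) \<le> norm (zs k n) + norm (zs (Suc k) n - zs k n)"
        by (metis norm_triangle_sub)
      also have "\<dots> \<le> r * (1 - (1/2)^k) * w n + r / 2 * (1/2)^k * w n"
        using Suc by (intro add_mono) auto
      also have "\<dots> = r * (1 - (1/2)^Suc k) * w n" by (simp add: algebra_simps)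
      finally show ?thesis .
    qed
    have b2: "norm (zs (Suc k) n) \<le> r * w n" for n
    proof -
      have "r * (1 - (1/2)^Suc k) * w n \<le> r * 1 * w n"
        using r w by (intro mult_right_mono mult_left_mono) auto
      then show ?thesis using b1[of n] by linarith
    qed
    have "norm (T (zs (Suc k)) n - T (zs k) n) \<le> (r / 2 * (1/2)^k) / 2 * w n" for n
    proof (rule lip)
      show "zs k \<in> S" using Suc by blast
      show "norm (zs (Suc k) n - zs k n) \<le> r / 2 * (1/2)^k * w n" for n using Suc by blast
      show "0 \<le> r / 2 * (1/2)^k" using r by simp
    qed (fact S b b2)+
    then have "\<forall>n. norm (zs (Suc (Suc k)) n - zs (Suc k) n) \<le> r / 2 * (1/2)^Suc k * w n"
      by (simp add: zs_Suc[symmetric])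
    then show ?case using S b1 by blast
  qed
  have S: "zs k \<in> S" for k using main by blast
  have b: "norm (zs k n) \<le> r * w n" for k n
  proof -
    have "r * (1 - (1/2)^k) * w n \<le> r * 1 * w n"
      using r w by (intro mult_right_mono mult_left_mono) auto
    moreover have "norm (zs k n) \<le> r * (1 - (1/2)^k) * w n" using main by blast
    ultimately show ?thesis by linarith
  qed
  have "convergent (\<lambda>k. zs k n)" for n
  proof -
    have "summable (\<lambda>k. zs (Suc k) n - zs k n)"
    proof (rule summable_comparison_test')
      show "summable (\<lambda>k. (r / 2 * w n) * (1/2::real)^k)"
        by (intro summable_mult summable_geometric) auto
      show "norm (zs (Suc k) n - zs k n) \<le> (r / 2 * w n) * (1/2)^k" if "k \<ge> 0" for k
        using main[of k] by (simp only: mult_ac)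
    qed
    then have "convergent (\<lambda>k. \<Sum>i<k. zs (Suc i) n - zs i n)"
      by (simp add: summable_iff_convergent)
    moreover have "(\<lambda>k. \<Sum>i<k. zs (Suc i) n - zs i n) = (\<lambda>k. zs k n - zs 0 n)"
      by (rule ext) (rule sum_lessThan_telescope)
    ultimately have "convergent (\<lambda>k. zs k n - zs 0 n)" by (simp only:)
    from convergent_add[OF this convergent_const[of "zs 0 n"]] show ?thesis
      by (simp only: diff_add_cancel)
  qed
  then have z: "(\<lambda>k. zs k n) \<longlonglongrightarrow> lim (\<lambda>k. zs k n)" for n
    by (simp add: convergent_LIMSEQ_iff)
  define z where "z n = lim (\<lambda>k. zs k n)" for n
  note z = z[folded z_def]
  have zS: "z \<in> S" using closed S z by blast
  have zb: "norm (z n) \<le> r * w n" for n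
    by (rule Lim_norm_ubound[OF _ z]) (use b in auto)
  have diff: "norm (zs (k + m) n - zs k n) \<le> r * ((1/2)^k - (1/2)^(k+m)) * w n" for k m n
  proof (induction m)
    case (Suc m)
    have "norm (zs (k + Suc m) n - zs k n)
        \<le> norm (zs (k + m) n - zs k n) + norm (zs (Suc (k+m)) n - zs (k+m) n)"
      using norm_triangle_ineq[of "zs (k + m) n - zs k n" "zs (Suc (k+m)) n - zs (k+m) n"] by simp
    also have "\<dots> \<le> r * ((1/2)^k - (1/2)^(k+m)) * w n + r / 2 * (1/2)^(k+m) * w n"
      using main Suc by (intro add_mono) auto
    also have "\<dots> = r * ((1/2)^k - (1/2)^(k+Suc m)) * w n" by (simp add: algebra_simps)
    finally show ?case .
  qed simp
  have lim: "norm (z n - zs k n) \<le> r * (1/2)^k * w n" for k n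
  proof (rule Lim_norm_ubound)
    show "(\<lambda>m. zs (m + k) n - zs k n) \<longlonglongrightarrow> z n - zs k n"
      by (intro tendsto_diff tendsto_const LIMSEQ_ignore_initial_segment z)
    have "norm (zs (m + k) n - zs k n) \<le> r * (1/2)^k * w n" for m
    proof -
      have "r * ((1/2)^k - (1/2)^(k+m)) * w n \<le> r * ((1/2)^k) * w n"
        using r w by (intro mult_right_mono mult_left_mono) auto
      then show ?thesis unfolding add.commute[of m k] using diff[of k m n] by linarith
    qed
    then show "\<forall>\<^sub>F m in sequentially. norm (zs (m + k) n - zs k n) \<le> r * (1/2)^k * w n"
      by simp
  qed auto
  have "T z n = z n" for n
  proof -
    have "norm (T z n - zs (Suc k) n) \<le> (r * (1/2)^k) / 2 * w n" for k
      unfolding zs_Suc by (rule lip[OF zS S zb b _ lim]) (use r in simp)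
    moreover have "(\<lambda>k. (r * (1/2)^k) / 2 * w n) \<longlonglongrightarrow> 0"
    proof -
      have "(\<lambda>k. (1/2::real)^k) \<longlonglongrightarrow> 0" by (rule LIMSEQ_power_zero) simp
      from tendsto_mult_left[OF this, of "r / 2 * w n"] show ?thesis by (simp add: mult_ac)
    qed
    ultimately have "(\<lambda>k. T z n - zs (Suc k) n) \<longlonglongrightarrow> 0"
      by (rule Lim_null_comparison[OF always_eventually[OF allI]])
    moreover have "(\<lambda>k. T z n - zs (Suc k) n) \<longlonglongrightarrow> T z n - z n"
      by (rule tendsto_diff[OF tendsto_const LIMSEQ_Suc[OF z]])
    ultimately have "0 = T z n - z n" by (rule LIMSEQ_unique)
    then show ?thesis by simp
  qed
  then show ?thesis using zS zb by blast
qed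


section \<open>Bounded Lipschitz families of sequences\<close>

text \<open>Evenness expresses the reflection symmetry of the wave. The unit ball is the common
  domain of all estimates; the solution itself will lie in a ball of radius O(e).\<close>

definition adm :: "real \<Rightarrow> (int \<Rightarrow> complex) \<Rightarrow> bool" where
  "adm \<rho> z \<longleftrightarrow> (\<forall>n. z (- n) = z n \<and> cmod (z n) \<le> wt \<rho> n)"

definition near :: "real \<Rightarrow> real \<Rightarrow> (int \<Rightarrow> complex) \<Rightarrow> (int \<Rightarrow> complex) \<Rightarrow> bool" where
  "near \<rho> d z z' \<longleftrightarrow> (\<forall>n. cmod (z n - z' n) \<le> d * wt \<rho> n)"

text \<open>The amplitude \<open>e\<close> is an argument because bounds have to be uniform in it: a
  factor \<open>e\<close> in front of a bounded Lipschitz family is then a contraction for small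
  \<open>e\<close>.\<close>

type_synonym family = "real \<Rightarrow> (int \<Rightarrow> complex) \<Rightarrow> int \<Rightarrow> real"

text \<open>The parameter \<open>s\<close> is the parity of the sequences: \<open>1\<close> for even, \<open>- 1\<close> for odd.\<close>

definition BL :: "real \<Rightarrow> real \<Rightarrow> real \<Rightarrow> family \<Rightarrow> bool" where
  "BL \<rho> e0 s P \<longleftrightarrow> (\<exists>M\<ge>0. \<forall>e z. 0 < e \<and> e \<le> e0 \<and> adm \<rho> z \<longrightarrow>
     bd \<rho> M (P e z) \<and> (\<forall>n. P e z (- n) = s * P e z n) \<and>
     (\<forall>z' d. adm \<rho> z' \<and> near \<rho> d z z' \<longrightarrow> bd \<rho> (M * d) (\<lambda>n. P e z n - P e z' n)))"

text \<open>Fourier multipliers, measured without weight. They may depend on \<open>e\<close> and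
  \<open>z\<close>, since the depth that enters coth is part of the solution.\<close>

definition BL_symbol :: "real \<Rightarrow> real \<Rightarrow> real \<Rightarrow> family \<Rightarrow> bool" where
  "BL_symbol \<rho> e0 s a \<longleftrightarrow> (\<exists>M\<ge>0. \<forall>e z. 0 < e \<and> e \<le> e0 \<and> adm \<rho> z \<longrightarrow>
     (\<forall>n. \<bar>a e z n\<bar> \<le> M \<and> a e z (- n) = s * a e z n) \<and>
     (\<forall>z' d. adm \<rho> z' \<and> near \<rho> d z z' \<longrightarrow> (\<forall>n. \<bar>a e z n - a e z' n\<bar> \<le> M * d)))"

lemma near_nonneg: "near \<rho> d z z' \<Longrightarrow> d \<ge> 0"
  by (metis near_def mult.right_neutral norm_ge_zero order_trans wt_0)

lemma BL_I:
  assumes "\<And>e z. 0 < e \<Longrightarrow> e \<le> e0 \<Longrightarrow> adm \<rho> z \<Longrightarrow> bd \<rho> A (P e z)"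
    and "\<And>e z n. 0 < e \<Longrightarrow> e \<le> e0 \<Longrightarrow> adm \<rho> z \<Longrightarrow> P e z (- n) = s * P e z n"
    and "\<And>e z z' d. 0 < e \<Longrightarrow> e \<le> e0 \<Longrightarrow> adm \<rho> z \<Longrightarrow> adm \<rho> z' \<Longrightarrow> near \<rho> d z z' \<Longrightarrow>
       bd \<rho> (B * d) (\<lambda>n. P e z n - P e z' n)"
  shows "BL \<rho> e0 s P"
  unfolding BL_def
proof (intro exI[of _ "max 0 (max A B)"] conjI allI impI; (elim conjE)?)
  fix e z z' d assume "0 < e" "e \<le> e0" "adm \<rho> z" "adm \<rho> z'" and n: "near \<rho> d z z'"
  moreover have "B * d \<le> max 0 (max A B) * d"
    using near_nonneg[OF n] by (intro mult_right_mono) auto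
  ultimately show "bd \<rho> (max 0 (max A B) * d) (\<lambda>n. P e z n - P e z' n)"
    using assms(3) bd_mono by blast
qed (use assms in \<open>auto intro: bd_mono[OF assms(1)]\<close>)

lemma BL_E:
  assumes "BL \<rho> e0 s P"
  obtains M where "M \<ge> 0"
    and "\<And>e z. 0 < e \<Longrightarrow> e \<le> e0 \<Longrightarrow> adm \<rho> z \<Longrightarrow> bd \<rho> M (P e z)"
    and "\<And>e z n. 0 < e \<Longrightarrow> e \<le> e0 \<Longrightarrow> adm \<rho> z \<Longrightarrow> P e z (- n) = s * P e z n"
    and "\<And>e z z' d. 0 < e \<Longrightarrow> e \<le> e0 \<Longrightarrow> adm \<rho> z \<Longrightarrow> adm \<rho> z' \<Longrightarrow> near \<rho> d z z' \<Longrightarrow>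
       bd \<rho> (M * d) (\<lambda>n. P e z n - P e z' n)"
  using assms unfolding BL_def by blast

lemma BL_add:
  assumes "BL \<rho> e0 s P" "BL \<rho> e0 s Q"
  shows "BL \<rho> e0 s (\<lambda>e z n. P e z n + Q e z n)"
proof -
  obtain M where M: "M \<ge> 0"
    "\<And>e z. 0 < e \<Longrightarrow> e \<le> e0 \<Longrightarrow> adm \<rho> z \<Longrightarrow> bd \<rho> M (P e z)"
    "\<And>e z n. 0 < e \<Longrightarrow> e \<le> e0 \<Longrightarrow> adm \<rho> z \<Longrightarrow> P e z (- n) = s * P e z n"
    "\<And>e z z' d. 0 < e \<Longrightarrow> e \<le> e0 \<Longrightarrow> adm \<rho> z \<Longrightarrow> adm \<rho> z' \<Longrightarrow> near \<rho> d z z' \<Longrightarrow>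
       bd \<rho> (M * d) (\<lambda>n. P e z n - P e z' n)"
    using assms(1) by (rule BL_E) blast
  obtain N where N: "N \<ge> 0"
    "\<And>e z. 0 < e \<Longrightarrow> e \<le> e0 \<Longrightarrow> adm \<rho> z \<Longrightarrow> bd \<rho> N (Q e z)"
    "\<And>e z n. 0 < e \<Longrightarrow> e \<le> e0 \<Longrightarrow> adm \<rho> z \<Longrightarrow> Q e z (- n) = s * Q e z n"
    "\<And>e z z' d. 0 < e \<Longrightarrow> e \<le> e0 \<Longrightarrow> adm \<rho> z \<Longrightarrow> adm \<rho> z' \<Longrightarrow> near \<rho> d z z' \<Longrightarrow>
       bd \<rho> (N * d) (\<lambda>n. Q e z n - Q e z' n)"
    using assms(2) by (rule BL_E) blast
  show ?thesis
  proof (rule BL_I[where A="M+N" and B="M+N"])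
    fix e z z' d assume *: "0 < e" "e \<le> e0" "adm \<rho> z" "adm \<rho> z'" "near \<rho> d z z'"
    from bd_add[OF M(4)[OF *] N(4)[OF *]]
    show "bd \<rho> ((M + N) * d) (\<lambda>n. P e z n + Q e z n - (P e z' n + Q e z' n))"
      by (simp add: algebra_simps)
  qed (use M N in \<open>auto intro: bd_add simp: algebra_simps\<close>)
qed

lemma BL_symbol_mult:
  assumes "BL_symbol \<rho> e0 s a" "BL \<rho> e0 t Q"
  shows "BL \<rho> e0 (s * t) (\<lambda>e z n. a e z n * Q e z n)"
proof -
  obtain M where M: "M \<ge> 0"
    "\<And>e z n. 0 < e \<Longrightarrow> e \<le> e0 \<Longrightarrow> adm \<rho> z \<Longrightarrow> \<bar>a e z n\<bar> \<le> M"
    "\<And>e z n. 0 < e \<Longrightarrow> e \<le> e0 \<Longrightarrow> adm \<rho> z \<Longrightarrow> a e z (- n) = s * a e z n"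
    "\<And>e z z' d n. 0 < e \<Longrightarrow> e \<le> e0 \<Longrightarrow> adm \<rho> z \<Longrightarrow> adm \<rho> z' \<Longrightarrow> near \<rho> d z z' \<Longrightarrow>
       \<bar>a e z n - a e z' n\<bar> \<le> M * d"
    using assms(1) unfolding BL_symbol_def by blast
  obtain N where N: "N \<ge> 0"
    "\<And>e z. 0 < e \<Longrightarrow> e \<le> e0 \<Longrightarrow> adm \<rho> z \<Longrightarrow> bd \<rho> N (Q e z)"
    "\<And>e z n. 0 < e \<Longrightarrow> e \<le> e0 \<Longrightarrow> adm \<rho> z \<Longrightarrow> Q e z (- n) = t * Q e z n"
    "\<And>e z z' d. 0 < e \<Longrightarrow> e \<le> e0 \<Longrightarrow> adm \<rho> z \<Longrightarrow> adm \<rho> z' \<Longrightarrow> near \<rho> d z z' \<Longrightarrow>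
       bd \<rho> (N * d) (\<lambda>n. Q e z n - Q e z' n)"
    using assms(2) by (rule BL_E) blast
  show ?thesis
  proof (rule BL_I[where A="M*N" and B="2*M*N"])
    fix e z z' d assume *: "0 < e" "e \<le> e0" "adm \<rho> z" "adm \<rho> z'" "near \<rho> d z z'"
    have "bd \<rho> ((M * d) * N) (\<lambda>n. (a e z n - a e z' n) * Q e z n)"
      by (rule bd_symbol) (use M N * in auto)
    moreover have "bd \<rho> (M * (N * d)) (\<lambda>n. a e z' n * (Q e z n - Q e z' n))"
      by (rule bd_symbol) (use M N * in auto)
    ultimately have "bd \<rho> ((M * d) * N + M * (N * d))
        (\<lambda>n. (a e z n - a e z' n) * Q e z n + a e z' n * (Q e z n - Q e z' n))"
      by (rule bd_add)
    then show "bd \<rho> (2 * M * N * d) (\<lambda>n. a e z n * Q e z n - a e z' n * Q e z' n)"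
      by (simp add: algebra_simps)
  qed (use M N in \<open>auto intro: bd_symbol\<close>)
qed

lemma BL_symbol_const:
  assumes "\<And>n. \<bar>a n\<bar> \<le> A" "\<And>n. a (- n) = s * a n"
  shows "BL_symbol \<rho> e0 s (\<lambda>e z. a)"
  unfolding BL_symbol_def
proof (intro exI[of _ "max 0 A"] conjI allI impI; (elim conjE)?)
  fix z z' d assume "near \<rho> d z z'"
  then show "\<bar>a n - a n\<bar> \<le> max 0 A * d" for n by (simp add: near_nonneg)
qed (use assms in \<open>auto intro: order_trans[OF _ max.cobounded2]\<close>)

lemma BL_symbol_small: "BL_symbol \<rho> e0 1 (\<lambda>e z n. e)"
  unfolding BL_symbol_def
proof (intro exI[of _ "max 0 e0"] conjI allI impI; (elim conjE)?)
  fix e :: real and z z' d assume "near \<rho> d z z'"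
  then show "\<bar>e - e\<bar> \<le> max 0 e0 * d" by (simp add: near_nonneg)
qed auto

lemma BL_cmult: "BL \<rho> e0 s P \<Longrightarrow> BL \<rho> e0 s (\<lambda>e z n. a * P e z n)"
  using BL_symbol_mult[OF BL_symbol_const[of "\<lambda>_. a" "\<bar>a\<bar>" 1]] by auto

lemma BL_small: "BL \<rho> e0 s P \<Longrightarrow> BL \<rho> e0 s (\<lambda>e z n. e * P e z n)"
  using BL_symbol_mult[OF BL_symbol_small] by auto

lemma BL_uminus: "BL \<rho> e0 s P \<Longrightarrow> BL \<rho> e0 s (\<lambda>e z n. - P e z n)"
  using BL_cmult[of \<rho> e0 s P "-1"] by simp

lemma BL_diff: "BL \<rho> e0 s P \<Longrightarrow> BL \<rho> e0 s Q \<Longrightarrow> BL \<rho> e0 s (\<lambda>e z n. P e z n - Q e z n)"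
  using BL_add[OF _ BL_uminus, of \<rho> e0 s P Q] by simp

lemma BL_conv:
  assumes "\<rho> \<ge> 0" "BL \<rho> e0 s P" "BL \<rho> e0 t Q"
  shows "BL \<rho> e0 (s * t) (\<lambda>e z. conv (P e z) (Q e z))"
proof -
  obtain M where M: "M \<ge> 0"
    "\<And>e z. 0 < e \<Longrightarrow> e \<le> e0 \<Longrightarrow> adm \<rho> z \<Longrightarrow> bd \<rho> M (P e z)"
    "\<And>e z n. 0 < e \<Longrightarrow> e \<le> e0 \<Longrightarrow> adm \<rho> z \<Longrightarrow> P e z (- n) = s * P e z n"
    "\<And>e z z' d. 0 < e \<Longrightarrow> e \<le> e0 \<Longrightarrow> adm \<rho> z \<Longrightarrow> adm \<rho> z' \<Longrightarrow> near \<rho> d z z' \<Longrightarrow>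
       bd \<rho> (M * d) (\<lambda>n. P e z n - P e z' n)"
    using assms(2) by (rule BL_E) blast
  obtain N where N: "N \<ge> 0"
    "\<And>e z. 0 < e \<Longrightarrow> e \<le> e0 \<Longrightarrow> adm \<rho> z \<Longrightarrow> bd \<rho> N (Q e z)"
    "\<And>e z n. 0 < e \<Longrightarrow> e \<le> e0 \<Longrightarrow> adm \<rho> z \<Longrightarrow> Q e z (- n) = t * Q e z n"
    "\<And>e z z' d. 0 < e \<Longrightarrow> e \<le> e0 \<Longrightarrow> adm \<rho> z \<Longrightarrow> adm \<rho> z' \<Longrightarrow> near \<rho> d z z' \<Longrightarrow>
       bd \<rho> (N * d) (\<lambda>n. Q e z n - Q e z' n)"
    using assms(3) by (rule BL_E) blast
  show ?thesis
  proof (rule BL_I[where A="4 * wt_sum * M * N" and B="8 * wt_sum * M * N"])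
    fix e z z' d assume *: "0 < e" "e \<le> e0" "adm \<rho> z" "adm \<rho> z'" "near \<rho> d z z'"
    have "bd \<rho> (4 * wt_sum * (M * d) * N + 4 * wt_sum * M * (N * d))
      (\<lambda>n. conv (\<lambda>n. P e z n - P e z' n) (Q e z) n + conv (P e z') (\<lambda>n. Q e z n - Q e z' n) n)"
      by (intro bd_add bd_conv assms M N *)
    also have "(\<lambda>n. conv (\<lambda>n. P e z n - P e z' n) (Q e z) n + conv (P e z') (\<lambda>n. Q e z n - Q e z' n) n)
       = (\<lambda>n. conv (P e z) (Q e z) n - conv (P e z') (Q e z') n)"
      by (rule ext, rule conv_diff[symmetric, OF assms(1) M(2)[OF *(1-3)] M(2)[OF *(1,2,4)] N(2)[OF *(1-3)] N(2)[OF *(1,2,4)]])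
    finally show "bd \<rho> (8 * wt_sum * M * N * d)
        (\<lambda>n. conv (P e z) (Q e z) n - conv (P e z') (Q e z') n)"
      by (simp add: algebra_simps)
  next
    fix e z n assume "0 < e" "e \<le> e0" "adm \<rho> z"
    then show "conv (P e z) (Q e z) (- n) = s * t * conv (P e z) (Q e z) n"
      using M N by (intro conv_parity) auto
  qed (intro bd_conv assms M N)
qed

text \<open>The constant function \<open>a\<close> as a Fourier sequence; constants such as the
  speed then enter products by convolution like any other factor.\<close>

definition single :: "real \<Rightarrow> int \<Rightarrow> real" where
  "single a n = (if n = 0 then a else 0)"

text \<open>\<open>L\<close> extracts one of the two real unknowns that are packed into the complex
  sequence.\<close>

lemma BL_affine:
  assumes "bd \<rho> B b" "\<And>n. \<bar>a n\<bar> \<le> A" "\<And>n. b (- n) = s * b n" "\<And>n. a (- n) = s * a n"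
    and L: "L = Re \<or> L = Im"
  shows "BL \<rho> e0 s (\<lambda>e z n. b n + a n * L (z n))"
proof (rule BL_I[where A="B + A" and B=A])
  have L1: "\<bar>L w\<bar> \<le> cmod w" for w using L abs_Re_le_cmod abs_Im_le_cmod by auto
  have Ld: "L w - L w' = L (w - w')" for w w' using L by auto
  fix e z assume "adm \<rho> z"
  then have "bd \<rho> 1 (\<lambda>n. L (z n))"
    unfolding adm_def bd_def using L1 order_trans by (metis mult_1)
  from bd_add[OF assms(1) bd_symbol[OF this assms(2)]]
  show "bd \<rho> (B + A) (\<lambda>n. b n + a n * L (z n))" by simp
  show "b (- n) + a (- n) * L (z (- n)) = s * (b n + a n * L (z n))" for n
    using \<open>adm \<rho> z\<close> by (simp add: assms adm_def algebra_simps)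
  fix z' d assume "near \<rho> d z z'"
  then have "bd \<rho> d (\<lambda>n. L (z n - z' n))"
    unfolding near_def bd_def using L1 order_trans by blast
  from bd_symbol[where a=a, OF this assms(2)]
  show "bd \<rho> (A * d) (\<lambda>n. b n + a n * L (z n) - (b n + a n * L (z' n)))"
    by (simp add: Ld[symmetric] algebra_simps)
qed

lemma BL_single:
  assumes "L = Re \<or> L = Im"
  shows "BL \<rho> e0 1 (\<lambda>e z. single (b + a * L (z k)))"
proof (rule BL_I[where A="\<bar>b\<bar> + \<bar>a\<bar> * wt \<rho> k" and B="\<bar>a\<bar> * wt \<rho> k"])
  have L1: "\<bar>L w\<bar> \<le> cmod w" for w using assms abs_Re_le_cmod abs_Im_le_cmod by auto
  have Ld: "L w - L w' = L (w - w')" for w w' using assms by auto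
  fix e z assume "adm \<rho> z"
  then have "\<bar>L (z k)\<bar> \<le> wt \<rho> k" using L1 unfolding adm_def by (meson order_trans)
  then have "\<bar>b + a * L (z k)\<bar> \<le> \<bar>b\<bar> + \<bar>a\<bar> * wt \<rho> k"
    by (intro order_trans[OF abs_triangle_ineq]) (auto simp: abs_mult intro: mult_left_mono)
  then show "bd \<rho> (\<bar>b\<bar> + \<bar>a\<bar> * wt \<rho> k) (single (b + a * L (z k)))"
    by (auto simp: bd_def single_def wt_0 intro!: mult_nonneg_nonneg add_nonneg_nonneg)
  show "single (b + a * L (z k)) (- n) = 1 * single (b + a * L (z k)) n" for n
    by (simp add: single_def)
  fix z' d assume n: "near \<rho> d z z'"
  then have "\<bar>L (z k) - L (z' k)\<bar> \<le> d * wt \<rho> k"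
    unfolding near_def using L1 Ld order_trans by metis
  then have "\<bar>a\<bar> * \<bar>L (z k) - L (z' k)\<bar> \<le> \<bar>a\<bar> * (d * wt \<rho> k)" by (intro mult_left_mono) auto
  then have "\<bar>(b + a * L (z k)) - (b + a * L (z' k))\<bar> \<le> \<bar>a\<bar> * wt \<rho> k * d"
    by (simp add: abs_mult[symmetric] algebra_simps)
  then show "bd \<rho> (\<bar>a\<bar> * wt \<rho> k * d) (\<lambda>n. single (b + a * L (z k)) n - single (b + a * L (z' k)) n)"
    using near_nonneg[OF n]
    by (auto simp: bd_def single_def wt_0 intro!: mult_nonneg_nonneg add_nonneg_nonneg)
qed

lemma conv_single: "conv (single a) f n = a * f n"
proof -
  have "conv (single a) f n = (\<Sum>\<^sub>\<infinity>l\<in>{0}. single a l * f (n - l))"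
    unfolding conv_def by (rule infsum_cong_neutral) (auto simp: single_def)
  then show ?thesis by (simp add: single_def)
qed

section \<open>The dispersion relation\<close>

text \<open>For \<open>x > 0\<close> this is \<open>coth (x H)\<close>, or its limit \<open>1\<close> in infinite depth.\<close>

definition cth :: "ereal \<Rightarrow> real \<Rightarrow> real \<Rightarrow> real" where
  "cth h H x = (if h = \<infinity> then 1 else 1 + 2 / (exp (2 * x * H) - 1))"

definition disp :: "real \<Rightarrow> ereal \<Rightarrow> real \<Rightarrow> real \<Rightarrow> real \<Rightarrow> real \<Rightarrow> real" where
  "disp g h \<kappa> \<gamma> c x = g + c * \<gamma> - c\<^sup>2 * (x * cth h (real_of_ereal h) x) + \<kappa> * x\<^sup>2"

lemma exp_minus_one_ge: "a > 0 \<Longrightarrow> exp a - 1 \<ge> a" for a :: real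
  using exp_ge_add_one_self[of a] by linarith

lemma cth_ge_1: "x > 0 \<Longrightarrow> H > 0 \<Longrightarrow> cth h H x \<ge> 1"
  by (auto simp: cth_def)

lemma cth_le:
  assumes "x \<ge> 1" "H0 > 0" "H \<ge> H0"
  shows "cth h H x \<le> 1 + 1 / H0"
proof -
  have "2 * H0 \<le> 2 * x * H"
    using mult_mono[of 1 x H0 H] assms by simp
  also have "\<dots> \<le> exp (2 * x * H) - 1" using assms by (intro exp_minus_one_ge) simp
  finally have "2 / (exp (2 * x * H) - 1) \<le> 2 / (2 * H0)"
    using assms by (intro divide_left_mono) auto
  then show ?thesis using assms by (simp add: cth_def)
qed

text \<open>With \<open>a = 2 * x * H\<close> and \<open>b = 2 * x * H'\<close>, convexity gives
  \<open>exp b - exp a \<le> exp b * (b - a)\<close>. The factor \<open>x\<close> in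
  \<open>b - a\<close> is cancelled by \<open>exp a - 1 \<ge> 2 * x * H0\<close>, so the constant
  does not grow with the frequency.\<close>

lemma cth_lipschitz_aux:
  fixes x H0 H H' :: real
  assumes "x > 0" "H0 > 0" "H \<ge> H0" "H' \<ge> H"
  shows "\<bar>2 / (exp (2 * x * H) - 1) - 2 / (exp (2 * x * H') - 1)\<bar>
    \<le> 2 * (1 + 1 / (2 * x * H0)) / H0 * (H' - H)"
proof -
  define a b where "a = 2 * x * H" and "b = 2 * x * H'"
  have a: "a > 0" "a \<ge> 2 * x * H0" and b: "b > 0" "b \<ge> 2 * x * H0" and ab: "a \<le> b"
    using assms by (auto simp: a_def b_def)
  have x0: "2 * x * H0 > 0" using assms by simp
  have A: "exp a - 1 \<ge> 2 * x * H0" and B: "exp b - 1 \<ge> 2 * x * H0"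
    using exp_minus_one_ge[OF a(1)] exp_minus_one_ge[OF b(1)] a b by auto
  have p: "exp a - 1 > 0" "exp b - 1 > 0" using A B x0 by linarith+
  have "2 / (exp a - 1) - 2 / (exp b - 1) = 2 * (exp b - exp a) / ((exp a - 1) * (exp b - 1))"
    using p by (simp add: field_simps)
  moreover have "0 \<le> 2 * (exp b - exp a) / ((exp a - 1) * (exp b - 1))"
    using ab p by auto
  moreover have "2 * (exp b - exp a) / ((exp a - 1) * (exp b - 1))
      \<le> 2 * (exp b * (b - a)) / ((exp a - 1) * (exp b - 1))"
  proof -
    have "exp b - exp a \<le> exp b * (b - a)"
    proof -
      have "exp a = exp b * exp (a - b)" by (simp add: exp_add[symmetric])
      moreover have "exp (a - b) \<ge> 1 + (a - b)" by (rule exp_ge_add_one_self)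
      then have "exp b * exp (a - b) \<ge> exp b * (1 + (a - b))" by (intro mult_left_mono) auto
      ultimately show ?thesis by (simp add: algebra_simps)
    qed
    then show ?thesis using p by (intro divide_right_mono) auto
  qed
  moreover have "2 * (exp b * (b - a)) / ((exp a - 1) * (exp b - 1))
     = 2 * (b - a) * ((1 + 1 / (exp b - 1)) * (1 / (exp a - 1)))"
    using p by (simp add: field_simps)
  moreover have "\<dots> \<le> 2 * (b - a) * ((1 + 1 / (2 * x * H0)) * (1 / (2 * x * H0)))"
    using A B ab x0 p by (intro mult_left_mono mult_mono add_mono divide_left_mono) auto
  moreover have "2 * (b - a) * ((1 + 1 / (2 * x * H0)) * (1 / (2 * x * H0)))
      = 2 * (1 + 1 / (2 * x * H0)) / H0 * (H' - H)"
    using assms by (simp add: a_def b_def field_simps)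
  ultimately show ?thesis unfolding a_def b_def by linarith
qed

lemma cth_lipschitz:
  assumes "x \<ge> 1" "H0 > 0" "H \<ge> H0" "H' \<ge> H0"
  shows "\<bar>cth h H x - cth h H' x\<bar> \<le> 2 * (1 + 1 / (2 * H0)) / H0 * \<bar>H' - H\<bar>"
proof -
  have "1 / (2 * x * H0) \<le> 1 / (2 * H0)"
    using assms by (intro divide_left_mono) auto
  then have le: "2 * (1 + 1 / (2 * x * H0)) / H0 * d \<le> 2 * (1 + 1 / (2 * H0)) / H0 * d" if "d \<ge> 0" for d
    using assms that
    by (intro mult_right_mono divide_right_mono mult_left_mono add_left_mono) auto
  show ?thesis
  proof (cases "H \<le> H'")
    case True
    then show ?thesis
      using cth_lipschitz_aux[of x H0 H H'] le[of "H' - H"] assms by (auto simp: cth_def)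
  next
    case False
    then show ?thesis
      using cth_lipschitz_aux[of x H0 H' H] le[of "H - H'"] assms
      by (auto simp: cth_def abs_minus_commute)
  qed
qed

lemma real_of_ereal_depth_pos: "h > 0 \<Longrightarrow> h \<noteq> \<infinity> \<Longrightarrow> real_of_ereal h > 0"
  by (cases h) auto

text \<open>In infinite depth \<open>real_of_ereal h\<close> is 0, hence so is its reciprocal, and
  both bounds are 1.\<close>

lemma cth_depth_bounds:
  assumes "h > 0" "x \<ge> 1"
  shows "1 \<le> cth h (real_of_ereal h) x"
    and "cth h (real_of_ereal h) x \<le> 1 + 1 / real_of_ereal h"
proof -
  show "1 \<le> cth h (real_of_ereal h) x"
    using cth_ge_1[of x "real_of_ereal h" h] assms real_of_ereal_depth_pos[of h]
    by (cases "h = \<infinity>") (auto simp: cth_def)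
  show "cth h (real_of_ereal h) x \<le> 1 + 1 / real_of_ereal h"
    using cth_le[of x "real_of_ereal h" "real_of_ereal h" h] assms real_of_ereal_depth_pos[of h]
    by (cases "h = \<infinity>") (auto simp: cth_def)
qed

text \<open>Without surface tension the term of order \<open>x\<close> with coth dominates,
  otherwise \<open>\<kappa> * x^2\<close> does. The first lower bound is what controls one
  derivative of the solution of the linear problem, the second what controls \<open>\<kappa>\<close>
  times two derivatives.\<close>

lemma disp_growth:
  assumes "h > 0" "\<kappa> \<ge> 0" "c \<noteq> 0"
  shows "\<exists>a X. a > 0 \<and> X \<ge> 1 \<and> (\<forall>x\<ge>X. \<bar>disp g h \<kappa> \<gamma> c x\<bar> \<ge> a * x \<and> \<bar>disp g h \<kappa> \<gamma> c x\<bar> \<ge> a * (\<kappa> * x\<^sup>2))"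
proof -
  let ?H = "real_of_ereal h"
  define A where "A = \<bar>g\<bar> + \<bar>c * \<gamma>\<bar>"
  have A: "\<bar>g + c * \<gamma>\<bar> \<le> A" "A \<ge> 0" by (auto simp: A_def)
  show ?thesis
  proof (cases "\<kappa> = 0")
    case True
    have "\<bar>disp g h \<kappa> \<gamma> c x\<bar> \<ge> c\<^sup>2 / 2 * x" if x: "x \<ge> max 1 (2 * A / c\<^sup>2)" for x
    proof -
      have "c\<^sup>2 * (x * cth h ?H x) \<ge> c\<^sup>2 * (x * 1)"
        using x cth_depth_bounds(1)[OF assms(1)] by (intro mult_left_mono) auto
      moreover have "c\<^sup>2 / 2 * x \<ge> A" using x assms by (simp add: field_simps)
      ultimately show ?thesis using True A by (simp add: disp_def)
    qed
    then show ?thesis using assms True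
      by (intro exI[of _ "c\<^sup>2 / 2"] exI[of _ "max 1 (2 * A / c\<^sup>2)"]) auto
  next
    case False
    \<comment> \<open>For \<open>x \<ge> 1\<close> all terms other than
      \<open>\<kappa> * x^2\<close> are at most \<open>B * x\<close>, and this is at most half of
      that term once \<open>x \<ge> 2 * B / \<kappa>\<close>.\<close>
    define B where "B = A + c\<^sup>2 * (1 + 1 / ?H)"
    have B: "\<bar>disp g h \<kappa> \<gamma> c x\<bar> \<ge> \<kappa> / 2 * x\<^sup>2" if x: "x \<ge> max 1 (2 * B / \<kappa>)" for x
    proof -
      have "c\<^sup>2 * (x * cth h ?H x) \<le> c\<^sup>2 * (x * (1 + 1 / ?H))"
        using x cth_depth_bounds(2)[OF assms(1)] by (intro mult_left_mono) auto
      moreover have "A * 1 \<le> A * x" using x A by (intro mult_left_mono) auto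
      moreover have "B * x \<le> \<kappa> / 2 * x\<^sup>2"
      proof -
        have "B \<le> \<kappa> / 2 * x" using x False assms by (simp add: field_simps)
        then have "B * x \<le> \<kappa> / 2 * x * x" using x by (intro mult_right_mono) auto
        then show ?thesis by (simp add: power2_eq_square)
      qed
      moreover have "B * x = A * x + c\<^sup>2 * (x * (1 + 1 / ?H))"
        by (simp add: B_def algebra_simps)
      ultimately have "c\<^sup>2 * (x * cth h ?H x) + A \<le> \<kappa> / 2 * x\<^sup>2"
        by linarith
      moreover have "- A \<le> g + c * \<gamma>" using A(1) by linarith
      ultimately have "disp g h \<kappa> \<gamma> c x \<ge> \<kappa> / 2 * x\<^sup>2"
        unfolding disp_def by linarith
      then show ?thesis by linarith
    qed
    have "\<bar>disp g h \<kappa> \<gamma> c x\<bar> \<ge> min (1/2) (\<kappa>/2) * x \<and> \<bar>disp g h \<kappa> \<gamma> c x\<bar> \<ge> min (1/2) (\<kappa>/2) * (\<kappa> * x\<^sup>2)"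
      if x: "x \<ge> max 1 (2 * B / \<kappa>)" for x
    proof
      have "min (1/2) (\<kappa>/2) * x \<le> \<kappa> / 2 * (x * x)"
        using x assms False mult_mono[of 1 x 1 x] mult_left_mono[of 1 x x]
        by (intro mult_mono) (auto)
      then show "\<bar>disp g h \<kappa> \<gamma> c x\<bar> \<ge> min (1/2) (\<kappa>/2) * x"
        using B[OF x] by (simp add: power2_eq_square)
      have "min (1/2) (\<kappa>/2) * (\<kappa> * x\<^sup>2) \<le> 1/2 * (\<kappa> * x\<^sup>2)"
        using assms by (intro mult_right_mono) auto
      then show "\<bar>disp g h \<kappa> \<gamma> c x\<bar> \<ge> min (1/2) (\<kappa>/2) * (\<kappa> * x\<^sup>2)"
        using B[OF x] by simp
    qed
    then show ?thesis using assms False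
      by (intro exI[of _ "min (1/2) (\<kappa>/2)"] exI[of _ "max 1 (2 * B / \<kappa>)"]) auto
  qed
qed

text \<open>With \<open>t\<close> the tanh factor, squaring away the root in \<open>Omega\<close>
  gives the quadratic equation \<open>c^2 * j^2 - c * j * \<gamma> * t = (g + \<kappa> * j^2) * j *
  t\<close>; division by \<open>j * t > 0\<close> turns it into the dispersion function. The speed
  is nonzero because the root exceeds |\<gamma> t / 2|.\<close>

lemma Omega_disp:
  assumes "g > 0" "h > 0" "\<kappa> \<ge> 0" "j \<noteq> 0" and c: "c = Omega g h \<kappa> \<gamma> (of_int j) / of_int j"
  shows "disp g h \<kappa> \<gamma> c \<bar>of_int j\<bar> = 0" and "c \<noteq> 0"
proof -
  let ?j = "real_of_int j"
  define t where "t = (if h = \<infinity> then sgn ?j else tanh (real_of_ereal h * ?j))"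
  have jt: "?j * t > 0"
  proof (cases "h = \<infinity>")
    case True
    then show ?thesis using assms by (simp add: t_def linordered_idom_class.abs_sgn[symmetric])
  next
    case False
    then have "real_of_ereal h > 0" using assms real_of_ereal_depth_pos by auto
    then show ?thesis using False assms
      by (cases "j > 0") (auto simp: t_def zero_less_mult_iff mult_neg_neg mult_pos_neg)
  qed
  define w where "w = (g + \<kappa> * ?j\<^sup>2) * (?j * t) + \<gamma>\<^sup>2 / 4 * t\<^sup>2"
  have O: "Omega g h \<kappa> \<gamma> ?j = \<gamma> / 2 * t + sqrt w"
  proof (cases "h = \<infinity>")
    case True
    have "(sgn ?j)\<^sup>2 = 1" "?j * sgn ?j = \<bar>?j\<bar>"
      using assms by (auto simp: sgn_if power2_eq_square)
    then show ?thesis using True by (simp add: Omega_def t_def w_def)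
  next
    case False
    then show ?thesis by (simp add: Omega_def t_def w_def mult.assoc Let_def)
  qed
  have p: "(g + \<kappa> * ?j\<^sup>2) * (?j * t) > 0"
    by (rule mult_pos_pos[OF _ jt]) (use assms in \<open>simp add: add_pos_nonneg\<close>)
  then have w: "w > (\<gamma> / 2 * t)\<^sup>2" by (simp add: w_def power_mult_distrib power_divide)
  then have "sqrt w > \<bar>\<gamma> / 2 * t\<bar>" by (intro real_less_rsqrt) (simp only: power2_abs)
  then have "Omega g h \<kappa> \<gamma> ?j > 0" unfolding O by linarith
  then show "c \<noteq> 0" using c assms by auto
  have "(c * ?j - \<gamma> / 2 * t)\<^sup>2 = w"
    unfolding c using O w assms by (simp add: order.trans[OF zero_le_power2 less_imp_le])
  then have e: "c\<^sup>2 * ?j\<^sup>2 - c * ?j * \<gamma> * t = (g + \<kappa> * ?j\<^sup>2) * (?j * t)"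
    by (simp add: w_def power2_eq_square algebra_simps)
  have t0: "t \<noteq> 0" using jt by auto
  have "\<bar>?j\<bar> * cth h (real_of_ereal h) \<bar>?j\<bar> = ?j / t"
  proof (cases "h = \<infinity>")
    case True
    then show ?thesis using assms by (auto simp: cth_def t_def sgn_if)
  next
    case False
    have ct: "1 + 2 / (exp (2 * x) - 1) = 1 / tanh x" if "x > 0" for x :: real
    proof -
      have "exp (2 * x) > 1" using that by simp
      then show ?thesis
        unfolding tanh_real_altdef using that
        by (simp add: exp_minus field_simps)
    qed
    have H: "real_of_ereal h > 0" using False assms real_of_ereal_depth_pos by auto
    have "\<bar>?j\<bar> * cth h (real_of_ereal h) \<bar>?j\<bar> = \<bar>?j\<bar> / tanh (\<bar>?j\<bar> * real_of_ereal h)"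
      using ct[of "\<bar>?j\<bar> * real_of_ereal h"] H False assms by (simp add: cth_def mult.assoc)
    also have "\<dots> = ?j / t"
      using False by (cases "j > 0") (auto simp: t_def mult.commute)
    finally show ?thesis .
  qed
  then have "disp g h \<kappa> \<gamma> c \<bar>?j\<bar> = g + c * \<gamma> - c\<^sup>2 * (?j / t) + \<kappa> * ?j\<^sup>2"
    by (simp add: disp_def)
  moreover have "(g + c * \<gamma> - c\<^sup>2 * (?j / t) + \<kappa> * ?j\<^sup>2) * (?j * t) = 0"
    using e t0 by (simp add: field_simps power2_eq_square)
  ultimately show "disp g h \<kappa> \<gamma> c \<bar>?j\<bar> = 0" using jt by auto
qed

text \<open>Restricting to functions of period \<open>2 \<pi> / K\<close> with \<open>K\<close> the largest wave number of the
  given speed removes all other resonances, so that the kernel becomes simple.\<close>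

lemma largest_resonance:
  assumes "g > 0" "h > 0" "\<kappa> \<ge> 0" "j \<noteq> 0" and c: "c = Omega g h \<kappa> \<gamma> (of_int j) / of_int j"
  obtains K :: nat where "K \<ge> 1" "disp g h \<kappa> \<gamma> c K = 0"
    "\<And>n. n \<ge> 2 \<Longrightarrow> disp g h \<kappa> \<gamma> c (real K * real n) \<noteq> 0"
proof -
  define S where "S = {k::nat. k \<ge> 1 \<and> disp g h \<kappa> \<gamma> c k = 0}"
  obtain a X where a: "a > 0" "X \<ge> 1" "\<And>x. x \<ge> X \<Longrightarrow> \<bar>disp g h \<kappa> \<gamma> c x\<bar> \<ge> a * x"
    using disp_growth[of h \<kappa> c g \<gamma>] Omega_disp[OF assms] assms by blast
  have "S \<subseteq> {..nat \<lceil>X\<rceil>}"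
  proof
    fix k assume "k \<in> S"
    then have k: "disp g h \<kappa> \<gamma> c k = 0" by (simp add: S_def)
    have "real k < X"
    proof (rule ccontr)
      assume *: "\<not> real k < X"
      then have "a * k \<le> 0" using a(3)[of k] k by simp
      moreover have "a * k > 0" using a * by simp
      ultimately show False by simp
    qed
    then show "k \<in> {..nat \<lceil>X\<rceil>}" by simp linarith
  qed
  then have fin: "finite S" using finite_subset by blast
  have "nat \<bar>j\<bar> \<in> S" using Omega_disp(1)[OF assms] assms by (auto simp: S_def)
  then have ne: "S \<noteq> {}" by auto
  have M: "Max S \<in> S" using fin ne by simp
  show ?thesis
  proof (rule that[of "Max S"])
    show "Max S \<ge> 1" "disp g h \<kappa> \<gamma> c (Max S) = 0" using M by (auto simp: S_def)
    fix n :: nat assume n: "n \<ge> 2"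
    then have "Max S * n > Max S" using \<open>Max S \<ge> 1\<close> by simp
    then have "Max S * n \<notin> S" using fin Max_ge leD by blast
    then show "disp g h \<kappa> \<gamma> c (real (Max S) * real n) \<noteq> 0"
      using n \<open>Max S \<ge> 1\<close> by (auto simp: S_def)
  qed
qed

section \<open>Lyapunov--Schmidt reduction in conformal variables\<close>

text \<open>Up to a factor i, the multiplier from the boundary trace of a function that is harmonic
  in the strip and constant on the bottom to the trace of its harmonic conjugate; in infinite depth
  it is the periodic Hilbert transform.\<close>

definition qsym :: "ereal \<Rightarrow> nat \<Rightarrow> real \<Rightarrow> int \<Rightarrow> real" where
  "qsym h K H n = sgn (of_int n) * cth h H (real K * \<bar>of_int n\<bar>)"

lemma qsym_uminus [simp]: "qsym h K H (- n) = - qsym h K H n"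
  by (simp add: qsym_def sgn_minus)

lemma qsym_0 [simp]: "qsym h K H 0 = 0"
  by (simp add: qsym_def)

lemma K_abs_ge_1:
  assumes "K \<ge> (1::nat)" "n \<noteq> (0::int)"
  shows "real K * \<bar>of_int n\<bar> \<ge> 1"
proof -
  have "\<bar>real_of_int n\<bar> \<ge> 1" using assms(2) by linarith
  then show ?thesis using assms(1) mult_mono[of 1 "real K" 1 "\<bar>real_of_int n\<bar>"] by simp
qed

lemma qsym_bound:
  assumes "K \<ge> 1" "H0 > 0" "H \<ge> H0"
  shows "\<bar>qsym h K H n\<bar> \<le> 1 + 1 / H0"
proof (cases "n = 0")
  case False
  then have x: "real K * \<bar>of_int n\<bar> \<ge> 1" using K_abs_ge_1 assms by blast
  moreover have "cth h H (real K * \<bar>of_int n\<bar>) \<ge> 1" using x assms by (intro cth_ge_1) auto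
  ultimately show ?thesis using cth_le[OF x assms(2,3)] False
    by (simp add: qsym_def abs_mult abs_sgn_eq)
qed (use assms in auto)

lemma qsym_lipschitz:
  assumes "K \<ge> 1" "H0 > 0" "H \<ge> H0" "H' \<ge> H0"
  shows "\<bar>qsym h K H n - qsym h K H' n\<bar> \<le> 2 * (1 + 1 / (2 * H0)) / H0 * \<bar>H - H'\<bar>"
proof (cases "n = 0")
  case False
  then have x: "real K * \<bar>of_int n\<bar> \<ge> 1" using K_abs_ge_1 assms by blast
  have "\<bar>qsym h K H n - qsym h K H' n\<bar> = \<bar>cth h H (real K * \<bar>of_int n\<bar>) - cth h H' (real K * \<bar>of_int n\<bar>)\<bar>"
    using False by (auto simp: qsym_def sgn_if)
  then show ?thesis using cth_lipschitz[OF x assms(2-4)] by (simp add: abs_minus_commute)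
qed (use assms in auto)

lemma qsym_infinite: "qsym \<infinity> K H n = qsym \<infinity> K H' n"
  by (simp add: qsym_def cth_def)

lemma BL_symbol_I:
  assumes "\<And>e z n. 0 < e \<Longrightarrow> e \<le> e0 \<Longrightarrow> adm \<rho> z \<Longrightarrow> \<bar>a e z n\<bar> \<le> A"
    and "\<And>e z n. 0 < e \<Longrightarrow> e \<le> e0 \<Longrightarrow> adm \<rho> z \<Longrightarrow> a e z (- n) = s * a e z n"
    and "\<And>e z z' d n. 0 < e \<Longrightarrow> e \<le> e0 \<Longrightarrow> adm \<rho> z \<Longrightarrow> adm \<rho> z' \<Longrightarrow> near \<rho> d z z' \<Longrightarrow>
       \<bar>a e z n - a e z' n\<bar> \<le> B * d"
  shows "BL_symbol \<rho> e0 s a"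
  unfolding BL_symbol_def
proof (intro exI[of _ "max 0 (max A B)"] conjI allI impI; (elim conjE)?)
  fix e z z' d n assume "0 < e" "e \<le> e0" "adm \<rho> z" "adm \<rho> z'" and n: "near \<rho> d z z'"
  moreover have "B * d \<le> max 0 (max A B) * d"
    using near_nonneg[OF n] by (intro mult_right_mono) auto
  ultimately show "\<bar>a e z n - a e z' n\<bar> \<le> max 0 (max A B) * d"
    using assms(3) order_trans by blast
next
  fix e z n assume "0 < e" "e \<le> e0" "adm \<rho> z"
  then show "\<bar>a e z n\<bar> \<le> max 0 (max A B)" using assms(1)[of e z n] by linarith
qed (use assms in auto)

lemma BL_conv_even: "\<rho> \<ge> 0 \<Longrightarrow> BL \<rho> e0 1 P \<Longrightarrow> BL \<rho> e0 1 Q \<Longrightarrow> BL \<rho> e0 1 (\<lambda>e z. conv (P e z) (Q e z))"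
  and BL_conv_odd: "\<rho> \<ge> 0 \<Longrightarrow> BL \<rho> e0 (-1) P \<Longrightarrow> BL \<rho> e0 (-1) Q \<Longrightarrow> BL \<rho> e0 1 (\<lambda>e z. conv (P e z) (Q e z))"
  and BL_conv_oe: "\<rho> \<ge> 0 \<Longrightarrow> BL \<rho> e0 (-1) P \<Longrightarrow> BL \<rho> e0 1 Q \<Longrightarrow> BL \<rho> e0 (-1) (\<lambda>e z. conv (P e z) (Q e z))"
  using BL_conv[of \<rho> e0 1 P 1 Q] BL_conv[of \<rho> e0 "-1" P "-1" Q] BL_conv[of \<rho> e0 "-1" P 1 Q] by auto

lemma BL_odd_symbol:
  "BL_symbol \<rho> e0 (-1) a \<Longrightarrow> BL \<rho> e0 (-1) Q \<Longrightarrow> BL \<rho> e0 1 (\<lambda>e z n. a e z n * Q e z n)"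
  "BL_symbol \<rho> e0 (-1) a \<Longrightarrow> BL \<rho> e0 1 Q \<Longrightarrow> BL \<rho> e0 (-1) (\<lambda>e z n. a e z n * Q e z n)"
  using BL_symbol_mult[of \<rho> e0 "-1" a "-1" Q] BL_symbol_mult[of \<rho> e0 "-1" a 1 Q] by auto

definition av :: "(int \<Rightarrow> real) \<Rightarrow> int \<Rightarrow> real" where
  "av f = single (f 0)"

lemma BL_av: "BL \<rho> e0 1 P \<Longrightarrow> BL \<rho> e0 1 (\<lambda>e z. av (P e z))"
proof -
  assume "BL \<rho> e0 1 P"
  then have "BL \<rho> e0 (1 * 1) (\<lambda>e z n. (if n = 0 then 1 else 0) * P e z n)"
    by (intro BL_symbol_mult[OF BL_symbol_const[where A=1]]) auto
  moreover have "(\<lambda>e z n. (if n = 0 then 1 else 0) * P e z n) = (\<lambda>e z. av (P e z))"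
    by (intro ext) (auto simp: av_def single_def)
  ultimately show ?thesis by simp
qed

section \<open>The linearized operator and the unknowns of the reduced problem\<close>

locale bifurcation =
  fixes g \<kappa> \<gamma> cs \<rho> :: real and h :: ereal and K :: nat
  assumes g: "g > 0" and h: "h > 0" and \<kappa>: "\<kappa> \<ge> 0" and K: "K \<ge> 1" and \<rho>: "\<rho> \<ge> 0"
    and cs: "cs \<noteq> 0"
    and res: "disp g h \<kappa> \<gamma> cs K = 0"
    and nonres: "\<And>n. n \<ge> 2 \<Longrightarrow> disp g h \<kappa> \<gamma> cs (real K * real n) \<noteq> 0"
begin

definition hr :: real where "hr = real_of_ereal h"

definition m :: "int \<Rightarrow> real" where "m n = real K * of_int n"

abbreviation q :: "real \<Rightarrow> int \<Rightarrow> real" where "q \<equiv> qsym h K"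

text \<open>The symbol of the linearization at the trivial flow of speed \<open>cs\<close>. It vanishes
  exactly at \<open>n = \<plusminus>1\<close>, with the junk value \<open>1 / D n = 0\<close> there.\<close>

definition D :: "int \<Rightarrow> real" where
  "D n = g + (if n = 0 then 0 else cs * \<gamma>) - cs\<^sup>2 * (m n * q hr n) + \<kappa> * (m n)\<^sup>2"

definition theta :: real where "theta = \<gamma> - 2 * cs * (m 1 * q hr 1)"

text \<open>On the unit ball |Re (z 0)| is at most 1 and \<open>y e z 0 = Re (z 0) / g\<close>, so
  \<open>e \<le> g * hr / 2\<close> keeps the conformal depth above \<open>hr / 2\<close>.\<close>

definition e0 :: real where "e0 = (if h = \<infinity> then 1 else min 1 (g * hr / 2))"

lemma hr_pos: "h \<noteq> \<infinity> \<Longrightarrow> hr > 0"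
  unfolding hr_def using h real_of_ereal_depth_pos by blast

lemma e0_pos: "e0 > 0"
  using hr_pos g by (auto simp: e0_def)

lemma m_uminus [simp]: "m (- n) = - m n" and m_0 [simp]: "m 0 = 0"
  by (simp_all add: m_def)

lemma m_abs: "\<bar>m n\<bar> = real K * \<bar>of_int n\<bar>"
  by (simp add: m_def abs_mult)

lemma m_ge_1: "n \<noteq> 0 \<Longrightarrow> \<bar>m n\<bar> \<ge> 1"
  using K_abs_ge_1[OF K] by (simp add: m_abs)

lemma D_uminus [simp]: "D (- n) = D n"
  by (simp add: D_def)

lemma m_q: "m n * q H n = \<bar>m n\<bar> * cth h H \<bar>m n\<bar>"
  by (simp add: qsym_def m_abs mult.assoc[symmetric])
    (simp add: m_def mult.assoc linordered_idom_class.abs_sgn[symmetric] mult.commute[of "sgn _"])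

lemma D_disp: "n \<noteq> 0 \<Longrightarrow> D n = disp g h \<kappa> \<gamma> cs \<bar>m n\<bar>"
  by (simp add: D_def disp_def m_q hr_def)

lemma D_0: "D 0 = g"
  by (simp add: D_def)

lemma D_1: "D 1 = 0" and D_minus_1: "D (- 1) = 0"
  using res by (simp_all add: D_disp m_def)

lemma D_nonzero: "\<bar>n\<bar> \<noteq> 1 \<Longrightarrow> D n \<noteq> 0"
proof (cases "n = 0")
  case False
  assume "\<bar>n\<bar> \<noteq> 1"
  with False have "nat \<bar>n\<bar> \<ge> 2" by linarith
  from nonres[OF this] show ?thesis using False by (simp add: D_disp m_abs)
qed (use g in \<open>simp add: D_0\<close>)

text \<open>This is the transversality condition. If the derivative vanished,
  \<open>cs * \<gamma>\<close> would be twice \<open>cs^2 * (m 1 * q hr 1)\<close>, and the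
  resonance \<open>D 1 = 0\<close> would become a sum of nonnegative terms and
  \<open>g > 0\<close>.\<close>

lemma theta_nonzero: "theta \<noteq> 0"
proof
  assume "theta = 0"
  then have "\<gamma> = 2 * cs * (m 1 * q hr 1)" by (simp add: theta_def)
  then have "cs * \<gamma> = 2 * (cs\<^sup>2 * (m 1 * q hr 1))" by (simp add: power2_eq_square)
  then have "D 1 = g + cs\<^sup>2 * (m 1 * q hr 1) + \<kappa> * (m 1)\<^sup>2"
    by (simp add: D_def)
  moreover have "m 1 * q hr 1 \<ge> 0"
    using cth_depth_bounds(1)[OF h m_ge_1[of 1]] by (simp add: m_q hr_def)
  ultimately have "D 1 > 0" using g \<kappa>
    by (simp add: add_pos_nonneg)
  then show False by (simp add: D_1)
qed

lemma q_bound_h: "\<exists>C. \<forall>n. \<bar>q hr n\<bar> \<le> C"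
proof (cases "h = \<infinity>")
  case True
  then have "\<bar>q hr n\<bar> \<le> 1" for n by (simp add: qsym_def cth_def sgn_if)
  then show ?thesis by blast
next
  case False
  then show ?thesis using qsym_bound[OF K hr_pos order_refl] by blast
qed

text \<open>The growth of the dispersion function settles large frequencies, and finitely many
  remain. So inverting the linear part gains one derivative, and two with the factor
  \<open>\<kappa>\<close>.\<close>

lemma inverse_D_bounds:
  obtains C where "\<And>n. \<bar>1 / D n\<bar> \<le> C" "\<And>n. \<bar>m n / D n\<bar> \<le> C" "\<And>n. \<bar>\<kappa> * (m n)\<^sup>2 / D n\<bar> \<le> C"
proof -
  obtain a X where a: "a > 0" "X \<ge> 1" "\<And>x. x \<ge> X \<Longrightarrow> \<bar>disp g h \<kappa> \<gamma> cs x\<bar> \<ge> a * x"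
    "\<And>x. x \<ge> X \<Longrightarrow> \<bar>disp g h \<kappa> \<gamma> cs x\<bar> \<ge> a * (\<kappa> * x\<^sup>2)"
    using disp_growth[OF h \<kappa> cs, of g \<gamma>] by blast
  define N where "N = nat \<lceil>X\<rceil>"
  define b where "b n = \<bar>1 / D n\<bar> + \<bar>m n / D n\<bar> + \<bar>\<kappa> * (m n)\<^sup>2 / D n\<bar>" for n
  define C where "C = 1 / a + (\<Sum>n\<in>{- int N..int N}. b n)"
  have b0: "b n \<ge> 0" for n by (simp add: b_def)
  then have S0: "(\<Sum>n\<in>{- int N..int N}. b n) \<ge> 0" by (intro sum_nonneg) auto
  have "\<bar>1 / D n\<bar> \<le> C \<and> \<bar>m n / D n\<bar> \<le> C \<and> \<bar>\<kappa> * (m n)\<^sup>2 / D n\<bar> \<le> C" for n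
  proof (cases "\<bar>n\<bar> \<le> int N")
    case True
    then have "b n \<le> (\<Sum>n\<in>{- int N..int N}. b n)"
      using b0 by (intro member_le_sum) auto
    moreover have "1 / a > 0" using a by simp
    ultimately have "b n \<le> C" unfolding C_def by linarith
    moreover have "\<bar>1 / D n\<bar> \<le> b n" "\<bar>m n / D n\<bar> \<le> b n" "\<bar>\<kappa> * (m n)\<^sup>2 / D n\<bar> \<le> b n"
      by (simp_all add: b_def)
    ultimately show ?thesis by linarith
  next
    case False
    then have n0: "n \<noteq> 0" by auto
    have "\<bar>real_of_int n\<bar> \<ge> X" using False unfolding N_def by linarith
    moreover have "1 * \<bar>real_of_int n\<bar> \<le> real K * \<bar>real_of_int n\<bar>"
      using K by (intro mult_right_mono) auto
    ultimately have mX: "\<bar>m n\<bar> \<ge> X" by (simp add: m_abs)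
    have m1: "\<bar>m n\<bar> \<ge> 1" using m_ge_1 n0 by simp
    have D1: "\<bar>D n\<bar> \<ge> a * \<bar>m n\<bar>" using a(3)[OF mX] n0 by (simp add: D_disp)
    have D2: "\<bar>D n\<bar> \<ge> a * (\<kappa> * (m n)\<^sup>2)" using a(4)[OF mX] n0 by (simp add: D_disp)
    have "a * 1 \<le> a * \<bar>m n\<bar>" using a m1 by (intro mult_left_mono) auto
    then have D0: "\<bar>D n\<bar> \<ge> a" using D1 by linarith
    then have Dp: "\<bar>D n\<bar> > 0" using a by linarith
    have "1 / a \<le> C" using S0 by (simp add: C_def)
    moreover have "\<bar>1 / D n\<bar> \<le> 1 / a" using D0 Dp a by (simp add: field_simps)
    moreover have "\<bar>m n / D n\<bar> \<le> 1 / a" using D1 Dp a by (simp add: field_simps)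
    moreover have "\<bar>\<kappa> * (m n)\<^sup>2 / D n\<bar> \<le> 1 / a"
      using D2 Dp a \<kappa> by (simp add: field_simps abs_mult)
    ultimately show ?thesis by linarith
  qed
  then show ?thesis using that by blast
qed

text \<open>One sequence \<open>z\<close> carries all unknowns: \<open>y = Y / e\<close> in \<open>Re z = D y\<close> off \<open>n = \<plusminus>1\<close>, the speed
  \<open>cs + Re (z 1) / theta\<close>, and \<open>rh\<close>, with \<open>\<bar>Z'\<bar>\<inverse> = 1 + e * rh\<close>, in \<open>Im z = rh + lam\<close>, where
  \<open>X' = 1 + e * lam\<close>. Here \<open>theta\<close> is the derivative of the symbol at \<open>n = 1\<close> with respect to the speed.\<close>

definition y :: family where
  "y e z n = (if \<bar>n\<bar> = 1 then 1 else 0) + 1 / D n * Re (z n)"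

definition yd :: family where "yd e z n = m n * y e z n"

definition yk :: family where "yk e z n = \<kappa> * (m n)\<^sup>2 * y e z n"

definition sg :: family where "sg e z n = Im (z n)"

definition cc :: family where "cc e z = single (cs + 1 / theta * Re (z 1))"

definition Hh :: "real \<Rightarrow> (int \<Rightarrow> complex) \<Rightarrow> real" where "Hh e z = hr + e * y e z 0"

definition Q :: "family \<Rightarrow> family" where "Q P e z n = q (Hh e z) n * P e z n"

text \<open>The effect of replacing the depth \<open>hr\<close> by \<open>Hh e z\<close> in the
  multiplier, divided by \<open>e\<close> to be of order one: \<open>lam\<close> is its value at
  depth \<open>hr\<close> plus \<open>e * EE\<close>.\<close>

definition EE :: family where "EE e z n = (q (Hh e z) n - q hr n) / e * yd e z n"

lemma bd_unit: "bd \<rho> (a / wt \<rho> 1) (\<lambda>n. if \<bar>n\<bar> = 1 then a else 0)" if "a \<ge> 0" for a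
proof -
  have "a \<le> a / wt \<rho> 1 * wt \<rho> n" if "\<bar>n\<bar> = 1" for n
  proof -
    have "wt \<rho> n = wt \<rho> 1" using that wt_uminus[of \<rho> 1] by (cases "n \<ge> 0") auto
    then show ?thesis using wt_pos[of \<rho> 1] by simp
  qed
  then show ?thesis using that wt_pos[of \<rho> 1] by (auto simp: bd_def less_imp_le)
qed

lemma BL_y: "BL \<rho> e0 1 y"
proof -
  obtain C where C: "\<And>n. \<bar>1 / D n\<bar> \<le> C" by (rule inverse_D_bounds) blast
  have "BL \<rho> e0 1 (\<lambda>e z n. (if \<bar>n\<bar> = 1 then 1 else 0) + 1 / D n * Re (z n))"
    by (rule BL_affine[OF bd_unit[of 1] C]) auto
  then show ?thesis by (simp add: y_def[abs_def])
qed

lemma BL_yd: "BL \<rho> e0 (-1) yd"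
proof -
  obtain C where C: "\<And>n. \<bar>m n / D n\<bar> \<le> C" by (rule inverse_D_bounds) blast
  have "bd \<rho> (real K * (1 / wt \<rho> 1)) (\<lambda>n. (if n = 1 then real K else if n = - 1 then - real K else 0) * (if \<bar>n\<bar> = 1 then 1 else 0))"
    by (rule bd_symbol[OF bd_unit[of 1]]) auto
  then have "BL \<rho> e0 (-1) (\<lambda>e z n. (if n = 1 then real K else if n = - 1 then - real K else 0) * (if \<bar>n\<bar> = 1 then 1 else 0) + m n / D n * Re (z n))"
    by (rule BL_affine[OF _ C]) auto
  moreover have "(\<lambda>e z n. (if n = 1 then real K else if n = - 1 then - real K else 0) * (if \<bar>n\<bar> = 1 then 1 else 0) + m n / D n * Re (z n)) = yd"
  proof (intro ext)
    fix e z and n :: int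
    consider "n = 1" | "n = -1" | "\<bar>n\<bar> \<noteq> 1" by linarith
    then show "(if n = 1 then real K else if n = - 1 then - real K else 0) * (if \<bar>n\<bar> = 1 then 1 else 0) + m n / D n * Re (z n) = yd e z n"
      by cases (simp_all add: yd_def y_def m_def ring_distribs)
  qed
  ultimately show ?thesis by simp
qed

lemma BL_yk: "BL \<rho> e0 1 yk"
proof -
  obtain C where C: "\<And>n. \<bar>\<kappa> * (m n)\<^sup>2 / D n\<bar> \<le> C" by (rule inverse_D_bounds) blast
  have "BL \<rho> e0 1 (\<lambda>e z n. (if \<bar>n\<bar> = 1 then \<kappa> * (m 1)\<^sup>2 else 0) + \<kappa> * (m n)\<^sup>2 / D n * Re (z n))"
    by (rule BL_affine[OF bd_unit C]) (use \<kappa> in auto)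
  moreover have "(\<lambda>e z n. (if \<bar>n\<bar> = 1 then \<kappa> * (m 1)\<^sup>2 else 0) + \<kappa> * (m n)\<^sup>2 / D n * Re (z n)) = yk"
  proof (intro ext)
    fix e z and n :: int
    consider "n = 1" | "n = -1" | "\<bar>n\<bar> \<noteq> 1" by linarith
    then show "(if \<bar>n\<bar> = 1 then \<kappa> * (m 1)\<^sup>2 else 0) + \<kappa> * (m n)\<^sup>2 / D n * Re (z n) = yk e z n"
      by cases (simp_all add: yk_def y_def m_def ring_distribs)
  qed
  ultimately show ?thesis by simp
qed

lemma BL_sg: "BL \<rho> e0 1 sg"
proof -
  have "BL \<rho> e0 1 (\<lambda>e z n. 0 + 1 * Im (z n))"
    by (rule BL_affine[where B=0 and A=1]) (auto simp: bd_def)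
  then show ?thesis by (simp add: sg_def[abs_def])
qed

lemma BL_cc: "BL \<rho> e0 1 cc"
  unfolding cc_def[abs_def] by (rule BL_single) auto

lemma y_0: "y e z 0 = Re (z 0) / g"
  by (simp add: y_def D_0)

lemma Hh_ge:
  assumes "0 < e" "e \<le> e0" "adm \<rho> z" "h \<noteq> \<infinity>"
  shows "Hh e z \<ge> hr / 2"
proof -
  have "\<bar>Re (z 0)\<bar> \<le> 1"
    using assms(3) abs_Re_le_cmod[of "z 0"] unfolding adm_def
    by (metis order_trans wt_0)
  then have "\<bar>e * y e z 0\<bar> \<le> e * (1 / g)"
    using assms g by (simp add: y_0 abs_mult divide_right_mono)
  also have "\<dots> \<le> (g * hr / 2) * (1 / g)"
    using assms g by (intro mult_right_mono) (auto simp: e0_def)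
  also have "\<dots> = hr / 2" using g by simp
  finally show ?thesis unfolding Hh_def by linarith
qed

lemma Hh_diff:
  assumes "0 < e" "near \<rho> d z z'"
  shows "\<bar>Hh e z - Hh e z'\<bar> \<le> e * (d / g)"
proof -
  have "\<bar>Re (z 0) - Re (z' 0)\<bar> \<le> d"
    using assms(2) abs_Re_le_cmod[of "z 0 - z' 0"] unfolding near_def
    by (metis minus_complex.sel(1) mult.right_neutral order_trans wt_0)
  then have "\<bar>e * ((Re (z 0) - Re (z' 0)) / g)\<bar> \<le> e * (d / g)"
    using assms g by (simp add: abs_mult divide_right_mono)
  moreover have "Hh e z - Hh e z' = e * ((Re (z 0) - Re (z' 0)) / g)"
    by (simp add: Hh_def y_0 diff_divide_distrib right_diff_distrib)
  ultimately show ?thesis by simp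
qed

lemma Hh_diff0:
  assumes "0 < e" "adm \<rho> z"
  shows "\<bar>Hh e z - hr\<bar> \<le> e * (1 / g)"
proof -
  have "\<bar>Re (z 0)\<bar> \<le> 1"
    using assms(2) abs_Re_le_cmod[of "z 0"] unfolding adm_def
    by (metis order_trans wt_0)
  then show ?thesis
    using assms g by (simp add: Hh_def y_0 abs_mult divide_right_mono)
qed

lemma BL_symbol_q: "BL_symbol \<rho> e0 (-1) (\<lambda>e z. q (Hh e z))"
proof (cases "h = \<infinity>")
  case True
  have "BL_symbol \<rho> e0 (-1) (\<lambda>e z. q hr)"
    using q_bound_h by (auto intro: BL_symbol_const)
  moreover have "(\<lambda>e z. q hr) = (\<lambda>e z. q (Hh e z))"
    using True qsym_infinite by blast
  ultimately show ?thesis by simp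
next
  case False
  then have hp: "hr / 2 > 0" using hr_pos by simp
  define C where "C = 2 * (1 + 1 / (2 * (hr / 2))) / (hr / 2)"
  have C: "C \<ge> 0" using hp by (simp add: C_def)
  have "\<bar>q (Hh e z) n\<bar> \<le> 1 + 1 / (hr / 2)" if "0 < e" "e \<le> e0" "adm \<rho> z" for e z n
    by (rule qsym_bound[OF K hp Hh_ge[OF that False]])
  moreover have "\<bar>q (Hh e z) n - q (Hh e z') n\<bar> \<le> C * e0 / g * d"
    if "0 < e" "e \<le> e0" "adm \<rho> z" "adm \<rho> z'" "near \<rho> d z z'" for e z n z' d
  proof -
    have "\<bar>q (Hh e z) n - q (Hh e z') n\<bar> \<le> C * \<bar>Hh e z - Hh e z'\<bar>"
      unfolding C_def using that False by (intro qsym_lipschitz[OF K hp] Hh_ge) auto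
    also have "\<dots> \<le> C * (e * (d / g))"
      using that C by (intro mult_left_mono Hh_diff) auto
    also have "\<dots> \<le> C * (e0 * (d / g))"
      using that C g near_nonneg by (intro mult_left_mono mult_right_mono) auto
    finally show ?thesis by (simp add: mult_ac)
  qed
  ultimately show ?thesis
    by (intro BL_symbol_I[where A="1 + 1 / (hr / 2)" and B="C * e0 / g"]) auto
qed

text \<open>The depth moves by O(e), both away from \<open>hr\<close> and between two sequences, so
  the Lipschitz bound of the symbol absorbs the division by \<open>e\<close>.\<close>

lemma BL_symbol_dq: "BL_symbol \<rho> e0 (-1) (\<lambda>e z n. (q (Hh e z) n - q hr n) / e)"
proof (cases "h = \<infinity>")
  case True
  then have "(\<lambda>e z n. (q (Hh e z) n - q hr n) / e) = (\<lambda>e z n. 0)"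
    using qsym_infinite by (metis diff_self div_0)
  then show ?thesis using BL_symbol_const[of "\<lambda>_. 0" 0 "-1"] by simp
next
  case False
  then have hp: "hr / 2 > 0" using hr_pos by simp
  define C where "C = 2 * (1 + 1 / (2 * (hr / 2))) / (hr / 2)"
  have C: "C \<ge> 0" using hp by (simp add: C_def)
  have "\<bar>(q (Hh e z) n - q hr n) / e\<bar> \<le> C / g" if "0 < e" "e \<le> e0" "adm \<rho> z" for e z n
  proof -
    have "\<bar>q (Hh e z) n - q hr n\<bar> \<le> C * \<bar>Hh e z - hr\<bar>"
      unfolding C_def using that False hp by (intro qsym_lipschitz[OF K hp] Hh_ge) auto
    also have "\<dots> \<le> C * (e * (1 / g))"
      using that C by (intro mult_left_mono Hh_diff0) auto
    finally show ?thesis using that by (simp add: field_simps)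
  qed
  moreover have "\<bar>(q (Hh e z) n - q hr n) / e - (q (Hh e z') n - q hr n) / e\<bar> \<le> C / g * d"
    if "0 < e" "e \<le> e0" "adm \<rho> z" "adm \<rho> z'" "near \<rho> d z z'" for e z n z' d
  proof -
    have "\<bar>q (Hh e z) n - q (Hh e z') n\<bar> \<le> C * \<bar>Hh e z - Hh e z'\<bar>"
      unfolding C_def using that False by (intro qsym_lipschitz[OF K hp] Hh_ge) auto
    also have "\<dots> \<le> C * (e * (d / g))"
      using that C by (intro mult_left_mono Hh_diff) auto
    finally have "\<bar>(q (Hh e z) n - q (Hh e z') n) / e\<bar> \<le> C / g * d"
      using that by (simp add: field_simps)
    then show ?thesis by (simp add: diff_divide_distrib)
  qed
  moreover have "(q (Hh e z) (- n) - q hr (- n)) / e = -1 * ((q (Hh e z) n - q hr n) / e)" for e z n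
    by (simp add: diff_divide_distrib)
  ultimately show ?thesis
    unfolding BL_symbol_def using C g
    by (intro exI[of _ "C / g"]) auto
qed

lemma BL_Q: "BL \<rho> e0 (-1) P \<Longrightarrow> BL \<rho> e0 1 (Q P)" "BL \<rho> e0 1 P \<Longrightarrow> BL \<rho> e0 (-1) (Q P)"
  unfolding Q_def[abs_def] using BL_odd_symbol[OF BL_symbol_q] by blast+

lemma BL_EE: "BL \<rho> e0 1 EE"
  unfolding EE_def[abs_def] by (rule BL_odd_symbol(1)[OF BL_symbol_dq BL_yd])

end

section \<open>The nonlinear terms and their fixed point\<close>

context bifurcation
begin

text \<open>With \<open>J = \<bar>Z'\<bar>\<^sup>2 = 1 + e * jj\<close>, the term \<open>P0\<close> collects the part of Bernoulli's law that is at least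
  quadratic in \<open>Y\<close>, divided by \<open>e\<^sup>2\<close>, and \<open>sg = e * P2\<close> is \<open>J * (1 + e * rh)\<^sup>2 = 1\<close> solved for its
  linear part.\<close>

definition lam :: family where "lam = Q yd"
definition kd :: family where "kd = Q yk"
definition j2 :: family where
  "j2 e z n = conv (lam e z) (lam e z) n - conv (yd e z) (yd e z) n"
definition jj :: family where "jj e z n = 2 * lam e z n + e * j2 e z n"
definition rh :: family where "rh e z n = sg e z n - lam e z n"
definition yl :: family where "yl e z = conv (y e z) (lam e z)"
text \<open>As \<open>y^2\<close> has derivative \<open>2 * y * y'\<close>, the conformal derivative
  of the potential on the surface is \<open>c * e * lam + \<gamma> * e^2 * w2\<close>.\<close>

definition w2 :: family where "w2 = Q (\<lambda>e z. conv (yd e z) (y e z))"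
text \<open>\<open>e * m1\<close> is the mean of the stream function over the physical variable,
  hence the Jacobian \<open>1 + e * lam\<close> as a factor; \<open>m2\<close> is what remains of it
  beyond \<open>c\<close> times the mean of \<open>y\<close>, divided by \<open>e\<close>.\<close>

definition m2 :: family where
  "m2 e z = av (\<lambda>n. \<gamma> / 2 * conv (y e z) (y e z) n + conv (cc e z) (yl e z) n
     + \<gamma> / 2 * (e * conv (conv (y e z) (y e z)) (lam e z) n))"
definition m1 :: family where "m1 e z n = conv (cc e z) (av (y e z)) n + e * m2 e z n"
text \<open>Chosen so that the relative tangential velocity in Bernoulli's law, before squaring, is
  \<open>- (c + \<gamma> * e * tt)\<close>.\<close>

definition tt :: family where "tt e z n = y e z n - e * (w2 e z n - yl e z n)"
text \<open>The quadratic part of the curvature numerator: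
  \<open>\<kappa> * (Y'' * X' - Y' * X'')\<close> is \<open>e * (- yk + e * k1)\<close>.\<close>

definition k1 :: family where
  "k1 e z n = conv (yd e z) (kd e z) n - conv (yk e z) (lam e z) n"
definition P0 :: family where
  "P0 e z n = conv (\<lambda>n. g * y e z n - \<gamma> * m1 e z n) (jj e z) n - \<gamma> * m2 e z n
     - 1 / 2 * conv (conv (cc e z) (cc e z)) (j2 e z) n
     - \<gamma> * conv (cc e z) (\<lambda>n. w2 e z n - yl e z n) n
     + \<gamma>\<^sup>2 / 2 * conv (tt e z) (tt e z) n
     - (k1 e z n + conv (rh e z) (\<lambda>n. e * k1 e z n - yk e z n) n)"
text \<open>The linear operator that is inverted has the multiplier at depth \<open>hr\<close>; the
  last term carries the difference to the true conformal depth.\<close>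

definition P1 :: family where
  "P1 e z n = P0 e z n - conv (cc e z) (conv (cc e z) (EE e z)) n"
definition P2 :: family where
  "P2 e z n = - (1 / 2) * (j2 e z n + conv (rh e z) (rh e z) n + 2 * conv (jj e z) (rh e z) n
     + e * conv (jj e z) (conv (rh e z) (rh e z)) n)"

lemma BL_lam: "BL \<rho> e0 1 lam" and BL_kd: "BL \<rho> e0 (-1) kd"
  unfolding lam_def kd_def by (intro BL_Q BL_yd BL_yk)+

lemma BL_j2: "BL \<rho> e0 1 j2"
  unfolding j2_def[abs_def] by (intro BL_diff BL_conv_even[OF \<rho> BL_lam BL_lam] BL_conv_odd[OF \<rho> BL_yd BL_yd])

lemma BL_jj: "BL \<rho> e0 1 jj"
  unfolding jj_def[abs_def] by (intro BL_add BL_cmult BL_small BL_lam BL_j2)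

lemma BL_rh: "BL \<rho> e0 1 rh"
  unfolding rh_def[abs_def] by (intro BL_diff BL_lam BL_sg)

lemma BL_yl: "BL \<rho> e0 1 yl"
  unfolding yl_def[abs_def] by (intro BL_conv_even[OF \<rho>] BL_lam BL_y)

lemma BL_w2: "BL \<rho> e0 1 w2"
  unfolding w2_def by (intro BL_Q(1) BL_conv_oe[OF \<rho>] BL_yd BL_y)

lemma BL_m2: "BL \<rho> e0 1 m2"
  unfolding m2_def[abs_def]
  by (intro BL_av BL_add BL_cmult BL_small BL_conv_even[OF \<rho>] BL_lam BL_y BL_cc BL_yl)

lemma BL_m1: "BL \<rho> e0 1 m1"
  unfolding m1_def[abs_def]
  by (intro BL_av BL_add BL_small BL_conv_even[OF \<rho>] BL_y BL_cc BL_m2)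

lemma BL_tt: "BL \<rho> e0 1 tt"
  unfolding tt_def[abs_def] by (intro BL_diff BL_small BL_y BL_w2 BL_yl)

lemma BL_k1: "BL \<rho> e0 1 k1"
  unfolding k1_def[abs_def]
  by (intro BL_diff BL_conv_odd[OF \<rho> BL_yd BL_kd] BL_conv_even[OF \<rho> BL_yk BL_lam])

lemma BL_P0: "BL \<rho> e0 1 P0"
  unfolding P0_def[abs_def]
  by (intro BL_diff BL_add BL_cmult BL_small BL_conv_even[OF \<rho>]
      BL_y BL_m1 BL_jj BL_m2 BL_cc BL_j2 BL_w2 BL_yl BL_tt BL_k1 BL_rh BL_yk)

lemma BL_P1: "BL \<rho> e0 1 P1"
  unfolding P1_def[abs_def] by (intro BL_diff BL_conv_even[OF \<rho>] BL_P0 BL_cc BL_EE)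

lemma BL_P2: "BL \<rho> e0 1 P2"
  unfolding P2_def[abs_def]
  by (intro BL_cmult BL_add BL_small BL_conv_even[OF \<rho>] BL_j2 BL_rh BL_jj)

definition dl :: "(int \<Rightarrow> complex) \<Rightarrow> real" where "dl z = 1 / theta * Re (z 1)"

text \<open>Changing the speed from \<open>cs\<close> to \<open>cs + dl z\<close> changes the symbol
  by \<open>dl z * (\<gamma> - (2 * cs + dl z) * (m n * q hr n))\<close> for
  \<open>n \<noteq> 0\<close>, and not at all for \<open>n = 0\<close>. At the resonant modes the
  part \<open>dl z * theta\<close> is the unknown \<open>Re (z 1)\<close> itself, so only the
  quadratic rest stays. The product \<open>dl z * GG z n\<close> is quadratic in \<open>z\<close> in
  all cases or of higher order.\<close>

definition GG :: "(int \<Rightarrow> complex) \<Rightarrow> int \<Rightarrow> real" where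
  "GG z n = (if n = 0 then 0 else if \<bar>n\<bar> = 1 then - dl z * (m 1 * q hr 1)
     else (\<gamma> - (2 * cs + dl z) * (m n * q hr n)) * (1 / D n * Re (z n)))"

definition Qd :: "(int \<Rightarrow> complex) \<Rightarrow> int \<Rightarrow> real" where "Qd z n = dl z * GG z n"

definition TT :: "real \<Rightarrow> (int \<Rightarrow> complex) \<Rightarrow> int \<Rightarrow> complex" where
  "TT e z n = Complex (- Qd z n - e * P1 e z n) (e * P2 e z n)"

lemma wt_le_1: "wt \<rho> n \<le> 1"
proof -
  have "wt \<rho> n \<le> 1 / 1"
    unfolding wt_def using \<rho> by (intro frac_le) auto
  then show ?thesis by simp
qed

lemma wt_abs_1: "\<bar>n\<bar> = 1 \<Longrightarrow> wt \<rho> n = wt \<rho> 1"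
  using wt_uminus[of \<rho> 1] by (cases "n \<ge> 0") auto

text \<open>This term carries no factor \<open>e\<close>. It vanishes to second order at 0 instead,
  so its Lipschitz constant on a ball is proportional to the radius, which will be O(e).\<close>

lemma Qd_lipschitz:
  "\<exists>C\<ge>0. \<forall>z z' r d n. r \<le> 1 \<longrightarrow> (\<forall>n. cmod (z n) \<le> r * wt \<rho> n) \<longrightarrow> (\<forall>n. cmod (z' n) \<le> r * wt \<rho> n) \<longrightarrow>
     near \<rho> d z z' \<longrightarrow> \<bar>Qd z n - Qd z' n\<bar> \<le> C * r * d * wt \<rho> n"
proof -
  obtain C1 where C1: "\<And>n. \<bar>1 / D n\<bar> \<le> C1" "\<And>n. \<bar>m n / D n\<bar> \<le> C1"
    by (rule inverse_D_bounds) blast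
  obtain C2 where C2: "\<And>n. \<bar>q hr n\<bar> \<le> C2" using q_bound_h by blast
  have C0: "C1 \<ge> 0" "C2 \<ge> 0" using C1(1)[of 0] C2[of 0] by linarith+
  define A1 where "A1 = 1 / \<bar>theta\<bar>"
  define A2 where "A2 = A1 * (\<bar>m 1\<bar> * C2) + (\<bar>\<gamma>\<bar> + 2 * \<bar>cs\<bar> * C2 + A1 * C2) * C1"
  define A3 where "A3 = A2 + A1 * C2 * C1"
  have A0: "A1 \<ge> 0" "A2 \<ge> 0" "A3 \<ge> 0" using C0 by (auto simp: A1_def A2_def A3_def)
  have dl_b: "\<bar>dl z\<bar> \<le> A1 * r * wt \<rho> 1" if "\<forall>n. cmod (z n) \<le> r * wt \<rho> n" for z r
  proof -
    have "\<bar>Re (z 1)\<bar> \<le> r * wt \<rho> 1" using that abs_Re_le_cmod order_trans by blast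
    then show ?thesis by (simp add: dl_def A1_def abs_mult divide_right_mono)
  qed
  have dl_d: "\<bar>dl z - dl z'\<bar> \<le> A1 * d * wt \<rho> 1" if "near \<rho> d z z'" for z z' d
  proof -
    have "\<bar>Re (z 1 - z' 1)\<bar> \<le> d * wt \<rho> 1"
      using that abs_Re_le_cmod order_trans unfolding near_def by blast
    moreover have "dl z - dl z' = 1 / theta * Re (z 1 - z' 1)"
      by (simp add: dl_def right_diff_distrib diff_divide_distrib)
    ultimately show ?thesis by (simp add: A1_def abs_mult divide_right_mono)
  qed
  show ?thesis
  proof (intro exI[of _ "A1 * A2 + A1 * A3"] conjI allI impI)
    fix z z' :: "int \<Rightarrow> complex" and r d n
    assume r: "r \<le> 1" and z: "\<forall>n. cmod (z n) \<le> r * wt \<rho> n" and z': "\<forall>n. cmod (z' n) \<le> r * wt \<rho> n"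
      and near: "near \<rho> d z z'"
    have r0: "r \<ge> 0" using z[rule_format, of 0] wt_0[of \<rho>] by (metis mult.right_neutral norm_ge_zero order_trans)
    have d0: "d \<ge> 0" using near near_nonneg by blast
    have le1: "A1 * x * wt \<rho> k \<le> A1 * x" if "x \<ge> 0" for x k
      using wt_le_1[of k] A0 that mult_left_mono[of "wt \<rho> k" 1 "A1 * x"] by simp
    have dz: "\<bar>dl z\<bar> \<le> A1 * r" "\<bar>dl z'\<bar> \<le> A1 * r" "\<bar>dl z - dl z'\<bar> \<le> A1 * d"
      using dl_b[OF z] dl_b[OF z'] dl_d[OF near] le1 r0 d0 by (meson order_trans)+
    have A1r: "A1 * r \<le> A1" using r A0 by (simp add: mult_left_le)
    have G: "\<bar>GG z n\<bar> \<le> A2 * r * wt \<rho> n \<and> \<bar>GG z n - GG z' n\<bar> \<le> A3 * d * wt \<rho> n"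
    proof -
      consider "n = 0" | "\<bar>n\<bar> = 1" | "n \<noteq> 0" "\<bar>n\<bar> \<noteq> 1" by linarith
      then show ?thesis
      proof cases
        case 1
        then show ?thesis using A0 r0 d0 by (simp add: GG_def)
      next
        case 2
        have mq: "\<bar>m 1 * q hr 1\<bar> \<le> \<bar>m 1\<bar> * C2"
          unfolding abs_mult using C2 by (intro mult_left_mono) auto
        have A: "A1 * (\<bar>m 1\<bar> * C2) \<le> A2" "A2 \<le> A3" using C0 A0 by (auto simp: A2_def A3_def)
        have "\<bar>GG z n\<bar> = \<bar>dl z\<bar> * \<bar>m 1 * q hr 1\<bar>" using 2 by (auto simp: GG_def abs_mult)
        also have "\<dots> \<le> (A1 * r * wt \<rho> 1) * (\<bar>m 1\<bar> * C2)"
          by (rule mult_mono[OF dl_b[OF z] mq]) (use A0 r0 in auto)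
        also have "\<dots> = (A1 * (\<bar>m 1\<bar> * C2)) * (r * wt \<rho> 1)" by simp
        also have "\<dots> \<le> A2 * (r * wt \<rho> 1)" using A r0 by (intro mult_right_mono) auto
        finally have 3: "\<bar>GG z n\<bar> \<le> A2 * r * wt \<rho> n" using wt_abs_1[OF 2] by simp
        have "\<bar>GG z n - GG z' n\<bar> = \<bar>dl z - dl z'\<bar> * \<bar>m 1 * q hr 1\<bar>"
          using 2 by (auto simp: GG_def abs_mult[symmetric] algebra_simps)
        also have "\<dots> \<le> (A1 * d * wt \<rho> 1) * (\<bar>m 1\<bar> * C2)"
          by (rule mult_mono[OF dl_d[OF near] mq]) (use A0 d0 in auto)
        also have "\<dots> = (A1 * (\<bar>m 1\<bar> * C2)) * (d * wt \<rho> 1)" by simp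
        also have "\<dots> \<le> A3 * (d * wt \<rho> 1)" using A d0 by (intro mult_right_mono) auto
        finally show ?thesis using wt_abs_1[OF 2] 3 by simp
      next
        case 3
        define a where "a = 1 / D n"
        define b where "b = q hr n * (m n / D n)"
        have a: "\<bar>a\<bar> \<le> C1" unfolding a_def by (rule C1)
        have b: "\<bar>b\<bar> \<le> C2 * C1" unfolding b_def abs_mult by (rule mult_mono[OF C2 C1(2)]) (use C0 in auto)
        have GG_eq: "GG z n = (\<gamma> * a - (2 * cs + dl z) * b) * Re (z n)" for z
          using 3 by (simp add: GG_def a_def b_def algebra_simps add_divide_distrib)
        have co: "\<bar>\<gamma> * a - (2 * cs + dl z) * b\<bar> \<le> A2" if "\<bar>dl z\<bar> \<le> A1" for z
        proof -
          have "\<bar>\<gamma> * a - (2 * cs + dl z) * b\<bar> \<le> \<bar>\<gamma>\<bar> * \<bar>a\<bar> + \<bar>2 * cs + dl z\<bar> * \<bar>b\<bar>"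
            unfolding abs_mult[symmetric] by (rule abs_triangle_ineq4)
          also have "\<dots> \<le> \<bar>\<gamma>\<bar> * C1 + (2 * \<bar>cs\<bar> + A1) * (C2 * C1)"
            using a b that A0 by (intro add_mono mult_mono) auto
          also have "\<dots> \<le> A2" using A0 C0 by (simp add: A2_def algebra_simps)
          finally show ?thesis .
        qed
        have Rz: "\<bar>Re (z n)\<bar> \<le> r * wt \<rho> n" using z abs_Re_le_cmod order_trans by blast
        have Rd: "\<bar>Re (z n) - Re (z' n)\<bar> \<le> d * wt \<rho> n"
          using near abs_Re_le_cmod[of "z n - z' n"] order_trans unfolding near_def
          by (metis minus_complex.sel(1))
        have "\<bar>GG z n\<bar> \<le> A2 * (r * wt \<rho> n)"
          unfolding GG_eq abs_mult by (rule mult_mono[OF co Rz]) (use dz A1r A0 in auto)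
        moreover have "\<bar>GG z n - GG z' n\<bar> \<le> A3 * (d * wt \<rho> n)"
        proof -
          have "GG z n - GG z' n = (\<gamma> * a - (2 * cs + dl z') * b) * (Re (z n) - Re (z' n))
              + (- b) * (dl z - dl z') * Re (z n)"
            by (simp add: GG_eq algebra_simps)
          also have "\<bar>\<dots>\<bar> \<le> \<bar>\<gamma> * a - (2 * cs + dl z') * b\<bar> * \<bar>Re (z n) - Re (z' n)\<bar>
              + \<bar>b\<bar> * \<bar>dl z - dl z'\<bar> * \<bar>Re (z n)\<bar>"
            by (rule order_trans[OF abs_triangle_ineq]) (simp add: abs_mult)
          also have "\<dots> \<le> A2 * (d * wt \<rho> n) + (C2 * C1) * (A1 * d) * (1 * wt \<rho> n)"
          proof (intro add_mono mult_mono co Rd b dz)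
            show "\<bar>Re (z n)\<bar> \<le> 1 * wt \<rho> n"
              using Rz r by (meson mult_right_mono order_trans wt_nonneg)
          qed (use A0 C0 d0 dz A1r in auto)
          also have "\<dots> = A3 * (d * wt \<rho> n)" by (simp add: A3_def algebra_simps)
          finally show ?thesis .
        qed
        ultimately show ?thesis by (simp add: mult.assoc)
      qed
    qed
    have "Qd z n - Qd z' n = (dl z - dl z') * GG z n + dl z' * (GG z n - GG z' n)"
      by (simp add: Qd_def algebra_simps)
    also have "\<bar>\<dots>\<bar> \<le> \<bar>dl z - dl z'\<bar> * \<bar>GG z n\<bar> + \<bar>dl z'\<bar> * \<bar>GG z n - GG z' n\<bar>"
      by (rule order_trans[OF abs_triangle_ineq]) (simp add: abs_mult)
    also have "\<dots> \<le> (A1 * d) * (A2 * r * wt \<rho> n) + (A1 * r) * (A3 * d * wt \<rho> n)"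
      using G dz A0 r0 d0 by (intro add_mono mult_mono) auto
    also have "\<dots> = (A1 * A2 + A1 * A3) * r * d * wt \<rho> n" by (simp add: algebra_simps)
    finally show "\<bar>Qd z n - Qd z' n\<bar> \<le> (A1 * A2 + A1 * A3) * r * d * wt \<rho> n" .
  qed (use A0 in auto)
qed

lemma Qd_even: "(\<And>n. z (- n) = z n) \<Longrightarrow> Qd z (- n) = Qd z n"
  by (simp add: Qd_def GG_def)

lemma cmod_Complex_le: "cmod (Complex a b) \<le> \<bar>a\<bar> + \<bar>b\<bar>"
  by (metis cmod_le complex.sel(1) complex.sel(2))

text \<open>The image of 0 is O(e) because \<open>Qd\<close> vanishes at 0, which dictates the
  radius \<open>2 * M * e\<close>. On that ball the Lipschitz constant consists of \<open>C\<close>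
  times the radius, from \<open>Qd\<close>, and \<open>e * (M1 + M2)\<close>.\<close>

lemma fixed_point:
  "\<exists>M e1. M > 0 \<and> 0 < e1 \<and> e1 \<le> e0 \<and> (\<forall>e. 0 < e \<and> e \<le> e1 \<longrightarrow>
     (\<exists>z. adm \<rho> z \<and> (\<forall>n. cmod (z n) \<le> M * e * wt \<rho> n) \<and> TT e z = z))"
proof -
  obtain M1 where M1: "M1 \<ge> 0"
    "\<And>e z. 0 < e \<Longrightarrow> e \<le> e0 \<Longrightarrow> adm \<rho> z \<Longrightarrow> bd \<rho> M1 (P1 e z)"
    "\<And>e z n. 0 < e \<Longrightarrow> e \<le> e0 \<Longrightarrow> adm \<rho> z \<Longrightarrow> P1 e z (- n) = 1 * P1 e z n"
    "\<And>e z z' d. 0 < e \<Longrightarrow> e \<le> e0 \<Longrightarrow> adm \<rho> z \<Longrightarrow> adm \<rho> z' \<Longrightarrow> near \<rho> d z z' \<Longrightarrow>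
       bd \<rho> (M1 * d) (\<lambda>n. P1 e z n - P1 e z' n)"
    using BL_P1 by (rule BL_E) blast
  obtain M2 where M2: "M2 \<ge> 0"
    "\<And>e z. 0 < e \<Longrightarrow> e \<le> e0 \<Longrightarrow> adm \<rho> z \<Longrightarrow> bd \<rho> M2 (P2 e z)"
    "\<And>e z n. 0 < e \<Longrightarrow> e \<le> e0 \<Longrightarrow> adm \<rho> z \<Longrightarrow> P2 e z (- n) = 1 * P2 e z n"
    "\<And>e z z' d. 0 < e \<Longrightarrow> e \<le> e0 \<Longrightarrow> adm \<rho> z \<Longrightarrow> adm \<rho> z' \<Longrightarrow> near \<rho> d z z' \<Longrightarrow>
       bd \<rho> (M2 * d) (\<lambda>n. P2 e z n - P2 e z' n)"
    using BL_P2 by (rule BL_E) blast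
  obtain C where C: "C \<ge> 0"
    "\<And>z z' r d n. r \<le> 1 \<Longrightarrow> (\<forall>n. cmod (z n) \<le> r * wt \<rho> n) \<Longrightarrow> (\<forall>n. cmod (z' n) \<le> r * wt \<rho> n) \<Longrightarrow>
     near \<rho> d z z' \<Longrightarrow> \<bar>Qd z n - Qd z' n\<bar> \<le> C * r * d * wt \<rho> n"
    using Qd_lipschitz by blast
  define M where "M = M1 + M2 + 1"
  have M: "M > 0" using M1 M2 by (simp add: M_def)
  \<comment> \<open>\<open>B * e\<close> bounds the Lipschitz constant; the choice of
    \<open>e1\<close> makes it at most 1/2 and keeps the radius at most 1.\<close>
  define B where "B = 2 * C * M + M"
  have B: "B > 0" "2 * M \<le> 2 * B + 2 * M" using C M by (auto simp: B_def intro: add_nonneg_pos)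
  define e1 where "e1 = min e0 (1 / (2 * B + 2 * M))"
  have "\<exists>z. adm \<rho> z \<and> (\<forall>n. cmod (z n) \<le> (2 * M) * e * wt \<rho> n) \<and> TT e z = z"
    if e: "0 < e" "e \<le> e1" for e
  proof -
    have e': "e \<le> e0" "e \<le> 1 / (2 * B + 2 * M)" using e by (auto simp: e1_def)
    then have "e * (2 * B + 2 * M) \<le> 1" using B M by (simp add: pos_le_divide_eq)
    moreover have "0 \<le> e * (2 * B)" "0 \<le> e * (2 * M)" using B M e by auto
    ultimately have eB: "B * e \<le> 1 / 2" and eM: "2 * M * e \<le> 1"
      by (simp_all add: algebra_simps)
    define r where "r = 2 * M * e"
    have r: "0 \<le> r" "r \<le> 1" using eM M e by (auto simp: r_def)
    define S where "S = {z :: int \<Rightarrow> complex. \<forall>n. z (- n) = z n}"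
    have adm: "adm \<rho> z" if "z \<in> S" "\<And>n. cmod (z n) \<le> r * wt \<rho> n" for z
      unfolding adm_def
    proof (intro allI conjI)
      fix n
      show "z (- n) = z n" using that by (simp add: S_def)
      have "r * wt \<rho> n \<le> 1 * wt \<rho> n" using r by (intro mult_right_mono) auto
      then show "cmod (z n) \<le> wt \<rho> n" using that(2)[of n] by linarith
    qed
    have z0: "(\<lambda>_. 0) \<in> S" by (simp add: S_def)
    have "\<exists>z\<in>S. (\<forall>n. norm (z n) \<le> r * wt \<rho> n) \<and> TT e z = z"
    proof (rule weighted_contraction)
      fix zs :: "nat \<Rightarrow> int \<Rightarrow> complex" and z
      assume zs: "\<And>k. zs k \<in> S" "\<And>n. (\<lambda>k. zs k n) \<longlonglongrightarrow> z n"
      show "z \<in> S" unfolding S_def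
      proof (intro CollectI allI)
        fix n
        have "(\<lambda>k. zs k (- n)) = (\<lambda>k. zs k n)" using zs(1) by (simp add: S_def)
        then show "z (- n) = z n" using zs(2)[of n] zs(2)[of "- n"] LIMSEQ_unique by metis
      qed
    next
      fix z assume z: "z \<in> S" "\<And>n. norm (z n) \<le> r * wt \<rho> n"
      have a: "adm \<rho> z" by (rule adm[OF z])
      show "TT e z \<in> S"
        using M1(3)[OF e(1) e'(1) a] M2(3)[OF e(1) e'(1) a] Qd_even[of z] z
        by (simp add: S_def TT_def)
    next
      fix n
      have a: "adm \<rho> (\<lambda>_. 0)" by (rule adm[OF z0]) (use r in auto)
      have "norm (TT e (\<lambda>_. 0) n) \<le> \<bar>e * P1 e (\<lambda>_. 0) n\<bar> + \<bar>e * P2 e (\<lambda>_. 0) n\<bar>"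
        unfolding TT_def by (rule order_trans[OF cmod_Complex_le]) (simp add: Qd_def dl_def)
      also have "\<dots> = e * (\<bar>P1 e (\<lambda>_. 0) n\<bar> + \<bar>P2 e (\<lambda>_. 0) n\<bar>)"
        using e by (simp add: abs_mult distrib_left)
      also have "\<dots> \<le> e * (M1 * wt \<rho> n + M2 * wt \<rho> n)"
        using e M1(2)[OF e(1) e'(1) a] M2(2)[OF e(1) e'(1) a] by (intro mult_left_mono add_mono bdD) auto
      also have "\<dots> = (M - 1) * e * wt \<rho> n" by (simp add: M_def algebra_simps)
      also have "\<dots> \<le> M * e * wt \<rho> n" using e by (intro mult_right_mono) auto
      finally show "norm (TT e (\<lambda>_. 0) n) \<le> r / 2 * wt \<rho> n" by (simp add: r_def)
    next
      fix z z' :: "int \<Rightarrow> complex" and d n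
      assume z: "z \<in> S" and z': "z' \<in> S" and b: "\<And>n. norm (z n) \<le> r * wt \<rho> n"
        and b': "\<And>n. norm (z' n) \<le> r * wt \<rho> n" and d: "d \<ge> 0"
        and dz: "\<And>n. norm (z n - z' n) \<le> d * wt \<rho> n"
      have a: "adm \<rho> z" "adm \<rho> z'" using adm z z' b b' by auto
      have near: "near \<rho> d z z'" using dz by (simp add: near_def)
      have "TT e z n - TT e z' n = Complex (- (Qd z n - Qd z' n) - e * (P1 e z n - P1 e z' n))
          (e * (P2 e z n - P2 e z' n))"
        by (simp add: TT_def complex_eq_iff algebra_simps)
      also have "cmod \<dots> \<le> \<bar>- (Qd z n - Qd z' n) - e * (P1 e z n - P1 e z' n)\<bar> + \<bar>e * (P2 e z n - P2 e z' n)\<bar>"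
        by (rule cmod_Complex_le)
      also have "\<dots> \<le> \<bar>Qd z n - Qd z' n\<bar> + e * \<bar>P1 e z n - P1 e z' n\<bar> + e * \<bar>P2 e z n - P2 e z' n\<bar>"
        using e by (intro add_mono order_trans[OF abs_triangle_ineq4]) (auto simp: abs_mult)
      also have "\<dots> \<le> C * r * d * wt \<rho> n + e * (M1 * d * wt \<rho> n) + e * (M2 * d * wt \<rho> n)"
        using e b b' r near
        by (intro add_mono mult_left_mono C(2) bdD[OF M1(4)[OF e(1) e'(1) a near]]
            bdD[OF M2(4)[OF e(1) e'(1) a near]]) auto
      also have "\<dots> = ((2 * C * M + (M - 1)) * e) * (d * wt \<rho> n)"
        by (simp add: r_def M_def algebra_simps)
      also have "\<dots> \<le> (B * e) * (d * wt \<rho> n)"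
        using d e unfolding B_def by (intro mult_right_mono) auto
      also have "\<dots> \<le> 1 / 2 * (d * wt \<rho> n)"
        using d eB by (intro mult_right_mono) auto
      finally show "norm (TT e z n - TT e z' n) \<le> d / 2 * wt \<rho> n" by simp
    qed (use r z0 in auto)
    then show ?thesis using adm unfolding r_def by blast
  qed
  moreover have "0 < e1" "e1 \<le> e0" using e0_pos B M by (auto simp: e1_def)
  ultimately show ?thesis using M by (intro exI[of _ "2 * M"] exI[of _ e1]) auto
qed

text \<open>Undoes the splitting into a linear part at speed \<open>cs\<close> and depth
  \<open>hr\<close> and a remainder: all terms are collected at the true speed \<open>c\<close> and,
  through \<open>lam\<close>, at the true depth.\<close>

lemma fixed_point_equations:
  assumes "TT e z = z" "e > 0" and even: "\<And>n. z (- n) = z n"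
  defines "c \<equiv> cs + dl z"
  shows "g * y e z n + c * \<gamma> * (y e z n - av (y e z) n) - c\<^sup>2 * lam e z n + yk e z n + e * P0 e z n = 0"
    and "sg e z n = e * P2 e z n"
proof -
  have T: "Re (z n) = - Qd z n - e * P1 e z n" "Im (z n) = e * P2 e z n" for n
    using assms(1) by (metis TT_def complex.sel)+
  show "sg e z n = e * P2 e z n" using T by (simp add: sg_def)
  have cc: "cc e z = single c" by (simp add: cc_def c_def dl_def)
  have P1: "P1 e z n = P0 e z n - c\<^sup>2 * EE e z n"
    by (simp add: P1_def cc conv_single power2_eq_square)
  have lam: "lam e z n = q hr n * yd e z n + e * EE e z n"
    using assms(2) by (simp add: lam_def Q_def EE_def left_diff_distrib)
  have eq: "Re (z n) + Qd z n + e * P0 e z n - e * c\<^sup>2 * EE e z n = 0"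
    using T(1)[of n] by (simp add: P1 algebra_simps)
  \<comment> \<open>The linear part at the new speed but the old depth. It equals
    \<open>Re (z n) + Qd z n\<close>, for different reasons at the mean, at the resonant modes and
    at the others.\<close>
  define L where "L = g * y e z n + c * \<gamma> * (y e z n - av (y e z) n)
      - c\<^sup>2 * (q hr n * yd e z n) + yk e z n"
  have "L = Re (z n) + Qd z n"
  proof -
    consider "n = 0" | "\<bar>n\<bar> = 1" | "n \<noteq> 0" "\<bar>n\<bar> \<noteq> 1" by linarith
    then show ?thesis
    proof cases
      case 1
      then show ?thesis using g
        by (simp add: L_def av_def single_def yk_def Qd_def GG_def y_0)
    next
      case 2
      have D1: "g + cs * \<gamma> - cs\<^sup>2 * (m 1 * q hr 1) + \<kappa> * (m 1)\<^sup>2 = 0"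
        using D_1 by (simp add: D_def)
      have n1: "n = 1 \<or> n = - 1" using 2 by linarith
      then have "D n = 0" using D_1 D_minus_1 by blast
      then have yn: "y e z n = 1" using 2 by (simp add: y_def)
      have mq: "q hr n * m n = m 1 * q hr 1" "(m n)\<^sup>2 = (m 1)\<^sup>2"
        using n1 by auto
      have zn: "z n = z 1" using n1 even[of 1] by auto
      have th: "dl z * theta = Re (z 1)" using theta_nonzero by (simp add: dl_def)
      have "L = g + c * \<gamma> - c\<^sup>2 * (m 1 * q hr 1) + \<kappa> * (m 1)\<^sup>2"
        using 2 yn mq by (auto simp: L_def av_def single_def yk_def yd_def)
      also have "\<dots> = dl z * theta - (dl z)\<^sup>2 * (m 1 * q hr 1)"
        using D1 by (simp add: c_def theta_def power2_eq_square algebra_simps)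
      also have "\<dots> = Re (z n) + Qd z n"
        using 2 by (auto simp: th zn Qd_def GG_def power2_eq_square)
      finally show ?thesis .
    next
      case 3
      have D: "D n \<noteq> 0" using D_nonzero 3 by blast
      have yn: "y e z n = 1 / D n * Re (z n)" using 3 by (simp add: y_def)
      have "L = (g + c * \<gamma> - c\<^sup>2 * (m n * q hr n) + \<kappa> * (m n)\<^sup>2) * y e z n"
        using 3 by (simp add: L_def av_def single_def yk_def yd_def algebra_simps)
      also have "\<dots> = (D n + dl z * (\<gamma> - (2 * cs + dl z) * (m n * q hr n))) * y e z n"
        using 3 by (simp add: D_def c_def power2_eq_square algebra_simps)
      also have "\<dots> = Re (z n) + Qd z n"
        using 3 D by (simp add: yn Qd_def GG_def add_divide_distrib distrib_right mult.assoc)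
      finally show ?thesis .
    qed
  qed
  then have "L - e * c\<^sup>2 * EE e z n + e * P0 e z n = 0" using eq by simp
  then show "g * y e z n + c * \<gamma> * (y e z n - av (y e z) n) - c\<^sup>2 * lam e z n + yk e z n + e * P0 e z n = 0"
    by (simp add: L_def lam algebra_simps)
qed

end

section \<open>Exponential series with decaying coefficients\<close>

definition fexp :: "nat \<Rightarrow> int \<Rightarrow> complex \<Rightarrow> complex" where
  "fexp K n w = exp (\<i> * of_real (real K * of_int n) * w)"

definition fser :: "nat \<Rightarrow> (int \<Rightarrow> complex) \<Rightarrow> complex \<Rightarrow> complex" where
  "fser K a w = (\<Sum>\<^sub>\<infinity>n. a n * fexp K n w)"

definition cbd :: "real \<Rightarrow> real \<Rightarrow> (int \<Rightarrow> complex) \<Rightarrow> bool" where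
  "cbd \<rho> C a \<longleftrightarrow> (\<forall>n. cmod (a n) \<le> C * wt \<rho> n)"

text \<open>Where each exponential occurring in the series is at most \<open>exp (K \<bar>n\<bar> R)\<close>.\<close>

definition fdom :: "nat \<Rightarrow> real \<Rightarrow> (int \<Rightarrow> complex) \<Rightarrow> complex \<Rightarrow> bool" where
  "fdom K R a w \<longleftrightarrow> (\<forall>n. a n \<noteq> 0 \<longrightarrow> - of_int n * Im w \<le> \<bar>of_int n\<bar> * R)"

lemma norm_fexp: "norm (fexp K n w) = exp (- (real K * of_int n) * Im w)"
  by (simp add: fexp_def)

lemma fexp_of_real: "fexp K n (of_real x) = cis (real K * of_int n * x)"
  by (simp add: fexp_def cis_conv_exp mult_ac)

lemma fexp_deriv: "(fexp K n has_field_derivative (\<i> * of_real (real K * of_int n)) * fexp K n w) (at w)"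
  unfolding fexp_def[abs_def] by (auto intro!: derivative_eq_intros)

lemma cbd_nonneg: "cbd \<rho> C a \<Longrightarrow> C \<ge> 0"
  unfolding cbd_def by (metis mult.right_neutral norm_ge_zero order_trans wt_0)

lemma cbd_of_real: "cbd \<rho> C (\<lambda>n. of_real (f n)) \<longleftrightarrow> bd \<rho> C f"
  by (simp add: cbd_def bd_def)

text \<open>The rate \<open>real K * R\<close> of the coefficients exactly offsets the growth
  allowed by \<open>fdom\<close>, and the factor \<open>1 / (1 + n^2)\<close> is left for
  summation.\<close>

lemma fser_term_le:
  assumes "cbd (real K * R) C a" "fdom K R a w"
  shows "norm (a n * fexp K n w) \<le> C * (1 / (1 + (of_int n)\<^sup>2))"
proof (cases "a n = 0")
  case True
  then show ?thesis using cbd_nonneg[OF assms(1)] by simp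
next
  case False
  then have "real K * (- of_int n * Im w) \<le> real K * (\<bar>of_int n\<bar> * R)"
    using assms(2) by (intro mult_left_mono) (auto simp: fdom_def)
  then have e: "norm (fexp K n w) \<le> exp (real K * R * \<bar>of_int n\<bar>)"
    by (simp add: norm_fexp mult_ac)
  have "norm (a n * fexp K n w) \<le> (C * wt (real K * R) n) * exp (real K * R * \<bar>of_int n\<bar>)"
    unfolding norm_mult using assms(1) e cbd_nonneg[OF assms(1)]
    by (intro mult_mono) (auto simp: cbd_def)
  also have "\<dots> = C * (1 / (1 + (of_int n)\<^sup>2)) * (exp (- (real K * R * \<bar>of_int n\<bar>)) * exp (real K * R * \<bar>of_int n\<bar>))"
    by (simp add: wt_def)
  also have "\<dots> = C * (1 / (1 + (of_int n)\<^sup>2))"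
    by (simp add: exp_minus)
  finally show ?thesis .
qed

lemma summable_wt0_cmult: "(\<lambda>n::int. C * (1 / (1 + (real_of_int n)\<^sup>2))) summable_on UNIV"
  by (intro summable_on_cmult_right summable_wt0)

lemma fser_abs_summable:
  assumes "cbd (real K * R) C a" "fdom K R a w"
  shows "(\<lambda>n. norm (a n * fexp K n w)) summable_on UNIV"
  by (rule Infinite_Sum.abs_summable_on_comparison_test'[OF summable_wt0_cmult fser_term_le[OF assms]])

lemma fser_summable:
  assumes "cbd (real K * R) C a" "fdom K R a w"
  shows "(\<lambda>n. a n * fexp K n w) summable_on UNIV"
  using fser_abs_summable[OF assms] by (rule abs_summable_summable)

lemma fser_has_sum:
  assumes "cbd (real K * R) C a" "fdom K R a w"
  shows "((\<lambda>n. a n * fexp K n w) has_sum fser K a w) UNIV"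
  unfolding fser_def using fser_summable[OF assms] by simp

lemma fser_norm_le:
  assumes "cbd (real K * R) C a" "fdom K R a w"
  shows "norm (fser K a w) \<le> C * wt_sum"
proof -
  have "norm (fser K a w) \<le> (\<Sum>\<^sub>\<infinity>n::int. C * (1 / (1 + (real_of_int n)\<^sup>2)))"
    by (rule norm_infsum_le[OF fser_has_sum[OF assms] has_sum_infsum[OF summable_wt0_cmult] fser_term_le[OF assms]])
  then show ?thesis by (simp only: infsum_cmult_right' wt_sum_def)
qed

text \<open>Weierstrass' theorem on uniform limits of holomorphic functions. It also yields
  summability of the differentiated series, without a bound on its coefficients.\<close>

lemma fser_derivative:
  assumes "cbd (real K * R) C a" "open S" "\<And>w. w \<in> S \<Longrightarrow> fdom K R a w" "w \<in> S"
  defines "a' \<equiv> \<lambda>n. \<i> * of_real (real K * of_int n) * a n"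
  shows "(fser K a has_field_derivative fser K a' w) (at w)"
    and "(\<lambda>n. a' n * fexp K n w) summable_on UNIV"
proof -
  obtain r where r: "r > 0" "cball w r \<subseteq> S" using assms open_contains_cball by blast
  let ?F = "finite_subsets_at_top (UNIV :: int set)"
  have ul: "uniform_limit (cball w r) (\<lambda>X y. \<Sum>n\<in>X. a n * fexp K n y) (fser K a) ?F"
    by (rule Weierstrass_m_test_general'[where M="\<lambda>n. C * (1 / (1 + (real_of_int n)\<^sup>2))"])
      (use r assms(1,3) in \<open>auto intro!: fser_term_le fser_has_sum summable_wt0_cmult
        simp del: times_divide_eq_right times_divide_eq_left\<close>)
  have d: "((\<lambda>y. \<Sum>n\<in>X. a n * fexp K n y) has_field_derivative (\<Sum>n\<in>X. a' n * fexp K n y)) (at y)" for X y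
  proof (rule DERIV_sum)
    fix n
    show "((\<lambda>y. a n * fexp K n y) has_field_derivative a' n * fexp K n y) (at y)"
      using DERIV_cmult[OF fexp_deriv, of "a n" K n y] by (simp add: a'_def mult_ac)
  qed
  have ev: "\<forall>\<^sub>F X in ?F. continuous_on (cball w r) (\<lambda>y. \<Sum>n\<in>X. a n * fexp K n y) \<and>
      (\<forall>y\<in>ball w r. ((\<lambda>y. \<Sum>n\<in>X. a n * fexp K n y) has_field_derivative (\<Sum>n\<in>X. a' n * fexp K n y)) (at y))"
    using d by (intro always_eventually allI conjI ballI)
      (auto intro!: DERIV_continuous_on[OF has_field_derivative_at_within] )
  obtain g' where "\<And>y. y \<in> ball w r \<Longrightarrow> (fser K a has_field_derivative g' y) (at y) \<and>
      ((\<lambda>X. \<Sum>n\<in>X. a' n * fexp K n y) \<longlongrightarrow> g' y) ?F"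
    using has_complex_derivative_uniform_limit[OF ev ul _ r(1)] by auto
  then have g': "(fser K a has_field_derivative g' w) (at w)"
      "((\<lambda>n. a' n * fexp K n w) has_sum g' w) UNIV"
    using r(1) by (auto simp: has_sum_def)
  then show "(\<lambda>n. a' n * fexp K n w) summable_on UNIV" by (auto intro: has_sum_imp_summable)
  have "fser K a' w = g' w" unfolding fser_def using g'(2) by (rule infsumI)
  then show "(fser K a has_field_derivative fser K a' w) (at w)" using g'(1) by simp
qed

lemma fser_holomorphic:
  assumes "cbd (real K * R) C a" "open S" "\<And>w. w \<in> S \<Longrightarrow> fdom K R a w"
  shows "fser K a holomorphic_on S"
  using fser_derivative(1)[OF assms] assms(2) holomorphic_on_open by blast

lemma fexp_periodic: "fexp K n (w + 2 * of_real pi) = fexp K n w"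
proof -
  have "\<i> * of_real (real K * of_int n) * (w + 2 * of_real pi)
      = \<i> * of_real (real K * of_int n) * w + of_int (int K * n) * (2 * of_real pi * \<i>)"
    by (simp add: algebra_simps)
  moreover have "exp (of_int (int K * n) * (2 * of_real pi * \<i>)) = 1"
    unfolding exp_eq_1 by (auto simp: intro!: exI[of _ "int K * n"])
  ultimately show ?thesis by (simp only: fexp_def exp_add mult_1_right)
qed

lemma fser_periodic: "fser K a (w + 2 * of_real pi) = fser K a w"
  by (simp add: fser_def fexp_periodic)

definition strip :: "real \<Rightarrow> complex set" where "strip R = {w. \<bar>Im w\<bar> < R}"

lemma open_strip: "open (strip R)"
  unfolding strip_def by (intro open_Collect_less continuous_intros)

lemma strip_fdom: "w \<in> strip R \<Longrightarrow> fdom K R a w"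
proof -
  assume "w \<in> strip R"
  then have le: "\<bar>Im w\<bar> \<le> R" by (simp add: strip_def)
  have "- of_int n * Im w \<le> \<bar>of_int n\<bar> * R" for n
  proof -
    have "- of_int n * Im w \<le> \<bar>- of_int n * Im w\<bar>" by (rule abs_ge_self)
    also have "\<dots> = \<bar>of_int n\<bar> * \<bar>Im w\<bar>" by (simp add: abs_mult)
    also have "\<dots> \<le> \<bar>of_int n\<bar> * R" using le by (intro mult_left_mono) auto
    finally show ?thesis .
  qed
  then show ?thesis by (simp add: fdom_def)
qed

lemma real_fdom: "R \<ge> 0 \<Longrightarrow> fdom K R a (of_real x)"
  by (simp add: fdom_def)

lemma fser_single: "fser K (\<lambda>n. if n = k then b else 0) w = b * fexp K k w"
proof -
  have "fser K (\<lambda>n. if n = k then b else 0) w = (\<Sum>\<^sub>\<infinity>n\<in>{k}. (if n = k then b else 0) * fexp K n w)"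
    unfolding fser_def by (rule infsum_cong_neutral) auto
  then show ?thesis by simp
qed

lemma fser_cmult: "fser K (\<lambda>n. c * a n) w = c * fser K a w"
  unfolding fser_def by (simp add: mult.assoc infsum_cmult_right')

lemma fser_add:
  assumes "(\<lambda>n. a n * fexp K n w) summable_on UNIV" "(\<lambda>n. b n * fexp K n w) summable_on UNIV"
  shows "fser K (\<lambda>n. a n + b n) w = fser K a w + fser K b w"
  unfolding fser_def distrib_right by (rule infsum_add[OF assms])

text \<open>Instead of exchanging sum and integral, an explicit primitive \<open>G\<close> of the
  integrand is used: the modes \<open>n \<noteq> k\<close> are divided by
  \<open>i * K * (n - k)\<close>. It is periodic apart from the term \<open>a k * w\<close>, which
  alone contributes to the integral.\<close>

lemma fser_coeff:
  fixes a :: "int \<Rightarrow> complex"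
  assumes "K \<ge> 1" "R > 0" "cbd (real K * R) C a"
  shows "((\<lambda>x. fser K a (of_real x) * cis (- (real K * of_int k * x))) has_integral 2 * pi * a k) {0..2 * pi}"
proof -
  define c where "c n = (if n = k then 0 else a n / (\<i> * of_real (real K * of_int (n - k))))" for n
  have cb: "cbd (real K * R) C c"
    unfolding cbd_def
  proof
    fix n
    have a: "cmod (a n) \<le> C * wt (real K * R) n" using assms(3) by (simp add: cbd_def)
    show "cmod (c n) \<le> C * wt (real K * R) n"
    proof (cases "n = k")
      case True
      then show ?thesis using cbd_nonneg[OF assms(3)] by (simp add: c_def)
    next
      case False
      then have "1 \<le> real K * \<bar>of_int (n - k)\<bar>" using K_abs_ge_1[OF assms(1), of "n - k"] by simp
      moreover have "cmod (c n) = cmod (a n) / (real K * \<bar>of_int (n - k)\<bar>)"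
        using False unfolding c_def by (simp add: norm_divide norm_mult del: of_int_diff)
      moreover have "cmod (a n) / x \<le> cmod (a n) / 1" if "1 \<le> x" for x
        using that by (intro divide_left_mono) auto
      ultimately have "cmod (c n) \<le> cmod (a n)" by (simp only: div_by_1)
      then show ?thesis using a by linarith
    qed
  qed
  define G where "G w = a k * w + fexp K (- k) w * fser K c w" for w :: complex
  have G: "(G has_field_derivative (fser K a w * fexp K (- k) w)) (at w)" if w: "w \<in> strip R" for w
  proof -
    let ?c' = "\<lambda>n. \<i> * of_real (real K * of_int n) * c n"
    have sc: "(\<lambda>n. c n * fexp K n w) summable_on UNIV"
      by (rule fser_summable[OF cb strip_fdom[OF w]])
    have sc': "(\<lambda>n. ?c' n * fexp K n w) summable_on UNIV"
      by (rule fser_derivative(2)[OF cb open_strip strip_fdom w])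
    define b where "b = \<i> * complex_of_real (real K * of_int (- k))"
    have 1: "((\<lambda>w. a k * w) has_field_derivative a k * 1) (at w)"
      by (rule DERIV_cmult[OF DERIV_ident])
    have 2: "(fexp K (- k) has_field_derivative b * fexp K (- k) w) (at w)"
      unfolding b_def by (rule fexp_deriv)
    have 3: "(fser K c has_field_derivative fser K ?c' w) (at w)"
      by (rule fser_derivative(1)[OF cb open_strip strip_fdom w])
    have 4: "(G has_field_derivative a k * 1 + (b * fexp K (- k) w * fser K c w
        + fser K ?c' w * fexp K (- k) w)) (at w)"
      unfolding G_def[abs_def] by (rule DERIV_add[OF 1 DERIV_mult[OF 2 3]])
    have "fser K ?c' w + b * fser K c w = fser K (\<lambda>n. ?c' n + b * c n) w"
    proof (subst fser_cmult[symmetric], rule fser_add[symmetric, OF sc'])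
      show "(\<lambda>n. b * c n * fexp K n w) summable_on UNIV"
        unfolding mult.assoc by (rule summable_on_cmult_right[OF sc])
    qed
    also have "(\<lambda>n. ?c' n + b * c n) = (\<lambda>n. a n + (if n = k then - a k else 0))"
    proof
      fix n
      show "?c' n + b * c n = a n + (if n = k then - a k else 0)"
      proof (cases "n = k")
        case False
        have "?c' n + b * c n = (\<i> * of_real (real K * of_int (n - k))) * c n"
          by (simp add: b_def algebra_simps)
        also have "\<dots> = a n" using False assms(1) unfolding c_def by (simp del: of_int_diff)
        finally show ?thesis using False by simp
      qed (simp add: c_def)
    qed
    also have "fser K (\<lambda>n. a n + (if n = k then - a k else 0)) w = fser K a w - a k * fexp K k w"
    proof (subst fser_add)
      show "(\<lambda>n. a n * fexp K n w) summable_on UNIV"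
        by (rule fser_summable[OF assms(3) strip_fdom[OF w]])
      show "(\<lambda>n. (if n = k then - a k else 0) * fexp K n w) summable_on UNIV"
        by (rule finite_nonzero_values_imp_summable_on) (rule finite_subset[of _ "{k}"], auto)
    qed (simp add: fser_single)
    finally have 5: "fser K ?c' w + b * fser K c w = fser K a w - a k * fexp K k w" .
    have 6: "fexp K k w * fexp K (- k) w = 1"
      by (simp add: fexp_def exp_add[symmetric])
    have "a k * 1 + (b * fexp K (- k) w * fser K c w + fser K ?c' w * fexp K (- k) w)
        = a k + (fser K ?c' w + b * fser K c w) * fexp K (- k) w"
      by (simp only: ring_distribs mult_ac mult_1_right add_ac mult_1_left)
    also have "\<dots> = a k + fser K a w * fexp K (- k) w - a k * (fexp K k w * fexp K (- k) w)"
      unfolding 5 by (simp only: left_diff_distrib mult.assoc add_diff_eq)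
    also have "\<dots> = fser K a w * fexp K (- k) w" unfolding 6 by simp
    finally show ?thesis using 4 by simp
  qed
  have "((\<lambda>x. fser K a (of_real x) * fexp K (- k) (of_real x)) has_integral
      (G (of_real (2 * pi)) - G (of_real 0))) {0..2 * pi}"
  proof (rule fundamental_theorem_of_calculus)
    fix x assume "x \<in> {0..2 * pi}"
    have "complex_of_real x \<in> strip R" using assms by (simp add: strip_def)
    from G[OF this]
    have "((\<lambda>x. G (of_real x)) has_vector_derivative (fser K a (of_real x) * fexp K (- k) (of_real x))) (at x)"
      by (rule has_vector_derivative_real_field)
    then show "((\<lambda>x. G (of_real x)) has_vector_derivative (fser K a (of_real x) * fexp K (- k) (of_real x))) (at x within {0..2 * pi})"
      by (rule has_vector_derivative_at_within)
  qed simp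
  moreover have "G (of_real (2 * pi)) - G (of_real 0) = 2 * pi * a k"
    using fexp_periodic[of K "- k" 0] fser_periodic[of K c 0] by (simp add: G_def)
  ultimately show ?thesis by (simp add: fexp_of_real)
qed

lemma fser_cnj:
  assumes "\<And>n. f (- n) = s * f n"
  shows "cnj (fser K (\<lambda>n. of_real (f n)) w) = of_real s * fser K (\<lambda>n. of_real (f n)) (cnj w)"
proof -
  have "cnj (fser K (\<lambda>n. of_real (f n)) w) = (\<Sum>\<^sub>\<infinity>n. of_real (f n) * fexp K (- n) (cnj w))"
    unfolding fser_def infsum_cnj[symmetric] by (rule infsum_cong) (simp add: fexp_def exp_cnj)
  also have "\<dots> = (\<Sum>\<^sub>\<infinity>n. of_real (f (- n)) * fexp K (- (- n)) (cnj w))"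
    by (rule infsum_reindex_bij_betw[symmetric]) (rule bij_betwI[where g=uminus], auto)
  finally show ?thesis
    by (simp add: assms fser_def mult.assoc infsum_cmult_right')
qed

text \<open>Fubini for an absolutely summable double series, then the shift of \<open>n\<close> by
  \<open>l\<close>. On the real axis all exponentials have modulus 1.\<close>

lemma fser_conv:
  assumes "\<rho> \<ge> 0" "bd \<rho> A f" "bd \<rho> B g"
  shows "fser K (\<lambda>n. of_real (conv f g n)) (of_real x)
    = fser K (\<lambda>n. of_real (f n)) (of_real x) * fser K (\<lambda>n. of_real (g n)) (of_real x)"
proof -
  define e where "e n = fexp K n (of_real x)" for n
  have e_norm: "norm (e n) = 1" for n by (simp add: e_def norm_fexp)
  have e_add: "e (n + l) = e n * e l" for n l
    by (simp add: e_def fexp_def exp_add[symmetric] algebra_simps)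
  define T where "T l n = complex_of_real (f l * g (n - l)) * e n" for l n
  have abs0: "(\<lambda>n. \<bar>F n\<bar>) summable_on UNIV" if "bd \<rho> C F" for C F
  proof (rule Infinite_Sum.abs_summable_on_comparison_test'[OF summable_wt0_cmult[of C], where f=F, unfolded real_norm_def])
    fix n :: int
    have "wt \<rho> n \<le> 1 / (1 + (of_int n)\<^sup>2)"
      unfolding wt_def using assms(1) by (intro divide_right_mono) auto
    then have "C * wt \<rho> n \<le> C * (1 / (1 + (of_int n)\<^sup>2))"
      using bd_nonneg[OF that] by (intro mult_left_mono)
    then show "\<bar>F n\<bar> \<le> C * (1 / (1 + (of_int n)\<^sup>2))" using bdD[OF that, of n] by linarith
  qed
  have g_shift: "(\<lambda>n. \<bar>g (n - l)\<bar>) summable_on UNIV" "(\<Sum>\<^sub>\<infinity>n. \<bar>g (n - l)\<bar>) = (\<Sum>\<^sub>\<infinity>n. \<bar>g n\<bar>)" for l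
  proof -
    have b: "bij_betw (\<lambda>n::int. n - l) UNIV UNIV"
      by (rule bij_betwI[where g="\<lambda>n. n + l"]) auto
    show "(\<lambda>n. \<bar>g (n - l)\<bar>) summable_on UNIV"
      using summable_on_reindex_bij_betw[OF b, of "\<lambda>n. \<bar>g n\<bar>"] abs0[OF assms(3)] by simp
    show "(\<Sum>\<^sub>\<infinity>n. \<bar>g (n - l)\<bar>) = (\<Sum>\<^sub>\<infinity>n. \<bar>g n\<bar>)"
      by (rule infsum_reindex_bij_betw[OF b])
  qed
  have sT: "(\<lambda>(l, n). T l n) summable_on UNIV \<times> UNIV"
  proof -
    have "(\<lambda>p. norm ((\<lambda>(l, n). T l n) p)) summable_on (SIGMA l:UNIV. UNIV)"
    proof (rule iffD2[OF Infinite_Sum.abs_summable_on_Sigma_iff], intro conjI ballI)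
      show "(\<lambda>n. norm ((\<lambda>(l, n). T l n) (l, n))) summable_on UNIV" for l
        using summable_on_cmult_right[OF g_shift(1), of "\<bar>f l\<bar>" l]
        by (simp add: T_def norm_mult e_norm abs_mult)
      have "(\<Sum>\<^sub>\<infinity>n. norm (T l n)) = \<bar>f l\<bar> * (\<Sum>\<^sub>\<infinity>n. \<bar>g n\<bar>)" for l
        by (simp add: T_def norm_mult e_norm abs_mult infsum_cmult_right' g_shift(2) del: infsum_0_simp)
      then show "(\<lambda>l. norm (\<Sum>\<^sub>\<infinity>n. norm ((\<lambda>(l, n). T l n) (l, n)))) summable_on UNIV"
        using summable_on_cmult_left[OF abs0[OF assms(2)], of "\<Sum>\<^sub>\<infinity>n. \<bar>g n\<bar>"]
        by (simp add: abs_mult infsum_nonneg)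
    qed
    then show ?thesis by (rule abs_summable_summable)
  qed
  have "fser K (\<lambda>n. of_real (conv f g n)) (of_real x) = (\<Sum>\<^sub>\<infinity>n. \<Sum>\<^sub>\<infinity>l. T l n)"
    unfolding fser_def e_def[symmetric]
  proof (rule infsum_cong)
    fix n
    have s: "(\<lambda>l. f l * g (n - l)) summable_on UNIV"
      by (rule conv_summable_and_bd(1)[OF assms])
    have "complex_of_real (conv f g n) = (\<Sum>\<^sub>\<infinity>l. complex_of_real (f l * g (n - l)))"
      unfolding conv_def
      by (rule infsumI[symmetric], rule has_sum_of_real, rule has_sum_infsum[OF s])
    then show "complex_of_real (conv f g n) * e n = (\<Sum>\<^sub>\<infinity>l. T l n)"
      by (simp add: T_def infsum_cmult_left')
  qed
  also have "\<dots> = (\<Sum>\<^sub>\<infinity>l. \<Sum>\<^sub>\<infinity>n. T l n)"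
    by (rule infsum_swap_banach[OF sT, symmetric])
  also have "\<dots> = (\<Sum>\<^sub>\<infinity>l. (of_real (f l) * e l) * (\<Sum>\<^sub>\<infinity>n. of_real (g n) * e n))"
  proof (rule infsum_cong)
    fix l
    have b: "bij_betw (\<lambda>n::int. n + l) UNIV UNIV"
      by (rule bij_betwI[where g="\<lambda>n. n - l"]) auto
    have "(\<Sum>\<^sub>\<infinity>n. T l n) = (\<Sum>\<^sub>\<infinity>n. T l (n + l))"
      by (rule infsum_reindex_bij_betw[OF b, symmetric])
    also have "\<dots> = (\<Sum>\<^sub>\<infinity>n. (of_real (f l) * e l) * (of_real (g n) * e n))"
      by (rule infsum_cong) (simp only: T_def e_add add_diff_cancel of_real_mult mult_ac)
    finally show "(\<Sum>\<^sub>\<infinity>n. T l n) = (of_real (f l) * e l) * (\<Sum>\<^sub>\<infinity>n. of_real (g n) * e n)"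
      by (simp only: infsum_cmult_right')
  qed
  also have "\<dots> = (\<Sum>\<^sub>\<infinity>l. of_real (f l) * e l) * (\<Sum>\<^sub>\<infinity>n. of_real (g n) * e n)"
    by (rule infsum_cmult_left')
  finally show ?thesis by (simp only: fser_def e_def)
qed

section \<open>Solutions of the conformal Bernoulli equation\<close>

text \<open>For an even real sequence the series is real on the real axis and \<open>ev\<close> is
  all of it, a cosine series; for an odd one it is i times \<open>od\<close>, a sine series.\<close>

definition ev :: "nat \<Rightarrow> (int \<Rightarrow> real) \<Rightarrow> real \<Rightarrow> real" where
  "ev K f x = Re (fser K (\<lambda>n. of_real (f n)) (of_real x))"

definition od :: "nat \<Rightarrow> (int \<Rightarrow> real) \<Rightarrow> real \<Rightarrow> real" where
  "od K f x = Im (fser K (\<lambda>n. of_real (f n)) (of_real x))"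

lemma od_uminus: "od K f (- x) = - od K f x"
proof -
  have "fser K (\<lambda>n. of_real (f n)) (of_real (- x)) = cnj (fser K (\<lambda>n. of_real (f n)) (of_real x))"
    unfolding fser_def infsum_cnj[symmetric] by (rule infsum_cong) (simp add: fexp_def exp_cnj)
  then show ?thesis by (simp add: od_def)
qed

definition good :: "real \<Rightarrow> real \<Rightarrow> (int \<Rightarrow> real) \<Rightarrow> bool" where
  "good \<rho> s f \<longleftrightarrow> (\<exists>C. bd \<rho> C f) \<and> (\<forall>n. f (- n) = s * f n)"

lemma good_add: "good \<rho> s f \<Longrightarrow> good \<rho> s g \<Longrightarrow> good \<rho> s (\<lambda>n. f n + g n)"
  unfolding good_def by (auto intro: bd_add simp: distrib_left)

lemma good_cmult: "good \<rho> s f \<Longrightarrow> good \<rho> s (\<lambda>n. a * f n)"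
  unfolding good_def by (auto intro: bd_cmult)

lemma good_divide: "good \<rho> s f \<Longrightarrow> good \<rho> s (\<lambda>n. f n / a)"
  using good_cmult[of \<rho> s f "1 / a"] by simp

lemma good_uminus: "good \<rho> s f \<Longrightarrow> good \<rho> s (\<lambda>n. - f n)"
  using good_cmult[of \<rho> s f "-1"] by simp

lemma good_diff: "good \<rho> s f \<Longrightarrow> good \<rho> s g \<Longrightarrow> good \<rho> s (\<lambda>n. f n - g n)"
  using good_add[OF _ good_uminus, of \<rho> s f g] by simp

lemma good_conv:
  assumes "\<rho> \<ge> 0" "good \<rho> s f" "good \<rho> t g"
  shows "good \<rho> (s * t) (conv f g)"
proof -
  obtain A B where "bd \<rho> A f" "bd \<rho> B g" using assms by (auto simp: good_def)
  then have "bd \<rho> (4 * wt_sum * A * B) (conv f g)" using assms(1) by (intro bd_conv)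
  then show ?thesis using assms conv_parity[of f s g t] unfolding good_def by blast
qed

lemma good_single: "good \<rho> 1 (single a)"
  unfolding good_def by (auto simp: bd_def single_def wt_0 intro!: exI[of _ "\<bar>a\<bar>"])

lemma good_summable:
  assumes "\<rho> \<ge> 0" "good \<rho> s f"
  shows "(\<lambda>n. of_real (f n) * fexp K n (of_real x)) summable_on UNIV"
proof -
  obtain C where C: "bd \<rho> C f" using assms by (auto simp: good_def)
  have "cbd (real K * 0) C (\<lambda>n. of_real (f n))"
    unfolding cbd_def
  proof
    fix n
    have "wt \<rho> n \<le> wt 0 n"
      unfolding wt_def using assms(1) by (intro divide_right_mono) auto
    then have "C * wt \<rho> n \<le> C * wt 0 n" using bd_nonneg[OF C] by (intro mult_left_mono)
    then show "cmod (of_real (f n)) \<le> C * wt (real K * 0) n" using bdD[OF C, of n] by simp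
  qed
  from fser_summable[OF this real_fdom] show ?thesis by simp
qed

lemma ev_add:
  assumes "\<rho> \<ge> 0" "good \<rho> s f" "good \<rho> s g"
  shows "ev K (\<lambda>n. f n + g n) x = ev K f x + ev K g x" "od K (\<lambda>n. f n + g n) x = od K f x + od K g x"
  unfolding ev_def od_def of_real_add
  by (subst fser_add[OF good_summable[OF assms(1,2)] good_summable[OF assms(1,3)]], simp)+

lemma ev_cmult: "ev K (\<lambda>n. a * f n) x = a * ev K f x" "od K (\<lambda>n. a * f n) x = a * od K f x"
  unfolding ev_def od_def by (simp_all add: fser_cmult)

lemma ev_divide: "ev K (\<lambda>n. f n / a) x = ev K f x / a"
  using ev_cmult(1)[of K "1 / a"] by simp

lemma ev_uminus: "ev K (\<lambda>n. - f n) x = - ev K f x"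
  using ev_cmult(1)[of K "-1"] by simp

lemma ev_diff:
  assumes "\<rho> \<ge> 0" "good \<rho> s f" "good \<rho> s g"
  shows "ev K (\<lambda>n. f n - g n) x = ev K f x - ev K g x"
  using ev_add(1)[OF assms(1,2) good_uminus[OF assms(3)]] by (simp add: ev_uminus)

lemma ev_single: "ev K (single a) x = a"
proof -
  have "(\<lambda>n. complex_of_real (single a n)) = (\<lambda>n. if n = 0 then of_real a else 0)"
    by (auto simp: single_def)
  then show ?thesis by (simp add: ev_def fser_single fexp_def)
qed

lemma fser_even: "(\<And>n. f (- n) = f n) \<Longrightarrow> fser K (\<lambda>n. of_real (f n)) (of_real x) = of_real (ev K f x)"
  using fser_cnj[of f 1 K "of_real x"] by (simp add: ev_def complex_eq_iff)

lemma fser_odd: "(\<And>n. f (- n) = - f n) \<Longrightarrow> fser K (\<lambda>n. of_real (f n)) (of_real x) = \<i> * of_real (od K f x)"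
  using fser_cnj[of f "-1" K "of_real x"] by (simp add: od_def complex_eq_iff)

lemma ev_conv_even:
  assumes "\<rho> \<ge> 0" "good \<rho> 1 f" "good \<rho> 1 g"
  shows "ev K (conv f g) x = ev K f x * ev K g x"
proof -
  obtain A B where "bd \<rho> A f" "bd \<rho> B g" using assms by (auto simp: good_def)
  from fser_conv[OF assms(1) this] show ?thesis
    using assms(2,3) by (simp add: ev_def[of K "conv f g"] fser_even good_def)
qed

lemma ev_conv_odd:
  assumes "\<rho> \<ge> 0" "good \<rho> (-1) f" "good \<rho> (-1) g"
  shows "ev K (conv f g) x = - od K f x * od K g x"
proof -
  obtain A B where "bd \<rho> A f" "bd \<rho> B g" using assms by (auto simp: good_def)
  from fser_conv[OF assms(1) this] show ?thesis
    using assms(2,3) by (simp add: ev_def[of K "conv f g"] fser_odd good_def)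
qed

lemma BL_good:
  assumes "BL \<rho> e0 s P" "0 < e" "e \<le> e0" "adm \<rho> z"
  shows "good \<rho> s (P e z)"
  using BL_E[OF assms(1)] assms unfolding good_def by metis

lemma conv_add_right:
  assumes "\<rho> \<ge> 0" "good \<rho> s f" "good \<rho> t g" "good \<rho> t g'"
  shows "conv f (\<lambda>n. g n + g' n) n = conv f g n + conv f g' n"
proof -
  obtain A B C where b: "bd \<rho> A f" "bd \<rho> B g" "bd \<rho> C g'" using assms by (auto simp: good_def)
  show ?thesis unfolding conv_def distrib_left
    by (rule infsum_add) (use conv_summable_and_bd(1)[OF assms(1)] b in blast)+
qed

lemma conv_cmult_right: "conv f (\<lambda>n. a * g n) n = a * conv f g n"
  unfolding conv_def by (simp add: mult.left_commute[of _ a] infsum_cmult_right')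

lemma conv_cmult_left: "conv (\<lambda>n. a * f n) g n = a * conv f g n"
  unfolding conv_def by (simp add: mult.assoc infsum_cmult_right')

lemma conv_add_left:
  assumes "\<rho> \<ge> 0" "good \<rho> t g" "good \<rho> s f" "good \<rho> s f'"
  shows "conv (\<lambda>n. f n + f' n) g n = conv f g n + conv f' g n"
  using conv_add_right[OF assms] by (simp add: conv_commute[of _ g])

text \<open>Bernoulli's law on the free surface, multiplied by \<open>J = \<bar>Z'\<bar>\<^sup>2\<close>, where \<open>Z\<close> is the conformal
  parametrization, \<open>Y\<close> the sequence of cosine coefficients of the elevation and \<open>R\<close> that of the
  trace of the harmonic conjugate of the potential. The constant is fixed by the normalization of
  \<open>\<partial>\<^sub>x\<^sup>-\<^sup>1\<close>.\<close>

definition bernoulli :: "real \<Rightarrow> ereal \<Rightarrow> real \<Rightarrow> real \<Rightarrow> nat \<Rightarrow> real \<Rightarrow> (int \<Rightarrow> real) \<Rightarrow> bool" where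
  "bernoulli g h \<kappa> \<gamma> K c Y \<longleftrightarrow>
    (let m = (\<lambda>n. real K * of_int n);
         q = qsym h K (real_of_ereal h + Y 0);
         lam = (\<lambda>n. q n * (m n * Y n));
         R = (\<lambda>n. c * Y n + \<gamma> / 2 * conv Y Y n)
     in \<forall>x. let X' = 1 + ev K lam x; Y' = - od K (\<lambda>n. m n * Y n) x;
                X'' = - od K (\<lambda>n. m n * lam n) x; Y'' = - ev K (\<lambda>n. (m n)\<^sup>2 * Y n) x;
                J = X'\<^sup>2 + Y'\<^sup>2
       in (g * ev K Y x - c\<^sup>2 / 2 - \<gamma> * conv R (\<lambda>n. single 1 n + lam n) 0) * J
          + (ev K (\<lambda>n. q n * (m n * R n)) x - (c + \<gamma> * ev K Y x) * X')\<^sup>2 / 2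
          - \<kappa> * (Y'' * X' - Y' * X'') / sqrt J = 0)"

section \<open>From the fixed point to Bernoulli's law\<close>

context bifurcation
begin

lemmas ev_rules = ev_add(1)[OF \<rho>, where s=1] ev_diff[OF \<rho>, where s=1] ev_uminus ev_divide ev_cmult(1) ev_single ev_conv_even[OF \<rho>] ev_conv_odd[OF \<rho>]

lemma good_conv_ee: "good \<rho> 1 f \<Longrightarrow> good \<rho> 1 f' \<Longrightarrow> good \<rho> 1 (conv f f')"
  and good_conv_oo: "good \<rho> (-1) f \<Longrightarrow> good \<rho> (-1) f' \<Longrightarrow> good \<rho> 1 (conv f f')"
  using good_conv[OF \<rho>, of 1 f 1 f'] good_conv[OF \<rho>, of "-1" f "-1" f'] by simp_all

lemmas good_rules = good_uminus good_divide good_add good_diff good_cmult good_single good_conv_ee good_conv_oo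

text \<open>Evaluation at a point \<open>x\<close> turns convolutions into products, so the fixed
  point equations become polynomial identities between real numbers.\<close>

lemma fixed_point_functions:
  fixes x :: real
  assumes T: "TT e z = z" and e: "0 < e" "e \<le> e0" and adm: "adm \<rho> z"
  defines "c \<equiv> cs + dl z" and "E \<equiv> (\<lambda>P::family. ev K (P e z) x)"
  defines "jv \<equiv> 2 * E lam + e * ((E lam)\<^sup>2 + (od K (yd e z) x)\<^sup>2)"
    and "kv \<equiv> - od K (yd e z) x * od K (kd e z) x - E yk * E lam"
    and "tv \<equiv> E y - e * (E w2 - E y * E lam)"
  shows "(g * (e * E y) - c\<^sup>2 / 2 - \<gamma> * (e * m1 e z 0)) * (1 + e * jv) + (c + \<gamma> * e * tv)\<^sup>2 / 2
      - e * (- E yk + e * kv) * (1 + e * E rh) = 0"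
    and "(1 + e * jv) * (1 + e * E rh)\<^sup>2 = 1"
proof -
  note G = BL_good[OF _ e adm]
  note Gs = G[OF BL_y] G[OF BL_yd] G[OF BL_yk] G[OF BL_sg] G[OF BL_lam] G[OF BL_kd] G[OF BL_j2]
    G[OF BL_jj] G[OF BL_rh] G[OF BL_yl] G[OF BL_w2] G[OF BL_m2] G[OF BL_m1] G[OF BL_tt] G[OF BL_k1]
    G[OF BL_P0] G[OF BL_P2]
  note [simp] = Gs good_rules ev_rules
  have cc: "cc e z = single c" by (simp add: cc_def c_def dl_def)
  have sing: "conv (single c) f = (\<lambda>n. c * f n)" for f by (rule ext) (rule conv_single)
  have sing2: "(\<lambda>n. a * single b n) = single (a * b)" for a b by (auto simp: single_def)
  have F: "(\<And>n. z (- n) = z n)" using adm by (simp add: adm_def)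
  note eqs = fixed_point_equations[OF T e(1) F, folded c_def]
  have j2: "ev K (j2 e z) x = (E lam)\<^sup>2 + (od K (yd e z) x)\<^sup>2"
    unfolding j2_def E_def by (simp add: power2_eq_square)
  have jj: "ev K (jj e z) x = jv"
    unfolding jj_def jv_def by (simp add: j2) (simp add: E_def)
  have rh: "E rh = E sg - E lam"
    unfolding E_def rh_def by simp
  have yl: "ev K (yl e z) x = E y * E lam"
    unfolding yl_def E_def by simp
  have tt: "ev K (tt e z) x = tv"
    unfolding tt_def tv_def by (simp add: yl) (simp add: E_def)
  have k1: "ev K (k1 e z) x = kv"
    unfolding k1_def kv_def by (simp add: E_def)
  have m2s: "m2 e z = single (m2 e z 0)"
    unfolding m2_def av_def by (auto simp: single_def)
  have m2: "ev K (m2 e z) x = m2 e z 0" by (subst m2s) simp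
  have m1s: "m1 e z = single (m1 e z 0)"
  proof
    fix n
    have "m2 e z n = 0" if "n \<noteq> 0" using that by (subst m2s) (simp add: single_def)
    then show "m1 e z n = single (m1 e z 0) n"
      by (simp add: m1_def cc conv_single av_def single_def)
  qed
  have m1: "ev K (m1 e z) x = m1 e z 0" by (subst m1s) simp
  have m10: "m1 e z 0 = c * y e z 0 + e * m2 e z 0"
    by (simp add: m1_def cc conv_single av_def single_def)
  have P0: "ev K (P0 e z) x = (g * E y - \<gamma> * m1 e z 0) * jv - \<gamma> * m2 e z 0
      - c\<^sup>2 / 2 * ((E lam)\<^sup>2 + (od K (yd e z) x)\<^sup>2) - \<gamma> * c * (E w2 - E y * E lam)
      + \<gamma>\<^sup>2 / 2 * tv\<^sup>2 - (kv + E rh * (e * kv - E yk))"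
    unfolding P0_def cc sing sing2
    by (simp add: jj m1 m2 j2 yl tt k1 conv_single power2_eq_square) (simp add: E_def)
  have P2: "ev K (P2 e z) x = - (1 / 2) * ((E lam)\<^sup>2 + (od K (yd e z) x)\<^sup>2 + (E rh)\<^sup>2 + 2 * jv * E rh
      + e * jv * (E rh)\<^sup>2)"
    unfolding P2_def by (simp add: jj j2 power2_eq_square) (simp add: E_def)
  have "sg e z = (\<lambda>n. e * P2 e z n)" using eqs(2) by blast
  then have sg: "E sg = e * ev K (P2 e z) x" unfolding E_def by simp
  show "(1 + e * jv) * (1 + e * E rh)\<^sup>2 = 1"
  proof -
    have "(1 + e * jv) * (1 + e * E rh)\<^sup>2 - 1
      = e * (jv + 2 * E rh + e * ((E rh)\<^sup>2 + 2 * jv * E rh + e * jv * (E rh)\<^sup>2))"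
      by (simp add: power2_eq_square algebra_simps)
    also have "jv + 2 * E rh = 2 * E sg + e * ((E lam)\<^sup>2 + (od K (yd e z) x)\<^sup>2)"
      by (simp add: jv_def rh)
    also have "2 * E sg = - e * ((E lam)\<^sup>2 + (od K (yd e z) x)\<^sup>2 + (E rh)\<^sup>2 + 2 * jv * E rh
      + e * jv * (E rh)\<^sup>2)"
      by (simp add: sg P2)
    finally show ?thesis by (simp add: algebra_simps)
  qed
  have "(\<lambda>n. g * y e z n + c * \<gamma> * (y e z n - av (y e z) n) - c\<^sup>2 * lam e z n + yk e z n + e * P0 e z n) = single 0"
    using eqs(1) by (auto simp: single_def)
  then have "ev K (\<lambda>n. g * y e z n + c * \<gamma> * (y e z n - av (y e z) n) - c\<^sup>2 * lam e z n + yk e z n + e * P0 e z n) x = 0"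
    by simp
  then have eq: "g * E y + c * \<gamma> * (E y - y e z 0) - c\<^sup>2 * E lam + E yk + e * ev K (P0 e z) x = 0"
    unfolding av_def by (simp) (simp add: E_def)
  \<comment> \<open>At order zero the two terms with \<open>c^2 / 2\<close> cancel, so a factor
    \<open>e\<close> comes out. What is left is the linear equation plus
    \<open>e * P0\<close>.\<close>
  have "(g * (e * E y) - c\<^sup>2 / 2 - \<gamma> * (e * m1 e z 0)) * (1 + e * jv) + (c + \<gamma> * e * tv)\<^sup>2 / 2
      - e * (- E yk + e * kv) * (1 + e * E rh)
    = e * ((g * E y - \<gamma> * m1 e z 0) * (1 + e * jv) - c\<^sup>2 / 2 * jv + c * \<gamma> * tv + e * (\<gamma>\<^sup>2 / 2 * tv\<^sup>2)
        + E yk - e * (kv + E rh * (e * kv - E yk)))"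
    by (simp add: power2_eq_square algebra_simps add_divide_distrib)
  also have "(g * E y - \<gamma> * m1 e z 0) * (1 + e * jv) - c\<^sup>2 / 2 * jv + c * \<gamma> * tv + e * (\<gamma>\<^sup>2 / 2 * tv\<^sup>2)
        + E yk - e * (kv + E rh * (e * kv - E yk))
      = g * E y + c * \<gamma> * (E y - y e z 0) - c\<^sup>2 * E lam + E yk + e * ev K (P0 e z) x"
    unfolding P0 by (simp add: m10 jv_def tv_def algebra_simps)
  finally show "(g * (e * E y) - c\<^sup>2 / 2 - \<gamma> * (e * m1 e z 0)) * (1 + e * jv) + (c + \<gamma> * e * tv)\<^sup>2 / 2
      - e * (- E yk + e * kv) * (1 + e * E rh) = 0" using eq by simp
qed

text \<open>The smallness condition makes \<open>1 + e * rh\<close> positive, which selects the root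
  \<open>1 / sqrt J\<close> of \<open>J * r^2 = 1\<close> and restores the true curvature
  term.\<close>

lemma fixed_point_bernoulli:
  assumes T: "TT e z = z" and e: "0 < e" "e \<le> e0" and adm: "adm \<rho> z"
    and small: "\<And>x. \<bar>e * ev K (rh e z) x\<bar> \<le> 1 / 2"
  shows "bernoulli g h \<kappa> \<gamma> K (cs + dl z) (\<lambda>n. e * y e z n)"
proof -
  note G = BL_good[OF _ e adm]
  define c where "c = cs + dl z"
  define Y where "Y n = e * y e z n" for n
  define qq where "qq = q (hr + Y 0)"
  define L where "L n = qq n * (m n * Y n)" for n
  define R where "R n = c * Y n + \<gamma> / 2 * conv Y Y n" for n
  have qq: "qq = q (Hh e z)" by (simp add: qq_def Hh_def Y_def)
  have L: "L = (\<lambda>n. e * lam e z n)"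
    by (auto simp: L_def qq Y_def lam_def Q_def yd_def)
  have mY: "(\<lambda>n. m n * Y n) = (\<lambda>n. e * yd e z n)"
    by (auto simp: Y_def yd_def)
  have cYY: "conv Y Y n = e\<^sup>2 * conv (y e z) (y e z) n" for n
    unfolding Y_def by (simp add: conv_cmult_left conv_cmult_right power2_eq_square)
  have kY: "\<kappa> * ev K (\<lambda>n. (m n)\<^sup>2 * Y n) x = e * ev K (yk e z) x" for x
  proof -
    have "(\<lambda>n. \<kappa> * ((m n)\<^sup>2 * Y n)) = (\<lambda>n. e * yk e z n)"
      by (auto simp: Y_def yk_def)
    then show ?thesis by (metis ev_cmult(1))
  qed
  have kL: "\<kappa> * od K (\<lambda>n. m n * L n) x = e * od K (kd e z) x" for x
  proof -
    have "(\<lambda>n. \<kappa> * (m n * L n)) = (\<lambda>n. e * kd e z n)"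
      by (auto simp: L lam_def kd_def Q_def yk_def yd_def power2_eq_square)
    then show ?thesis by (metis ev_cmult(2))
  qed
  have mR: "qq n * (m n * R n) = c * e * lam e z n + \<gamma> * e\<^sup>2 * w2 e z n" for n
  proof -
    obtain A B where b: "bd \<rho> A (y e z)" "bd \<rho> B (yd e z)"
      using G[OF BL_y] G[OF BL_yd] by (auto simp: good_def)
    have "(\<lambda>n. real K * of_int n * y e z n) = yd e z" by (auto simp: yd_def m_def)
    then have "m n * conv (y e z) (y e z) n = conv (yd e z) (y e z) n + conv (y e z) (yd e z) n"
      using conv_deriv[OF \<rho> b(1) b(1), of B "real K" B n] b by (simp add: m_def)
    then have "m n * conv (y e z) (y e z) n = 2 * conv (yd e z) (y e z) n"
      by (simp add: conv_commute)
    moreover have "qq n * (m n * R n)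
        = c * e * (qq n * (m n * y e z n)) + \<gamma> / 2 * e\<^sup>2 * (qq n * (m n * conv (y e z) (y e z) n))"
      unfolding R_def cYY Y_def by (simp add: algebra_simps)
    ultimately show ?thesis
      by (simp add: qq lam_def w2_def Q_def yd_def)
  qed
  have evR: "ev K (\<lambda>n. qq n * (m n * R n)) x = c * e * ev K (lam e z) x + \<gamma> * e\<^sup>2 * ev K (w2 e z) x" for x
    unfolding mR using G[OF BL_lam] G[OF BL_w2]
    by (simp add: good_rules ev_rules)
  have cc: "cc e z = single c" by (simp add: cc_def c_def dl_def)
  have mm: "conv R (\<lambda>n. single 1 n + L n) 0 = e * m1 e z 0"
  proof -
    have gy: "good \<rho> 1 (y e z)" and gl: "good \<rho> 1 (lam e z)" using G BL_y BL_lam by blast+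
    have R: "R = (\<lambda>n. c * e * y e z n + \<gamma> / 2 * e\<^sup>2 * conv (y e z) (y e z) n)"
    proof
      fix n
      have "R n = c * Y n + \<gamma> / 2 * (e\<^sup>2 * conv (y e z) (y e z) n)" by (simp only: R_def cYY)
      then show "R n = c * e * y e z n + \<gamma> / 2 * e\<^sup>2 * conv (y e z) (y e z) n" by (simp add: Y_def)
    qed
    have gR: "good \<rho> 1 R" unfolding R using gy by (intro good_add good_cmult good_conv_ee)
    have "conv R (\<lambda>n. single 1 n + L n) 0 = conv R (single 1) 0 + conv R L 0"
      unfolding L by (rule conv_add_right[OF \<rho> gR good_single good_cmult[OF gl]])
    also have "conv R (single 1) 0 = R 0" by (subst conv_commute) (simp add: conv_single)
    also have "conv R L 0 = e * conv R (lam e z) 0" unfolding L by (rule conv_cmult_right)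
    also have "conv R (lam e z) 0 = c * e * conv (y e z) (lam e z) 0
        + \<gamma> / 2 * e\<^sup>2 * conv (conv (y e z) (y e z)) (lam e z) 0"
      unfolding R
      by (subst conv_add_left[OF \<rho> gl good_cmult[OF gy] good_cmult[OF good_conv_ee[OF gy gy]]])
        (simp only: conv_cmult_left)
    finally show ?thesis
      by (simp add: R m1_def m2_def cc conv_single av_def single_def yl_def power2_eq_square algebra_simps)
  qed
  show ?thesis
    unfolding bernoulli_def Let_def Y_def[symmetric] m_def[symmetric] hr_def[symmetric]
      c_def[symmetric] qq_def[symmetric] L_def[symmetric] R_def[symmetric] mm
  proof
    fix x
    note F = fixed_point_functions[OF T e adm, of x, folded c_def]
    define r where "r = 1 + e * ev K (rh e z) x"
    define J where "J = (1 + ev K L x)\<^sup>2 + (- od K (\<lambda>n. m n * Y n) x)\<^sup>2"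
    have evL: "ev K L x = e * ev K (lam e z) x" unfolding L by (rule ev_cmult)
    have odY: "od K (\<lambda>n. m n * Y n) x = e * od K (yd e z) x" unfolding mY by (rule ev_cmult)
    have evY: "ev K Y x = e * ev K (y e z) x" unfolding Y_def[abs_def] by (rule ev_cmult)
    have J: "J = 1 + e * (2 * ev K (lam e z) x + e * ((ev K (lam e z) x)\<^sup>2 + (od K (yd e z) x)\<^sup>2))"
      unfolding J_def evL odY by (simp add: power2_eq_square algebra_simps)
    have r: "r > 0" using small[of x] unfolding r_def by linarith
    have Jr: "J * r\<^sup>2 = 1" using F(2) unfolding J r_def .
    then have "(sqrt J * r)\<^sup>2 = 1"
      using r by (metis mult_nonneg_nonneg power_mult_distrib real_sqrt_pow2 zero_le_mult_iff zero_le_one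
          zero_le_power2 linorder_not_le zero_less_power mult_less_0_iff not_one_less_zero order_less_imp_le)
    then have "sqrt J * r = 1 \<or> sqrt J * r = - 1" by (simp add: power2_eq_1_iff)
    moreover have "J > 0" using Jr r by (metis zero_less_mult_pos2 zero_less_one zero_less_power)
    then have "sqrt J * r > 0" using r by simp
    ultimately have sr: "r = 1 / sqrt J" using \<open>J > 0\<close> by (auto simp: field_simps)
    have "\<kappa> * (- ev K (\<lambda>n. (m n)\<^sup>2 * Y n) x * (1 + ev K L x)
          - - od K (\<lambda>n. m n * Y n) x * - od K (\<lambda>n. m n * L n) x)
        = - (\<kappa> * ev K (\<lambda>n. (m n)\<^sup>2 * Y n) x) * (1 + ev K L x)
          - od K (\<lambda>n. m n * Y n) x * (\<kappa> * od K (\<lambda>n. m n * L n) x)"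
      by (simp add: algebra_simps)
    also have "\<dots> = e * (- ev K (yk e z) x + e * (- od K (yd e z) x * od K (kd e z) x - ev K (yk e z) x * ev K (lam e z) x))"
      unfolding kY kL evL odY by (simp add: algebra_simps)
    finally have k: "\<kappa> * (- ev K (\<lambda>n. (m n)\<^sup>2 * Y n) x * (1 + ev K L x)
          - - od K (\<lambda>n. m n * Y n) x * - od K (\<lambda>n. m n * L n) x) / sqrt J
        = e * (- ev K (yk e z) x + e * (- od K (yd e z) x * od K (kd e z) x - ev K (yk e z) x * ev K (lam e z) x)) * r"
      unfolding sr by simp
    have v: "ev K (\<lambda>n. qq n * (m n * R n)) x - (c + \<gamma> * ev K Y x) * (1 + ev K L x)
        = - (c + \<gamma> * e * (ev K (y e z) x - e * (ev K (w2 e z) x - ev K (y e z) x * ev K (lam e z) x)))"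
      unfolding evR evY evL by (simp add: power2_eq_square algebra_simps)
    show "(g * ev K Y x - c\<^sup>2 / 2 - \<gamma> * (e * m1 e z 0)) *
          ((1 + ev K L x)\<^sup>2 + (- od K (\<lambda>n. m n * Y n) x)\<^sup>2) +
          (ev K (\<lambda>n. qq n * (m n * R n)) x - (c + \<gamma> * ev K Y x) * (1 + ev K L x))\<^sup>2 / 2 -
          \<kappa> * (- ev K (\<lambda>n. (m n)\<^sup>2 * Y n) x * (1 + ev K L x)
          - - od K (\<lambda>n. m n * Y n) x * - od K (\<lambda>n. m n * L n) x) /
          sqrt ((1 + ev K L x)\<^sup>2 + (- od K (\<lambda>n. m n * Y n) x)\<^sup>2) = 0"
      unfolding J_def[symmetric] unfolding k v unfolding power2_minus
      using F(1) unfolding J r_def evY .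
  qed
qed

text \<open>\<open>Y 1 = e\<close> holds because \<open>1 / D 1\<close> is 0, so that the unknown
  cannot alter the prescribed mode; it is what later makes the wave non-trivial.\<close>

theorem conformal_solution:
  "\<exists>M e1. M > 0 \<and> e1 > 0 \<and> (\<forall>e. 0 < e \<and> e \<le> e1 \<longrightarrow> (\<exists>c Y. \<bar>c - cs\<bar> \<le> M * e \<and> (\<forall>n. Y (- n) = Y n) \<and>
     bd \<rho> (M * e) Y \<and> Y 1 = e \<and> (h \<noteq> \<infinity> \<longrightarrow> real_of_ereal h + Y 0 \<ge> real_of_ereal h / 2) \<and>
     bernoulli g h \<kappa> \<gamma> K c Y))"
proof -
  obtain M e1 where M: "M > 0" "0 < e1" "e1 \<le> e0"
    "\<And>e. 0 < e \<Longrightarrow> e \<le> e1 \<Longrightarrow> \<exists>z. adm \<rho> z \<and> (\<forall>n. cmod (z n) \<le> M * e * wt \<rho> n) \<and> TT e z = z"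
    using fixed_point by blast
  obtain A where A: "\<And>e z. 0 < e \<Longrightarrow> e \<le> e0 \<Longrightarrow> adm \<rho> z \<Longrightarrow> bd \<rho> A (y e z)" "A \<ge> 0"
    using BL_y by (rule BL_E) blast
  obtain B where B: "\<And>e z. 0 < e \<Longrightarrow> e \<le> e0 \<Longrightarrow> adm \<rho> z \<Longrightarrow> bd \<rho> B (rh e z)" "B \<ge> 0"
    using BL_rh by (rule BL_E) blast
  define N where "N = max A (M / \<bar>theta\<bar>)"
  define e2 where "e2 = min e1 (1 / (2 * (B * wt_sum + 1)))"
  have Bw: "B * wt_sum \<ge> 0" using B wt_sum_nonneg by simp
  have "\<exists>c Y. \<bar>c - cs\<bar> \<le> N * e \<and> (\<forall>n. Y (- n) = Y n) \<and>
     bd \<rho> (N * e) Y \<and> Y 1 = e \<and> (h \<noteq> \<infinity> \<longrightarrow> real_of_ereal h + Y 0 \<ge> real_of_ereal h / 2) \<and>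
     bernoulli g h \<kappa> \<gamma> K c Y" if e: "0 < e" "e \<le> e2" for e
  proof -
    have e1: "e \<le> e1" "e \<le> e0" using e M by (auto simp: e2_def)
    obtain z where z: "adm \<rho> z" "\<And>n. cmod (z n) \<le> M * e * wt \<rho> n" "TT e z = z"
      using M(4)[OF e(1) e1(1)] by blast
    have "e * (2 * (B * wt_sum + 1)) \<le> 1"
    proof -
      have "e \<le> 1 / (2 * (B * wt_sum + 1))" using e by (simp add: e2_def)
      then show ?thesis using Bw by (simp add: pos_le_divide_eq)
    qed
    then have eB: "e * (B * wt_sum) \<le> 1 / 2" using e by (simp add: algebra_simps)
    have small: "\<bar>e * ev K (rh e z) x\<bar> \<le> 1 / 2" for x
    proof -
      have b: "bd \<rho> B (rh e z)" using B e e1 z by blast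
      have "cbd (real K * 0) B (\<lambda>n. of_real (rh e z n))"
        unfolding cbd_of_real bd_def
      proof
        fix n
        have "wt \<rho> n \<le> wt 0 n"
          unfolding wt_def using \<rho> by (intro divide_right_mono) auto
        then have "B * wt \<rho> n \<le> B * wt 0 n" using B by (intro mult_left_mono) auto
        then show "\<bar>rh e z n\<bar> \<le> B * wt (real K * 0) n" using bdD[OF b, of n] by simp
      qed
      from fser_norm_le[OF this real_fdom, of x]
      have "\<bar>ev K (rh e z) x\<bar> \<le> B * wt_sum"
        unfolding ev_def using abs_Re_le_cmod order_trans by auto
      then have "e * \<bar>ev K (rh e z) x\<bar> \<le> e * (B * wt_sum)" using e by (intro mult_left_mono) auto
      moreover have "\<bar>e * ev K (rh e z) x\<bar> = e * \<bar>ev K (rh e z) x\<bar>" using e by (simp add: abs_mult)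
      ultimately show ?thesis using eB by linarith
    qed
    have "\<bar>dl z\<bar> \<le> N * e"
    proof -
      have "\<bar>Re (z 1)\<bar> \<le> M * e * wt \<rho> 1" using z(2) abs_Re_le_cmod order_trans by blast
      also have "\<dots> \<le> M * e * 1" using M e wt_le_1 by (intro mult_left_mono) auto
      finally have "\<bar>dl z\<bar> \<le> M * e / \<bar>theta\<bar>" by (simp add: dl_def abs_mult divide_right_mono)
      also have "\<dots> = M / \<bar>theta\<bar> * e" by simp
      also have "\<dots> \<le> N * e" unfolding N_def using e by (intro mult_right_mono) auto
      finally show ?thesis .
    qed
    moreover have "bd \<rho> (N * e) (\<lambda>n. e * y e z n)"
    proof -
      have "bd \<rho> (\<bar>e\<bar> * A) (\<lambda>n. e * y e z n)" using A e e1 z by (intro bd_cmult) auto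
      moreover have "\<bar>e\<bar> * A \<le> N * e" unfolding N_def using e by (auto simp: mult.commute)
      ultimately show ?thesis by (rule bd_mono)
    qed
    moreover have "y e z (- n) = y e z n" for n using z(1) by (simp add: y_def adm_def)
    moreover have "e * y e z 1 = e" by (simp add: y_def D_1)
    moreover have "h \<noteq> \<infinity> \<longrightarrow> real_of_ereal h + e * y e z 0 \<ge> real_of_ereal h / 2"
      using Hh_ge[OF e(1) e1(2) z(1)] by (simp add: Hh_def hr_def)
    moreover have "bernoulli g h \<kappa> \<gamma> K (cs + dl z) (\<lambda>n. e * y e z n)"
      by (rule fixed_point_bernoulli[OF z(3) e(1) e1(2) z(1) small])
    ultimately show ?thesis by (intro exI[of _ "cs + dl z"] exI[of _ "\<lambda>n. e * y e z n"]) auto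
  qed
  moreover have "N > 0" using M theta_nonzero by (auto simp: N_def less_max_iff_disj)
  moreover have "e2 > 0" using M Bw by (auto simp: e2_def)
  ultimately show ?thesis by blast
qed

end

section \<open>Fourier series of periodic functions\<close>

lemma periodic_plus_int:
  assumes "periodic f"
  shows "f (x + 2 * pi * of_int k) = f x"
proof -
  have p: "f (y + 2 * pi) = f y" for y using assms by (simp add: periodic_def)
  have n: "f (y + 2 * pi * of_nat n) = f y" for y n
  proof (induction n)
    case (Suc n)
    have "f (y + 2 * pi * of_nat (Suc n)) = f ((y + 2 * pi * of_nat n) + 2 * pi)"
      by (simp add: algebra_simps)
    then show ?case using p Suc by simp
  qed simp
  show ?thesis
  proof (cases "k \<ge> 0")
    case True
    then show ?thesis using n[of x "nat k"] by simp
  next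
    case False
    then show ?thesis using n[of "x + 2 * pi * of_int k" "nat (- k)"] by simp
  qed
qed

lemma periodic_reduce:
  obtains k :: int where "x - 2 * pi * of_int k \<in> {0..2 * pi}"
proof
  show "x - 2 * pi * of_int \<lfloor>x / (2 * pi)\<rfloor> \<in> {0..2 * pi}"
  proof -
    define r where "r = x / (2 * pi)"
    have "2 * pi * of_int \<lfloor>r\<rfloor> \<le> 2 * pi * r" "2 * pi * r \<le> 2 * pi * (of_int \<lfloor>r\<rfloor> + 1)"
      using floor_correct[of r] by (intro mult_left_mono; simp)+
    moreover have "2 * pi * r = x" by (simp add: r_def)
    ultimately show ?thesis by (simp add: r_def[symmetric] distrib_left)
  qed
qed

lemma periodic_ext_bound:
  assumes "periodic f" "\<And>x. x \<in> {0..2 * pi} \<Longrightarrow> P (f x)"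
  shows "P (f x)"
proof -
  obtain k where k: "x - 2 * pi * of_int k \<in> {0..2 * pi}" by (rule periodic_reduce)
  have "f x = f (x - 2 * pi * of_int k)"
    using periodic_plus_int[OF assms(1), of "x - 2 * pi * of_int k" k] by simp
  then show ?thesis using assms(2)[OF k] by simp
qed

text \<open>A real linear function of \<open>cis t\<close> is a combination of \<open>cis t\<close>
  and \<open>cis (- t)\<close>, which only shift \<open>k\<close> by one. The function
  \<open>w\<close> is arbitrary so that in the product case the hypothesis for one factor can be
  applied to \<open>w\<close> times the other.\<close>

lemma trig_orthogonal_mult:
  assumes "real_polynomial_function p"
  shows "\<And>w. continuous_on {0..2 * pi} w \<Longrightarrow>
    (\<And>k::int. ((\<lambda>t. w t * cis (of_int k * t)) has_integral 0) {0..2 * pi}) \<Longrightarrow>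
    ((\<lambda>t. w t * complex_of_real (p (cis t)) * cis (of_int k * t)) has_integral 0) {0..2 * pi}"
  using assms
proof (induction p arbitrary: k rule: real_polynomial_function.induct)
  case (linear f)
  have f: "f (cis t) = cos t * f 1 + sin t * f \<i>" for t
  proof -
    have "cis t = cos t *\<^sub>R 1 + sin t *\<^sub>R \<i>" by (simp add: complex_eq_iff)
    then show ?thesis
      using linear(1) by (simp add: bounded_linear.linear linear_add linear_scale)
  qed
  have c: "complex_of_real (cos t) = (cis t + cis (- t)) / 2"
      "complex_of_real (sin t) = (cis t - cis (- t)) / (2 * \<i>)" for t
    by (simp_all add: complex_eq_iff)
  have cc: "cis t * cis (of_int k * t) = cis (of_int (k + 1) * t)"
      "cis (- t) * cis (of_int k * t) = cis (of_int (k - 1) * t)" for t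
    by (simp_all add: cis_mult algebra_simps)
  have eq: "w t * complex_of_real (f (cis t)) * cis (of_int k * t)
      = (of_real (f 1) / 2 + of_real (f \<i>) / (2 * \<i>)) * (w t * cis (of_int (k + 1) * t))
       + (of_real (f 1) / 2 - of_real (f \<i>) / (2 * \<i>)) * (w t * cis (of_int (k - 1) * t))" for t
    unfolding f of_real_add of_real_mult c cc[symmetric] by (simp add: field_simps)
  show ?case unfolding eq
    using has_integral_add[OF has_integral_mult_right[OF linear(3), of "of_real (f 1) / 2 + of_real (f \<i>) / (2 * \<i>)"]
        has_integral_mult_right[OF linear(3), of "of_real (f 1) / 2 - of_real (f \<i>) / (2 * \<i>)"]]
    by (simp only: mult_zero_right add_0_right)
next
  case (const c)
  have eq: "w t * complex_of_real c * cis (of_int k * t) = of_real c * (w t * cis (of_int k * t))" for t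
    by simp
  show ?case unfolding eq
    using has_integral_mult_right[OF const(2), of "of_real c"] by (simp only: mult_zero_right)
next
  case (add f g)
  have eq: "w t * complex_of_real (f (cis t) + g (cis t)) * cis (of_int k * t)
     = w t * complex_of_real (f (cis t)) * cis (of_int k * t) + w t * complex_of_real (g (cis t)) * cis (of_int k * t)" for t
    by (simp add: algebra_simps)
  show ?case unfolding eq
    using has_integral_add[OF add(3)[OF add(5,6)] add(4)[OF add(5,6)]] by simp
next
  case (mult f g)
  have "continuous_on {0..2 * pi} (\<lambda>t. w t * complex_of_real (f (cis t)))"
  proof (intro continuous_intros mult(5))
    show "continuous_on {0..2 * pi} (\<lambda>t. f (cis t))"
    proof (rule continuous_on_compose2[where g=f and f=cis, OF continuous_on_polymonial_function _ subset_UNIV])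
      show "polynomial_function f" using mult(1) by (simp add: real_polynomial_function_eq)
      show "continuous_on {0..2 * pi} cis" unfolding cis_conv_exp by (intro continuous_intros)
    qed
  qed
  from mult(4)[OF this mult(3)[OF mult(5,6)]]
  show ?case by (simp add: mult.assoc)
qed

text \<open>By \<open>trig_orthogonal_mult\<close> the function is orthogonal to all polynomials
  restricted to the unit circle. These approximate it uniformly by Stone-Weierstrass, so the
  integral of its square is arbitrarily small.\<close>

lemma fourier_coeff_0_imp_0:
  assumes cont: "continuous_on UNIV v" and per: "periodic v" and "\<And>k. fourier_coeff v k = 0"
  shows "v x = 0"
proof -
  let ?I = "{0..2 * pi}"
  define f where "f z = v (Arg z)" for z
  have vArg: "f (cis t) = v t" for t
  proof -
    have "cis (Arg (cis t)) = cis t" by (simp add: cis_Arg sgn_eq)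
    then have "sin (Arg (cis t)) = sin t \<and> cos (Arg (cis t)) = cos t"
      by (auto simp: complex_eq_iff)
    then obtain k :: int where "Arg (cis t) = t + 2 * pi * of_int k"
      unfolding sin_cos_eq_iff by (auto simp: mult_ac)
    then show ?thesis using periodic_plus_int[OF per] by (simp add: f_def)
  qed
  have contv: "isCont v t" for t using cont by (simp add: continuous_on_eq_continuous_at)
  \<comment> \<open>\<open>Arg\<close> jumps on the negative real axis. There the function is
    expressed by \<open>Arg (- z) + pi\<close>, which is continuous; periodicity makes the two
    expressions agree.\<close>
  have f_minus: "f z = v (Arg (- z) + pi)" if "z \<noteq> 0" for z
  proof -
    have "v (Arg z + pi + pi) = v (Arg z)"
      using per by (simp add: periodic_def add.assoc flip: mult_2)
    then show ?thesis using Arg_minus[OF that] by (simp add: f_def)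
  qed
  have contf: "continuous_on (sphere 0 1) f"
  proof (rule continuous_at_imp_continuous_on, rule ballI)
    fix z :: complex assume "z \<in> sphere 0 1"
    then have z0: "z \<noteq> 0" by auto
    show "isCont f z"
    proof (cases "z \<in> \<real>\<^sub>\<le>\<^sub>0")
      case False
      show ?thesis unfolding f_def
        by (rule continuous_at_compose[OF continuous_at_Arg[OF False] contv, unfolded o_def])
    next
      case True
      then have "- z \<notin> \<real>\<^sub>\<le>\<^sub>0"
        using z0 by (simp add: complex_nonpos_Reals_iff complex_eq_iff)
      then have "isCont Arg (- z)" by (rule continuous_at_Arg)
      then have "isCont (\<lambda>z. Arg (- z) + pi) z"
        by (intro isCont_add continuous_const isCont_o2[OF isCont_minus[OF continuous_ident]])
      from continuous_at_compose[OF this contv, unfolded o_def]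
      have "isCont (\<lambda>z. v (Arg (- z) + pi)) z" .
      moreover have "\<forall>\<^sub>F w in nhds z. f w = v (Arg (- w) + pi)"
        using t1_space_nhds[OF z0] by (auto elim!: eventually_mono simp: f_minus)
      ultimately show ?thesis
        using isCont_cong[of f "\<lambda>w. v (Arg (- w) + pi)" z] by simp
    qed
  qed
  have contI: "continuous_on ?I v" using cont continuous_on_subset by blast
  have "bounded (v ` ?I)"
    by (rule compact_imp_bounded[OF compact_continuous_image[OF contI compact_Icc]])
  then obtain B where "\<forall>y\<in>v ` ?I. norm y \<le> B"
    by (auto simp: bounded_iff)
  then have B: "\<bar>v t\<bar> \<le> B" if "t \<in> ?I" for t using that by simp
  have B0: "B \<ge> 0" using B[of 0] by auto
  have ort: "((\<lambda>t. complex_of_real (v t) * cis (of_int k * t)) has_integral 0) ?I" for k :: int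
  proof -
    have "(\<lambda>t. complex_of_real (v t) * cis (of_int k * t)) integrable_on ?I"
      by (intro integrable_continuous_interval continuous_intros contI)
    moreover have "integral ?I (\<lambda>t. complex_of_real (v t) * cis (of_int k * t)) = 0"
      using assms(3)[of "- k"] by (simp add: fourier_coeff_def)
    ultimately show ?thesis by (simp add: has_integral_iff)
  qed
  have v2: "(\<lambda>t. v t * v t) integrable_on ?I"
    by (intro integrable_continuous_interval continuous_intros contI)
  have le: "integral ?I (\<lambda>t. v t * v t) \<le> 2 * pi * B * e" if "e > 0" for e
  proof -
    obtain p where p: "real_polynomial_function p" "\<And>z. z \<in> sphere 0 1 \<Longrightarrow> \<bar>f z - p z\<bar> < e"
    proof (rule Stone_Weierstrass_real_polynomial_function[OF compact_sphere contf \<open>e > 0\<close>])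
      fix p assume "real_polynomial_function p" "\<And>z. z \<in> sphere 0 1 \<Longrightarrow> \<bar>f z - p z\<bar> < e"
      then show thesis by (rule that)
    qed
    have "((\<lambda>t. complex_of_real (v t) * complex_of_real (p (cis t)) * cis (of_int 0 * t)) has_integral 0) ?I"
      by (rule trig_orthogonal_mult[OF p(1) _ ort]) (intro continuous_intros contI)
    then have "((\<lambda>t. Re (complex_of_real (v t) * complex_of_real (p (cis t)) * cis (of_int 0 * t))) has_integral Re 0) ?I"
      by (rule has_integral_Re)
    then have "((\<lambda>t. v t * p (cis t)) has_integral 0) ?I" by simp
    from has_integral_diff[OF integrable_integral[OF v2] this]
    have i: "((\<lambda>t. v t * v t - v t * p (cis t)) has_integral integral ?I (\<lambda>t. v t * v t)) ?I" by simp
    have "v t * v t - v t * p (cis t) \<le> B * e" if "t \<in> ?I" for t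
    proof -
      have "v t * v t - v t * p (cis t) = v t * (f (cis t) - p (cis t))"
        by (simp add: vArg algebra_simps)
      also have "\<dots> \<le> \<bar>v t\<bar> * \<bar>f (cis t) - p (cis t)\<bar>" by (metis abs_ge_self abs_mult)
      also have "\<dots> \<le> B * e"
        using B[OF that] p(2)[of "cis t"] B0 by (intro mult_mono) (auto simp: less_imp_le)
      finally show ?thesis .
    qed
    moreover have "((\<lambda>t. B * e) has_integral (2 * pi * B * e)) ?I"
      using has_integral_const_real[of "B * e" 0 "2 * pi"] by (simp add: mult.assoc)
    ultimately show ?thesis using has_integral_le[OF i] by blast
  qed
  have "integral ?I (\<lambda>t. v t * v t) \<le> 0"
  proof (rule field_le_epsilon)
    fix e :: real assume "e > 0"
    define d where "d = e / (2 * pi * (B + 1))"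
    have pos: "d > 0" using B0 \<open>e > 0\<close> by (simp add: d_def)
    have "2 * pi * B * d \<le> 2 * pi * (B + 1) * d"
      using pos by (intro mult_right_mono mult_left_mono) auto
    also have "\<dots> = e" using B0 by (simp add: d_def)
    finally have "2 * pi * B * d \<le> e" .
    then show "integral ?I (\<lambda>t. v t * v t) \<le> 0 + e" using le[OF pos] by linarith
  qed
  moreover have "integral ?I (\<lambda>t. v t * v t) \<ge> 0" by (intro integral_nonneg v2) auto
  ultimately have "integral ?I (\<lambda>t. v t * v t) = 0" by simp
  moreover have "continuous_on ?I (\<lambda>t. v t * v t)" by (intro continuous_intros contI)
  ultimately have "\<forall>t\<in>?I. v t * v t = 0"
    using integral_eq_0_iff[of 0 "2 * pi" "\<lambda>t. v t * v t"] by simp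
  then have "v t = 0" if "t \<in> ?I" for t using that by simp
  then show ?thesis by (rule periodic_ext_bound[OF per, where P="\<lambda>y. y = 0"])
qed

lemma fourier_coeff_fser:
  assumes "R > 0" "cbd R C a" "\<And>x. complex_of_real (u x) = fser 1 a (of_real x)"
  shows "fourier_coeff u k = a k"
proof -
  have "cbd (real 1 * R) C a" using assms(2) by simp
  from fser_coeff[OF _ assms(1) this, of k]
  have "((\<lambda>x. complex_of_real (u x) * cis (- (of_int k * x))) has_integral 2 * pi * a k) {0..2 * pi}"
    by (simp add: assms(3))
  then show ?thesis by (simp add: fourier_coeff_def integral_unique)
qed

lemma fser_continuous:
  assumes "R > 0" "cbd (real K * R) C a"
  shows "continuous_on UNIV (\<lambda>x. fser K a (of_real x))"
proof (rule continuous_on_compose2[of "strip R" "fser K a"])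
  show "continuous_on (strip R) (fser K a)"
    using fser_holomorphic[OF assms(2) open_strip strip_fdom] holomorphic_on_imp_continuous_on by blast
qed (use assms in \<open>auto simp: strip_def intro!: continuous_intros\<close>)

lemma fourier_coeff_uminus:
  assumes "continuous_on UNIV u"
  shows "fourier_coeff u (- k) = cnj (fourier_coeff u k)"
proof -
  have "(\<lambda>x. complex_of_real (u x) * cis (- (of_int k * x))) integrable_on {0..2 * pi}"
    by (intro integrable_continuous_interval continuous_intros continuous_on_subset[OF assms]) auto
  from has_integral_linear[OF integrable_integral[OF this] bounded_linear_cnj]
  have "((\<lambda>x. complex_of_real (u x) * cis (- (of_int (- k) * x))) has_integral
     cnj (integral {0..2 * pi} (\<lambda>x. complex_of_real (u x) * cis (- (of_int k * x))))) {0..2 * pi}"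
    by (simp add: o_def cis_cnj)
  then show ?thesis by (simp add: fourier_coeff_def integral_unique)
qed

lemma fser_hermitian:
  assumes "\<And>n. a (- n) = cnj (a n)"
  shows "cnj (fser K a (of_real x)) = fser K a (of_real x)"
proof -
  have "cnj (fser K a (of_real x)) = (\<Sum>\<^sub>\<infinity>n. a (- n) * fexp K (- n) (of_real x))"
    unfolding fser_def infsum_cnj[symmetric]
    by (rule infsum_cong) (simp add: assms fexp_def exp_cnj)
  also have "\<dots> = fser K a (of_real x)"
    unfolding fser_def by (rule infsum_reindex_bij_betw) (rule bij_betwI[where g=uminus], auto)
  finally show ?thesis .
qed

text \<open>The function and the sum of its series are both continuous and have the same Fourier
  coefficients, so uniqueness applies to the difference.\<close>

lemma fourier_inversion:
  assumes u: "continuous_on UNIV u" "periodic u" and R: "R > 0" "cbd R C (fourier_coeff u)"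
  shows "complex_of_real (u x) = fser 1 (fourier_coeff u) (of_real x)"
proof -
  let ?a = "fourier_coeff u"
  define s where "s x = fser 1 ?a (complex_of_real x)" for x
  have "cnj (s x) = s x" for x
    unfolding s_def by (rule fser_hermitian) (rule fourier_coeff_uminus[OF u(1)])
  then have sR: "s x = of_real (Re (s x))" for x by (metis complex_cnj_cancel_iff Reals_cnj_iff of_real_Re)
  have contS: "continuous_on UNIV s"
    unfolding s_def[abs_def] using fser_continuous[of R 1] R by simp
  have perS: "s (x + 2 * pi) = s x" for x
    using fser_periodic[of 1 ?a "of_real x"] by (simp add: s_def)
  define v where "v x = u x - Re (s x)" for x
  have "v x = 0"
  proof (rule fourier_coeff_0_imp_0[where v=v and x=x])
    show "continuous_on UNIV v" unfolding v_def[abs_def] by (intro continuous_intros u contS)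
    show "periodic v" using u perS by (simp add: periodic_def v_def)
    fix k
    have c: "fourier_coeff (\<lambda>x. Re (s x)) k = ?a k"
      by (rule fourier_coeff_fser[OF R]) (unfold s_def[symmetric], rule sR[symmetric])
    have i: "(\<lambda>x. complex_of_real (w x) * cis (- (of_int k * x))) integrable_on {0..2 * pi}"
      if "continuous_on UNIV w" for w
      by (intro integrable_continuous_interval continuous_intros continuous_on_subset[OF that]) auto
    have "(\<lambda>x. complex_of_real (v x) * cis (- (of_int k * x)))
        = (\<lambda>x. complex_of_real (u x) * cis (- (of_int k * x)) - complex_of_real (Re (s x)) * cis (- (of_int k * x)))"
      by (rule ext) (simp only: v_def of_real_diff left_diff_distrib)
    then have "fourier_coeff v k = fourier_coeff u k - fourier_coeff (\<lambda>x. Re (s x)) k"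
      unfolding fourier_coeff_def
      by (simp only: integral_diff[OF i[OF u(1)] i[OF continuous_on_Re[OF contS]]] diff_divide_distrib)
    then show "fourier_coeff v k = 0" by (simp add: c)
  qed
  then show ?thesis using sR[of x] by (simp add: v_def s_def)
qed

text \<open>On the convex strip \<open>G\<close> has a primitive \<open>P\<close>. By periodicity of
  \<open>G\<close> the increment of \<open>P\<close> over one period has derivative zero, and this
  constant is the integral at every height.\<close>

lemma contour_shift:
  assumes G: "G holomorphic_on strip R" and per: "\<And>w. w \<in> strip R \<Longrightarrow> G (w + 2 * of_real pi) = G w"
    and \<tau>: "\<bar>\<tau>\<bar> < R"
  shows "integral {0..2 * pi} (\<lambda>x. G (of_real x)) = integral {0..2 * pi} (\<lambda>x. G (of_real x + \<i> * of_real \<tau>))"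
proof -
  have conv: "convex (strip R)"
  proof -
    have "strip R = {w. Im w < R} \<inter> {w. Im w > - R}" by (auto simp: strip_def)
    then show ?thesis by (simp add: convex_Int convex_halfspace_Im_lt convex_halfspace_Im_gt)
  qed
  obtain P where P0: "\<And>w. w \<in> strip R \<Longrightarrow> (P has_field_derivative G w) (at w within strip R)"
  proof (rule holomorphic_convex_primitive'[OF conv open_strip G])
    fix P assume "\<And>w. w \<in> strip R \<Longrightarrow> (P has_field_derivative G w) (at w within strip R)"
    then show thesis by (rule that)
  qed
  then have P: "(P has_field_derivative G w) (at w)" if "w \<in> strip R" for w
    using P0[OF that] by (simp only: at_within_open[OF that open_strip])
  have sh: "w + 2 * of_real pi \<in> strip R" if "w \<in> strip R" for w
    using that by (simp add: strip_def)
  have "((\<lambda>w. P (w + 2 * of_real pi) - P w) has_field_derivative 0) (at w within strip R)"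
    if w: "w \<in> strip R" for w
  proof -
    have "((\<lambda>w. P (w + 2 * of_real pi)) has_field_derivative G (w + 2 * of_real pi)) (at w)"
      using P[OF sh[OF w]] by (rule iffD1[OF DERIV_shift])
    from DERIV_diff[OF this P[OF w]] show ?thesis
      using per[OF w] by (simp add: has_field_derivative_at_within)
  qed
  from has_field_derivative_zero_constant[OF conv this]
  obtain c where c: "\<And>w. w \<in> strip R \<Longrightarrow> P (w + 2 * of_real pi) - P w = c"
    by auto
  have "integral {0..2 * pi} (\<lambda>x. G (of_real x + \<i> * of_real t)) = c" if t: "\<bar>t\<bar> < R" for t
  proof -
    have "((\<lambda>x. G (of_real x + \<i> * of_real t)) has_integral
        (P (of_real (2 * pi) + \<i> * of_real t) - P (of_real 0 + \<i> * of_real t))) {0..2 * pi}"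
    proof (rule fundamental_theorem_of_calculus)
      fix x assume "x \<in> {0..2 * pi}"
      have "of_real x + \<i> * of_real t \<in> strip R" using t by (simp add: strip_def)
      from P[OF this]
      have "((\<lambda>w. P (w + \<i> * of_real t)) has_field_derivative G (of_real x + \<i> * of_real t)) (at (of_real x))"
        by (rule iffD1[OF DERIV_shift])
      then have "((\<lambda>x. P (of_real x + \<i> * of_real t)) has_vector_derivative G (of_real x + \<i> * of_real t)) (at x)"
        by (rule has_vector_derivative_real_field)
      then show "((\<lambda>x. P (of_real x + \<i> * of_real t)) has_vector_derivative G (of_real x + \<i> * of_real t)) (at x within {0..2 * pi})"
        by (rule has_vector_derivative_at_within)
    qed simp
    moreover have "\<i> * of_real t \<in> strip R" using t by (simp add: strip_def)
    from c[OF this] have "P (of_real (2 * pi) + \<i> * of_real t) - P (of_real 0 + \<i> * of_real t) = c"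
      by (simp add: add.commute)
    ultimately show ?thesis by (simp add: integral_unique)
  qed
  from this[of 0] this[OF \<tau>] \<tau> show ?thesis by simp
qed

text \<open>The contour is shifted in the conformal variable, so that no complex extension of \<open>u\<close>
  itself is needed.\<close>

lemma pullback_coeff_bound:
  fixes u X X' :: "real \<Rightarrow> real" and XX XD FF :: "complex \<Rightarrow> complex"
  assumes u: "continuous_on UNIV u" and X: "\<And>x. (X has_real_derivative X' x) (at x)"
    and X0: "X 0 = 0" "X (2 * pi) = 2 * pi"
    and hol: "XX holomorphic_on strip R" "XD holomorphic_on strip R" "FF holomorphic_on strip R"
    and real: "\<And>x. XX (of_real x) = of_real (X x)" "\<And>x. XD (of_real x) = of_real (X' x)"
      "\<And>x. FF (of_real x) = of_real (u (X x))"
    and per: "\<And>w. XX (w + 2 * of_real pi) = XX w + 2 * of_real pi" "\<And>w. XD (w + 2 * of_real pi) = XD w"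
      "\<And>w. FF (w + 2 * of_real pi) = FF w"
    and bds: "\<And>w. w \<in> strip R \<Longrightarrow> cmod (XX w - w) \<le> 1" "\<And>w. w \<in> strip R \<Longrightarrow> cmod (XD w) \<le> 2"
      "\<And>w. w \<in> strip R \<Longrightarrow> cmod (FF w) \<le> B"
    and \<tau>: "0 < \<tau>" "\<tau> < R"
  shows "cmod (fourier_coeff u k) \<le> 2 * B * exp (- (\<tau> - 1) * \<bar>of_int k\<bar>)"
proof -
  let ?I = "{0..2 * pi}"
  define G where "G w = FF w * XD w * exp (- (\<i> * of_int k * XX w))" for w
  have B: "B \<ge> 0"
    using order_trans[OF norm_ge_zero bds(3)[of 0]] \<tau> by (simp add: strip_def)
  have contX: "continuous_on S X" for S
    using X by (intro DERIV_continuous_on[OF has_field_derivative_at_within]) auto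
  obtain b where b: "\<And>x. x \<in> ?I \<Longrightarrow> \<bar>X x\<bar> \<le> b"
  proof -
    have "bounded (X ` ?I)" by (rule compact_imp_bounded[OF compact_continuous_image[OF contX compact_Icc]])
    then obtain b where "\<forall>y\<in>X ` ?I. norm y \<le> b" by (auto simp: bounded_iff)
    then show thesis by (intro that[of b]) auto
  qed
  have "((\<lambda>x. X' x *\<^sub>R (complex_of_real (u (X x)) * cis (- (of_int k * X x)))) has_integral
      (integral {X 0..X (2 * pi)} (\<lambda>x. complex_of_real (u x) * cis (- (of_int k * x))))) ?I"
  proof (rule has_integral_substitution)
    show "X ` ?I \<subseteq> {- b..b}" using b by (fastforce simp: abs_le_iff)
    show "continuous_on {- b..b} (\<lambda>x. complex_of_real (u x) * cis (- (of_int k * x)))"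
      by (intro continuous_intros continuous_on_subset[OF u]) auto
  qed (use X0 X in \<open>auto intro: has_field_derivative_at_within\<close>)
  moreover have "X' x *\<^sub>R (complex_of_real (u (X x)) * cis (- (of_int k * X x))) = G (of_real x)" for x
    by (simp add: G_def real cis_conv_exp scaleR_conv_of_real mult_ac)
  ultimately have "integral ?I (\<lambda>x. complex_of_real (u x) * cis (- (of_int k * x))) = integral ?I (\<lambda>x. G (of_real x))"
    by (simp add: X0 integral_unique)
  \<comment> \<open>The shift goes against the sign of \<open>k\<close>, so that the exponential, of
    modulus \<open>exp (k * Im XX)\<close>, decays. As \<open>XX\<close> differs from the identity
    by at most 1, one unit of the rate is lost.\<close>
  also have "\<dots> = integral ?I (\<lambda>x. G (of_real x + \<i> * of_real (- sgn (of_int k) * \<tau>)))"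
  proof (rule contour_shift)
    show "G holomorphic_on strip R" unfolding G_def by (intro holomorphic_intros hol)
    show "\<bar>- sgn (of_int k) * \<tau>\<bar> < R" using \<tau> by (auto simp: abs_mult sgn_if)
    fix w
    have "exp (- (\<i> * of_int k * (XX w + 2 * of_real pi))) = exp (- (\<i> * of_int k * XX w))"
    proof -
      have "- (\<i> * of_int k * (XX w + 2 * of_real pi)) = - (\<i> * of_int k * XX w) + of_int (- k) * (2 * of_real pi * \<i>)"
        by (simp add: algebra_simps)
      moreover have "exp (of_int (- k) * (2 * of_real pi * \<i>)) = 1"
        unfolding exp_eq_1 by (auto intro!: exI[of _ "- k"])
      ultimately show ?thesis by (simp only: exp_add mult_1_right)
    qed
    then show "G (w + 2 * of_real pi) = G w" by (simp only: G_def per)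
  qed
  finally have eq: "fourier_coeff u k = integral ?I (\<lambda>x. G (of_real x + \<i> * of_real (- sgn (of_int k) * \<tau>))) / (2 * pi)"
    by (simp add: fourier_coeff_def)
  have "cmod (integral ?I (\<lambda>x. G (of_real x + \<i> * of_real (- sgn (of_int k) * \<tau>))))
      \<le> (2 * B * exp (- (\<tau> - 1) * \<bar>of_int k\<bar>)) * (2 * pi - 0)"
  proof (rule integral_bound)
    let ?w = "\<lambda>x. complex_of_real x + \<i> * of_real (- sgn (of_int k) * \<tau>)"
    have w: "?w x \<in> strip R" for x using \<tau> by (auto simp: strip_def abs_mult sgn_if)
    have "continuous_on (strip R) G"
      unfolding G_def by (intro holomorphic_on_imp_continuous_on holomorphic_intros hol)
    then show "continuous_on ?I (\<lambda>x. G (?w x))"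
      by (rule continuous_on_compose2) (use w in \<open>auto intro!: continuous_intros\<close>)
    fix x assume "x \<in> ?I"
    have "\<bar>Im (XX (?w x)) - Im (?w x)\<bar> \<le> 1"
      using bds(1)[OF w, of x] abs_Im_le_cmod[of "XX (?w x) - ?w x"] by simp
    then have "\<bar>of_int k\<bar> * \<bar>Im (XX (?w x)) - Im (?w x)\<bar> \<le> \<bar>of_int k\<bar> * 1"
      by (intro mult_left_mono) auto
    then have "of_int k * (Im (XX (?w x)) - Im (?w x)) \<le> \<bar>of_int k\<bar>"
      unfolding abs_mult[symmetric] by linarith
    moreover have "of_int k * Im (?w x) = - (\<tau> * \<bar>of_int k\<bar>)" by (simp add: sgn_if)
    ultimately have "of_int k * Im (XX (?w x)) \<le> - (\<tau> - 1) * \<bar>of_int k\<bar>"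
      by (simp only: right_diff_distrib left_diff_distrib) (simp add: algebra_simps)
    then have e: "cmod (exp (- (\<i> * of_int k * XX (?w x)))) \<le> exp (- (\<tau> - 1) * \<bar>of_int k\<bar>)"
      by simp
    show "cmod (G (?w x)) \<le> 2 * B * exp (- (\<tau> - 1) * \<bar>of_int k\<bar>)"
      unfolding G_def norm_mult
      using mult_mono[OF mult_mono[OF bds(3)[OF w] bds(2)[OF w]] e] B by (simp add: mult.commute)
  qed simp
  then show ?thesis unfolding eq norm_divide
    by (simp add: field_simps)
qed

text \<open>For coefficients decaying like \<open>exp (- (\<sigma> + 1) * |k|)\<close> the weight
  \<open>exp (2 * \<sigma> * |k|)\<close> cancels, and this sum, independent of
  \<open>\<sigma>\<close>, bounds the squared norm.\<close>

definition Hconst :: "real \<Rightarrow> real" where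
  "Hconst s = (\<Sum>\<^sub>\<infinity>k::int. bracket k powr (2 * s) * exp (- 2 * \<bar>of_int k\<bar>))"

lemma summable_Hconst: "(\<lambda>k::int. bracket k powr (2 * s) * exp (- 2 * \<bar>of_int k\<bar>)) summable_on UNIV"
proof -
  have "summable (\<lambda>n. max 1 (real n) powr (2 * s) * exp (- 2 * real n))"
  proof (rule summable_comparison_test_ev)
    have "((\<lambda>x::real. x powr (2 * s) * exp (- x)) \<longlongrightarrow> 0) at_top" by real_asymp
    then have "\<forall>\<^sub>F x::real in at_top. x powr (2 * s) * exp (- x) < 1"
      by (intro order_tendstoD(2)) auto
    from eventually_compose_filterlim[OF this filterlim_real_sequentially]
    have "\<forall>\<^sub>F n in sequentially. real n powr (2 * s) * exp (- real n) < 1" .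
    then show "\<forall>\<^sub>F n in sequentially. norm (max 1 (real n) powr (2 * s) * exp (- 2 * real n)) \<le> exp (- 1) ^ n"
      using eventually_ge_at_top[of 1]
    proof eventually_elim
      case (elim n)
      have "max 1 (real n) powr (2 * s) * exp (- 2 * real n) = (real n powr (2 * s) * exp (- real n)) * exp (- real n)"
        using elim by (simp add: exp_add[symmetric])
      also have "\<dots> \<le> 1 * exp (- real n)" using elim by (intro mult_right_mono) auto
      also have "\<dots> = exp (- 1) ^ n" by (simp add: exp_of_nat_mult[symmetric])
      finally show ?case by simp
    qed
    show "summable (\<lambda>n. exp (- 1 :: real) ^ n)" by (rule summable_geometric) simp
  qed
  then have "(\<lambda>n. max 1 (real n) powr (2 * s) * exp (- 2 * real n)) summable_on UNIV"
    by (intro summable_nonneg_imp_summable_on) auto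
  then show ?thesis by (intro summable_on_int_if_nat) (auto simp: bracket_def)
qed

lemma Hspace_fser:
  assumes "\<sigma> > 0" and a: "cbd (\<sigma> + 1) C a" and u: "\<And>x. complex_of_real (u x) = fser 1 a (of_real x)"
  shows "u \<in> Hspace \<sigma> s" "fourier_coeff u = a" "Hnorm \<sigma> s u \<le> C * sqrt (Hconst s)"
proof -
  have R: "\<sigma> + 1 > 0" using assms by simp
  show fa: "fourier_coeff u = a" using fourier_coeff_fser[OF R a u] by blast
  have C: "C \<ge> 0" using a cbd_nonneg by blast
  have le: "weighted_sq \<sigma> s u k \<le> C\<^sup>2 * (bracket k powr (2 * s) * exp (- 2 * \<bar>of_int k\<bar>))" for k
  proof -
    have "wt (\<sigma> + 1) k \<le> exp (- (\<sigma> + 1) * \<bar>of_int k\<bar>) / 1"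
      unfolding wt_def by (intro divide_left_mono) (auto intro: add_pos_nonneg)
    then have "C * wt (\<sigma> + 1) k \<le> C * exp (- (\<sigma> + 1) * \<bar>of_int k\<bar>)" using C by (intro mult_left_mono) auto
    then have "cmod (a k) \<le> C * exp (- (\<sigma> + 1) * \<bar>of_int k\<bar>)"
      using a unfolding cbd_def by (meson order_trans)
    then have "(cmod (a k))\<^sup>2 \<le> (C * exp (- (\<sigma> + 1) * \<bar>of_int k\<bar>))\<^sup>2" by (intro power_mono) auto
    also have "\<dots> = C\<^sup>2 * exp (- 2 * (\<sigma> + 1) * \<bar>of_int k\<bar>)"
      by (simp add: power_mult_distrib power2_eq_square exp_add[symmetric])
    finally have "(cmod (a k))\<^sup>2 * (bracket k powr (2 * s) * exp (2 * \<sigma> * \<bar>of_int k\<bar>))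
        \<le> C\<^sup>2 * exp (- 2 * (\<sigma> + 1) * \<bar>of_int k\<bar>) * (bracket k powr (2 * s) * exp (2 * \<sigma> * \<bar>of_int k\<bar>))"
      by (intro mult_right_mono) auto
    also have "\<dots> = C\<^sup>2 * bracket k powr (2 * s) * (exp (- 2 * (\<sigma> + 1) * \<bar>of_int k\<bar>) * exp (2 * \<sigma> * \<bar>of_int k\<bar>))"
      by simp
    also have "exp (- 2 * (\<sigma> + 1) * \<bar>of_int k\<bar>) * exp (2 * \<sigma> * \<bar>of_int k\<bar>) = exp (- 2 * \<bar>of_int k\<bar> :: real)"
      by (simp add: exp_add[symmetric] algebra_simps)
    finally show ?thesis by (simp add: weighted_sq_def fa mult.assoc)
  qed
  have s: "(\<lambda>k::int. C\<^sup>2 * (bracket k powr (2 * s) * exp (- 2 * \<bar>of_int k\<bar>))) summable_on UNIV"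
    by (intro summable_on_cmult_right summable_Hconst)
  have w0: "weighted_sq \<sigma> s u k \<ge> 0" for k by (simp add: weighted_sq_def)
  have ws: "weighted_sq \<sigma> s u summable_on UNIV"
    by (rule Infinite_Sum.summable_on_comparison_test[OF s]) (use le w0 in auto)
  have cb: "cbd (real 1 * (\<sigma> + 1)) C a" using a by simp
  show "u \<in> Hspace \<sigma> s"
    unfolding Hspace_def
  proof (intro CollectI conjI allI ws)
    show "periodic u" unfolding periodic_def
    proof
      fix x
      have "complex_of_real (u (x + 2 * pi)) = of_real (u x)"
        unfolding u using fser_periodic[of 1 a "of_real x"] by simp
      then show "u (x + 2 * pi) = u x" by simp
    qed
    fix x
    show "((\<lambda>k. fourier_coeff u k * cis (of_int k * x)) has_sum complex_of_real (u x)) UNIV"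
      using fser_has_sum[OF cb real_fdom, of x] R by (simp add: u fa fexp_of_real)
  qed
  have "(\<Sum>\<^sub>\<infinity>k. weighted_sq \<sigma> s u k) \<le> C\<^sup>2 * Hconst s"
    unfolding Hconst_def infsum_cmult_right'[symmetric] by (rule infsum_mono[OF ws s le])
  then have "Hnorm \<sigma> s u \<le> sqrt (C\<^sup>2 * Hconst s)" unfolding Hnorm_def by (rule real_sqrt_le_mono)
  then show "Hnorm \<sigma> s u \<le> C * sqrt (Hconst s)" using C by (simp add: real_sqrt_mult)
qed

text \<open>One unit of exponential rate buys the factor \<open>1 / (1 + k^2)\<close>, since
  \<open>1 + x^2 \<le> 2 * exp x\<close> for \<open>x \<ge> 0\<close>.\<close>

lemma exp_le_wt: "exp (- (\<rho> + 1) * \<bar>of_int k\<bar>) \<le> 2 * wt \<rho> k"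
proof -
  have "1 + \<bar>real_of_int k\<bar> + \<bar>real_of_int k\<bar>\<^sup>2 / 2 \<le> exp \<bar>real_of_int k\<bar>"
    by (rule exp_lower_Taylor_quadratic) simp
  then have "1 + (real_of_int k)\<^sup>2 \<le> 2 * exp \<bar>real_of_int k\<bar>" by simp
  moreover have "1 + (real_of_int k)\<^sup>2 > 0" by (rule add_pos_nonneg) auto
  ultimately have "exp (- \<bar>real_of_int k\<bar>) \<le> 2 / (1 + (real_of_int k)\<^sup>2)"
    by (simp add: exp_minus field_simps)
  then have "exp (- \<rho> * \<bar>of_int k\<bar>) * exp (- \<bar>real_of_int k\<bar>) \<le> exp (- \<rho> * \<bar>of_int k\<bar>) * (2 / (1 + (real_of_int k)\<^sup>2))"
    by (intro mult_left_mono) auto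
  then show ?thesis by (simp add: wt_def exp_add[symmetric] algebra_simps)
qed

section \<open>Periodic primitives\<close>

lemma avg_cong_const:
  assumes "continuous_on UNIV f"
  shows "avg (\<lambda>x. f x + c) = avg f + c"
proof -
  have i: "f integrable_on {0..2 * pi}"
    by (intro integrable_continuous_interval continuous_on_subset[OF assms]) auto
  have "integral {0..2 * pi} (\<lambda>x. f x + c) = integral {0..2 * pi} f + 2 * pi * c"
    by (subst integral_add[OF i]) auto
  then show ?thesis by (simp add: avg_def add_divide_distrib)
qed

lemma dinv_eqI:
  assumes F: "\<And>x. (F has_real_derivative f x) (at x)" "periodic F" "avg F = 0"
  shows "dinv f = F"
  unfolding dinv_def
proof (rule the_equality)
  show "(\<forall>x. (F has_real_derivative f x) (at x)) \<and> periodic F \<and> avg F = 0" using F by blast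
  fix G assume G: "(\<forall>x. (G has_real_derivative f x) (at x)) \<and> periodic G \<and> avg G = 0"
  have "((\<lambda>x. G x - F x) has_real_derivative 0) (at x)" for x
    using DERIV_diff[OF G[THEN conjunct1, rule_format, of x] F(1)[of x]] by simp
  then have c: "G x - F x = G 0 - F 0" for x by (metis DERIV_isconst_all)
  then have "G = (\<lambda>x. F x + (G 0 - F 0))" by (metis diff_add_cancel add.commute)
  moreover have "continuous_on UNIV F"
    using F(1) by (intro DERIV_continuous_on[OF has_field_derivative_at_within]) auto
  ultimately have "avg G = avg F + (G 0 - F 0)" using avg_cong_const by metis
  then have "G 0 - F 0 = 0" using G F by simp
  then show "G = F" using c by (intro ext) (metis eq_iff_diff_eq_0)
qed

lemma avg_derivative:
  assumes "\<And>x. (F has_real_derivative f x) (at x)" "periodic F"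
  shows "avg f = 0"
proof -
  have "(f has_integral (F (2 * pi) - F 0)) {0..2 * pi}"
    by (rule fundamental_theorem_of_calculus)
      (use assms(1) in \<open>auto simp: has_real_derivative_iff_has_vector_derivative[symmetric] intro: has_field_derivative_at_within\<close>)
  moreover have "F (2 * pi) = F 0" using assms(2) unfolding periodic_def by (metis add_0)
  ultimately show ?thesis by (simp add: avg_def integral_unique)
qed

lemma avg_fourier_coeff: "continuous_on UNIV u \<Longrightarrow> fourier_coeff u 0 = of_real (avg u)"
proof -
  assume "continuous_on UNIV u"
  then have "u integrable_on {0..2 * pi}"
    by (intro integrable_continuous_interval) (auto intro: continuous_on_subset)
  from has_integral_of_real[OF integrable_integral[OF this], where ?'b=complex]
  show ?thesis by (simp add: fourier_coeff_def avg_def integral_unique)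
qed

text \<open>Integration divides the coefficients by \<open>i * n\<close>, which preserves the bound;
  removing the mode 0 makes both the integrand and the primitive have mean zero.\<close>

lemma dinv_series:
  assumes u: "continuous_on UNIV u" "periodic u" and R: "R > 0" "cbd R C (fourier_coeff u)"
  defines "b \<equiv> \<lambda>n. if n = 0 then 0 else fourier_coeff u n / (\<i> * of_int n)"
  shows "complex_of_real (dinv (proj_perp u) x) = fser 1 b (of_real x)"
    and "cbd R C b"
    and "(dinv (proj_perp u) has_real_derivative u x - avg u) (at x)"
    and "avg (dinv (proj_perp u)) = 0"
proof -
  let ?a = "fourier_coeff u"
  show b: "cbd R C b" unfolding cbd_def
  proof
    fix n
    have a: "cmod (?a n) \<le> C * wt R n" using R by (simp add: cbd_def)
    show "cmod (b n) \<le> C * wt R n"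
    proof (cases "n = 0")
      case True
      then show ?thesis using cbd_nonneg[OF R(2)] by (simp add: b_def)
    next
      case False
      then have "1 \<le> \<bar>real_of_int n\<bar>" by linarith
      then have "cmod (?a n) / \<bar>real_of_int n\<bar> \<le> cmod (?a n) / 1" by (intro divide_left_mono) auto
      moreover have "cmod (b n) = cmod (?a n) / \<bar>real_of_int n\<bar>"
        using False by (simp add: b_def norm_divide norm_mult)
      ultimately show ?thesis using a by simp
    qed
  qed
  then have b': "cbd (real 1 * R) C b" by simp
  have a': "cbd (real 1 * R) C ?a" using R by simp
  define p where "p x = Re (fser 1 b (of_real x))" for x
  have herm: "b (- n) = cnj (b n)" for n
    by (simp add: b_def fourier_coeff_uminus[OF u(1)])
  have p: "complex_of_real (p x) = fser 1 b (of_real x)" for x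
    using fser_hermitian[of b 1 x, OF herm] by (simp add: p_def complex_eq_iff)
  have perp: "periodic p"
    unfolding periodic_def p_def using fser_periodic[of 1 b] by simp
  have d: "(p has_real_derivative u x - avg u) (at x)" for x
  proof -
    have w: "complex_of_real x \<in> strip R" using R by (simp add: strip_def)
    have "fser 1 (\<lambda>n. \<i> * of_real (real 1 * of_int n) * b n) (of_real x)
        = fser 1 (\<lambda>n. ?a n + (if n = 0 then - ?a 0 else 0)) (of_real x)"
      by (rule arg_cong[where f="\<lambda>a. fser 1 a (of_real x)"]) (auto simp: b_def)
    also have "\<dots> = fser 1 ?a (of_real x) - ?a 0"
    proof (subst fser_add)
      show "(\<lambda>n. ?a n * fexp 1 n (of_real x)) summable_on UNIV"
        by (rule fser_summable[OF a' strip_fdom[OF w]])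
      show "(\<lambda>n. (if n = 0 then - ?a 0 else 0) * fexp 1 n (of_real x)) summable_on UNIV"
        by (rule finite_nonzero_values_imp_summable_on) (rule finite_subset[of _ "{0}"], auto)
    qed (simp add: fser_single fexp_def)
    also have "\<dots> = of_real (u x - avg u)"
      using fourier_inversion[OF u R, of x] avg_fourier_coeff[OF u(1)] by simp
    finally have "(fser 1 b has_field_derivative of_real (u x - avg u)) (at (of_real x))"
      using fser_derivative(1)[OF b' open_strip strip_fdom w] by simp
    then have "((\<lambda>x. fser 1 b (of_real x)) has_vector_derivative of_real (u x - avg u)) (at x)"
      by (rule has_vector_derivative_real_field)
    then have "((\<lambda>x. Re (fser 1 b (of_real x))) has_vector_derivative Re (of_real (u x - avg u))) (at x)"
      by (rule bounded_linear.has_vector_derivative[OF bounded_linear_Re])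
    then show ?thesis
      by (simp add: p_def[abs_def] has_real_derivative_iff_has_vector_derivative)
  qed
  have "of_real (avg p) = fourier_coeff p 0"
    by (rule avg_fourier_coeff[symmetric])
      (use d in \<open>auto intro!: DERIV_continuous_on[OF has_field_derivative_at_within]\<close>)
  also have "\<dots> = 0" using fourier_coeff_fser[OF R(1) b p, of 0] by (simp add: b_def)
  finally have avg: "avg p = 0" by simp
  have eq: "dinv (proj_perp u) = p"
    by (rule dinv_eqI) (use d perp avg in \<open>auto simp: proj_perp_def\<close>)
  show "complex_of_real (dinv (proj_perp u) x) = fser 1 b (of_real x)" using p eq by simp
  show "(dinv (proj_perp u) has_real_derivative u x - avg u) (at x)" using d eq by simp
  show "avg (dinv (proj_perp u)) = 0" using avg eq by simp
qed

section \<open>Uniqueness of the velocity potential\<close>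

lemma pdx_DERIV:
  assumes "f differentiable (at (x, y))"
  shows "((\<lambda>t. f (t, y)) has_real_derivative pdx f (x, y)) (at x)"
proof -
  obtain F where F: "(f has_derivative F) (at (x, y))" using assms by (auto simp: differentiable_def)
  have "((\<lambda>t. (t, y)) has_derivative (\<lambda>t. (t, 0))) (at x)"
    by (auto intro!: derivative_eq_intros)
  from has_derivative_compose[OF this F]
  have "(\<lambda>t. f (t, y)) differentiable (at x)" by (auto simp: differentiable_def)
  then show ?thesis by (simp add: pdx_def DERIV_deriv_iff_real_differentiable)
qed

lemma pdy_DERIV:
  assumes "f differentiable (at (x, y))"
  shows "((\<lambda>t. f (x, t)) has_real_derivative pdy f (x, y)) (at y)"
proof -
  obtain F where F: "(f has_derivative F) (at (x, y))" using assms by (auto simp: differentiable_def)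
  have "((\<lambda>t. (x, t)) has_derivative (\<lambda>t. (0, t))) (at y)"
    by (auto intro!: derivative_eq_intros)
  from has_derivative_compose[OF this F]
  have "(\<lambda>t. f (x, t)) differentiable (at y)" by (auto simp: differentiable_def)
  then show ?thesis by (simp add: pdy_def DERIV_deriv_iff_real_differentiable)
qed

text \<open>If \<open>c > 0\<close>, the derivative is positive just to the right of its zero
  \<open>x\<close>, and the mean value theorem gives a larger value there.\<close>

lemma second_derivative_local_max:
  fixes f f' :: "real \<Rightarrow> real"
  assumes d: "d > 0" and f: "\<And>t. \<bar>t - x\<bar> < d \<Longrightarrow> (f has_real_derivative f' t) (at t)"
    and c: "(f' has_real_derivative c) (at x)"
    and max: "\<And>t. \<bar>t - x\<bar> < d \<Longrightarrow> f t \<le> f x"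
  shows "c \<le> 0"
proof (rule ccontr)
  assume "\<not> c \<le> 0"
  then obtain e where e: "e > 0" "\<And>h. 0 < h \<Longrightarrow> h < e \<Longrightarrow> f' x < f' (x + h)"
    using DERIV_pos_inc_right[OF c] by auto
  have "f' x = 0"
    by (rule DERIV_local_max[OF f[of x] d]) (use d max in \<open>auto simp: abs_minus_commute\<close>)
  define h where "h = min d e / 2"
  have h: "0 < h" "h < d" "h < e" using d e by (auto simp: h_def)
  have "\<exists>z>x. z < x + h \<and> f (x + h) - f x = (x + h - x) * f' z"
    using h by (intro MVT2) (auto intro!: f)
  then obtain z where z: "x < z" "z < x + h" "f (x + h) - f x = h * f' z" by auto
  have "f' z > 0" using e(2)[of "z - x"] z h \<open>f' x = 0\<close> by simp
  then have "f (x + h) > f x" using z(3) mult_pos_pos[OF h(1), of "f' z"] by simp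
  then show False using max[of "x + h"] h by simp
qed

lemma open_fluid:
  assumes "continuous_on UNIV \<eta>"
  shows "open (fluid h \<eta>)"
proof -
  have 1: "open {p :: real \<times> real. - h < ereal (snd p)}"
  proof (cases h)
    case (real r)
    have "open {p :: real \<times> real. - r < snd p}" by (intro open_Collect_less continuous_intros)
    then show ?thesis using real by simp
  qed auto
  have "continuous_on UNIV (\<lambda>p::real \<times> real. \<eta> (fst p))"
    by (rule continuous_on_compose2[OF assms]) (auto intro: continuous_intros)
  then have "open {p :: real \<times> real. snd p < \<eta> (fst p)}" by (intro open_Collect_less continuous_intros)
  then have "open ({p. - h < ereal (snd p)} \<inter> {p :: real \<times> real. snd p < \<eta> (fst p)})"
    using 1 by blast
  also have "{p. - h < ereal (snd p)} \<inter> {p :: real \<times> real. snd p < \<eta> (fst p)} = fluid h \<eta>"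
    by (auto simp: fluid_def)
  finally show ?thesis .
qed

lemma differentiable_on_open_at: "f differentiable_on S \<Longrightarrow> open S \<Longrightarrow> p \<in> S \<Longrightarrow> f differentiable (at p)"
  by (metis at_within_open differentiable_on_def)

text \<open>Periodicity is known only at points of the fluid; at fixed height \<open>W\<close> is
  therefore continued by 0 outside it, which yields a periodic function on the line.\<close>

lemma fluid_periodic_int:
  assumes "periodic \<eta>" and per: "\<And>x y. (x, y) \<in> fluid h \<eta> \<Longrightarrow> W (x + 2 * pi, y) = W (x, y)"
    and "(x, y) \<in> fluid h \<eta>"
  shows "(x + 2 * pi * of_int k, y) \<in> fluid h \<eta>" "W (x + 2 * pi * of_int k, y) = (W (x, y) :: real)"
proof -
  have shift: "(t + 2 * pi, y) \<in> fluid h \<eta> \<longleftrightarrow> (t, y) \<in> fluid h \<eta>" for t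
    using assms(1) by (simp add: fluid_def periodic_def)
  show in_fluid: "(x + 2 * pi * of_int k, y) \<in> fluid h \<eta>"
    using assms periodic_plus_int[of \<eta>] by (simp add: fluid_def)
  define w where "w t = (if (t, y) \<in> fluid h \<eta> then W (t, y) else 0)" for t
  have "periodic w" unfolding periodic_def w_def using per shift by auto
  from periodic_plus_int[OF this, of x k] show "W (x + 2 * pi * of_int k, y) = W (x, y)"
    using in_fluid assms(3) by (simp add: w_def)
qed

text \<open>The barrier \<open>\<tau> (y + exp y)\<close> is strictly subharmonic and its slope stays above \<open>\<tau>\<close> down to
  \<open>y = - \<infinity>\<close>, so one maximum principle argument covers finite and infinite depth.\<close>

lemma potential_le:
  assumes P1: "is_potential h \<eta> \<psi> \<Phi>1" and P2: "is_potential h \<eta> \<psi> \<Phi>2"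
    and \<eta>: "continuous_on UNIV \<eta>" "periodic \<eta>" and p0: "(x0, y0) \<in> fluid h \<eta>"
  shows "\<Phi>1 (x0, y0) \<le> \<Phi>2 (x0, y0)"
proof (rule ccontr)
  assume "\<not> \<Phi>1 (x0, y0) \<le> \<Phi>2 (x0, y0)"
  define W where "W p = \<Phi>1 p - \<Phi>2 p" for p
  define a where "a = W (x0, y0)"
  have a: "a > 0" using \<open>\<not> _\<close> by (simp add: a_def W_def)
  let ?S = "fluid h \<eta>"
  note op = open_fluid[OF \<eta>(1), of h]
  have H: "harmonic_on ?S \<Phi>1" "harmonic_on ?S \<Phi>2" using P1 P2 by (auto simp: is_potential_def)
  have diff: "\<Phi>i differentiable (at p)" "pdx \<Phi>i differentiable (at p)" "pdy \<Phi>i differentiable (at p)"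
    if "harmonic_on ?S \<Phi>i" "p \<in> ?S" for \<Phi>i p
    using that differentiable_on_open_at[OF _ op] unfolding harmonic_on_def C1_on_def by blast+
  have Wx: "((\<lambda>t. W (t, y)) has_real_derivative pdx \<Phi>1 (x, y) - pdx \<Phi>2 (x, y)) (at x)"
    and Wy: "((\<lambda>t. W (x, t)) has_real_derivative pdy \<Phi>1 (x, y) - pdy \<Phi>2 (x, y)) (at y)"
    and Wxx: "((\<lambda>t. pdx \<Phi>1 (t, y) - pdx \<Phi>2 (t, y)) has_real_derivative
         pdx (pdx \<Phi>1) (x, y) - pdx (pdx \<Phi>2) (x, y)) (at x)"
    and Wyy: "((\<lambda>t. pdy \<Phi>1 (x, t) - pdy \<Phi>2 (x, t)) has_real_derivative
         pdy (pdy \<Phi>1) (x, y) - pdy (pdy \<Phi>2) (x, y)) (at y)"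
    if "(x, y) \<in> ?S" for x y
    unfolding W_def
    by (rule DERIV_diff[OF pdx_DERIV[OF diff(1)[OF H(1) that]] pdx_DERIV[OF diff(1)[OF H(2) that]]]
        DERIV_diff[OF pdy_DERIV[OF diff(1)[OF H(1) that]] pdy_DERIV[OF diff(1)[OF H(2) that]]]
        DERIV_diff[OF pdx_DERIV[OF diff(2)[OF H(1) that]] pdx_DERIV[OF diff(2)[OF H(2) that]]]
        DERIV_diff[OF pdy_DERIV[OF diff(3)[OF H(1) that]] pdy_DERIV[OF diff(3)[OF H(2) that]]])+
  have Wper: "W (x + 2 * pi, y) = W (x, y)" if "(x, y) \<in> ?S" for x y
  proof -
    have *: "\<Phi>i (x + 2 * pi, y) = \<Phi>i (x, y)" if "is_potential h \<eta> \<psi> \<Phi>i" for \<Phi>i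
      using that \<open>(x, y) \<in> ?S\<close> by (auto simp: is_potential_def)
    show ?thesis unfolding W_def *[OF P1] *[OF P2] ..
  qed
  have "compact (\<eta> ` {0..2 * pi})"
    by (rule compact_continuous_image[OF continuous_on_subset[OF \<eta>(1)] compact_Icc]) auto
  then have "bounded (\<eta> ` {0..2 * pi})" by (rule compact_imp_bounded)
  then obtain B where "\<forall>y\<in>\<eta> ` {0..2 * pi}. norm y \<le> B" by (auto simp: bounded_iff)
  then have "\<bar>\<eta> x\<bar> \<le> B" if "x \<in> {0..2 * pi}" for x using that by simp
  then have B: "\<bar>\<eta> x\<bar> \<le> B" for x by (rule periodic_ext_bound[OF \<eta>(2), where P="\<lambda>y. \<bar>y\<bar> \<le> B"])
  define \<phi> where "\<phi> y = y + exp y" for y :: real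
  have \<phi>_mono: "\<phi> y \<le> \<phi> y'" if "y \<le> y'" for y y' using that by (simp add: \<phi>_def add_mono)
  \<comment> \<open>With \<open>\<tau> = a / N\<close> the barrier varies by less than
    \<open>a\<close> between the height \<open>y0\<close> and the top \<open>B\<close>, so the
    maximum of \<open>V\<close> cannot be attained at the surface.\<close>
  define N where "N = 2 * (\<bar>\<phi> B - \<phi> y0\<bar> + 1)"
  have N: "N > 0" "\<bar>\<phi> B - \<phi> y0\<bar> < N"
  proof -
    have "2 * (x + 1) > 0 \<and> x < 2 * (x + 1)" if "x \<ge> 0" for x :: real using that by simp
    from this[OF abs_ge_zero] show "N > 0" "\<bar>\<phi> B - \<phi> y0\<bar> < N" unfolding N_def by blast+
  qed
  define \<tau> where "\<tau> = a / N"
  have \<tau>: "\<tau> > 0" using a N by (simp add: \<tau>_def)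
  have "\<tau> * (\<phi> B - \<phi> y0) \<le> \<tau> * \<bar>\<phi> B - \<phi> y0\<bar>" using \<tau> by (intro mult_left_mono) auto
  also have "\<dots> < \<tau> * N" using \<tau> N by (intro mult_strict_left_mono)
  also have "\<dots> = a" using N by (simp add: \<tau>_def)
  finally have \<tau>a: "\<tau> * \<phi> B < a + \<tau> * \<phi> y0" by (simp add: right_diff_distrib)
  define V where "V p = W p + \<tau> * \<phi> (snd p)" for p
  obtain x1 where x1: "x1 \<in> {0..2 * pi}" "\<And>x. x \<in> {0..2 * pi} \<Longrightarrow> \<eta> x1 \<le> \<eta> x"
    using continuous_attains_inf[of "{0..2 * pi}" \<eta>] continuous_on_subset[OF \<eta>(1)] by auto
  have x1': "\<eta> x1 \<le> \<eta> x" for x by (rule periodic_ext_bound[OF \<eta>(2), where P="\<lambda>y. \<eta> x1 \<le> y"]) (use x1 in auto)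
  have hx1: "- h < ereal (\<eta> x1)" using P1 by (simp add: is_potential_def)
  have ul: "\<forall>\<^sub>F y in at_right (- h). \<forall>x. \<bar>pdy \<Phi>i (x, real_of_ereal y)\<bar> < \<tau> / 4" if "is_potential h \<eta> \<psi> \<Phi>i" for \<Phi>i
  proof -
    have "uniform_limit UNIV (\<lambda>y x. pdy \<Phi>i (x, real_of_ereal y)) (\<lambda>_. 0) (at_right (- h))"
      using that by (simp add: is_potential_def)
    from uniform_limitD[OF this, of "\<tau> / 4"] show ?thesis using \<tau> by simp
  qed
  have "\<forall>\<^sub>F y in at_right (- h). \<forall>x. \<bar>pdy \<Phi>1 (x, real_of_ereal y) - pdy \<Phi>2 (x, real_of_ereal y)\<bar> < \<tau> / 2"
    using ul[OF P1] ul[OF P2]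
  proof eventually_elim
    case (elim y)
    show ?case
    proof
      fix x
      show "\<bar>pdy \<Phi>1 (x, real_of_ereal y) - pdy \<Phi>2 (x, real_of_ereal y)\<bar> < \<tau> / 2"
        using elim(1)[rule_format, of x] elim(2)[rule_format, of x] by linarith
    qed
  qed
  then obtain b where b: "b > - h" "\<And>y x. - h < y \<Longrightarrow> y < b \<Longrightarrow>
      \<bar>pdy \<Phi>1 (x, real_of_ereal y) - pdy \<Phi>2 (x, real_of_ereal y)\<bar> < \<tau> / 2"
    unfolding eventually_at_right[OF hx1] by auto
  have "- h < min b (min (ereal (\<eta> x1)) (ereal y0))" using b(1) hx1 p0 by (auto simp: fluid_def)
  then obtain y1 where y1: "- h < ereal y1" "ereal y1 < min b (min (ereal (\<eta> x1)) (ereal y0))"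
    using ereal_dense2 by blast
  then have y1': "ereal y1 < b" "y1 < \<eta> x1" "y1 < y0" by auto
  \<comment> \<open>One period of the fluid, cut off at a height \<open>y1\<close> at which the
    vertical velocities already differ by less than \<open>\<tau> / 2\<close>; this set is
    compact.\<close>
  define K where "K = {p. fst p \<in> {0..2 * pi} \<and> y1 \<le> snd p \<and> snd p \<le> \<eta> (fst p)}"
  have KS: "K \<subseteq> fluid_surf h \<eta>"
  proof
    fix p assume "p \<in> K"
    then have "ereal y1 \<le> ereal (snd p)" "snd p \<le> \<eta> (fst p)" by (auto simp: K_def)
    then show "p \<in> fluid_surf h \<eta>" using y1(1) by (cases p) (auto simp: fluid_surf_def intro: less_le_trans)
  qed
  have cK: "compact K"
  proof -
    have c: "continuous_on UNIV (\<lambda>p::real \<times> real. \<eta> (fst p))"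
      by (rule continuous_on_compose2[OF \<eta>(1)]) (auto intro: continuous_intros)
    have "closed {p::real \<times> real. y1 \<le> snd p}" "closed {p::real \<times> real. snd p \<le> \<eta> (fst p)}"
      by (intro closed_Collect_le continuous_intros c)+
    then have cl: "closed ({p::real \<times> real. y1 \<le> snd p} \<inter> {p. snd p \<le> \<eta> (fst p)})" by blast
    have "compact ({0..2 * pi} \<times> {y1..B})" by (intro compact_Times compact_Icc)
    from compact_Int_closed[OF this cl]
    have "compact (({0..2 * pi} \<times> {y1..B}) \<inter> ({p::real \<times> real. y1 \<le> snd p} \<inter> {p. snd p \<le> \<eta> (fst p)}))" .
    also have "({0..2 * pi} \<times> {y1..B}) \<inter> ({p::real \<times> real. y1 \<le> snd p} \<inter> {p. snd p \<le> \<eta> (fst p)}) = K"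
      using order_trans[OF _ abs_le_D1[OF B]] by (auto simp: K_def)
    finally show ?thesis .
  qed
  have cV: "continuous_on K V"
    unfolding V_def W_def \<phi>_def
    by (intro continuous_intros continuous_on_subset[OF _ KS]) (use P1 P2 in \<open>auto simp: is_potential_def\<close>)
  have "(x1, \<eta> x1) \<in> K" using y1' x1 by (simp add: K_def)
  then have K_ne: "K \<noteq> {}" by blast
  obtain p where p: "p \<in> K" "\<And>p'. p' \<in> K \<Longrightarrow> V p' \<le> V p"
    using continuous_attains_sup[OF cK K_ne cV] by auto
  obtain xm ym where pm: "p = (xm, ym)" by fastforce
  \<comment> \<open>By periodicity the maximum over one period is a maximum over the whole truncated
    fluid, so a maximum point on a lateral side is no special case.\<close>
  have Vred: "V (x, y) \<le> V p" if "(x, y) \<in> ?S" "y1 \<le> y" for x y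
  proof -
    obtain k :: int where k: "x - 2 * pi * of_int k \<in> {0..2 * pi}" by (rule periodic_reduce)
    note F = fluid_periodic_int[OF \<eta>(2) Wper that(1), of "- k"]
    have "(x + 2 * pi * of_int (- k), y) \<in> K" using F(1) k that by (simp add: K_def fluid_def)
    from p(2)[OF this] show ?thesis using F(2) by (simp add: V_def)
  qed
  have "V p \<ge> a + \<tau> * \<phi> y0" using Vred[OF p0] y1' by (simp add: V_def a_def)
  then have Vp: "V p > \<tau> * \<phi> B" using \<tau>a by linarith
  have "ym \<noteq> \<eta> xm"
  proof
    assume e: "ym = \<eta> xm"
    have "W (xm, \<eta> xm) = 0" using P1 P2 by (simp add: is_potential_def W_def)
    then have "V p = \<tau> * \<phi> (\<eta> xm)" by (simp add: V_def pm e)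
    also have "\<dots> \<le> \<tau> * \<phi> B" using \<tau> B[of xm] by (intro mult_left_mono \<phi>_mono) auto
    finally show False using Vp by simp
  qed
  then have ym: "y1 \<le> ym" "ym < \<eta> xm" using p(1) by (auto simp: K_def pm)
  have pS: "(xm, ym) \<in> ?S"
  proof -
    have "ereal y1 \<le> ereal ym" using ym by simp
    then show ?thesis using y1(1) ym by (auto simp: fluid_def intro: less_le_trans)
  qed
  have Vy: "((\<lambda>t. V (x, t)) has_real_derivative (pdy \<Phi>1 (x, y) - pdy \<Phi>2 (x, y)) + \<tau> * (1 + exp y)) (at y)"
    if "(x, y) \<in> ?S" for x y
    unfolding V_def \<phi>_def snd_conv by (auto intro!: derivative_eq_intros Wy[OF that])
  have Vx: "((\<lambda>t. V (t, y)) has_real_derivative (pdx \<Phi>1 (x, y) - pdx \<Phi>2 (x, y))) (at x)"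
    if "(x, y) \<in> ?S" for x y
    unfolding V_def \<phi>_def snd_conv by (auto intro!: derivative_eq_intros Wx[OF that])
  obtain d0 where d0: "d0 > 0" "ball (xm, ym) d0 \<subseteq> ?S" using op pS open_contains_ball by blast
  have inS: "(t, ym) \<in> ?S" if "\<bar>t - xm\<bar> < d0" for t
    using that d0(2) by (auto simp: subset_iff dist_Pair_Pair dist_real_def abs_minus_commute)
  have inS': "(xm, t) \<in> ?S" if "\<bar>t - ym\<bar> < d0" for t
    using that d0(2) by (auto simp: subset_iff dist_Pair_Pair dist_real_def abs_minus_commute)
  show False
  proof (cases "ym = y1")
    case True
    \<comment> \<open>At the cut-off the slope of \<open>V\<close> exceeds
      \<open>\<tau> - \<tau> / 2\<close>, so \<open>V\<close> increases into the fluid.\<close>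
    have "\<bar>pdy \<Phi>1 (xm, ym) - pdy \<Phi>2 (xm, ym)\<bar> < \<tau> / 2"
      using b(2)[of "ereal ym" xm] y1(1) y1' True by simp
    moreover have "\<tau> * (1 + exp ym) > \<tau> * 1" using \<tau> by (intro mult_strict_left_mono) auto
    ultimately have "(pdy \<Phi>1 (xm, ym) - pdy \<Phi>2 (xm, ym)) + \<tau> * (1 + exp ym) > 0" using \<tau> by linarith
    from DERIV_pos_inc_right[OF Vy[OF pS] this]
    obtain e where e: "e > 0" "\<And>t. 0 < t \<Longrightarrow> t < e \<Longrightarrow> V (xm, ym) < V (xm, ym + t)" by auto
    define t where "t = min e d0 / 2"
    have t: "0 < t" "t < e" "t < d0" using e d0 by (auto simp: t_def)
    have "V (xm, ym + t) \<le> V p" using t ym by (intro Vred inS') auto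
    then show False using e(2)[OF t(1,2)] by (simp add: pm)
  next
    case False
    \<comment> \<open>An interior maximum contradicts strict subharmonicity: the two second
      derivatives of \<open>V\<close> add up to \<open>\<tau> * exp ym > 0\<close>.\<close>
    define d where "d = min d0 (ym - y1)"
    have d: "d > 0" "d \<le> d0" "d \<le> ym - y1" using False ym d0 by (auto simp: d_def)
    have xx: "pdx (pdx \<Phi>1) (xm, ym) - pdx (pdx \<Phi>2) (xm, ym) \<le> 0"
    proof (rule second_derivative_local_max[OF d(1) _ Wxx[OF pS]])
      fix t assume t: "\<bar>t - xm\<bar> < d"
      show "((\<lambda>t. V (t, ym)) has_real_derivative (pdx \<Phi>1 (t, ym) - pdx \<Phi>2 (t, ym))) (at t)"
        by (rule Vx[OF inS]) (use t d in auto)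
      show "V (t, ym) \<le> V (xm, ym)" using Vred[OF inS, of t] t d ym by (simp add: pm)
    qed
    have "((\<lambda>t. \<tau> * (1 + exp t)) has_real_derivative \<tau> * exp ym) (at ym)"
      by (auto intro!: derivative_eq_intros)
    from DERIV_add[OF Wyy[OF pS] this]
    have yy: "(pdy (pdy \<Phi>1) (xm, ym) - pdy (pdy \<Phi>2) (xm, ym)) + \<tau> * exp ym \<le> 0"
    proof (rule second_derivative_local_max[OF d(1), rotated])
      fix t assume t: "\<bar>t - ym\<bar> < d"
      show "((\<lambda>t. V (xm, t)) has_real_derivative (pdy \<Phi>1 (xm, t) - pdy \<Phi>2 (xm, t)) + \<tau> * (1 + exp t)) (at t)"
        by (rule Vy[OF inS']) (use t d in auto)
      have "V (xm, t) \<le> V p" by (rule Vred[OF inS']) (use t d in auto)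
      then show "V (xm, t) \<le> V (xm, ym)" by (simp add: pm)
    qed
    have "pdx (pdx \<Phi>1) (xm, ym) + pdy (pdy \<Phi>1) (xm, ym) = 0" "pdx (pdx \<Phi>2) (xm, ym) + pdy (pdy \<Phi>2) (xm, ym) = 0"
      using H pS by (auto simp: harmonic_on_def)
    moreover have "\<tau> * exp ym > 0" using \<tau> by simp
    ultimately show False using xx yy by linarith
  qed
qed

lemma potential_unique:
  assumes "is_potential h \<eta> \<psi> \<Phi>1" "is_potential h \<eta> \<psi> \<Phi>2"
    and "continuous_on UNIV \<eta>" "periodic \<eta>" and "p \<in> fluid h \<eta>"
  shows "\<Phi>1 p = \<Phi>2 p"
  using potential_le[OF assms(1,2,3,4), of "fst p" "snd p"]
    potential_le[OF assms(2,1,3,4), of "fst p" "snd p"] assms(5) by simp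

lemma pd_cong:
  assumes "open S" "p \<in> S" "\<And>p. p \<in> S \<Longrightarrow> f p = f' p"
  shows "pdx f p = pdx f' p" "pdy f p = pdy f' p"
proof -
  obtain x y where p: "p = (x, y)" by fastforce
  have o: "open ((\<lambda>t. (t, y)) -` S)" "open ((\<lambda>t. (x, t)) -` S)"
    by (intro open_vimage assms continuous_intros)+
  have "x \<in> (\<lambda>t. (t, y)) -` S" "y \<in> (\<lambda>t. (x, t)) -` S" using assms(2) p by auto
  then have "\<forall>\<^sub>F t in nhds x. t \<in> (\<lambda>t. (t, y)) -` S" "\<forall>\<^sub>F t in nhds y. t \<in> (\<lambda>t. (x, t)) -` S"
    using o eventually_nhds_in_open by blast+
  then have "\<forall>\<^sub>F t in nhds x. f (t, y) = f' (t, y)" "\<forall>\<^sub>F t in nhds y. f (x, t) = f' (x, t)"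
    using assms(3) by (auto elim!: eventually_mono)
  then show "pdx f p = pdx f' p" "pdy f p = pdy f' p"
    unfolding p pdx_def pdy_def by (auto intro!: deriv_cong_ev)
qed

text \<open>Makes limits from inside the fluid unique, as the definite description in
  \<open>dirichlet_neumann\<close> requires.\<close>

lemma surface_limit_point:
  assumes "- h < ereal (\<eta> x)"
  shows "\<not> trivial_limit (at (x, \<eta> x) within fluid h \<eta>)"
proof -
  obtain y0 where y0: "- h < ereal y0" "ereal y0 < ereal (\<eta> x)" using ereal_dense2[OF assms] by blast
  have "(x, \<eta> x) islimpt fluid h \<eta>"
    unfolding islimpt_approachable
  proof (intro allI impI)
    fix e :: real assume e: "e > 0"
    define y where "y = max y0 (\<eta> x - e / 2)"
    have y: "y < \<eta> x" "\<eta> x - y < e" using y0 e by (auto simp: y_def)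
    have "ereal y0 \<le> ereal y" by (simp add: y_def)
    then have "- h < ereal y" using y0(1) by (rule less_le_trans[rotated])
    then have "(x, y) \<in> fluid h \<eta>" using y by (simp add: fluid_def)
    moreover have "dist (x, y) (x, \<eta> x) < e" using y by (simp add: dist_Pair_Pair dist_real_def)
    ultimately show "\<exists>x'\<in>fluid h \<eta>. x' \<noteq> (x, \<eta> x) \<and> dist x' (x, \<eta> x) < e"
      using y by (intro bexI[of _ "(x, y)"]) auto
  qed
  then show ?thesis by (simp add: trivial_limit_within)
qed

text \<open>Two potentials coincide in the open fluid, hence so do their gradients there and the
  limits at the surface.\<close>

lemma dirichlet_neumann_eqI:
  assumes P: "is_potential h \<eta> \<psi> \<Phi>" and \<eta>: "continuous_on UNIV \<eta>" "periodic \<eta>"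
    and lim: "\<And>x. ((\<lambda>p. pdy \<Phi> p - pdx \<Phi> p * deriv \<eta> (fst p)) \<longlongrightarrow> f x) (at (x, \<eta> x) within fluid h \<eta>)"
  shows "dirichlet_neumann h \<eta> \<psi> = f"
  unfolding dirichlet_neumann_def
proof (rule the_equality)
  show "\<exists>\<Phi>. is_potential h \<eta> \<psi> \<Phi> \<and>
     (\<forall>x. ((\<lambda>p. pdy \<Phi> p - pdx \<Phi> p * deriv \<eta> (fst p)) \<longlongrightarrow> f x) (at (x, \<eta> x) within fluid h \<eta>))"
    using P lim by blast
  fix f' assume "\<exists>\<Phi>. is_potential h \<eta> \<psi> \<Phi> \<and>
     (\<forall>x. ((\<lambda>p. pdy \<Phi> p - pdx \<Phi> p * deriv \<eta> (fst p)) \<longlongrightarrow> f' x) (at (x, \<eta> x) within fluid h \<eta>))"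
  then obtain \<Phi>' where P': "is_potential h \<eta> \<psi> \<Phi>'"
    and lim': "\<And>x. ((\<lambda>p. pdy \<Phi>' p - pdx \<Phi>' p * deriv \<eta> (fst p)) \<longlongrightarrow> f' x) (at (x, \<eta> x) within fluid h \<eta>)"
    by blast
  show "f' = f"
  proof
    fix x
    have eq: "\<Phi> p = \<Phi>' p" if "p \<in> fluid h \<eta>" for p
      by (rule potential_unique[OF P P' \<eta> that])
    have "pdy \<Phi> p - pdx \<Phi> p * deriv \<eta> (fst p) = pdy \<Phi>' p - pdx \<Phi>' p * deriv \<eta> (fst p)"
      if "p \<in> fluid h \<eta>" for p
      using pd_cong[OF open_fluid[OF \<eta>(1)] that eq] by simp
    then have "\<forall>\<^sub>F p in at (x, \<eta> x) within fluid h \<eta>.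
        pdy \<Phi> p - pdx \<Phi> p * deriv \<eta> (fst p) = pdy \<Phi>' p - pdx \<Phi>' p * deriv \<eta> (fst p)"
      by (auto simp: eventually_at_filter)
    from Lim_transform_eventually[OF lim this]
    have "((\<lambda>p. pdy \<Phi>' p - pdx \<Phi>' p * deriv \<eta> (fst p)) \<longlongrightarrow> f x) (at (x, \<eta> x) within fluid h \<eta>)" .
    moreover have "- h < ereal (\<eta> x)" using P by (simp add: is_potential_def)
    ultimately show "f' x = f x"
      using tendsto_unique[OF surface_limit_point lim'] by blast
  qed
qed

section \<open>Harmonic functions from holomorphic functions\<close>

definition zc :: "real \<times> real \<Rightarrow> complex" where "zc p = Complex (fst p) (snd p)"

lemma zc_has_derivative: "(zc has_derivative zc) (at p)"
proof -
  have "bounded_linear zc"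
    by (rule bounded_linear_intro[where K=1]) (auto simp: zc_def complex_eq_iff cmod_def norm_prod_def)
  then show ?thesis by (rule bounded_linear_imp_has_derivative)
qed

lemma continuous_zc: "continuous_on A zc"
  unfolding zc_def Complex_eq by (intro continuous_intros)

text \<open>\<open>u\<close> need only agree with the real part on \<open>A\<close>, so that the
  lemma can be applied again to \<open>pdx u\<close> and \<open>pdy u\<close>, which are known there
  alone.\<close>

lemma Re_holomorphic_C1:
  assumes S: "open S" and f: "f holomorphic_on S" and A: "open A" "zc ` A \<subseteq> S"
    and u: "\<forall>p\<in>A. u p = Re (f (zc p))"
  shows "C1_on A u" and "\<forall>p\<in>A. pdx u p = Re (deriv f (zc p))" and "\<forall>p\<in>A. pdy u p = Re (\<i> * deriv f (zc p))"
proof -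
  define v where "v p = Re (f (zc p))" for p
  have uv: "u p = v p" if "p \<in> A" for p using u that by (simp add: v_def)
  have dv: "(v has_derivative (\<lambda>q. Re (deriv f (zc p) * zc q))) (at p)" if "p \<in> A" for p
  proof -
    have "zc p \<in> S" using A that by blast
    then have "(f has_derivative (\<lambda>h. deriv f (zc p) * h)) (at (zc p))"
      using holomorphic_derivI[OF f S] by (simp add: has_field_derivative_def)
    from has_derivative_compose[OF zc_has_derivative this]
    have "((\<lambda>q. f (zc q)) has_derivative (\<lambda>q. deriv f (zc p) * zc q)) (at p)" .
    from has_derivative_Re[OF this] show ?thesis unfolding v_def .
  qed
  have vx: "pdx v p = Re (deriv f (zc p))" and vy: "pdy v p = Re (\<i> * deriv f (zc p))" if pA: "p \<in> A" for p
  proof -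
    obtain x y where p: "p = (x, y)" by fastforce
    have "((\<lambda>t. (t, y)) has_derivative (\<lambda>t. (t, 0))) (at x)" by (auto intro!: derivative_eq_intros)
    from has_derivative_compose[OF this dv[OF pA, unfolded p]]
    have "((\<lambda>t. v (t, y)) has_derivative (*) (Re (deriv f (zc (x, y))))) (at x)"
      by (rule has_derivative_eq_rhs) (auto simp: zc_def)
    then show "pdx v p = Re (deriv f (zc p))"
      unfolding p by (simp only: pdx_def prod.case DERIV_imp_deriv has_field_derivative_def)
    have "((\<lambda>t. (x, t)) has_derivative (\<lambda>t. (0, t))) (at y)" by (auto intro!: derivative_eq_intros)
    from has_derivative_compose[OF this dv[OF pA, unfolded p]]
    have "((\<lambda>t. v (x, t)) has_derivative (*) (Re (\<i> * deriv f (zc (x, y))))) (at y)"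
      by (rule has_derivative_eq_rhs) (auto simp: zc_def)
    then show "pdy v p = Re (\<i> * deriv f (zc p))"
      unfolding p by (simp only: pdy_def prod.case DERIV_imp_deriv has_field_derivative_def)
  qed
  show ux: "\<forall>p\<in>A. pdx u p = Re (deriv f (zc p))" and uy: "\<forall>p\<in>A. pdy u p = Re (\<i> * deriv f (zc p))"
    using pd_cong[OF A(1) _ uv] vx vy by simp_all
  have cont: "continuous_on A (\<lambda>p. deriv f (zc p))"
  proof (rule continuous_on_compose2[where g="deriv f" and f=zc])
    show "continuous_on S (deriv f)"
      by (intro holomorphic_on_imp_continuous_on holomorphic_deriv f S)
  qed (use A continuous_zc in auto)
  have "(u has_derivative (\<lambda>q. Re (deriv f (zc p) * zc q))) (at p)" if "p \<in> A" for p
    by (rule has_derivative_transform_within_open[OF dv[OF that] A(1) that]) (simp add: uv)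
  then have "u differentiable_on A"
    unfolding differentiable_on_def differentiable_def using has_derivative_at_withinI by blast
  moreover have "continuous_on A (\<lambda>p. Re (deriv f (zc p)))" "continuous_on A (\<lambda>p. Re (\<i> * deriv f (zc p)))"
    by (intro continuous_intros cont)+
  then have "continuous_on A (pdx u)" "continuous_on A (pdy u)"
    using ux uy by (auto elim!: continuous_on_eq)
  ultimately show "C1_on A u" by (simp add: C1_on_def)
qed

text \<open>Apply the previous lemma to \<open>f\<close>, to its derivative and to i times its
  derivative; the two second derivatives cancel because the square of i is -1.\<close>

lemma Re_holomorphic_harmonic:
  assumes S: "open S" and f: "f holomorphic_on S" and A: "open A" "zc ` A \<subseteq> S"
    and u: "\<forall>p\<in>A. u p = Re (f (zc p))"
  shows "harmonic_on A u"
proof -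
  note 1 = Re_holomorphic_C1[OF S f A u]
  have f': "deriv f holomorphic_on S" by (rule holomorphic_deriv[OF f S])
  have if': "(\<lambda>z. \<i> * deriv f z) holomorphic_on S" by (intro holomorphic_intros f')
  note 2 = Re_holomorphic_C1[OF S f' A 1(2)]
  note 3 = Re_holomorphic_C1[OF S if' A 1(3)]
  have "deriv (\<lambda>z. \<i> * deriv f z) z = \<i> * deriv (deriv f) z" if "z \<in> S" for z
    using holomorphic_on_imp_differentiable_at[OF f' S that] by (rule deriv_cmult)
  then have "pdx (pdx u) p + pdy (pdy u) p = 0" if "p \<in> A" for p
    using 2(2) 3(3) A(2) that by (auto simp: image_subset_iff)
  then show ?thesis using 1(1) 2(1) 3(1) by (auto simp: harmonic_on_def)
qed

section \<open>From conformal to physical variables\<close>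

abbreviation fs :: "nat \<Rightarrow> (int \<Rightarrow> real) \<Rightarrow> complex \<Rightarrow> complex" where
  "fs K f \<equiv> fser K (\<lambda>n. of_real (f n))"

text \<open>By \<open>x \<le> exp x\<close>, a derivative costs \<open>real K\<close> of the
  exponential rate.\<close>

lemma bd_times_frequency:
  assumes "bd (\<rho> + real K) C f"
  shows "bd \<rho> C (\<lambda>n. real K * of_int n * f n)"
  unfolding bd_def
proof
  fix n
  let ?x = "real K * \<bar>of_int n\<bar>"
  have "?x \<le> exp ?x" using exp_ge_add_one_self[of ?x] by linarith
  then have "\<bar>real K * of_int n * f n\<bar> \<le> exp ?x * (C * wt (\<rho> + real K) n)"
    unfolding abs_mult by (intro mult_mono) (use bdD[OF assms, of n] in \<open>auto\<close>)
  also have "exp ?x * (C * wt (\<rho> + real K) n) = C * ((exp ?x * exp (- (\<rho> + real K) * \<bar>of_int n\<bar>)) / (1 + (of_int n)\<^sup>2))"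
    by (simp add: wt_def)
  also have "exp ?x * exp (- (\<rho> + real K) * \<bar>of_int n\<bar>) = exp (- \<rho> * \<bar>of_int n\<bar>)"
    by (simp add: exp_add[symmetric] algebra_simps)
  finally show "\<bar>real K * of_int n * f n\<bar> \<le> C * wt \<rho> n" by (simp add: wt_def)
qed

lemma bd_weaken:
  assumes "bd \<rho> C f" "\<rho>' \<le> \<rho>"
  shows "bd \<rho>' C f"
  unfolding bd_def
proof
  fix n
  have "wt \<rho> n \<le> wt \<rho>' n"
    unfolding wt_def using assms(2) by (intro divide_right_mono) (auto intro: mult_right_mono)
  then have "C * wt \<rho> n \<le> C * wt \<rho>' n" using bd_nonneg[OF assms(1)] by (intro mult_left_mono)
  then show "\<bar>f n\<bar> \<le> C * wt \<rho>' n" using bdD[OF assms(1), of n] by linarith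
qed

lemma real_bijection:
  fixes X X' :: "real \<Rightarrow> real"
  assumes X: "\<And>x. (X has_real_derivative X' x) (at x)" and X': "\<And>x. X' x \<ge> 1 / 2"
    and near: "\<And>x. \<bar>X x - x\<bar> \<le> B"
  obtains A where "\<And>x. X (A x) = x" "\<And>a. A (X a) = a" "\<And>x. (A has_real_derivative 1 / X' (A x)) (at x)"
proof -
  have cont: "continuous_on S X" for S
    using X by (intro DERIV_continuous_on[OF has_field_derivative_at_within]) auto
  have lip: "b - a \<le> 2 * (X b - X a)" if ab: "a < b" for a b
  proof -
    obtain z where "X b - X a = (b - a) * X' z"
      using MVT2[where f=X and f'=X', OF ab X] by blast
    moreover have "(b - a) * X' z \<ge> (b - a) * (1 / 2)" using X'[of z] ab by (intro mult_left_mono) auto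
    ultimately show ?thesis by simp
  qed
  have ex: "\<exists>a. X a = x" for x
  proof -
    have "X (x - \<bar>B\<bar> - 1) \<le> x" "x \<le> X (x + \<bar>B\<bar> + 1)"
      using near[of "x - \<bar>B\<bar> - 1"] near[of "x + \<bar>B\<bar> + 1"] by linarith+
    then show ?thesis using IVT'[of X "x - \<bar>B\<bar> - 1" x "x + \<bar>B\<bar> + 1"] cont by auto
  qed
  define A where "A x = (SOME a. X a = x)" for x
  have XA: "X (A x) = x" for x unfolding A_def using ex by (rule someI_ex)
  have lipA: "\<bar>A x - A y\<bar> \<le> 2 * \<bar>x - y\<bar>" for x y
    using lip[of "A x" "A y"] lip[of "A y" "A x"] XA by (cases "A x" "A y" rule: linorder_cases) auto
  have AX: "A (X a) = a" for a
    using lip[of "A (X a)" a] lip[of a "A (X a)"] XA[of "X a"] by (cases "A (X a)" a rule: linorder_cases) auto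
  have contA: "isCont A x" for x
    unfolding continuous_at_eps_delta
  proof (intro allI impI)
    fix e :: real assume "e > 0"
    show "\<exists>d>0. \<forall>x'. dist x' x < d \<longrightarrow> dist (A x') (A x) < e"
    proof (intro exI[of _ "e / 2"] conjI allI impI)
      fix x' assume "dist x' x < e / 2"
      then show "dist (A x') (A x) < e" using lipA[of x' x] by (simp add: dist_real_def)
    qed (use \<open>e > 0\<close> in simp)
  qed
  have "(A has_real_derivative 1 / X' (A x)) (at x)" for x
  proof -
    have "(A has_real_derivative inverse (X' (A x))) (at x)"
      by (rule DERIV_inverse_function[OF X, of _ _ "x - 1" "x + 1"])
        (use X'[of "A x"] XA contA in auto)
    then show ?thesis by (simp add: inverse_eq_divide)
  qed
  then show thesis using that XA AX by blast
qed

text \<open>Two derivatives lower the rate \<open>real K * (R + 3)\<close> and still leave it above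
  the rate \<open>real K * R\<close> needed for convergence on the strip. \<open>R\<close> is large
  enough for the domain to contain the bottom line and the unit discs around points of the fluid,
  and for a contour shift by \<open>\<sigma> + 3\<close>. The condition \<open>small\<close> makes
  \<open>Z\<close> a perturbation of the identity with Lipschitz constant 1/4.\<close>

locale conformal_wave =
  fixes g \<kappa> \<gamma> c \<sigma> N Cq R :: real and h :: ereal and K :: nat and Y :: "int \<Rightarrow> real"
  assumes h: "h > 0" and K: "K \<ge> 1" and \<sigma>: "\<sigma> > 0"
    and R: "R \<ge> 2 * real_of_ereal h + \<sigma> + 5"
    and Y_even: "\<And>n. Y (- n) = Y n"
    and Y_bd: "bd (real K * (R + 3)) N Y"
    and H_pos: "h \<noteq> \<infinity> \<Longrightarrow> real_of_ereal h + Y 0 > 0"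
    and Cq: "\<And>n. \<bar>qsym h K (real_of_ereal h + Y 0) n\<bar> \<le> Cq"
    and N1: "N \<le> 1" and small: "(1 + Cq) * N * wt_sum \<le> 1 / 4"
    and bern: "bernoulli g h \<kappa> \<gamma> K c Y"
begin

definition hr :: real where "hr = real_of_ereal h"
text \<open>The conformal depth. It differs from the physical one by the mean of \<open>Y\<close>;
  see \<open>Z_bottom\<close> for the reason.\<close>

definition H :: real where "H = hr + Y 0"
definition m :: "int \<Rightarrow> real" where "m n = real K * of_int n"
definition q :: "int \<Rightarrow> real" where "q = qsym h K H"
definition T :: "int \<Rightarrow> real" where "T n = c * Y n + \<gamma> / 2 * conv Y Y n"
text \<open>Bound for \<open>T\<close>. Thanks to \<open>N \<le> 1\<close> the quadratic term is
  estimated linearly in \<open>N\<close>, so that all later bounds are proportional to the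
  amplitude.\<close>

definition NT :: real where "NT = (\<bar>c\<bar> + 2 * \<bar>\<gamma>\<bar> * wt_sum) * N"
definition D :: "complex set" where "D = {w. Im w < R \<and> (h = \<infinity> \<or> - R < Im w)}"

text \<open>On the real axis, i times this series has imaginary part \<open>Y\<close> and as real
  part the conjugate of \<open>Y\<close>. In infinite depth \<open>1 - q n\<close> vanishes for
  \<open>n > 0\<close>, which removes the modes growing downwards.\<close>

definition za :: "int \<Rightarrow> real" where "za n = (1 - q n) * Y n"
definition qa :: "int \<Rightarrow> real" where "qa n = (1 - q n) * T n"

definition Z :: "complex \<Rightarrow> complex" where "Z w = w + \<i> * fs K za w"
definition Z' :: "complex \<Rightarrow> complex" where "Z' w = 1 - fs K (\<lambda>n. m n * za n) w"
definition Z'' :: "complex \<Rightarrow> complex" where "Z'' w = - \<i> * fs K (\<lambda>n. m n * (m n * za n)) w"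
definition Q :: "complex \<Rightarrow> complex" where "Q w = \<i> * fs K qa w"
definition Q' :: "complex \<Rightarrow> complex" where "Q' w = - fs K (\<lambda>n. m n * qa n) w"
definition Q'' :: "complex \<Rightarrow> complex" where "Q'' w = - \<i> * fs K (\<lambda>n. m n * (m n * qa n)) w"

lemma hr_pos: "h \<noteq> \<infinity> \<Longrightarrow> hr > 0" and hr_nonneg: "hr \<ge> 0"
  using real_of_ereal_depth_pos[OF h] unfolding hr_def by (simp, cases "h = \<infinity>") (simp_all add: less_imp_le)

lemma R_pos: "R > 0" "R \<ge> 5" "R \<ge> 2 * hr + 5" "R \<ge> \<sigma> + 5"
  using R \<sigma> hr_nonneg by (auto simp: hr_def)

lemma N_nonneg: "N \<ge> 0" using bd_nonneg[OF Y_bd] .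

lemma Cq_nonneg: "Cq \<ge> 0" using Cq[of 0] by simp

lemma Y0_le: "\<bar>Y 0\<bar> \<le> 1"
  using bdD[OF Y_bd, of 0] N1 by (simp add: wt_0)

lemma H: "h \<noteq> \<infinity> \<Longrightarrow> H > 0" "H \<le> hr + 1"
  using H_pos Y0_le by (auto simp: H_def hr_def)

lemma q_le: "\<bar>q n\<bar> \<le> Cq" and q_uminus [simp]: "q (- n) = - q n" and q_0 [simp]: "q 0 = 0"
  using Cq by (auto simp: q_def H_def hr_def)

lemma m_uminus [simp]: "m (- n) = - m n" and m_0 [simp]: "m 0 = 0"
  by (auto simp: m_def)

lemma NT_nonneg: "NT \<ge> 0"
  using N_nonneg wt_sum_nonneg by (simp add: NT_def)

lemma T_even: "T (- n) = T n"
  using conv_parity[of Y 1 Y 1 n] Y_even by (simp add: T_def)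

lemma T_bd: "bd (real K * (R + 3)) NT T"
proof -
  have "bd (real K * (R + 3)) (\<bar>c\<bar> * N + \<bar>\<gamma> / 2\<bar> * (4 * wt_sum * N * N)) T"
    unfolding T_def using R_pos by (intro bd_add bd_cmult bd_conv Y_bd) auto
  moreover have "\<bar>c\<bar> * N + \<bar>\<gamma> / 2\<bar> * (4 * wt_sum * N * N) \<le> NT"
  proof -
    have "4 * wt_sum * N * N \<le> 4 * wt_sum * N * 1"
      using N_nonneg N1 wt_sum_nonneg by (intro mult_left_mono) auto
    then have "\<bar>\<gamma> / 2\<bar> * (4 * wt_sum * N * N) \<le> \<bar>\<gamma> / 2\<bar> * (4 * wt_sum * N * 1)"
      by (rule mult_left_mono) auto
    moreover have "NT = \<bar>c\<bar> * N + \<bar>\<gamma> / 2\<bar> * (4 * wt_sum * N * 1)"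
      by (simp add: NT_def algebra_simps)
    ultimately show ?thesis by linarith
  qed
  ultimately show ?thesis by (rule bd_mono)
qed

lemma bd_m:
  assumes "bd (real K * (R + 3)) C f"
  shows "bd (real K * R) C f" "bd (real K * R) C (\<lambda>n. m n * f n)" "bd (real K * R) C (\<lambda>n. m n * (m n * f n))"
proof -
  show "bd (real K * R) C f" by (rule bd_weaken[OF assms]) (simp add: mult_left_mono)
  have 1: "bd (real K * (R + 2)) C (\<lambda>n. m n * f n)"
    unfolding m_def by (rule bd_times_frequency) (use assms in \<open>simp add: algebra_simps\<close>)
  then show "bd (real K * R) C (\<lambda>n. m n * f n)" by (rule bd_weaken) (simp add: mult_left_mono)
  have "bd (real K * (R + 1)) C (\<lambda>n. real K * of_int n * (m n * f n))"
    by (rule bd_times_frequency) (use 1 in \<open>simp add: algebra_simps\<close>)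
  then have "bd (real K * (R + 1)) C (\<lambda>n. m n * (m n * f n))" by (simp only: m_def)
  then show "bd (real K * R) C (\<lambda>n. m n * (m n * f n))" by (rule bd_weaken) (simp add: mult_left_mono)
qed

lemma one_minus_q: "\<bar>1 - q n\<bar> \<le> 1 + Cq"
  using q_le[of n] by linarith

lemma za_bd: "bd (real K * (R + 3)) ((1 + Cq) * N) za" and qa_bd: "bd (real K * (R + 3)) ((1 + Cq) * NT) qa"
  unfolding za_def qa_def by (intro bd_symbol Y_bd T_bd one_minus_q)+

lemma open_D: "open D"
proof (cases "h = \<infinity>")
  case True
  have "D = {w. Im w < R}" unfolding D_def using True by auto
  then show ?thesis by (simp add: open_halfspace_Im_lt)
next
  case False
  have "open ({w. Im w < R} \<inter> {w. Im w > - R})"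
    by (intro open_Int open_halfspace_Im_lt open_halfspace_Im_gt)
  also have "{w. Im w < R} \<inter> {w. Im w > - R} = D" using False by (auto simp: D_def)
  finally show ?thesis .
qed

lemma convex_D: "convex D"
proof (cases "h = \<infinity>")
  case True
  have "D = {w. Im w < R}" unfolding D_def using True by auto
  then show ?thesis by (simp add: convex_halfspace_Im_lt)
next
  case False
  have "convex ({w. Im w < R} \<inter> {w. Im w > - R})"
    by (intro convex_Int convex_halfspace_Im_lt convex_halfspace_Im_gt)
  also have "{w. Im w < R} \<inter> {w. Im w > - R} = D" using False by (auto simp: D_def)
  finally show ?thesis .
qed

lemma q_infinite: "h = \<infinity> \<Longrightarrow> n > 0 \<Longrightarrow> q n = 1"
  unfolding q_def qsym_def cth_def by simp

lemma D_fdom: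
  assumes "w \<in> D"
  shows "fdom K R (\<lambda>n. of_real ((1 - q n) * f n)) w"
proof (cases "h = \<infinity>")
  case True
  have "- of_int n * Im w \<le> \<bar>of_int n\<bar> * R" if "(1 - q n) * f n \<noteq> 0" for n
  proof -
    have "n \<le> 0" using q_infinite[OF True, of n] that by force
    then have "- of_int n * Im w \<le> - of_int n * R" using assms by (intro mult_left_mono) (auto simp: D_def)
    then show ?thesis using \<open>n \<le> 0\<close> by simp
  qed
  then show ?thesis by (simp add: fdom_def del: mult_eq_0_iff)
next
  case False
  then have "w \<in> strip R" using assms by (auto simp: D_def strip_def)
  then show ?thesis by (rule strip_fdom)
qed

lemma D_fdoms:
  assumes "w \<in> D"
  shows "fdom K R (\<lambda>n. of_real (za n)) w" "fdom K R (\<lambda>n. of_real (m n * za n)) w"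
    "fdom K R (\<lambda>n. of_real (m n * (m n * za n))) w"
    "fdom K R (\<lambda>n. of_real (qa n)) w" "fdom K R (\<lambda>n. of_real (m n * qa n)) w"
    "fdom K R (\<lambda>n. of_real (m n * (m n * qa n))) w"
  using D_fdom[OF assms, of Y] D_fdom[OF assms, of T]
  by (auto simp: fdom_def za_def qa_def)

lemma fs_deriv:
  assumes "bd (real K * R) C f" "\<And>w. w \<in> D \<Longrightarrow> fdom K R (\<lambda>n. of_real (f n)) w" "w \<in> D"
  shows "(fs K f has_field_derivative \<i> * fs K (\<lambda>n. m n * f n) w) (at w)"
proof -
  have "(fs K f has_field_derivative fser K (\<lambda>n. \<i> * of_real (real K * of_int n) * of_real (f n)) w) (at w)"
    by (rule fser_derivative(1)[OF _ open_D assms(2,3)]) (use assms(1) in \<open>simp_all add: cbd_of_real\<close>)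
  also have "fser K (\<lambda>n. \<i> * of_real (real K * of_int n) * of_real (f n)) w = \<i> * fs K (\<lambda>n. m n * f n) w"
    unfolding fser_cmult[symmetric] by (simp add: m_def mult.assoc)
  finally show ?thesis .
qed

lemma fs_le:
  assumes "bd (real K * R) C f" "fdom K R (\<lambda>n. of_real (f n)) w"
  shows "cmod (fs K f w) \<le> C * wt_sum"
  by (rule fser_norm_le[OF _ assms(2)]) (use assms(1) in \<open>simp add: cbd_of_real\<close>)

lemma bounds:
  assumes "w \<in> D"
  shows "cmod (fs K za w) \<le> 1 / 4" "cmod (fs K (\<lambda>n. m n * za n) w) \<le> 1 / 4"
    "cmod (Z'' w) \<le> 1 / 4" "cmod (Q w) \<le> (1 + Cq) * NT * wt_sum"
    "cmod (Q' w) \<le> (1 + Cq) * NT * wt_sum" "cmod (Q'' w) \<le> (1 + Cq) * NT * wt_sum"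
  unfolding Z''_def Q_def Q'_def Q''_def
  using fs_le[OF bd_m(1)[OF za_bd] D_fdoms(1)[OF assms]] fs_le[OF bd_m(2)[OF za_bd] D_fdoms(2)[OF assms]]
    fs_le[OF bd_m(3)[OF za_bd] D_fdoms(3)[OF assms]] small
    fs_le[OF bd_m(1)[OF qa_bd] D_fdoms(4)[OF assms]] fs_le[OF bd_m(2)[OF qa_bd] D_fdoms(5)[OF assms]]
    fs_le[OF bd_m(3)[OF qa_bd] D_fdoms(6)[OF assms]]
  by (simp_all add: norm_mult)

lemma Z_deriv: "w \<in> D \<Longrightarrow> (Z has_field_derivative Z' w) (at w)"
  and Z'_deriv: "w \<in> D \<Longrightarrow> (Z' has_field_derivative Z'' w) (at w)"
  and Q_deriv: "w \<in> D \<Longrightarrow> (Q has_field_derivative Q' w) (at w)"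
  and Q'_deriv: "w \<in> D \<Longrightarrow> (Q' has_field_derivative Q'' w) (at w)"
proof -
  assume w: "w \<in> D"
  note d = fs_deriv[OF bd_m(1)[OF za_bd] D_fdoms(1) w] fs_deriv[OF bd_m(2)[OF za_bd] D_fdoms(2) w]
    fs_deriv[OF bd_m(1)[OF qa_bd] D_fdoms(4) w] fs_deriv[OF bd_m(2)[OF qa_bd] D_fdoms(5) w]
  have i: "\<i> * (\<i> * z) = - z" "- (\<i> * z) = - \<i> * z" for z by (simp_all flip: mult.assoc)
  show "(Z has_field_derivative Z' w) (at w)"
    using DERIV_add[OF DERIV_ident DERIV_cmult[OF d(1), of \<i>]]
    unfolding i(1) Z_def[abs_def] Z'_def by simp
  show "(Z' has_field_derivative Z'' w) (at w)"
    using DERIV_diff[OF DERIV_const[of 1] d(2)] unfolding Z'_def[abs_def] Z''_def by simp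
  show "(Q has_field_derivative Q' w) (at w)"
    using DERIV_cmult[OF d(3), of \<i>] unfolding i(1) Q_def[abs_def] Q'_def .
  show "(Q' has_field_derivative Q'' w) (at w)"
    using DERIV_minus[OF d(4)] unfolding i(2) Q'_def[abs_def] Q''_def .
qed

lemma Z'_bounds:
  assumes "w \<in> D"
  shows "Re (Z' w) \<ge> 3 / 4" "cmod (Z' w) \<le> 2" "cmod (Z' w) \<ge> 3 / 4" "Z' w \<noteq> 0"
proof -
  have b: "cmod (fs K (\<lambda>n. m n * za n) w) \<le> 1 / 4" by (rule bounds(2)[OF assms])
  then show r: "Re (Z' w) \<ge> 3 / 4"
    using abs_Re_le_cmod[of "fs K (\<lambda>n. m n * za n) w"] by (simp add: Z'_def)
  show "cmod (Z' w) \<le> 2"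
    using norm_triangle_ineq4[of 1 "fs K (\<lambda>n. m n * za n) w"] b by (simp add: Z'_def)
  show "cmod (Z' w) \<ge> 3 / 4" using r complex_Re_le_cmod[of "Z' w"] by linarith
  then show "Z' w \<noteq> 0" by auto
qed

lemma lipschitz:
  assumes "w \<in> D" "w' \<in> D"
  shows "cmod (fs K za w - fs K za w') \<le> 1 / 4 * cmod (w - w')"
    and "cmod (Z' w - Z' w') \<le> 1 / 4 * cmod (w - w')"
    and "cmod (Q' w - Q' w') \<le> (1 + Cq) * NT * wt_sum * cmod (w - w')"
proof -
  have d: "(fs K za has_field_derivative \<i> * fs K (\<lambda>n. m n * za n) w) (at w within D)" if "w \<in> D" for w
    by (rule has_field_derivative_at_within, rule fs_deriv[OF bd_m(1)[OF za_bd] D_fdoms(1) that])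
  show "cmod (fs K za w - fs K za w') \<le> 1 / 4 * cmod (w - w')"
    by (rule field_differentiable_bound[OF convex_D d _ assms]) (auto simp: norm_mult bounds(2)[simplified])
  show "cmod (Z' w - Z' w') \<le> 1 / 4 * cmod (w - w')"
    by (rule field_differentiable_bound[OF convex_D has_field_derivative_at_within[OF Z'_deriv] bounds(3) assms])
  show "cmod (Q' w - Q' w') \<le> (1 + Cq) * NT * wt_sum * cmod (w - w')"
    by (rule field_differentiable_bound[OF convex_D has_field_derivative_at_within[OF Q'_deriv] bounds(6) assms])
qed

lemma Z_diff: "Z w - Z w' = (w - w') + \<i> * (fs K za w - fs K za w')"
  by (simp add: Z_def algebra_simps)

text \<open>The identity plus a perturbation of Lipschitz constant 1/4 is injective.\<close>

lemma inj_Z: "inj_on Z D"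
proof (rule inj_onI)
  fix w w' assume w: "w \<in> D" "w' \<in> D" and "Z w = Z w'"
  then have "w - w' = - \<i> * (fs K za w - fs K za w')" using Z_diff[of w w'] by (simp add: algebra_simps)
  then have "cmod (w - w') = cmod (fs K za w - fs K za w')" by (metis norm_minus_cancel norm_mult norm_ii mult_1 mult_minus_left)
  then have "cmod (w - w') \<le> 1 / 4 * cmod (w - w')" using lipschitz(1)[OF w] by simp
  then show "w = w'" by simp
qed

lemma Z_holomorphic: "Z holomorphic_on D" and Q_holomorphic: "Q holomorphic_on D"
  using Z_deriv Q_deriv open_D holomorphic_on_open by blast+

lemma real_in_D [simp]: "of_real x \<in> D"
  using R_pos by (simp add: D_def)

text \<open>Banach's fixed point theorem for the equation \<open>w = z - i * fs K za w\<close> on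
  the unit disc around \<open>z\<close>; the margin in \<open>R\<close> puts this disc inside
  \<open>D\<close>.\<close>

lemma surj_Z:
  assumes "Im z \<le> 2" "h \<noteq> \<infinity> \<Longrightarrow> Im z \<ge> - hr"
  shows "\<exists>w\<in>D. Z w = z \<and> cmod (w - z) \<le> 1"
proof -
  have sub: "cball z 1 \<subseteq> D"
  proof
    fix w assume "w \<in> cball z 1"
    then have "\<bar>Im w - Im z\<bar> \<le> 1"
      using abs_Im_le_cmod[of "w - z"] by (simp add: dist_norm norm_minus_commute)
    then show "w \<in> D" using assms R_pos hr_nonneg unfolding D_def by (cases "h = \<infinity>") auto
  qed
  define F where "F w = z - \<i> * fs K za w" for w
  have "\<exists>!w\<in>cball z 1. F w = w"
  proof (rule Banach_fix[where c="1/4"])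
    show "complete (cball z 1)" by (simp add: compact_imp_complete)
    show "F ` cball z 1 \<subseteq> cball z 1"
    proof
      fix v assume "v \<in> F ` cball z 1"
      then obtain w where w: "w \<in> cball z 1" "v = F w" by auto
      have "dist z v = cmod (fs K za w)" by (simp add: w F_def dist_norm norm_mult)
      then show "v \<in> cball z 1" using bounds(1)[of w] sub w by (auto simp: subset_iff)
    qed
    fix x y assume "x \<in> cball z 1" "y \<in> cball z 1"
    then have "x \<in> D" "y \<in> D" using sub by auto
    have "F x - F y = - \<i> * (fs K za x - fs K za y)" by (simp add: F_def algebra_simps)
    then have "dist (F x) (F y) = cmod (fs K za x - fs K za y)" by (simp add: dist_norm norm_mult)
    then show "dist (F x) (F y) \<le> 1 / 4 * dist x y"
      using lipschitz(1)[OF \<open>x \<in> D\<close> \<open>y \<in> D\<close>] by (simp add: dist_norm)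
  qed auto
  then obtain w where w: "w \<in> cball z 1" "F w = w" by blast
  then have "Z w = z" by (simp add: Z_def F_def algebra_simps)
  then show ?thesis using w sub by (intro bexI[of _ w]) (auto simp: dist_norm norm_minus_commute)
qed

definition W :: "complex \<Rightarrow> complex" where "W = inv_into D Z"

lemma W_Z: "w \<in> D \<Longrightarrow> W (Z w) = w"
  unfolding W_def by (rule inv_into_f_f[OF inj_Z])

lemma open_ZD: "open (Z ` D)"
  by (rule open_mapping_thm3[OF Z_holomorphic open_D inj_Z])

lemma W_deriv:
  assumes "w \<in> D"
  shows "(W has_field_derivative 1 / Z' w) (at (Z w))"
proof -
  obtain G where G: "G holomorphic_on Z ` D" "\<And>w. w \<in> D \<Longrightarrow> G (Z w) = w"
    "\<And>w. w \<in> D \<Longrightarrow> deriv Z w * deriv G (Z w) = 1"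
    using holomorphic_has_inverse[OF Z_holomorphic open_D inj_Z] by metis
  have "(G has_field_derivative deriv G (Z w)) (at (Z w))"
    using holomorphic_derivI[OF G(1) open_ZD] assms by blast
  moreover have "deriv G (Z w) = 1 / Z' w"
    using G(3)[OF assms] DERIV_imp_deriv[OF Z_deriv[OF assms]] Z'_bounds(4)[OF assms] by (simp add: field_simps)
  ultimately have "(G has_field_derivative 1 / Z' w) (at (Z w))" by simp
  then show ?thesis
    by (rule has_field_derivative_transform_within_open[OF _ open_ZD]) (use assms G(2) W_Z in auto)
qed

definition fz :: "complex \<Rightarrow> complex" where "fz z = Q (W z)"

lemma fz_deriv:
  assumes "w \<in> D"
  shows "(fz has_field_derivative Q' w / Z' w) (at (Z w))"
proof -
  have "(Q has_field_derivative Q' w) (at (W (Z w)))" using Q_deriv assms by (simp add: W_Z)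
  from DERIV_chain2[OF this W_deriv[OF assms]] show ?thesis by (simp add: fz_def[abs_def])
qed

lemma fz_holomorphic: "fz holomorphic_on Z ` D"
  using fz_deriv open_ZD by (auto simp: holomorphic_on_open)

end

lemma real_part_derivative:
  assumes "(F has_field_derivative F') (at (complex_of_real x))"
  shows "((\<lambda>x. Re (F (of_real x))) has_real_derivative Re F') (at x)"
    and "((\<lambda>x. Im (F (of_real x))) has_real_derivative Im F') (at x)"
proof -
  have v: "((\<lambda>x. F (of_real x)) has_vector_derivative F') (at x)"
    by (rule has_vector_derivative_real_field[OF assms])
  show "((\<lambda>x. Re (F (of_real x))) has_real_derivative Re F') (at x)"
    using bounded_linear.has_vector_derivative[OF bounded_linear_Re v]
    by (simp add: has_real_derivative_iff_has_vector_derivative)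
  show "((\<lambda>x. Im (F (of_real x))) has_real_derivative Im F') (at x)"
    using bounded_linear.has_vector_derivative[OF bounded_linear_Im v]
    by (simp add: has_real_derivative_iff_has_vector_derivative)
qed

section \<open>Boundary traces, the physical profile and the bottom\<close>

context conformal_wave
begin

definition lam :: "int \<Rightarrow> real" where "lam n = q n * (m n * Y n)"
definition Xr :: "real \<Rightarrow> real" where "Xr a = a + od K (\<lambda>n. q n * Y n) a"
definition X' :: "real \<Rightarrow> real" where "X' a = 1 + ev K lam a"
definition X'' :: "real \<Rightarrow> real" where "X'' a = - od K (\<lambda>n. m n * lam n) a"
definition Yr :: "real \<Rightarrow> real" where "Yr a = ev K Y a"
definition Y' :: "real \<Rightarrow> real" where "Y' a = - od K (\<lambda>n. m n * Y n) a"
definition Y'' :: "real \<Rightarrow> real" where "Y'' a = - ev K (\<lambda>n. (m n)\<^sup>2 * Y n) a"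
definition Pr :: "real \<Rightarrow> real" where "Pr a = od K (\<lambda>n. q n * T n) a"
definition P' :: "real \<Rightarrow> real" where "P' a = ev K (\<lambda>n. q n * (m n * T n)) a"
definition Tr :: "real \<Rightarrow> real" where "Tr a = ev K T a"
definition T' :: "real \<Rightarrow> real" where "T' a = - od K (\<lambda>n. m n * T n) a"

lemma KR_nonneg: "real K * R \<ge> 0" using R_pos by simp

lemma goods:
  "good (real K * R) 1 Y" "good (real K * R) (-1) (\<lambda>n. m n * Y n)" "good (real K * R) 1 (\<lambda>n. (m n)\<^sup>2 * Y n)"
  "good (real K * R) 1 T" "good (real K * R) (-1) (\<lambda>n. m n * T n)"
  using bd_m[OF Y_bd] bd_m[OF T_bd] Y_even T_even
  by (auto simp: good_def power2_eq_square mult.assoc)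

lemma good_q:
  assumes "good \<rho> s f"
  shows "good \<rho> (- s) (\<lambda>n. q n * f n)"
proof -
  obtain C where "bd \<rho> C f" using assms by (auto simp: good_def)
  then have "bd \<rho> (Cq * C) (\<lambda>n. q n * f n)" by (rule bd_symbol) (rule q_le)
  then show ?thesis using assms by (auto simp: good_def)
qed

lemma fs_one_minus_q:
  assumes "good (real K * R) s f"
  shows "fs K (\<lambda>n. (1 - q n) * f n) (of_real x) = fs K f (of_real x) - fs K (\<lambda>n. q n * f n) (of_real x)"
proof -
  have g: "good (real K * R) (- s) (\<lambda>n. - (q n * f n))" by (intro good_uminus good_q assms)
  have "fser K (\<lambda>n. of_real (f n) + of_real (- (q n * f n))) (of_real x)
      = fs K f (of_real x) + fs K (\<lambda>n. - (q n * f n)) (of_real x)"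
    by (rule fser_add[OF good_summable[OF KR_nonneg assms] good_summable[OF KR_nonneg g]])
  moreover have "fs K (\<lambda>n. - (q n * f n)) (of_real x) = - fs K (\<lambda>n. q n * f n) (of_real x)"
    using fser_cmult[of K "-1" "\<lambda>n. of_real (q n * f n)"] by simp
  ultimately show ?thesis by (simp add: algebra_simps)
qed

lemma fs_one_minus_q_even:
  assumes "good (real K * R) 1 f"
  shows "fs K (\<lambda>n. (1 - q n) * f n) (of_real x) = of_real (ev K f x) - \<i> * of_real (od K (\<lambda>n. q n * f n) x)"
  unfolding fs_one_minus_q[OF assms]
  using fser_even[of f K x] fser_odd[of "\<lambda>n. q n * f n" K x] assms by (simp add: good_def)

lemma fs_one_minus_q_odd:
  assumes "good (real K * R) (-1) f"
  shows "fs K (\<lambda>n. (1 - q n) * f n) (of_real x) = \<i> * of_real (od K f x) - of_real (ev K (\<lambda>n. q n * f n) x)"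
  unfolding fs_one_minus_q[OF assms]
  using fser_odd[of f K x] fser_even[of "\<lambda>n. q n * f n" K x] assms by (simp add: good_def)

text \<open>\<open>1 - q\<close> times an even or odd sequence splits into an even and an odd part,
  whose series are real and purely imaginary on the real axis; a factor \<open>m n\<close> exchanges
  the parities.\<close>

lemma on_real:
  "Z (of_real x) = Complex (Xr x) (Yr x)" "Z' (of_real x) = Complex (X' x) (Y' x)"
  "Z'' (of_real x) = Complex (X'' x) (Y'' x)"
  "Q (of_real x) = Complex (Pr x) (Tr x)" "Q' (of_real x) = Complex (P' x) (T' x)"
proof -
  have e: "za n = (1 - q n) * Y n" "m n * za n = (1 - q n) * (m n * Y n)"
    "m n * (m n * za n) = (1 - q n) * ((m n)\<^sup>2 * Y n)"
    "qa n = (1 - q n) * T n" "m n * qa n = (1 - q n) * (m n * T n)" for n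
    by (auto simp: za_def qa_def power2_eq_square)
  have l: "(\<lambda>n. m n * lam n) = (\<lambda>n. q n * ((m n)\<^sup>2 * Y n))" "lam = (\<lambda>n. q n * (m n * Y n))"
    by (auto simp: lam_def power2_eq_square)
  show "Z (of_real x) = Complex (Xr x) (Yr x)"
    unfolding Z_def e(1) fs_one_minus_q_even[OF goods(1)] by (simp add: complex_eq_iff Xr_def Yr_def)
  show "Z' (of_real x) = Complex (X' x) (Y' x)"
    unfolding Z'_def e(2) fs_one_minus_q_odd[OF goods(2)] by (simp add: complex_eq_iff X'_def Y'_def l(2))
  show "Z'' (of_real x) = Complex (X'' x) (Y'' x)"
    unfolding Z''_def e(3) fs_one_minus_q_even[OF goods(3)] by (simp add: complex_eq_iff X''_def Y''_def l(1))
  show "Q (of_real x) = Complex (Pr x) (Tr x)"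
    unfolding Q_def e(4) fs_one_minus_q_even[OF goods(4)] by (simp add: complex_eq_iff Pr_def Tr_def)
  show "Q' (of_real x) = Complex (P' x) (T' x)"
    unfolding Q'_def e(5) fs_one_minus_q_odd[OF goods(5)] by (simp add: complex_eq_iff P'_def T'_def)
qed

lemma Xr_deriv: "(Xr has_real_derivative X' x) (at x)" and Yr_deriv: "(Yr has_real_derivative Y' x) (at x)"
  and X'_deriv: "(X' has_real_derivative X'' x) (at x)" and Y'_deriv: "(Y' has_real_derivative Y'' x) (at x)"
  and Pr_deriv: "(Pr has_real_derivative P' x) (at x)" and Tr_deriv: "(Tr has_real_derivative T' x) (at x)"
  using real_part_derivative[OF Z_deriv[OF real_in_D], of x] real_part_derivative[OF Z'_deriv[OF real_in_D], of x]
    real_part_derivative[OF Q_deriv[OF real_in_D], of x]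
  by (simp_all add: on_real)

lemma Tr: "Tr x = c * Yr x + \<gamma> / 2 * (Yr x)\<^sup>2"
proof -
  have "good (real K * R) 1 (conv Y Y)" using good_conv[OF KR_nonneg goods(1) goods(1)] by simp
  then have "ev K (\<lambda>n. c * Y n + \<gamma> / 2 * conv Y Y n) x = c * ev K Y x + \<gamma> / 2 * ev K (conv Y Y) x"
    unfolding ev_cmult(1)[symmetric]
    by (rule ev_add(1)[OF KR_nonneg good_cmult[OF goods(1)] good_cmult])
  then show ?thesis unfolding Tr_def T_def[abs_def] Yr_def
    by (simp add: ev_conv_even[OF KR_nonneg goods(1) goods(1)] power2_eq_square)
qed

lemma T': "T' x = (c + \<gamma> * Yr x) * Y' x"
proof -
  have "(Tr has_real_derivative c * Y' x + \<gamma> / 2 * (2 * Yr x * Y' x)) (at x)"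
    unfolding Tr[abs_def] by (auto intro!: derivative_eq_intros Yr_deriv)
  from DERIV_unique[OF Tr_deriv this] show ?thesis by (simp add: algebra_simps)
qed

lemma X'_ge: "X' x \<ge> 3 / 4" "X' x > 0"
  using Z'_bounds(1)[OF real_in_D, of x] by (auto simp: on_real)

lemma Yr_le: "\<bar>Yr x\<bar> \<le> 1 / 4" and Xr_near: "\<bar>Xr x - x\<bar> \<le> 1 / 4"
proof -
  have "cmod (Z (of_real x) - of_real x) \<le> 1 / 4"
    using bounds(1)[OF real_in_D, of x] by (simp add: Z_def norm_mult)
  then show "\<bar>Yr x\<bar> \<le> 1 / 4" "\<bar>Xr x - x\<bar> \<le> 1 / 4"
    using abs_Im_le_cmod[of "Z (of_real x) - of_real x"] abs_Re_le_cmod[of "Z (of_real x) - of_real x"]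
    by (auto simp: on_real)
qed

lemma shift_periodic:
  "Z (w + 2 * of_real pi) = Z w + 2 * of_real pi" "Q (w + 2 * of_real pi) = Q w"
  by (simp_all add: Z_def Q_def fser_periodic)

lemma real_periodic:
  "Xr (x + 2 * pi) = Xr x + 2 * pi" "Yr (x + 2 * pi) = Yr x" "Pr (x + 2 * pi) = Pr x" "Tr (x + 2 * pi) = Tr x"
  using shift_periodic(1)[of "of_real x"] shift_periodic(2)[of "of_real x"]
    on_real(1)[of "x + 2 * pi"] on_real(1)[of x] on_real(4)[of "x + 2 * pi"] on_real(4)[of x]
  by (simp_all add: complex_eq_iff)

lemma Xr_period: "Xr 0 = 0" "Xr (2 * pi) = 2 * pi"
proof -
  show "Xr 0 = 0" using od_uminus[of K _ 0] by (simp add: Xr_def)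
  then show "Xr (2 * pi) = 2 * pi" using real_periodic(1)[of 0] by simp
qed

definition A :: "real \<Rightarrow> real" where
  "A = (SOME A. (\<forall>x. Xr (A x) = x) \<and> (\<forall>a. A (Xr a) = a) \<and> (\<forall>x. (A has_real_derivative 1 / X' (A x)) (at x)))"

lemma A: "Xr (A x) = x" "A (Xr a) = a" "(A has_real_derivative 1 / X' (A x)) (at x)"
proof -
  have "\<exists>A. (\<forall>x. Xr (A x) = x) \<and> (\<forall>a. A (Xr a) = a) \<and> (\<forall>x. (A has_real_derivative 1 / X' (A x)) (at x))"
  proof (rule real_bijection[OF Xr_deriv _ Xr_near])
    show "1 / 2 \<le> X' x" for x using X'_ge(1)[of x] by simp
  qed blast
  from someI_ex[OF this] show "Xr (A x) = x" "A (Xr a) = a" "(A has_real_derivative 1 / X' (A x)) (at x)"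
    by (simp_all add: A_def[symmetric])
qed

lemma A_periodic: "A (x + 2 * pi) = A x + 2 * pi"
  using A(2)[of "A x + 2 * pi"] A(1)[of x] by (simp add: real_periodic)

definition \<eta> :: "real \<Rightarrow> real" where "\<eta> x = Yr (A x)"
definition \<psi> :: "real \<Rightarrow> real" where "\<psi> x = Pr (A x)"
definition \<Phi> :: "real \<times> real \<Rightarrow> real" where "\<Phi> p = Re (fz (zc p))"

lemma comp_A_deriv:
  assumes "\<And>a. (F has_real_derivative F' a) (at a)"
  shows "((\<lambda>x. F (A x)) has_real_derivative F' (A x) / X' (A x)) (at x)"
  using DERIV_chain2[OF assms A(3)] by simp

lemma \<eta>_deriv: "(\<eta> has_real_derivative Y' (A x) / X' (A x)) (at x)"
  and \<psi>_deriv: "(\<psi> has_real_derivative P' (A x) / X' (A x)) (at x)"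
  unfolding \<eta>_def[abs_def] \<psi>_def[abs_def] by (rule comp_A_deriv Yr_deriv Pr_deriv)+

lemma deriv_\<eta>: "deriv \<eta> = (\<lambda>x. Y' (A x) / X' (A x))" and deriv_\<psi>: "deriv \<psi> = (\<lambda>x. P' (A x) / X' (A x))"
  using DERIV_imp_deriv[OF \<eta>_deriv] DERIV_imp_deriv[OF \<psi>_deriv] by auto

lemma \<eta>_periodic: "periodic \<eta>" and \<psi>_periodic: "periodic \<psi>"
  by (simp_all add: periodic_def \<eta>_def \<psi>_def A_periodic real_periodic)

lemma \<eta>_continuous: "continuous_on S \<eta>" and \<psi>_continuous: "continuous_on S \<psi>"
  by (auto intro!: DERIV_continuous_on[OF has_field_derivative_at_within] \<eta>_deriv \<psi>_deriv)

lemma \<eta>_le: "\<bar>\<eta> x\<bar> \<le> 1 / 4"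
  using Yr_le[of "A x"] by (simp add: \<eta>_def)

lemma Z_A: "Z (of_real (A x)) = Complex x (\<eta> x)"
  by (simp add: on_real A \<eta>_def)

text \<open>With \<open>t = m n * H\<close>, \<open>(1 - coth t) * exp t\<close> is
  \<open>- 1 / sinh t\<close>, an odd function.\<close>

lemma bottom_symbol:
  assumes "h \<noteq> \<infinity>" "n \<noteq> 0"
  shows "(1 - q (- n)) * exp (m (- n) * H) = - ((1 - q n) * exp (m n * H))"
proof -
  have main: "(1 - q (- n)) * exp (m (- n) * H) = - ((1 - q n) * exp (m n * H))" if n: "n > 0" for n
  proof -
    define E where "E = exp (m n * H)"
    have "m n * H > 0" using n K H(1)[OF assms(1)] by (simp add: m_def)
    then have E: "E > 1" by (simp add: E_def)
    then have E2: "E * E > 1" by (simp add: less_1_mult)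
    have q: "q n = 1 + 2 / (E * E - 1)"
      using n assms(1) unfolding q_def qsym_def cth_def E_def
      by (simp add: exp_add[symmetric] m_def algebra_simps)
    have "(1 - q (- n)) * exp (m (- n) * H) = (1 + q n) / E" by (simp add: E_def exp_minus field_simps)
    also have "\<dots> = - ((1 - q n) * E)" unfolding q using E E2 by (simp add: field_simps)
    finally show ?thesis by (simp add: E_def)
  qed
  show ?thesis
  proof (cases "n > 0")
    case True
    then show ?thesis by (rule main)
  next
    case False
    then show ?thesis using main[of "- n"] assms by simp
  qed
qed

lemma fexp_bottom: "fexp K n (of_real x - \<i> * of_real H) = of_real (exp (m n * H)) * fexp K n (of_real x)"
proof -
  have "\<i> * of_real (real K * of_int n) * (of_real x - \<i> * of_real H)
      = of_real (m n * H) + \<i> * of_real (real K * of_int n) * of_real x"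
    by (simp add: m_def algebra_simps)
  then show ?thesis by (simp only: fexp_def exp_add exp_of_real)
qed

lemma fs_bottom: "fs K a (of_real x - \<i> * of_real H) = fs K (\<lambda>n. exp (m n * H) * a n) (of_real x)"
  unfolding fser_def fexp_bottom by (simp add: mult_ac)

lemma bottom_in_D: "h \<noteq> \<infinity> \<Longrightarrow> of_real x - \<i> * of_real H \<in> D"
  using H R_pos hr_nonneg unfolding D_def by auto

text \<open>On the bottom line the coefficients without \<open>m n\<close> are odd off the mean, so
  the factor \<open>m n\<close> makes them even and the series real. For \<open>Z'\<close> and
  \<open>Q'\<close> this says that the bottom is flat and impermeable.\<close>

lemma bottom_real:
  assumes fin: "h \<noteq> \<infinity>" and f: "\<And>n. f (- n) = f n"
  shows "Im (fs K (\<lambda>n. m n * ((1 - q n) * f n)) (of_real x - \<i> * of_real H)) = 0"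
proof -
  have "exp (m (- n) * H) * (m (- n) * ((1 - q (- n)) * f (- n))) = exp (m n * H) * (m n * ((1 - q n) * f n))" for n
  proof (cases "n = 0")
    case False
    have "exp (m (- n) * H) * (m (- n) * ((1 - q (- n)) * f (- n)))
        = m (- n) * f (- n) * ((1 - q (- n)) * exp (m (- n) * H))"
      by (simp only: mult_ac)
    also have "\<dots> = m n * f n * ((1 - q n) * exp (m n * H))"
      by (subst bottom_symbol[OF fin False]) (simp add: f)
    finally show ?thesis by (simp only: mult_ac)
  qed simp
  from fser_even[of "\<lambda>n. exp (m n * H) * (m n * ((1 - q n) * f n))" K x, OF this]
  show ?thesis unfolding fs_bottom by simp
qed

text \<open>All modes except the mean have odd coefficients on this line and contribute nothing to
  the real part of the series. The mean contributes \<open>Y 0\<close>, and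
  \<open>- H + Y 0 = - hr\<close>.\<close>

lemma Z_bottom:
  assumes fin: "h \<noteq> \<infinity>"
  shows "Im (Z (of_real x - \<i> * of_real H)) = - hr"
proof -
  let ?w = "of_real x - \<i> * of_real H"
  define d where "d n = exp (m n * H) * za n" for n
  define b where "b n = (if n = 0 then 0 else d n)" for n
  have "cbd (real K * R) ((1 + Cq) * N) (\<lambda>n. of_real (za n))"
    using bd_m(1)[OF za_bd] by (simp add: cbd_of_real)
  then have "(\<lambda>n. of_real (za n) * fexp K n ?w) summable_on UNIV"
    by (rule fser_summable) (rule D_fdoms(1)[OF bottom_in_D[OF fin]])
  then have sd: "(\<lambda>n. of_real (d n) * fexp K n (of_real x)) summable_on UNIV"
    unfolding fexp_bottom by (simp add: d_def mult_ac)
  have s0: "(\<lambda>n. (if n = 0 then - of_real (d 0) else 0) * fexp K n (of_real x)) summable_on UNIV"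
    by (rule finite_nonzero_values_imp_summable_on) (rule finite_subset[of _ "{0}"], auto)
  have "b (- n) = - b n" for n
  proof (cases "n = 0")
    case False
    have "d (- n) = ((1 - q (- n)) * exp (m (- n) * H)) * Y (- n)"
      unfolding d_def za_def by (simp only: mult_ac)
    also have "\<dots> = - d n"
      unfolding bottom_symbol[OF fin False] Y_even d_def za_def by simp
    finally show ?thesis using False by (simp add: b_def)
  qed (simp add: b_def)
  from fser_odd[of b K x, OF this] have "Re (fs K b (of_real x)) = 0" by simp
  moreover have "fs K b (of_real x) = fs K d (of_real x) + fser K (\<lambda>n. if n = 0 then - of_real (d 0) else 0) (of_real x)"
    by (subst fser_add[OF sd s0, symmetric]) (rule arg_cong[where f="\<lambda>a. fser K a (of_real x)"], auto simp: b_def)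
  ultimately have "Re (fs K d (of_real x)) = d 0" by (simp add: fser_single fexp_def)
  then have "Re (fs K za ?w) = Y 0"
    unfolding fs_bottom by (simp add: d_def za_def)
  then show ?thesis by (simp add: Z_def H_def)
qed

text \<open>Compare \<open>w\<close> with the point of the bottom line vertically below it and use
  the Lipschitz constant 1/4 of the perturbation.\<close>

lemma height_above_bottom:
  assumes fin: "h \<noteq> \<infinity>" and "w \<in> D" "Z w = Complex x y"
  shows "\<bar>(y + hr) - (Im w + H)\<bar> \<le> 1 / 4 * \<bar>Im w + H\<bar>"
proof -
  define w1 where "w1 = of_real (Re w) - \<i> * of_real H"
  have w1: "w1 \<in> D" unfolding w1_def by (rule bottom_in_D[OF fin])
  have "Im (Z w - Z w1) = y + hr" using Z_bottom[OF fin, of "Re w"] assms(3) by (simp add: w1_def)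
  moreover have "Z w - Z w1 = (w - w1) + \<i> * (fs K za w - fs K za w1)" by (rule Z_diff)
  moreover have ww: "w - w1 = \<i> * of_real (Im w + H)" by (simp add: w1_def complex_eq_iff)
  ultimately have "(y + hr) - (Im w + H) = Re (fs K za w - fs K za w1)" by simp
  moreover have "cmod (w - w1) = \<bar>Im w + H\<bar>" unfolding ww norm_mult by (simp add: norm_of_real del: of_real_add)
  ultimately show ?thesis
    using lipschitz(1)[OF assms(2) w1] abs_Re_le_cmod[of "fs K za w - fs K za w1"] by simp
qed

lemma \<eta>_above_bottom: "h \<noteq> \<infinity> \<Longrightarrow> \<eta> x + hr \<ge> 3 / 4 * H"
proof -
  assume fin: "h \<noteq> \<infinity>"
  have "\<bar>\<eta> x + hr - H\<bar> \<le> 1 / 4 * H"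
    using height_above_bottom[OF fin real_in_D Z_A, of x] H(1)[OF fin] by simp
  then show ?thesis unfolding abs_le_iff by linarith
qed

lemma uminus_h: "h \<noteq> \<infinity> \<Longrightarrow> - h = ereal (- hr)"
  unfolding hr_def using h by (cases h) auto

lemma \<eta>_gt: "- h < ereal (\<eta> x)"
proof (cases "h = \<infinity>")
  case False
  then have "\<eta> x + hr > 0" using \<eta>_above_bottom[of x] H(1) by simp
  then show ?thesis unfolding uminus_h[OF False] by simp
qed simp

lemma zc_surj:
  assumes "(x, y) \<in> fluid_surf h \<eta>"
  obtains w where "w \<in> D" "Z w = Complex x y" "W (zc (x, y)) = w" "cmod (w - Complex x y) \<le> 1"
proof -
  have y: "y \<le> 2" using assms \<eta>_le[of x] by (auto simp: fluid_surf_def)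
  have "Im (Complex x y) \<ge> - hr" if "h \<noteq> \<infinity>"
    using assms uminus_h[OF that] by (auto simp: fluid_surf_def)
  then obtain w where "w \<in> D" "Z w = Complex x y" "cmod (w - Complex x y) \<le> 1"
    using surj_Z[of "Complex x y"] y by auto
  then show thesis using that W_Z[of w] by (simp add: zc_def)
qed

lemma surf_in_ZD: "zc ` fluid_surf h \<eta> \<subseteq> Z ` D"
proof
  fix z assume "z \<in> zc ` fluid_surf h \<eta>"
  then obtain x y where p: "(x, y) \<in> fluid_surf h \<eta>" "z = zc (x, y)" by auto
  obtain w where "w \<in> D" "Z w = Complex x y" by (rule zc_surj[OF p(1)])
  then show "z \<in> Z ` D" using p by (auto simp: zc_def intro!: image_eqI[of _ _ w])
qed

lemma fluid_subset: "fluid h \<eta> \<subseteq> fluid_surf h \<eta>"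
  by (auto simp: fluid_def fluid_surf_def)

lemma W_surface: "W (zc (x, \<eta> x)) = of_real (A x)"
  using W_Z[OF real_in_D, of "A x"] by (simp add: Z_A zc_def)

text \<open>The complex velocity \<Phi>_x - i \<Phi>_y at a physical point.\<close>

definition GG :: "complex \<Rightarrow> complex" where "GG z = Q' (W z) / Z' (W z)"

lemma deriv_fz: "z \<in> Z ` D \<Longrightarrow> deriv fz z = GG z"
  using DERIV_imp_deriv[OF fz_deriv] by (auto simp: GG_def W_Z)

lemma pd_\<Phi>:
  assumes "p \<in> fluid h \<eta>"
  shows "pdx \<Phi> p = Re (GG (zc p))" "pdy \<Phi> p = - Im (GG (zc p))"
proof -
  have sub: "zc ` fluid h \<eta> \<subseteq> Z ` D" using surf_in_ZD fluid_subset by blast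
  have "\<forall>p\<in>fluid h \<eta>. \<Phi> p = Re (fz (zc p))" by (simp add: \<Phi>_def)
  note C = Re_holomorphic_C1[OF open_ZD fz_holomorphic open_fluid[OF \<eta>_continuous] sub this]
  show "pdx \<Phi> p = Re (GG (zc p))" "pdy \<Phi> p = - Im (GG (zc p))"
    using C(2,3) assms deriv_fz[of "zc p"] sub by auto
qed

lemma GG_continuous: "continuous_on (fluid_surf h \<eta>) (\<lambda>p. GG (zc p))"
proof -
  have "continuous_on (Z ` D) (deriv fz)"
    by (intro holomorphic_on_imp_continuous_on holomorphic_deriv fz_holomorphic open_ZD)
  then have "continuous_on (fluid_surf h \<eta>) (\<lambda>p. deriv fz (zc p))"
    by (rule continuous_on_compose2[OF _ continuous_zc surf_in_ZD])
  then show ?thesis by (rule continuous_on_eq) (use deriv_fz surf_in_ZD in blast)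
qed

end

section \<open>The velocity potential, the Dirichlet-Neumann operator and the vector field\<close>

context conformal_wave
begin

definition L :: real where "L = (1 + Cq) * NT * wt_sum"

lemma L_nonneg: "L \<ge> 0"
  unfolding L_def using Cq_nonneg NT_nonneg wt_sum_nonneg by (intro mult_nonneg_nonneg) auto

text \<open>\<open>Q'\<close> and \<open>Z'\<close> are real on the bottom line, so their imaginary
  parts are at most their Lipschitz constants times the distance \<open>t\<close> to it. The
  quotient gives \<open>(2 + 1/4) * (4/3)^2 = 4\<close>, and \<open>t\<close> is at most twice the
  physical height.\<close>

lemma GG_finite_depth:
  assumes fin: "h \<noteq> \<infinity>" and p: "(x, y) \<in> fluid h \<eta>"
  shows "\<bar>Im (GG (zc (x, y)))\<bar> \<le> 8 * L * (y + hr)"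
proof -
  obtain w where w: "w \<in> D" "Z w = Complex x y" "W (zc (x, y)) = w"
    using zc_surj[of x y] p fluid_subset by blast
  define w1 where "w1 = of_real (Re w) - \<i> * of_real H"
  define t where "t = \<bar>Im w + H\<bar>"
  have w1: "w1 \<in> D" unfolding w1_def by (rule bottom_in_D[OF fin])
  have ww: "w - w1 = \<i> * of_real (Im w + H)" by (simp add: w1_def complex_eq_iff)
  have cw: "cmod (w - w1) = t" unfolding ww norm_mult t_def by (simp add: norm_of_real del: of_real_add)
  have i1: "Im (Q' w1) = 0" using bottom_real[where f=T, OF fin T_even, of "Re w"] by (simp add: Q'_def w1_def qa_def)
  have i2: "Im (Z' w1) = 0" using bottom_real[where f=Y, OF fin Y_even, of "Re w"] by (simp add: Z'_def w1_def za_def)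
  have a1: "\<bar>Im (Q' w)\<bar> \<le> L * t"
    using lipschitz(3)[OF w(1) w1] abs_Im_le_cmod[of "Q' w - Q' w1"] i1 unfolding cw L_def[symmetric] by simp
  have a2: "\<bar>Im (Z' w)\<bar> \<le> 1 / 4 * t"
    using lipschitz(2)[OF w(1) w1] abs_Im_le_cmod[of "Z' w - Z' w1"] i2 unfolding cw by simp
  have b1: "\<bar>Re (Q' w)\<bar> \<le> L" using bounds(5)[OF w(1)] abs_Re_le_cmod[of "Q' w"] unfolding L_def by linarith
  have b2: "\<bar>Re (Z' w)\<bar> \<le> 2" using Z'_bounds(2)[OF w(1)] abs_Re_le_cmod[of "Z' w"] by linarith
  have t0: "t \<ge> 0" by (simp add: t_def)
  have "Im (Q' w / Z' w) = (Im (Q' w) * Re (Z' w) - Re (Q' w) * Im (Z' w)) / (cmod (Z' w))\<^sup>2"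
    by (simp add: Im_divide cmod_power2)
  moreover have "\<bar>Im (Q' w) * Re (Z' w) - Re (Q' w) * Im (Z' w)\<bar> \<le> (L * t) * 2 + L * (1 / 4 * t)"
  proof (rule order_trans[OF abs_triangle_ineq4], unfold abs_mult, rule add_mono)
    show "\<bar>Im (Q' w)\<bar> * \<bar>Re (Z' w)\<bar> \<le> (L * t) * 2" by (rule mult_mono[OF a1 b2]) (use L_nonneg t0 in auto)
    show "\<bar>Re (Q' w)\<bar> * \<bar>Im (Z' w)\<bar> \<le> L * (1 / 4 * t)" by (rule mult_mono[OF b1 a2]) (use L_nonneg in auto)
  qed
  moreover have "(3 / 4)\<^sup>2 \<le> (cmod (Z' w))\<^sup>2" using Z'_bounds(3)[OF w(1)] by (intro power_mono) auto
  ultimately have "\<bar>Im (Q' w / Z' w)\<bar> \<le> ((L * t) * 2 + L * (1 / 4 * t)) / (3 / 4)\<^sup>2"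
    using L_nonneg t0 by (simp only: abs_divide abs_power2) (intro frac_le, auto)
  also have "\<dots> = 4 * L * t" by (simp add: power2_eq_square)
  also have "\<dots> \<le> 4 * L * (2 * (y + hr))"
  proof -
    have "y + hr > 0" using p uminus_h[OF fin] by (auto simp: fluid_def)
    moreover have "\<bar>(y + hr) - (Im w + H)\<bar> \<le> 1 / 4 * t" unfolding t_def by (rule height_above_bottom[OF fin w(1,2)])
    moreover have "s \<le> 2 * a" if "a > 0" "\<bar>a - b\<bar> \<le> 1 / 4 * s" "s = \<bar>b\<bar>" for a b s :: real
      using that by linarith
    ultimately have "t \<le> 2 * (y + hr)" unfolding t_def by blast
    then show ?thesis using L_nonneg by (intro mult_left_mono) auto
  qed
  also have "\<dots> = 8 * L * (y + hr)" by simp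
  finally show ?thesis unfolding GG_def w(3) .
qed

text \<open>Only modes \<open>n < 0\<close> occur in \<open>Q'\<close>, and
  \<open>K * |n| \<ge> 1\<close> bounds each exponential by \<open>exp (Im w)\<close> where
  \<open>Im w < 0\<close>. The condition on \<open>y\<close> ensures this, because \<open>W\<close>
  moves points by at most 1.\<close>

lemma GG_infinite_depth:
  assumes inf: "h = \<infinity>" and y: "y \<le> - 2"
  shows "\<bar>Im (GG (zc (x, y)))\<bar> \<le> 2 * L * exp (y + 1)"
proof -
  have p: "(x, y) \<in> fluid_surf h \<eta>" using \<eta>_le[of x] y unfolding fluid_surf_def abs_le_iff by (simp add: inf)
  obtain w where w: "w \<in> D" "W (zc (x, y)) = w" "cmod (w - Complex x y) \<le> 1"
    using zc_surj[OF p] by blast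
  have Iw: "Im w \<le> y + 1" using w(3) abs_Im_le_cmod[of "w - Complex x y"] by simp
  have "cmod (fs K (\<lambda>n. m n * qa n) w) \<le> exp (y + 1) * L"
  proof -
    let ?C = "(1 + Cq) * NT"
    have b: "bd (real K * R) ?C (\<lambda>n. m n * qa n)" by (rule bd_m(2)[OF qa_bd])
    have C: "?C \<ge> 0" using Cq_nonneg NT_nonneg by simp
    have cb: "cbd (real K * R) ?C (\<lambda>n. of_real (m n * qa n))" using b by (simp only: cbd_of_real)
    have le: "norm (of_real (m n * qa n) * fexp K n w) \<le> exp (y + 1) * (?C * (1 / (1 + (of_int n)\<^sup>2)))" for n
    proof (cases "m n * qa n = 0")
      case True
      show ?thesis unfolding True using C by simp
    next
      case False
      then have n: "n < 0" using q_infinite[OF inf, of n] by (cases n "0::int" rule: linorder_cases) (auto simp: qa_def)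
      have "1 \<le> real K * (- of_int n)" using K_abs_ge_1[OF K, of n] n by simp
      then have "(real K * (- of_int n)) * Im w \<le> 1 * Im w" using Iw y by (intro mult_right_mono_neg) auto
      then have e: "norm (fexp K n w) \<le> exp (y + 1)" using Iw by (simp add: norm_fexp)
      have "wt (real K * R) n \<le> 1 / (1 + (of_int n)\<^sup>2)"
        unfolding wt_def using R_pos by (intro divide_right_mono) auto
      then have "?C * wt (real K * R) n \<le> ?C * (1 / (1 + (of_int n)\<^sup>2))" using C by (rule mult_left_mono)
      then have "\<bar>m n * qa n\<bar> \<le> ?C * (1 / (1 + (of_int n)\<^sup>2))" using bdD[OF b, of n] by linarith
      then have "norm (fexp K n w) * \<bar>m n * qa n\<bar> \<le> exp (y + 1) * (?C * (1 / (1 + (of_int n)\<^sup>2)))"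
        by (intro mult_mono e) auto
      then show ?thesis by (simp add: norm_mult abs_mult mult.commute)
    qed
    have "cmod (fs K (\<lambda>n. m n * qa n) w) \<le> (\<Sum>\<^sub>\<infinity>n::int. exp (y + 1) * (?C * (1 / (1 + (of_int n)\<^sup>2))))"
      by (rule norm_infsum_le[OF fser_has_sum[OF cb D_fdoms(5)[OF w(1)]] has_sum_infsum le])
        (intro summable_on_cmult_right summable_wt0)
    also have "\<dots> = exp (y + 1) * L" by (simp only: infsum_cmult_right' L_def wt_sum_def)
    finally show ?thesis .
  qed
  then have Q: "cmod (Q' w) \<le> exp (y + 1) * L" by (simp add: Q'_def)
  have "cmod (Q' w / Z' w) \<le> (exp (y + 1) * L) / (3 / 4)"
    unfolding norm_divide using Q Z'_bounds(3)[OF w(1)] L_nonneg by (intro frac_le) auto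
  also have "\<dots> \<le> 2 * L * exp (y + 1)" using L_nonneg by (simp add: field_simps)
  finally have "cmod (GG (zc (x, y))) \<le> 2 * L * exp (y + 1)" by (simp add: GG_def w(2))
  then show ?thesis using abs_Im_le_cmod order_trans by blast
qed

lemma bottom_limit: "uniform_limit UNIV (\<lambda>y x. pdy \<Phi> (x, real_of_ereal y)) (\<lambda>_. 0) (at_right (- h))"
  unfolding uniform_limit_iff
proof (intro allI impI)
  fix e :: real assume e: "e > 0"
  have "\<exists>b>- h. \<forall>y>- h. y < b \<longrightarrow> (\<forall>x. \<bar>pdy \<Phi> (x, real_of_ereal y)\<bar> < e)"
  proof (cases "h = \<infinity>")
    case True
    define M where "M = min (- 2) (ln (e / (2 * L + 1)) - 1)"
    have L1: "2 * L + 1 > 0" using L_nonneg by simp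
    have "\<bar>pdy \<Phi> (x, real_of_ereal y)\<bar> < e" if y: "- h < y" "y < ereal M" for x y
    proof -
      obtain r where r: "y = ereal r" using y True by (cases y) auto
      then have rM: "r < - 2" "r + 1 < ln (e / (2 * L + 1))" using y by (auto simp: M_def)
      then have p: "(x, r) \<in> fluid h \<eta>" using \<eta>_le[of x] True unfolding fluid_def abs_le_iff by simp
      have "exp (r + 1) < e / (2 * L + 1)" using rM(2) e L1 by (metis divide_pos_pos exp_less_mono exp_ln)
      then have "(2 * L + 1) * exp (r + 1) < e" using L1 by (simp add: pos_less_divide_eq mult.commute)
      moreover have "2 * L * exp (r + 1) \<le> (2 * L + 1) * exp (r + 1)" by (intro mult_right_mono) auto
      ultimately have "2 * L * exp (r + 1) < e" by linarith
      then have "\<bar>Im (GG (zc (x, r)))\<bar> < e" using GG_infinite_depth[OF True, of r x] rM by linarith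
      then show ?thesis using pd_\<Phi>(2)[OF p] by (simp add: r)
    qed
    then show ?thesis using True by (intro exI[of _ "ereal M"]) auto
  next
    case False
    define d where "d = min (H / 2) (e / (8 * L + 1))"
    have L1: "8 * L + 1 > 0" using L_nonneg by simp
    have d: "d > 0" using H(1)[OF False] e L1 by (simp add: d_def)
    have "\<bar>pdy \<Phi> (x, real_of_ereal y)\<bar> < e" if y: "- h < y" "y < ereal (- hr + d)" for x y
    proof -
      obtain r where r: "y = ereal r" using y False uminus_h[OF False] by (cases y) auto
      have rr: "- hr < r" "r + hr < d" using y unfolding uminus_h[OF False] r by auto
      then have p: "(x, r) \<in> fluid h \<eta>"
        using \<eta>_above_bottom[OF False, of x] H(1)[OF False] uminus_h[OF False] unfolding fluid_def d_def by simp
      have "8 * L * (r + hr) \<le> (8 * L + 1) * (r + hr)" using rr by (intro mult_right_mono) auto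
      also have "\<dots> < (8 * L + 1) * d" using rr L1 by (intro mult_strict_left_mono)
      also have "\<dots> \<le> (8 * L + 1) * (e / (8 * L + 1))" using L1 by (intro mult_left_mono) (auto simp: d_def)
      also have "\<dots> = e" using L1 by simp
      finally have "\<bar>Im (GG (zc (x, r)))\<bar> < e" using GG_finite_depth[OF False p] by linarith
      then show ?thesis using pd_\<Phi>(2)[OF p] by (simp add: r)
    qed
    then show ?thesis using d uminus_h[OF False] by (intro exI[of _ "ereal (- hr + d)"]) auto
  qed
  then show "\<forall>\<^sub>F y in at_right (- h). \<forall>x\<in>UNIV. dist (pdy \<Phi> (x, real_of_ereal y)) 0 < e"
    unfolding eventually_at_right[OF \<eta>_gt[of 0]] by auto
qed

lemma potential: "is_potential h \<eta> \<psi> \<Phi>"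
  unfolding is_potential_def
proof (intro conjI allI ballI bottom_limit)
  show "- h < ereal (\<eta> x)" for x by (rule \<eta>_gt)
  show "case p of (x, y) \<Rightarrow> \<Phi> (x + 2 * pi, y) = \<Phi> (x, y)" if pf: "p \<in> fluid h \<eta>" for p
  proof -
    obtain x y where p: "p = (x, y)" by fastforce
    obtain w where w: "w \<in> D" "Z w = Complex x y"
      using zc_surj[of x y] pf fluid_subset p by blast
    have "w + 2 * of_real pi \<in> D" using w by (auto simp: D_def)
    moreover have "Z (w + 2 * of_real pi) = Complex (x + 2 * pi) y" by (simp add: shift_periodic w complex_eq_iff)
    ultimately have "W (Complex (x + 2 * pi) y) = w + 2 * of_real pi" using W_Z by metis
    moreover have "W (Complex x y) = w" using W_Z w by metis
    ultimately show ?thesis by (simp add: p \<Phi>_def zc_def fz_def shift_periodic)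
  qed
  have sub: "zc ` fluid h \<eta> \<subseteq> Z ` D" using surf_in_ZD fluid_subset by blast
  show "harmonic_on (fluid h \<eta>) \<Phi>"
    by (rule Re_holomorphic_harmonic[OF open_ZD fz_holomorphic open_fluid[OF \<eta>_continuous] sub]) (simp add: \<Phi>_def)
  have "continuous_on (fluid_surf h \<eta>) (\<lambda>p. fz (zc p))"
    by (rule continuous_on_compose2[OF holomorphic_on_imp_continuous_on[OF fz_holomorphic] continuous_zc surf_in_ZD])
  then show "continuous_on (fluid_surf h \<eta>) \<Phi>" unfolding \<Phi>_def[abs_def] by (intro continuous_intros)
  show "\<Phi> (x, \<eta> x) = \<psi> x" for x
    by (simp add: \<Phi>_def fz_def W_surface on_real \<psi>_def)
qed

text \<open>On the surface the complex velocity is \<open>(P' + i T') / (X' + i Y')\<close>. In the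
  combination with the slope \<open>Y' / X'\<close> the contribution of \<open>P'\<close> cancels
  and the factor \<open>X'^2 + Y'^2\<close> drops out.\<close>

lemma DN: "dirichlet_neumann h \<eta> \<psi> = (\<lambda>x. - (T' (A x) / X' (A x)))"
proof (rule dirichlet_neumann_eqI[OF potential \<eta>_continuous \<eta>_periodic])
  fix x
  let ?F = "at (x, \<eta> x) within fluid h \<eta>"
  have s: "(x, \<eta> x) \<in> fluid_surf h \<eta>" using \<eta>_gt by (simp add: fluid_surf_def)
  have "((\<lambda>p. GG (zc p)) \<longlongrightarrow> GG (zc (x, \<eta> x))) (at (x, \<eta> x) within fluid_surf h \<eta>)"
    using GG_continuous s by (simp add: continuous_on_def)
  then have G: "((\<lambda>p. GG (zc p)) \<longlongrightarrow> GG (zc (x, \<eta> x))) ?F"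
    by (rule tendsto_within_subset) (rule fluid_subset)
  have cA: "continuous_on UNIV A" "continuous_on UNIV X'" "continuous_on UNIV Y'"
    by (auto intro!: DERIV_continuous_on[OF has_field_derivative_at_within] A X'_deriv Y'_deriv)
  have c\<eta>': "continuous_on UNIV (deriv \<eta>)"
    unfolding deriv_\<eta>
    by (intro continuous_intros continuous_on_compose2[OF cA(2) cA(1)] continuous_on_compose2[OF cA(3) cA(1)])
      (use X'_ge(2) in \<open>auto simp: less_imp_neq[symmetric]\<close>)
  have "continuous_on UNIV (\<lambda>p::real \<times> real. deriv \<eta> (fst p))"
    by (rule continuous_on_compose2[OF c\<eta>']) (auto intro: continuous_intros)
  then have "((\<lambda>p::real \<times> real. deriv \<eta> (fst p)) \<longlongrightarrow> deriv \<eta> (fst (x, \<eta> x))) (at (x, \<eta> x) within UNIV)"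
    by (simp add: continuous_on_def)
  then have E: "((\<lambda>p::real \<times> real. deriv \<eta> (fst p)) \<longlongrightarrow> deriv \<eta> x) ?F"
    by (auto intro: tendsto_within_subset)
  have "((\<lambda>p. - Im (GG (zc p)) - Re (GG (zc p)) * deriv \<eta> (fst p)) \<longlongrightarrow>
      - Im (GG (zc (x, \<eta> x))) - Re (GG (zc (x, \<eta> x))) * deriv \<eta> x) ?F"
    by (intro tendsto_intros G E)
  moreover have "\<forall>\<^sub>F p in ?F. - Im (GG (zc p)) - Re (GG (zc p)) * deriv \<eta> (fst p)
      = pdy \<Phi> p - pdx \<Phi> p * deriv \<eta> (fst p)"
    by (auto simp: eventually_at_filter pd_\<Phi>)
  ultimately have lim: "((\<lambda>p. pdy \<Phi> p - pdx \<Phi> p * deriv \<eta> (fst p)) \<longlongrightarrow>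
      - Im (GG (zc (x, \<eta> x))) - Re (GG (zc (x, \<eta> x))) * deriv \<eta> x) ?F"
    by (rule Lim_transform_eventually)
  define a b l t where "a = X' (A x)" and "b = Y' (A x)" and "l = P' (A x)" and "t = T' (A x)"
  have a: "a > 0" using X'_ge by (simp add: a_def)
  then have J: "a\<^sup>2 + b\<^sup>2 > 0" by (simp add: add_pos_nonneg)
  have GG: "GG (zc (x, \<eta> x)) = Complex l t / Complex a b"
    by (simp add: GG_def W_surface on_real a_def b_def l_def t_def)
  have "- Im (GG (zc (x, \<eta> x))) - Re (GG (zc (x, \<eta> x))) * deriv \<eta> x
      = - ((t * a - l * b) / (a\<^sup>2 + b\<^sup>2)) - (l * a + t * b) / (a\<^sup>2 + b\<^sup>2) * (b / a)"
    unfolding GG deriv_\<eta> by (simp add: Re_divide Im_divide a_def b_def)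
  also have "\<dots> = - ((t * a - l * b) * a + (l * a + t * b) * b) / ((a\<^sup>2 + b\<^sup>2) * a)"
  proof -
    have "- (u / S) - w / S * (b / a) = - (u * a + w * b) / (S * a)" if "S > 0" for u w S
      using a that by (simp add: field_simps)
    then show ?thesis using J by blast
  qed
  also have "(t * a - l * b) * a + (l * a + t * b) * b = t * (a\<^sup>2 + b\<^sup>2)"
    by (simp add: power2_eq_square algebra_simps)
  also have "- (t * (a\<^sup>2 + b\<^sup>2)) / ((a\<^sup>2 + b\<^sup>2) * a) = - (t / a)" using a J by simp
  finally show "((\<lambda>p. pdy \<Phi> p - pdx \<Phi> p * deriv \<eta> (fst p)) \<longlongrightarrow> - (T' (A x) / X' (A x))) ?F"
    using lim by (simp add: t_def a_def)
qed

lemma DN_kinematic: "dirichlet_neumann h \<eta> \<psi> x = - ((c + \<gamma> * \<eta> x) * deriv \<eta> x)"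
  by (simp add: DN T' deriv_\<eta> \<eta>_def)

text \<open>In the conformal parameter the quotient is \<open>Y' / sqrt (X'^2 + Y'^2)\<close>, and
  differentiation in \<open>x\<close> is differentiation in the parameter divided by
  \<open>X'\<close>.\<close>

lemma curvature:
  "deriv (\<lambda>z. deriv \<eta> z / sqrt (1 + (deriv \<eta> z)\<^sup>2)) x
    = (Y'' (A x) * X' (A x) - Y' (A x) * X'' (A x)) / (sqrt ((X' (A x))\<^sup>2 + (Y' (A x))\<^sup>2)) ^ 3"
proof -
  let ?J = "\<lambda>a. (X' a)\<^sup>2 + (Y' a)\<^sup>2"
  have J: "?J a > 0" for a using X'_ge(2)[of a] by (simp add: add_pos_nonneg)
  have "deriv \<eta> z / sqrt (1 + (deriv \<eta> z)\<^sup>2) = Y' (A z) / sqrt (?J (A z))" for z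
  proof -
    have X: "X' (A z) > 0" by (rule X'_ge)
    have "1 + (deriv \<eta> z)\<^sup>2 = ?J (A z) / (X' (A z))\<^sup>2"
      using X by (simp add: deriv_\<eta> power_divide field_simps)
    then have "sqrt (1 + (deriv \<eta> z)\<^sup>2) = sqrt (?J (A z)) / X' (A z)"
      using X by (simp add: real_sqrt_divide)
    then show ?thesis using X by (simp add: deriv_\<eta>)
  qed
  moreover have "((\<lambda>a. Y' a / sqrt (?J a)) has_real_derivative
      X' a * (Y'' a * X' a - Y' a * X'' a) / (sqrt (?J a)) ^ 3) (at a)" for a
  proof -
    define s where "s = sqrt (?J a)"
    have s: "s > 0" "s\<^sup>2 = ?J a" using J[of a] by (simp_all add: s_def)
    have "((\<lambda>a. ?J a) has_real_derivative 2 * X' a * X'' a + 2 * Y' a * Y'' a) (at a)"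
      by (auto intro!: derivative_eq_intros X'_deriv Y'_deriv)
    from DERIV_chain2[OF DERIV_real_sqrt[OF J] this]
    have "((\<lambda>a. sqrt (?J a)) has_real_derivative inverse s / 2 * (2 * X' a * X'' a + 2 * Y' a * Y'' a)) (at a)"
      by (simp add: s_def)
    moreover have "sqrt (?J a) \<noteq> 0" using s(1) unfolding s_def by (metis less_irrefl)
    ultimately have "((\<lambda>a. Y' a / sqrt (?J a)) has_real_derivative
      (Y'' a * s - Y' a * (inverse s / 2 * (2 * X' a * X'' a + 2 * Y' a * Y'' a))) / (s * s)) (at a)"
      unfolding s_def by (rule DERIV_divide[OF Y'_deriv])
    moreover have "(Y'' a * s - Y' a * (inverse s / 2 * (2 * X' a * X'' a + 2 * Y' a * Y'' a))) / (s * s)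
        = (Y'' a * s\<^sup>2 - Y' a * (X' a * X'' a + Y' a * Y'' a)) / s ^ 3"
      using s(1) by (simp add: field_simps power2_eq_square power3_eq_cube)
    moreover have "Y'' a * s\<^sup>2 - Y' a * (X' a * X'' a + Y' a * Y'' a) = X' a * (Y'' a * X' a - Y' a * X'' a)"
      unfolding s(2) by (simp add: power2_eq_square algebra_simps)
    ultimately show ?thesis by (simp add: s_def)
  qed
  from comp_A_deriv[OF this, of x]
  have "((\<lambda>z. Y' (A z) / sqrt (?J (A z))) has_real_derivative
      X' (A x) * (Y'' (A x) * X' (A x) - Y' (A x) * X'' (A x)) / (sqrt (?J (A x))) ^ 3 / X' (A x)) (at x)" .
  ultimately have "deriv (\<lambda>z. deriv \<eta> z / sqrt (1 + (deriv \<eta> z)\<^sup>2)) x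
      = X' (A x) * (Y'' (A x) * X' (A x) - Y' (A x) * X'' (A x)) / (sqrt (?J (A x))) ^ 3 / X' (A x)"
    by (simp add: DERIV_imp_deriv)
  then show ?thesis using X'_ge(2)[of "A x"] by simp
qed

definition mm :: real where "mm = conv T (\<lambda>n. single 1 n + lam n) 0"

lemma bernoulli_eq:
  "(g * Yr a - c\<^sup>2 / 2 - \<gamma> * mm) * ((X' a)\<^sup>2 + (Y' a)\<^sup>2) + (P' a - (c + \<gamma> * Yr a) * X' a)\<^sup>2 / 2
    - \<kappa> * (Y'' a * X' a - Y' a * X'' a) / sqrt ((X' a)\<^sup>2 + (Y' a)\<^sup>2) = 0"
  using bern unfolding bernoulli_def Let_def
  unfolding hr_def[symmetric] H_def[symmetric] q_def[symmetric] m_def[symmetric]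
    T_def[symmetric] lam_def[symmetric] X'_def[symmetric] Y'_def[symmetric] X''_def[symmetric]
    Y''_def[symmetric] P'_def[symmetric] Yr_def[symmetric] mm_def[symmetric]
  by blast

text \<open>Substituting \<open>x = Xr a\<close> turns the mean over \<open>x\<close> into the
  zeroth Fourier coefficient of the product of \<open>Tr\<close> and \<open>X'\<close>. It is the
  constant by which the primitive of the Dirichlet-Neumann term is normalized.\<close>

lemma mean_level: "avg (\<lambda>x. Tr (A x)) = mm"
proof -
  have contTA: "continuous_on S (\<lambda>x. Tr (A x))" for S
    by (rule DERIV_continuous_on[OF has_field_derivative_at_within[OF comp_A_deriv[OF Tr_deriv]]])
  have "((\<lambda>a. X' a *\<^sub>R Tr (A (Xr a))) has_integral (integral {Xr 0..Xr (2 * pi)} (\<lambda>x. Tr (A x)))) {0..2 * pi}"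
  proof (rule has_integral_substitution)
    show "Xr ` {0..2 * pi} \<subseteq> {- 1..2 * pi + 1}"
    proof
      fix v assume "v \<in> Xr ` {0..2 * pi}"
      then obtain x where "x \<in> {0..2 * pi}" "v = Xr x" by auto
      then show "v \<in> {- 1..2 * pi + 1}" using Xr_near[of x] unfolding abs_le_iff by simp
    qed
  qed (use Xr_period contTA in \<open>auto intro: has_field_derivative_at_within Xr_deriv\<close>)
  then have "integral {0..2 * pi} (\<lambda>x. Tr (A x)) = integral {0..2 * pi} (\<lambda>a. X' a * Tr a)"
    by (simp add: Xr_period A integral_unique)
  moreover have "((\<lambda>a. Tr a * X' a) has_integral 2 * pi * mm) {0..2 * pi}"
  proof -
    have gl: "good (real K * R) 1 lam"
      unfolding lam_def[abs_def] using good_q[OF goods(2)] by simp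
    have gs: "good (real K * R) 1 (\<lambda>n. single 1 n + lam n)" by (intro good_add good_single gl)
    define F where "F = conv T (\<lambda>n. single 1 n + lam n)"
    have gF: "good (real K * R) 1 F" unfolding F_def using good_conv[OF KR_nonneg goods(4) gs] by simp
    have ev: "ev K F a = Tr a * X' a" for a
      unfolding F_def Tr_def X'_def
      by (simp add: ev_conv_even[OF KR_nonneg goods(4) gs] ev_add(1)[OF KR_nonneg good_single gl] ev_single)
    obtain C where C: "bd (real K * R) C F" using gF by (auto simp: good_def)
    have "((\<lambda>x. fs K F (of_real x)) has_integral complex_of_real (2 * pi * F 0)) {0..2 * pi}"
      using fser_coeff[OF K R_pos(1), of C "\<lambda>n. of_real (F n)" 0] C by (simp add: cbd_of_real)
    from has_integral_Re[OF this] have "((\<lambda>x. ev K F x) has_integral 2 * pi * F 0) {0..2 * pi}"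
      by (simp add: ev_def)
    moreover have "F 0 = mm" by (simp add: F_def mm_def)
    ultimately show ?thesis by (simp add: ev)
  qed
  then have "integral {0..2 * pi} (\<lambda>a. X' a * Tr a) = 2 * pi * mm" by (simp add: integral_unique mult.commute)
  ultimately show ?thesis by (simp add: avg_def)
qed

lemma TrA_deriv: "((\<lambda>x. Tr (A x)) has_real_derivative T' (A x) / X' (A x)) (at x)"
  by (rule comp_A_deriv[OF Tr_deriv])

lemma dinv_DN: "dinv (dirichlet_neumann h \<eta> \<psi>) = (\<lambda>x. mm - Tr (A x))"
proof (rule dinv_eqI)
  show "((\<lambda>x. mm - Tr (A x)) has_real_derivative dirichlet_neumann h \<eta> \<psi> x) (at x)" for x
    using DERIV_diff[OF DERIV_const TrA_deriv] by (simp add: DN)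
  show "periodic (\<lambda>x. mm - Tr (A x))" by (simp add: periodic_def A_periodic real_periodic)
  have i: "(\<lambda>x. Tr (A x)) integrable_on {0..2 * pi}"
    by (rule integrable_continuous_interval,
        rule DERIV_continuous_on[OF has_field_derivative_at_within[OF TrA_deriv]])
  have I: "integral {0..2 * pi} (\<lambda>x. Tr (A x)) = 2 * pi * mm"
    unfolding mean_level[symmetric] by (simp add: avg_def)
  have "((\<lambda>x. mm) has_integral 2 * pi * mm) {0..2 * pi}"
    using has_integral_const_real[of mm 0 "2 * pi"] by simp
  from has_integral_diff[OF this integrable_integral[OF i, unfolded I]]
  show "avg (\<lambda>x. mm - Tr (A x)) = 0" by (simp add: avg_def integral_unique)
qed

lemma N1_eq: "N1 h \<gamma> (\<eta>, \<psi>) = (\<lambda>x. - c * deriv \<eta> x)"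
  by (rule ext) (simp add: N1_def DN_kinematic distrib_right)

text \<open>Bernoulli's law divided by \<open>J\<close> eliminates the curvature. The terms with
  \<open>1 / J\<close> cancel against those from the quadratic term, and the constants against the
  mean level.\<close>

lemma N2_eq: "N2 g h \<kappa> \<gamma> (\<eta>, \<psi>) x = - c * deriv \<psi> x"
proof -
  define a b l y where "a = X' (A x)" and "b = Y' (A x)" and "l = P' (A x)" and "y = Yr (A x)"
  define J where "J = a\<^sup>2 + b\<^sup>2"
  define k where "k = Y'' (A x) * X' (A x) - Y' (A x) * X'' (A x)"
  define v where "v = c + \<gamma> * y"
  have a: "a > 0" using X'_ge by (simp add: a_def)
  then have J: "J > 0" by (simp add: J_def add_pos_nonneg)
  have d: "\<eta> x = y" "deriv \<eta> x = b / a" "deriv \<psi> x = l / a"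
    by (simp_all add: deriv_\<eta> deriv_\<psi> \<eta>_def a_def b_def l_def y_def)
  have G: "dirichlet_neumann h \<eta> \<psi> x = - v * (b / a)"
    unfolding DN_kinematic d v_def by (rule minus_mult_left)
  have curv: "deriv (\<lambda>z. deriv \<eta> z / sqrt (1 + (deriv \<eta> z)\<^sup>2)) x = k / (sqrt J) ^ 3"
    unfolding curvature k_def J_def a_def b_def ..
  have sJ: "(sqrt J) ^ 3 = J * sqrt J" using J by (simp add: power3_eq_cube)
  have B: "(g * y - c\<^sup>2 / 2 - \<gamma> * mm) * J + (l - v * a)\<^sup>2 / 2 - \<kappa> * k / sqrt J = 0"
    using bernoulli_eq[of "A x"] by (simp add: a_def b_def l_def y_def J_def k_def v_def)
  have K: "\<kappa> * (k / (sqrt J) ^ 3) = g * y - c\<^sup>2 / 2 - \<gamma> * mm + (l - v * a)\<^sup>2 / (2 * J)"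
  proof -
    have "\<kappa> * k / sqrt J = (g * y - c\<^sup>2 / 2 - \<gamma> * mm) * J + (l - v * a)\<^sup>2 / 2" using B by simp
    then have "(\<kappa> * k / sqrt J) / J = ((g * y - c\<^sup>2 / 2 - \<gamma> * mm) * J + (l - v * a)\<^sup>2 / 2) / J" by simp
    moreover have "(\<kappa> * k / sqrt J) / J = \<kappa> * (k / (sqrt J) ^ 3)" unfolding sJ by (simp add: mult.commute)
    moreover have "((g * y - c\<^sup>2 / 2 - \<gamma> * mm) * J + (l - v * a)\<^sup>2 / 2) / J
        = g * y - c\<^sup>2 / 2 - \<gamma> * mm + (l - v * a)\<^sup>2 / (2 * J)"
      using J by (simp add: field_simps)
    ultimately show ?thesis by simp
  qed
  \<comment> \<open>The derivative of \<open>\<psi>\<close> relative to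
    \<open>c + \<gamma> * \<eta>\<close>. As \<open>b^2 = J - a^2\<close>, the quadratic term of
    \<open>N2\<close> is \<open>p^2 / 2\<close> minus the kinetic term of Bernoulli's law.\<close>
  define p where "p = l / a - v"
  have S: "(b / a * (l / a) + - v * (b / a))\<^sup>2 / (2 * (1 + (b / a)\<^sup>2)) = p\<^sup>2 / 2 - (l - v * a)\<^sup>2 / (2 * J)"
  proof -
    have 1: "b / a * (l / a) + - v * (b / a) = b / a * p" by (simp add: p_def algebra_simps)
    have 2: "1 + (b / a)\<^sup>2 = J / a\<^sup>2" using a by (simp add: J_def power_divide field_simps)
    have 3: "l - v * a = a * p" using a by (simp add: p_def field_simps)
    have "(b / a * p)\<^sup>2 / (2 * (J / a\<^sup>2)) = b\<^sup>2 * p\<^sup>2 / (2 * J)"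
      using a by (simp add: power_mult_distrib power_divide)
    moreover have "p\<^sup>2 / 2 - (a * p)\<^sup>2 / (2 * J) = (J - a\<^sup>2) * p\<^sup>2 / (2 * J)"
      using J by (simp add: field_simps power_mult_distrib)
    moreover have "J - a\<^sup>2 = b\<^sup>2" by (simp add: J_def)
    ultimately show ?thesis unfolding 1 2 3 by simp
  qed
  have Tr': "Tr (A x) = c * y + \<gamma> / 2 * y\<^sup>2" by (simp add: Tr y_def)
  have "N2 g h \<kappa> \<gamma> (\<eta>, \<psi>) x = - g * y - (l / a)\<^sup>2 / 2 + (p\<^sup>2 / 2 - (l - v * a)\<^sup>2 / (2 * J))
      + (g * y - c\<^sup>2 / 2 - \<gamma> * mm + (l - v * a)\<^sup>2 / (2 * J)) + \<gamma> * y * (l / a)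
      + \<gamma> * (mm - (c * y + \<gamma> / 2 * y\<^sup>2))"
    unfolding N2_def prod.case curv dinv_DN Tr' K unfolding d G S ..
  also have "\<dots> = - c * (l / a)"
  proof -
    have "- g * y - r\<^sup>2 / 2 + ((r - (c + \<gamma> * y))\<^sup>2 / 2 - S)
      + (g * y - c\<^sup>2 / 2 - \<gamma> * mm + S) + \<gamma> * y * r + \<gamma> * (mm - (c * y + \<gamma> / 2 * y\<^sup>2)) = - c * r" for r S
      by (simp add: power2_eq_square field_simps)
    then show ?thesis unfolding p_def v_def .
  qed
  finally show ?thesis by (simp add: d)
qed

end

section \<open>Regularity in the physical variable and non-triviality\<close>

context conformal_wave
begin

text \<open>The contour shift needs a holomorphic extension of \<open>Xr\<close> that is real on the
  real axis, which \<open>Z\<close> is not. \<open>XX\<close> uses the symbol \<open>q\<close> in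
  place of \<open>1 - q\<close> and lives on a two-sided strip, also in infinite depth.\<close>

lemma pulled_back_coeffs:
  assumes u: "continuous_on UNIV u" and f: "bd (real K * R) C f"
    and ua: "\<And>a. complex_of_real (u (Xr a)) = s * fs K f (of_real a)" and s: "cmod s = 1"
  shows "cbd (\<sigma> + 1) (4 * C * wt_sum) (fourier_coeff u)"
proof -
  have b1: "bd (real K * R) (Cq * N) (\<lambda>n. q n * Y n)" by (intro bd_symbol[OF bd_m(1)[OF Y_bd]] q_le)
  have b2: "bd (real K * R) (Cq * N) (\<lambda>n. q n * (m n * Y n))" by (intro bd_symbol[OF bd_m(2)[OF Y_bd]] q_le)
  have holo: "fs K F holomorphic_on strip R" if "bd (real K * R) B F" for B F
    by (rule fser_holomorphic[OF _ open_strip strip_fdom]) (use that in \<open>simp_all add: cbd_of_real\<close>)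
  have le: "cmod (fs K F w) \<le> B * wt_sum" if "bd (real K * R) B F" "w \<in> strip R" for B F w
    by (rule fs_le[OF that(1) strip_fdom[OF that(2)]])
  have small': "Cq * N * wt_sum \<le> 1"
  proof -
    have "(1 + Cq) * N * wt_sum = N * wt_sum + Cq * N * wt_sum" by (simp add: distrib_right)
    with small mult_nonneg_nonneg[OF N_nonneg wt_sum_nonneg] show ?thesis by linarith
  qed
  define XX where "XX w = w - \<i> * fs K (\<lambda>n. q n * Y n) w" for w
  define XD where "XD w = 1 + fs K (\<lambda>n. q n * (m n * Y n)) w" for w
  have C0: "C * wt_sum \<ge> 0" using bd_nonneg[OF f] wt_sum_nonneg by simp
  \<comment> \<open>Shifting by \<open>\<sigma> + 3\<close> gives the rate
    \<open>\<sigma> + 2\<close>; \<open>exp_le_wt\<close> then trades one more unit for the weight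
    of rate \<open>\<sigma> + 1\<close>.\<close>
  have main: "cmod (fourier_coeff u k) \<le> 2 * (C * wt_sum) * exp (- ((\<sigma> + 3) - 1) * \<bar>of_int k\<bar>)" for k
  proof (rule pullback_coeff_bound[where X=Xr and X'=X' and XX=XX and XD=XD and FF="\<lambda>w. s * fs K f w" and R=R])
    show "XX holomorphic_on strip R" unfolding XX_def by (intro holomorphic_intros holo[OF b1])
    show "XD holomorphic_on strip R" unfolding XD_def by (intro holomorphic_intros holo[OF b2])
    show "(\<lambda>w. s * fs K f w) holomorphic_on strip R" by (intro holomorphic_intros holo[OF f])
    show "XX (of_real x) = of_real (Xr x)" for x
      using fser_odd[of "\<lambda>n. q n * Y n" K x] by (simp add: XX_def Xr_def Y_even flip: mult.assoc)
    show "XD (of_real x) = of_real (X' x)" for x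
      using fser_even[of "\<lambda>n. q n * (m n * Y n)" K x] by (simp add: XD_def X'_def lam_def[abs_def] Y_even)
    show "s * fs K f (of_real x) = of_real (u (Xr x))" for x using ua by simp
    show "XX (w + 2 * of_real pi) = XX w + 2 * of_real pi" "XD (w + 2 * of_real pi) = XD w"
      "s * fs K f (w + 2 * of_real pi) = s * fs K f w" for w
      by (simp_all add: XX_def XD_def fser_periodic)
    fix w assume w: "w \<in> strip R"
    show "cmod (XX w - w) \<le> 1" using le[OF b1 w] small' by (simp add: XX_def norm_mult)
    show "cmod (XD w) \<le> 2"
      using norm_triangle_ineq[of 1 "fs K (\<lambda>n. q n * (m n * Y n)) w"] le[OF b2 w] small' by (simp add: XD_def)
    show "cmod (s * fs K f w) \<le> C * wt_sum" using le[OF f w] by (simp add: norm_mult s)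
  qed (use u Xr_deriv Xr_period \<sigma> R_pos in auto)
  show ?thesis unfolding cbd_def
  proof
    fix k
    have "2 * (C * wt_sum) * exp (- ((\<sigma> + 1) + 1) * \<bar>of_int k\<bar>) \<le> 2 * (C * wt_sum) * (2 * wt (\<sigma> + 1) k)"
      using C0 by (intro mult_left_mono exp_le_wt) auto
    then show "cmod (fourier_coeff u k) \<le> 4 * C * wt_sum * wt (\<sigma> + 1) k"
      using main[of k] by (simp add: algebra_simps)
  qed
qed

lemma \<eta>_coeffs: "cbd (\<sigma> + 1) (4 * N * wt_sum) (fourier_coeff \<eta>)"
  by (rule pulled_back_coeffs[where s=1 and f=Y, OF \<eta>_continuous bd_m(1)[OF Y_bd]])
    (use fser_even[of Y K] Y_even in \<open>simp_all add: \<eta>_def A Yr_def\<close>)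

lemma \<psi>_coeffs: "cbd (\<sigma> + 1) (4 * (Cq * NT) * wt_sum) (fourier_coeff \<psi>)"
proof (rule pulled_back_coeffs[where s="- \<i>" and f="\<lambda>n. q n * T n", OF \<psi>_continuous])
  show "bd (real K * R) (Cq * NT) (\<lambda>n. q n * T n)" by (intro bd_symbol[OF bd_m(1)[OF T_bd]] q_le)
  show "complex_of_real (\<psi> (Xr a)) = - \<i> * fs K (\<lambda>n. q n * T n) (of_real a)" for a
    using fser_odd[of "\<lambda>n. q n * T n" K a] T_even by (simp add: \<psi>_def A Pr_def flip: mult.assoc)
qed simp

text \<open>\<open>Pr\<close> and \<open>Xr\<close> are sine-type, so the inverse \<open>A\<close>
  is odd and with it \<open>\<psi>\<close>.\<close>

lemma avg_\<psi>: "avg \<psi> = 0"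
proof -
  have "Xr (- a) = - Xr a" for a by (simp add: Xr_def od_uminus)
  then have "A (- x) = - A x" for x by (metis A(1) A(2))
  then have odd: "\<psi> (- x) = - \<psi> x" for x by (simp add: \<psi>_def Pr_def od_uminus)
  have per: "\<psi> (x + 2 * pi) = \<psi> x" for x using \<psi>_periodic by (simp add: periodic_def)
  have "integral {0..2 * pi} \<psi> = integral {- (2 * pi)..- 0} (\<lambda>x. \<psi> (- x))"
    by (rule Henstock_Kurzweil_Integration.integral_reflect_real[symmetric])
  also have "\<dots> = - integral {- (2 * pi)..0} \<psi>" by (simp add: odd)
  also have "integral {- (2 * pi)..0} \<psi> = integral {- (2 * pi)..0} (\<psi> \<circ> (\<lambda>x. x + 2 * pi))"
    by (simp add: o_def per)
  also have "\<dots> = integral {- (2 * pi) + 2 * pi..0 + 2 * pi} \<psi>"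
    by (rule integral_shift[OF \<psi>_continuous])
  finally show ?thesis by (simp add: avg_def)
qed

definition \<zeta> :: "real \<Rightarrow> real" where "\<zeta> x = \<psi> x - \<gamma> / 2 * dinv (proj_perp \<eta>) x"

definition Czeta :: real where "Czeta = 4 * (Cq * NT) * wt_sum + \<bar>\<gamma> / 2\<bar> * (4 * N * wt_sum)"

lemma \<sigma>1: "\<sigma> + 1 > 0" using \<sigma> by simp

lemmas primitive = dinv_series[OF \<eta>_continuous \<eta>_periodic \<sigma>1 \<eta>_coeffs]

lemma \<zeta>_deriv: "(\<zeta> has_real_derivative deriv \<psi> x - \<gamma> / 2 * (\<eta> x - avg \<eta>)) (at x)"
  unfolding \<zeta>_def[abs_def] deriv_\<psi>
  by (rule DERIV_diff[OF \<psi>_deriv DERIV_cmult[OF primitive(3)]])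

lemma \<eta>_series: "complex_of_real (\<eta> x) = fser 1 (fourier_coeff \<eta>) (of_real x)"
  by (rule fourier_inversion[OF \<eta>_continuous \<eta>_periodic \<sigma>1 \<eta>_coeffs])

lemma \<zeta>_series: "\<exists>a. cbd (\<sigma> + 1) Czeta a \<and> (\<forall>x. complex_of_real (\<zeta> x) = fser 1 a (of_real x))"
proof -
  define b where "b n = (if n = 0 then 0 else fourier_coeff \<eta> n / (\<i> * of_int n))" for n
  note P = primitive(1,2)[folded b_def]
  define a where "a n = fourier_coeff \<psi> n + of_real (- (\<gamma> / 2)) * b n" for n
  have "cbd (\<sigma> + 1) Czeta a" unfolding cbd_def
  proof
    fix n
    have "cmod (a n) \<le> cmod (fourier_coeff \<psi> n) + \<bar>\<gamma> / 2\<bar> * cmod (b n)"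
      unfolding a_def by (rule order_trans[OF norm_triangle_ineq]) (simp add: norm_mult)
    also have "\<dots> \<le> 4 * (Cq * NT) * wt_sum * wt (\<sigma> + 1) n + \<bar>\<gamma> / 2\<bar> * (4 * N * wt_sum * wt (\<sigma> + 1) n)"
      using \<psi>_coeffs P(2) by (intro add_mono mult_left_mono) (auto simp: cbd_def)
    also have "\<dots> = Czeta * wt (\<sigma> + 1) n" by (simp add: Czeta_def distrib_right mult.assoc)
    finally show "cmod (a n) \<le> Czeta * wt (\<sigma> + 1) n" .
  qed
  moreover have "complex_of_real (\<zeta> x) = fser 1 a (of_real x)" for x
  proof -
    have w: "complex_of_real x \<in> strip (\<sigma> + 1)" using \<sigma>1 by (simp add: strip_def)
    have s1: "(\<lambda>n. fourier_coeff \<psi> n * fexp 1 n (of_real x)) summable_on UNIV"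
      by (rule fser_summable[OF _ strip_fdom[OF w]]) (use \<psi>_coeffs in simp)
    have s2: "(\<lambda>n. b n * fexp 1 n (of_real x)) summable_on UNIV"
      by (rule fser_summable[OF _ strip_fdom[OF w]]) (use P(2) in simp)
    have s3: "(\<lambda>n. (of_real (- (\<gamma> / 2)) * b n) * fexp 1 n (of_real x)) summable_on UNIV"
      unfolding mult.assoc by (rule summable_on_cmult_right[OF s2])
    have "fser 1 a (of_real x) = fser 1 (fourier_coeff \<psi>) (of_real x) + of_real (- (\<gamma> / 2)) * fser 1 b (of_real x)"
      unfolding a_def fser_cmult[symmetric] by (rule fser_add[OF s1 s3])
    also have "\<dots> = of_real (\<psi> x) + of_real (- (\<gamma> / 2)) * of_real (dinv (proj_perp \<eta>) x)"
      unfolding P(1) fourier_inversion[OF \<psi>_continuous \<psi>_periodic \<sigma>1 \<psi>_coeffs] ..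
    finally show ?thesis by (simp add: \<zeta>_def)
  qed
  ultimately show ?thesis by blast
qed

lemma avg_\<zeta>: "avg \<zeta> = 0"
proof -
  have "continuous_on UNIV (dinv (proj_perp \<eta>))"
    by (rule DERIV_continuous_on[OF has_field_derivative_at_within[OF primitive(3)]])
  then have i: "dinv (proj_perp \<eta>) integrable_on {0..2 * pi}"
    using continuous_on_subset integrable_continuous_interval by blast
  have i': "\<psi> integrable_on {0..2 * pi}" by (rule integrable_continuous_interval[OF \<psi>_continuous])
  have "avg \<zeta> = avg \<psi> - \<gamma> / 2 * avg (dinv (proj_perp \<eta>))"
    using integral_diff[OF i' integrable_on_mult_right[OF i, of "\<gamma> / 2"]]
    by (simp add: avg_def \<zeta>_def[abs_def] diff_divide_distrib)
  then show ?thesis using avg_\<psi> primitive(4) by simp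
qed

text \<open>After \<open>N1_eq\<close> and \<open>N2_eq\<close> only the change of variables
  remains: the primitive of \<open>- c * deriv \<eta>\<close> is \<open>- c\<close> times the
  mean-free part of \<open>\<eta>\<close>, which cancels the shear part of
  \<open>c * deriv \<zeta>\<close>.\<close>

lemma Fmap_zero: "Fmap g h \<kappa> \<gamma> c (\<eta>, \<zeta>) = (\<lambda>x. 0, \<lambda>x. 0)"
proof -
  have T: "Tmap \<gamma> (\<eta>, \<zeta>) = (\<eta>, \<psi>)" by (simp add: Tmap_def \<zeta>_def)
  have d\<eta>: "(\<eta> has_real_derivative deriv \<eta> x) (at x)" for x using \<eta>_deriv by (simp add: deriv_\<eta>)
  have dN: "((\<lambda>x. - c * \<eta> x) has_real_derivative - c * deriv \<eta> x) (at x)" for x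
    by (rule DERIV_cmult[OF d\<eta>])
  have "periodic (\<lambda>x. - c * \<eta> x)" using \<eta>_periodic by (simp add: periodic_def)
  with dN have "avg (\<lambda>x. - c * deriv \<eta> x) = 0" by (rule avg_derivative)
  then have pN: "proj_perp (\<lambda>x. - c * deriv \<eta> x) = (\<lambda>x. - c * deriv \<eta> x)"
    by (simp add: proj_perp_def)
  have dinvN: "dinv (\<lambda>x. - c * deriv \<eta> x) = (\<lambda>x. - c * \<eta> x + c * avg \<eta>)"
  proof (rule dinv_eqI)
    show "((\<lambda>x. - c * \<eta> x + c * avg \<eta>) has_real_derivative - c * deriv \<eta> x) (at x)" for x
      using DERIV_add[OF dN DERIV_const] by simp
    show "periodic (\<lambda>x. - c * \<eta> x + c * avg \<eta>)" using \<eta>_periodic by (simp add: periodic_def)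
    have "avg (\<lambda>x. - c * \<eta> x) = - c * avg \<eta>" by (simp add: avg_def)
    then show "avg (\<lambda>x. - c * \<eta> x + c * avg \<eta>) = 0"
      by (subst avg_cong_const) (auto intro!: continuous_intros \<eta>_continuous)
  qed
  have "deriv \<zeta> x = deriv \<psi> x - \<gamma> / 2 * (\<eta> x - avg \<eta>)" for x by (rule DERIV_imp_deriv[OF \<zeta>_deriv])
  then have "c * deriv \<zeta> x + (- c * deriv \<psi> x - \<gamma> / 2 * (- c * \<eta> x + c * avg \<eta>)) = 0" for x
    by (simp only:) (simp add: field_simps)
  then show ?thesis
    unfolding Fmap_def T Nfield_def Tmap_inv_def N1_eq N2_eq Let_def prod.case fst_conv snd_conv pN dinvN
    by (auto simp: N2_eq field_simps)
qed

text \<open>Norm zero forces \<open>\<eta> = 0\<close>, hence \<open>Yr = 0\<close> because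
  \<open>A\<close> is onto, and the first coefficient \<open>Y 1\<close> would vanish.\<close>

lemma \<eta>_nonzero:
  assumes "Y 1 \<noteq> 0"
  shows "Hnorm \<sigma> s \<eta> > 0"
proof (rule ccontr)
  assume "\<not> Hnorm \<sigma> s \<eta> > 0"
  then have le: "(\<Sum>\<^sub>\<infinity>k. weighted_sq \<sigma> s \<eta> k) \<le> 0" by (simp add: Hnorm_def)
  have sum: "weighted_sq \<sigma> s \<eta> summable_on UNIV"
    using Hspace_fser(1)[OF \<sigma> \<eta>_coeffs \<eta>_series, of s] by (simp add: Hspace_def)
  have "weighted_sq \<sigma> s \<eta> k = 0" for k
    by (rule nonneg_infsum_le_0D[OF le sum]) (auto simp: weighted_sq_def)
  moreover have "bracket k powr (2 * s) > 0" for k by (simp add: bracket_def)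
  ultimately have "fourier_coeff \<eta> k = 0" for k by (auto simp: weighted_sq_def dest!: spec less_imp_neq)
  then have "\<eta> x = 0" for x using \<eta>_series[of x] by (simp add: fser_def)
  then have "Yr a = 0" for a using A(2)[of a] by (metis \<eta>_def)
  then have z: "fs K Y (of_real a) = 0" for a using fser_even[of Y K a] Y_even by (simp add: Yr_def)
  have "cbd (real K * R) N (\<lambda>n. of_real (Y n))" using bd_m(1)[OF Y_bd] by (simp add: cbd_of_real)
  from fser_coeff[OF K R_pos(1) this, of 1] have "((\<lambda>x. 0 :: complex) has_integral 2 * pi * Y 1) {0..2 * pi}"
    by (simp add: z)
  then have "complex_of_real (2 * pi * Y 1) = 0" using has_integral_0_eq by blast
  then show False using assms by simp
qed

text \<open>The factor beside \<open>N\<close> depends on the individual wave only through |c|, so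
  the amplitude can be chosen afterwards.\<close>

theorem stokes_wave:
  assumes "Y 1 \<noteq> 0"
  shows "\<exists>u\<in>Xspace \<sigma> s. 0 < Xnorm \<sigma> s u \<and>
    Xnorm \<sigma> s u \<le> N * ((4 + 4 * Cq * (\<bar>c\<bar> + 2 * \<bar>\<gamma>\<bar> * wt_sum) + 2 * \<bar>\<gamma>\<bar>) * wt_sum * sqrt (Hconst s)) \<and>
    Fmap g h \<kappa> \<gamma> c u = (\<lambda>x. 0, \<lambda>x. 0)"
proof (intro bexI conjI)
  obtain a where a: "cbd (\<sigma> + 1) Czeta a" "\<And>x. complex_of_real (\<zeta> x) = fser 1 a (of_real x)"
    using \<zeta>_series by blast
  note H\<eta> = Hspace_fser[OF \<sigma> \<eta>_coeffs \<eta>_series]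
  note H\<zeta> = Hspace_fser[OF \<sigma> a]
  show "(\<eta>, \<zeta>) \<in> Xspace \<sigma> s" using H\<eta>(1) H\<zeta>(1) avg_\<zeta> by (simp add: Xspace_def Hspace0_def)
  show "Fmap g h \<kappa> \<gamma> c (\<eta>, \<zeta>) = (\<lambda>x. 0, \<lambda>x. 0)" by (rule Fmap_zero)
  have pos: "Hnorm \<sigma> s \<eta> > 0" by (rule \<eta>_nonzero[OF assms])
  have nn: "Hnorm \<sigma> s \<zeta> \<ge> 0"
    unfolding Hnorm_def by (intro real_sqrt_ge_zero infsum_nonneg) (auto simp: weighted_sq_def)
  show "0 < Xnorm \<sigma> s (\<eta>, \<zeta>)" using pos by (simp add: Xnorm_def add_pos_nonneg)
  have "Xnorm \<sigma> s (\<eta>, \<zeta>) \<le> Hnorm \<sigma> s \<eta> + Hnorm \<sigma> s \<zeta>"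
    unfolding Xnorm_def fst_conv snd_conv using pos nn by (intro sqrt_sum_squares_le_sum) auto
  also have "\<dots> \<le> 4 * N * wt_sum * sqrt (Hconst s) + Czeta * sqrt (Hconst s)"
    by (rule add_mono[OF H\<eta>(3) H\<zeta>(3)])
  also have "\<dots> = N * ((4 + 4 * Cq * (\<bar>c\<bar> + 2 * \<bar>\<gamma>\<bar> * wt_sum) + 2 * \<bar>\<gamma>\<bar>) * wt_sum * sqrt (Hconst s))"
    by (simp add: Czeta_def NT_def algebra_simps)
  finally show "Xnorm \<sigma> s (\<eta>, \<zeta>) \<le> \<dots>" .
qed

end

section \<open>Uniform constants and the choice of the amplitude\<close>

lemma qsym_uniform_bound:
  assumes "h > 0" "K \<ge> 1"
  obtains C where "C \<ge> 0" "\<And>y n. (h \<noteq> \<infinity> \<Longrightarrow> real_of_ereal h + y \<ge> real_of_ereal h / 2) \<Longrightarrow>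
    \<bar>qsym h K (real_of_ereal h + y) n\<bar> \<le> C"
proof (cases "h = \<infinity>")
  case True
  have "\<bar>qsym h K H n\<bar> \<le> 1" for H n using True by (simp add: qsym_def cth_def sgn_if)
  then show thesis by (intro that[of 1]) auto
next
  case False
  then have "real_of_ereal h / 2 > 0" using real_of_ereal_depth_pos assms(1) by auto
  then show thesis
    using qsym_bound[OF assms(2), of "real_of_ereal h / 2"] False
    by (intro that[of "1 + 1 / (real_of_ereal h / 2)"]) (auto simp del: divide_divide_eq_right)
qed

lemma eventually_small: "b > 0 \<Longrightarrow> \<forall>\<^sub>F e in at_right 0. a * e < b" for a b :: real
proof -
  assume "b > 0"
  have "((\<lambda>e. a * e) \<longlongrightarrow> a * 0) (at_right 0)" by (intro tendsto_intros)
  then show ?thesis using \<open>b > 0\<close> by (intro order_tendstoD(2)) auto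
qed

theorem theorem1p1:
  fixes g \<kappa> \<gamma> \<sigma> s :: real and h :: ereal and j :: int
  assumes "g > 0" and "h > 0" and "\<kappa> \<ge> 0"
    and "\<sigma> > 0" and "s \<ge> 7 / 2" and "s + 1 / 2 \<in> \<nat>"
    and "j \<noteq> 0"
  shows "\<forall>\<epsilon>>0. \<exists>c::real. \<bar>c - Omega g h \<kappa> \<gamma> (of_int j) / of_int j\<bar> < \<epsilon> \<and>
    (\<exists>u\<in>Xspace \<sigma> s. 0 < Xnorm \<sigma> s u \<and> Xnorm \<sigma> s u < \<epsilon> \<and>
       Fmap g h \<kappa> \<gamma> c u = (\<lambda>x. 0, \<lambda>x. 0))"
proof (intro allI impI)
  fix \<epsilon> :: real assume \<epsilon>: "\<epsilon> > 0"
  define cs where "cs = Omega g h \<kappa> \<gamma> (of_int j) / of_int j"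
  note asm = \<open>g > 0\<close> \<open>h > 0\<close> \<open>\<kappa> \<ge> 0\<close> \<open>j \<noteq> 0\<close> cs_def
  obtain K :: nat where K: "K \<ge> 1" "disp g h \<kappa> \<gamma> cs K = 0"
      "\<And>n. n \<ge> 2 \<Longrightarrow> disp g h \<kappa> \<gamma> cs (real K * real n) \<noteq> 0"
    using largest_resonance[OF asm] by metis
  \<comment> \<open>The least value that \<open>conformal_wave\<close> admits. It has to precede the
    amplitude, as \<open>M\<close> and \<open>e1\<close> depend on the rate
    \<open>\<rho>\<close>.\<close>
  define R where "R = 2 * real_of_ereal h + \<sigma> + 5"
  define \<rho> where "\<rho> = real K * (R + 3)"
  have "real_of_ereal h \<ge> 0" using \<open>h > 0\<close> by (cases h) auto
  then have \<rho>: "\<rho> \<ge> 0" using \<open>\<sigma> > 0\<close> by (simp add: \<rho>_def R_def)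
  interpret bif: bifurcation g \<kappa> \<gamma> cs \<rho> h K
    using asm Omega_disp(2)[OF asm] K \<rho> by unfold_locales auto
  obtain M e1 where M: "M > 0" "e1 > 0" and sol: "\<And>e. 0 < e \<Longrightarrow> e \<le> e1 \<Longrightarrow>
      \<exists>c Y. \<bar>c - cs\<bar> \<le> M * e \<and> (\<forall>n. Y (- n) = Y n) \<and> bd \<rho> (M * e) Y \<and> Y 1 = e \<and>
        (h \<noteq> \<infinity> \<longrightarrow> real_of_ereal h + Y 0 \<ge> real_of_ereal h / 2) \<and> bernoulli g h \<kappa> \<gamma> K c Y"
    using bif.conformal_solution by blast
  obtain Cq where Cq: "Cq \<ge> 0" "\<And>y n. (h \<noteq> \<infinity> \<Longrightarrow> real_of_ereal h + y \<ge> real_of_ereal h / 2) \<Longrightarrow>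
      \<bar>qsym h K (real_of_ereal h + y) n\<bar> \<le> Cq"
    using qsym_uniform_bound[OF \<open>h > 0\<close> K(1)] by metis
  \<comment> \<open>The norm constant as a function of |c|; \<open>M * e < 1\<close> bounds |c| by
    \<open>|cs| + 1\<close>, a value known before the wave.\<close>
  define B where "B d = (4 + 4 * Cq * (d + 2 * \<bar>\<gamma>\<bar> * wt_sum) + 2 * \<bar>\<gamma>\<bar>) * wt_sum * sqrt (Hconst s)" for d
  have "\<forall>\<^sub>F e in at_right 0. 0 < e \<and> 1 * e < e1 \<and> M * e < \<epsilon> \<and> M * e < 1 \<and>
      ((1 + Cq) * M * wt_sum) * e < 1 / 4 \<and> (M * B (\<bar>cs\<bar> + 1)) * e < \<epsilon>"
    using M \<epsilon> by (intro eventually_conj eventually_small eventually_at_right_less) auto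
  then obtain e where e: "e > 0" "e < e1" "M * e < \<epsilon>" "M * e < 1" "((1 + Cq) * M * wt_sum) * e < 1 / 4"
      "(M * B (\<bar>cs\<bar> + 1)) * e < \<epsilon>"
    using eventually_happens' trivial_limit_at_right_real by (metis (no_types, lifting) mult_1)
  obtain c Y where Y: "\<bar>c - cs\<bar> \<le> M * e" "\<And>n. Y (- n) = Y n" "bd \<rho> (M * e) Y" "Y 1 = e"
      "h \<noteq> \<infinity> \<Longrightarrow> real_of_ereal h + Y 0 \<ge> real_of_ereal h / 2" "bernoulli g h \<kappa> \<gamma> K c Y"
    using sol[of e] e by auto
  interpret wave: conformal_wave g \<kappa> \<gamma> c \<sigma> "M * e" Cq R h K Y
  proof
    show "real_of_ereal h + Y 0 > 0" if "h \<noteq> \<infinity>"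
      using Y(5)[OF that] real_of_ereal_depth_pos[OF \<open>h > 0\<close> that] by linarith
    show "(1 + Cq) * (M * e) * wt_sum \<le> 1 / 4" using e(5) by (simp add: mult_ac)
    show "\<bar>qsym h K (real_of_ereal h + Y 0) n\<bar> \<le> Cq" for n using Cq(2) Y(5) by blast
  qed (use assms K Y e in \<open>auto simp: \<rho>_def R_def\<close>)
  obtain u where u: "u \<in> Xspace \<sigma> s" "0 < Xnorm \<sigma> s u" "Xnorm \<sigma> s u \<le> M * e * B \<bar>c\<bar>"
      "Fmap g h \<kappa> \<gamma> c u = (\<lambda>x. 0, \<lambda>x. 0)"
    using wave.stokes_wave[of s] Y(4) e(1) unfolding B_def by auto
  have "B \<bar>c\<bar> \<le> B (\<bar>cs\<bar> + 1)"
  proof -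
    have "sqrt (Hconst s) \<ge> 0" by (simp add: Hconst_def infsum_nonneg)
    then show ?thesis
      unfolding B_def using Y(1) e(4) Cq(1) wt_sum_nonneg
      by (intro mult_right_mono add_mono mult_left_mono) auto
  qed
  then have "M * e * B \<bar>c\<bar> \<le> M * e * B (\<bar>cs\<bar> + 1)" using M(1) e(1) by (intro mult_left_mono) auto
  with u(3) e(6) have "Xnorm \<sigma> s u < \<epsilon>" by (simp add: mult_ac)
  with u Y(1) e(3) show "\<exists>c::real. \<bar>c - Omega g h \<kappa> \<gamma> (of_int j) / of_int j\<bar> < \<epsilon> \<and>
    (\<exists>u\<in>Xspace \<sigma> s. 0 < Xnorm \<sigma> s u \<and> Xnorm \<sigma> s u < \<epsilon> \<and>
       Fmap g h \<kappa> \<gamma> c u = (\<lambda>x. 0, \<lambda>x. 0))"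
    unfolding cs_def by (intro exI[of _ c]) auto
qed

end
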